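(* Let $T\subset S^4$ be an ideal CCT of width $k\ge 3$. Then there exists an ideal $(k+1)$-CCT $T'$ in $S^4$ extending $T$.
   Context: Spheres are unit spheres; $S^4\subset\mathbb{R}^5$ and $S^3_{\mathrm{eq}}=\{x\in S^4:x_5=0\}$. Spherical polytopes are convex hulls of finitely many points in an open hemisphere; a (geometric) polytopal complex is a finite collection of polytopes closed under taking faces, any two intersecting in a common face. A cube is a polytope combinatorially equivalent to some $[0,1]^j$; a complex is cubical if all faces are cubes. CCTs: Let $\mathfrak{C}$ be the unit cube tiling of $\mathbb{R}^3$ with vertex set $\mathbb{Z}^3$ and, for $k\ge0$, $\mathfrak{C}[k]$ its subcomplex induced by the vertices $v$ with $0\le v_1+v_2+v_3\le k$. It is invariant under the lattice $\Lambda$ generated by $(3,-3,0)$ and $(-2,-2,4)$; let $\mathfrak{T}[k]=\mathfrak{C}[k]/\Lambda$ (abstract cubical complex). A $k$-CCT (cross-bedding cubical torus of width $k$) is a geometric cubical complex $T$ together with a combinatorial isomorphism $\varphi_T:\mathfrak{T}[k]\to T$. Layer $\ell$ of $T$ ($0\le \ell\le k$) is the set of images of vertex classes whose representatives have coordinate sum $\ell$; for $I\subseteq\mathbb{Z}$, $R(T,I)$ is the subcomplex induced by the vertices of the layers in $I$. A CCT $T'$ of width $\ell>k$ extends the $k$-CCT $T$ if $R(T',\{0,\dots,k\})=T$ (compatibly with the isomorphisms); it is an elementary extension if $\ell=k+1$. Symmetry: let $r_{1,2}$ be the linear map of $\mathbb{R}^5$ rotating the $(x_1,x_2)$-plane by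 $\pi/2$ and fixing $x_3,x_4,x_5$; $r_{3,4}$ rotates the $(x_3,x_4)$-plane by $\pi/3$ and fixes $x_1,x_2,x_5$; $s$ is the reflection $x_4\mapsto -x_4$. A CCT $T$ in $S^4$ or $S^3_{\mathrm{eq}}$ is symmetric if (a) $s$ maps $T$ to itself and corresponds (via $\varphi_T$) to the automorphism of $\mathfrak{T}[k]$ induced by swapping the first two coordinates of $\mathbb{R}^3$; (b) $r_{3,4}^2$ maps $T$ to itself and corresponds to the automorphism induced by translation by $(-1,1,0)$; (c) $r_{3,4}r_{1,2}$ maps $T$ to itself and corresponds to the automorphism induced by translation by $(0,-1,1)$. Clifford tori: $\mathcal{C}_\lambda=\{x\in S^3_{\mathrm{eq}}: x_1^2+x_2^2=1-\lambda/2,\ x_3^2+x_4^2=\lambda/2\}$, $\lambda\in[0,2]$. Define $\pi_1:S^3_{\mathrm{eq}}\setminus(\mathcal{C}_0\cup\mathcal{C}_2)\to\mathcal{C}_1$, $\pi_1(y)=\frac{(y_1,y_2,0,0,0)}{\sqrt2\,\|(y_1,y_2)\|}+\frac{(0,0,y_3,y_4,0)}{\sqrt2\,\|(y_3,y_4)\|}$, and $\pi_0:S^3_{\mathrm{eq}}\setminus\mathcal{C}_2\to\mathcal{C}_0$, $\pi_0(y)=\frac{(y_1,y_2,0,0,0)}{\|(y_1,y_2)\|}$. Transversality: a symmetric 2-CCT $T\subset S^3_{\mathrm{eq}}$ is transversal if $\pi_1$ is (defined and) injective on $T$; a symmetric $k$-CCT in $S^3_{\mathrm{eq}}$ is transversal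 if $R(T,\{i-1,i,i+1\})$ is transversal for all $1\le i\le k-1$. Slope: for a transversal symmetric 2-CCT $T\subset S^3_{\mathrm{eq}}$, pick a layer-2 vertex $s$, let $t=r_{3,4}^2s$ (also in layer 2), let $u$ be the middle (layer-1) vertex of the unique edge path of length 2 in $T$ from $s$ to $t$, and $m$ the midpoint of the geodesic segment $[s,t]$; the slope $\alpha(T)$ is the angle at $m$ between the geodesic segments $[m,\pi_0(m)]$ and $[m,u]$. A transversal symmetric $k$-CCT $T\subset S^3_{\mathrm{eq}}$, $k\ge2$, is ideal if $\alpha(R(T,\{k-2,k-1,k\}))>\pi/2$ and it is oriented towards $\mathcal{C}_0$, i.e. the closure of the connected component of $S^3_{\mathrm{eq}}\setminus T$ containing $\mathcal{C}_0$ meets layer $k$. For CCTs in $S^4$: let $p:S^4\setminus\{\pm e_5\}\to S^3_{\mathrm{eq}}$ be the orthogonal (nearest point) projection. A symmetric CCT $T\subset S^4$ is transversal (resp. ideal) if $p$ is injective on $T$ and the image CCT $p(T)$ (the control CCT) is transversal (resp. ideal).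
   Formalization: In symmetry condition (b), r_{3,4}^2 corresponds to translation by (1,-1,0) instead of (-1,1,0): with the printed sign, (r_{3,4}r_{1,2})^4=(r_{3,4}^2)^2 would force (2,-6,4) into the lattice Λ, which is false, so no symmetric CCT would exist. *)

theory Defs
  imports "HOL-Analysis.Analysis"
begin

section \<open>Spherical polytopes and polytopal complexes\<close>

text \<open>Coordinates of \<^typ>\<open>real^5\<close> are numbered 1 to 5 (in the index type, 5 = 0).\<close>

definition S4 :: "(real^5) set" where
  "S4 = sphere 0 1"

definition S3eq :: "(real^5) set" where
  "S3eq = {x \<in> S4. x $ 5 = 0}"

text \<open>Only meaningful for points in an open hemisphere, where 0 is not in the convex hull.\<close>

definition sph_hull :: "(real^5) set \<Rightarrow> (real^5) set" where
  "sph_hull V = sgn ` (convex hull V)"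

definition sph_polytope :: "(real^5) set \<Rightarrow> bool" where
  "sph_polytope P \<longleftrightarrow>
     (\<exists>V a. finite V \<and> V \<subseteq> S4 \<and> (\<forall>v\<in>V. 0 < a \<bullet> v) \<and> P = sph_hull V)"

text \<open>Faces are cut out by supporting great hyperspheres. The choice \<open>a = 0\<close> gives \<open>P\<close> itself,
  and an open hemisphere containing \<open>P\<close> gives the empty face.\<close>

definition sph_face :: "(real^5) set \<Rightarrow> (real^5) set \<Rightarrow> bool" where
  "sph_face F P \<longleftrightarrow> (\<exists>a. (\<forall>x\<in>P. 0 \<le> a \<bullet> x) \<and> F = {x \<in> P. a \<bullet> x = 0})"

definition polytopal_complex :: "(real^5) set set \<Rightarrow> bool" where
  "polytopal_complex K \<longleftrightarrow>
     finite K \<and>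
     (\<forall>P\<in>K. sph_polytope P) \<and>
     (\<forall>P\<in>K. \<forall>F. sph_face F P \<longrightarrow> F \<in> K) \<and>
     (\<forall>P\<in>K. \<forall>Q\<in>K. sph_face (P \<inter> Q) P \<and> sph_face (P \<inter> Q) Q)"

definition inclusion_isomorphic :: "'a set set \<Rightarrow> 'b set set \<Rightarrow> bool" where
  "inclusion_isomorphic A B \<longleftrightarrow>
     (\<exists>f. bij_betw f A B \<and> (\<forall>X\<in>A. \<forall>Y\<in>A. X \<subseteq> Y \<longleftrightarrow> f X \<subseteq> f Y))"

text \<open>The cube \<open>[0,1]\<^sup>j\<close> with \<open>j = card J\<close>, placed in a coordinate subspace. A polytope in the
  4-sphere has dimension at most 4, so the exponents \<open>j \<le> 5\<close> available here are no restriction.\<close>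

definition std_cube :: "5 set \<Rightarrow> (real^5) set" where
  "std_cube J = {x. \<forall>i. if i \<in> J then 0 \<le> x $ i \<and> x $ i \<le> 1 else x $ i = 0}"

definition sph_cube :: "(real^5) set \<Rightarrow> bool" where
  "sph_cube P \<longleftrightarrow>
     sph_polytope P \<and>
     (\<exists>J. inclusion_isomorphic {F. F face_of std_cube J} {F. sph_face F P})"

text \<open>The empty face belongs to every nonempty complex and is exempt from being a cube.\<close>

definition cubical_complex :: "(real^5) set set \<Rightarrow> bool" where
  "cubical_complex K \<longleftrightarrow> polytopal_complex K \<and> (\<forall>P\<in>K. P \<noteq> {} \<longrightarrow> sph_cube P)"

definition induced_subcomplex :: "(real^5) set set \<Rightarrow> (real^5) set \<Rightarrow> (real^5) set set" where
  "induced_subcomplex K W = {F \<in> K. \<forall>x. sph_face {x} F \<longrightarrow> x \<in> W}"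


section \<open>The abstract complexes\<close>

text \<open>A nonempty cell of the unit cube tiling is represented by its vertex set.\<close>

definition csum :: "int^3 \<Rightarrow> int" where
  "csum v = v $ 1 + v $ 2 + v $ 3"

definition unit_cell :: "int^3 \<Rightarrow> 3 set \<Rightarrow> (int^3) set" where
  "unit_cell v J = {w. \<forall>i. w $ i = v $ i \<or> (i \<in> J \<and> w $ i = v $ i + 1)}"

definition strip :: "nat \<Rightarrow> (int^3) set set" where
  "strip k = {unit_cell v J | v J. \<forall>w\<in>unit_cell v J. 0 \<le> csum w \<and> csum w \<le> int k}"

definition Lam :: "(int^3) set" where
  "Lam = {a *s vector [3, -3, 0] + b *s vector [-2, -2, 4] | a b. True}"

text \<open>A cell of the quotient is an orbit of cells, so a map \<open>f\<close> on the integer lattice induces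
  the map \<open>image (image f)\<close> on the quotient.\<close>

definition orbit :: "(int^3) set \<Rightarrow> (int^3) set set" where
  "orbit c = {(+) l ` c | l. l \<in> Lam}"

definition torus :: "nat \<Rightarrow> (int^3) set set set" where
  "torus k = orbit ` strip k"

definition torus_le :: "(int^3) set set \<Rightarrow> (int^3) set set \<Rightarrow> bool" where
  "torus_le X Y \<longleftrightarrow> (\<exists>c\<in>X. \<exists>d\<in>Y. c \<subseteq> d)"


section \<open>Cross-bedding cubical tori\<close>

record cct =
  cells :: "(real^5) set set"
  chart :: "(int^3) set set \<Rightarrow> (real^5) set"

definition is_cct :: "nat \<Rightarrow> cct \<Rightarrow> bool" where
  "is_cct k T \<longleftrightarrow>
     cubical_complex (cells T) \<and>
     bij_betw (chart T) (torus k) (cells T - {{}}) \<and>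
     (\<forall>X\<in>torus k. \<forall>Y\<in>torus k. torus_le X Y \<longleftrightarrow> chart T X \<subseteq> chart T Y)"

definition layer :: "cct \<Rightarrow> int \<Rightarrow> (real^5) set" where
  "layer T l = \<Union> {chart T (orbit {v}) | v. csum v = l}"

definition restrict_cells :: "cct \<Rightarrow> int set \<Rightarrow> (real^5) set set" where
  "restrict_cells T I = induced_subcomplex (cells T) (\<Union>l\<in>I. layer T l)"

definition extends :: "nat \<Rightarrow> cct \<Rightarrow> nat \<Rightarrow> cct \<Rightarrow> bool" where
  "extends k' T' k T \<longleftrightarrow>
     is_cct k' T' \<and> is_cct k T \<and> k < k' \<and>
     restrict_cells T' {0..int k} = cells T \<and>
     (\<forall>X\<in>torus k. chart T' X = chart T X)"

text \<open>The 2-CCT spanned by the layers \<open>i - 1\<close>, \<open>i\<close>, \<open>i + 1\<close>. Layers are renumbered from 0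
  by a shift along the third axis, which commutes with translations and with swapping the first
  two coordinates.\<close>

definition band :: "cct \<Rightarrow> nat \<Rightarrow> cct" where
  "band T i =
     \<lparr> cells = restrict_cells T {int i - 1, int i, int i + 1},
       chart = (\<lambda>X. chart T (image (image ((+) (vector [0, 0, int i - 1]))) X)) \<rparr>"


section \<open>Symmetry\<close>

definition r12 :: "real^5 \<Rightarrow> real^5" where
  "r12 x = (\<chi> i. if i = 1 then - x $ 2 else if i = 2 then x $ 1 else x $ i)"

definition r34 :: "real^5 \<Rightarrow> real^5" where
  "r34 x = (\<chi> i. if i = 3 then cos (pi/3) * x $ 3 - sin (pi/3) * x $ 4
                 else if i = 4 then sin (pi/3) * x $ 3 + cos (pi/3) * x $ 4
                 else x $ i)"

definition s4 :: "real^5 \<Rightarrow> real^5" where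
  "s4 x = (\<chi> i. if i = 4 then - x $ 4 else x $ i)"

definition swap12 :: "int^3 \<Rightarrow> int^3" where
  "swap12 v = vector [v $ 2, v $ 1, v $ 3]"

definition corresponds :: "nat \<Rightarrow> cct \<Rightarrow> (real^5 \<Rightarrow> real^5) \<Rightarrow> (int^3 \<Rightarrow> int^3) \<Rightarrow> bool" where
  "corresponds k T g f \<longleftrightarrow>
     image g ` cells T = cells T \<and>
     (\<forall>X\<in>torus k. g ` chart T X = chart T (image (image f) X))"

text \<open>The vector for \<open>r34 \<circ> r34\<close> is \<open>(1,-1,0)\<close>, where the source prints \<open>(-1,1,0)\<close>.
  Since \<open>(r34 \<circ> r12)\<^sup>4 = (r34 \<circ> r34)\<^sup>2\<close>, a vector \<open>v\<close> can only occur if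
  \<open>4 (0,-1,1) - 2 v\<close> lies in \<^const>\<open>Lam\<close>. For \<open>v = (1,-1,0)\<close> this is the generator
  \<open>(-2,-2,4)\<close>; for \<open>v = (-1,1,0)\<close> it fails, and no CCT at all would be symmetric, see
  \<open>no_cct_with_opposite_sign\<close>. Conjugation of \<open>r34 \<circ> r12\<close> by the reflection \<^const>\<open>s4\<close>
  forces the same sign. Changing instead \<open>(0,-1,1)\<close> to \<open>(0,1,-1)\<close> gives the same
  notion up to the isometry negating the coordinates 2 and 4.\<close>

definition symmetric_cct :: "nat \<Rightarrow> cct \<Rightarrow> bool" where
  "symmetric_cct k T \<longleftrightarrow>
     is_cct k T \<and>
     corresponds k T s4 swap12 \<and>
     corresponds k T (r34 \<circ> r34) ((+) (vector [1, -1, 0])) \<and>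
     corresponds k T (r34 \<circ> r12) ((+) (vector [0, -1, 1]))"


section \<open>Transversality, slope and ideal CCTs in the equator\<close>

definition clifford :: "real \<Rightarrow> (real^5) set" where
  "clifford l = {x \<in> S3eq. (x $ 1)\<^sup>2 + (x $ 2)\<^sup>2 = 1 - l/2 \<and> (x $ 3)\<^sup>2 + (x $ 4)\<^sup>2 = l/2}"

definition part12 :: "real^5 \<Rightarrow> real^5" where
  "part12 y = (\<chi> i. if i = 1 \<or> i = 2 then y $ i else 0)"

definition part34 :: "real^5 \<Rightarrow> real^5" where
  "part34 y = (\<chi> i. if i = 3 \<or> i = 4 then y $ i else 0)"

definition proj1 :: "real^5 \<Rightarrow> real^5" where
  "proj1 y = (1 / (sqrt 2 * norm (part12 y))) *\<^sub>R part12 y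
           + (1 / (sqrt 2 * norm (part34 y))) *\<^sub>R part34 y"

definition proj0 :: "real^5 \<Rightarrow> real^5" where
  "proj0 y = (1 / norm (part12 y)) *\<^sub>R part12 y"

definition transversal2 :: "cct \<Rightarrow> bool" where
  "transversal2 T \<longleftrightarrow>
     symmetric_cct 2 T \<and>
     \<Union> (cells T) \<subseteq> S3eq - (clifford 0 \<union> clifford 2) \<and>
     inj_on proj1 (\<Union> (cells T))"

definition transversal_eq :: "nat \<Rightarrow> cct \<Rightarrow> bool" where
  "transversal_eq k T \<longleftrightarrow>
     symmetric_cct k T \<and> \<Union> (cells T) \<subseteq> S3eq \<and>
     (\<forall>i. 1 \<le> i \<and> i + 1 \<le> k \<longrightarrow> transversal2 (band T i))"

definition is_edge :: "cct \<Rightarrow> real^5 \<Rightarrow> real^5 \<Rightarrow> bool" where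
  "is_edge T x y \<longleftrightarrow> {x} \<in> cells T \<and> {y} \<in> cells T \<and> x \<noteq> y \<and> sph_hull {x, y} \<in> cells T"

text \<open>The angle at \<open>m\<close> between the geodesic segments to \<open>a\<close> and \<open>b\<close>: the angle between
  the components of \<open>a\<close> and \<open>b\<close> tangent to the sphere at \<open>m\<close>.\<close>

definition sph_angle :: "real^5 \<Rightarrow> real^5 \<Rightarrow> real^5 \<Rightarrow> real" where
  "sph_angle a m b =
     (let u = a - (a \<bullet> m) *\<^sub>R m; v = b - (b \<bullet> m) *\<^sub>R m
      in arccos ((u \<bullet> v) / (norm u * norm v)))"

definition slope :: "cct \<Rightarrow> real" where
  "slope T =
     (let s = (SOME s. s \<in> layer T 2);
          t = r34 (r34 s);
          u = (THE u. is_edge T s u \<and> is_edge T u t);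
          m = sgn (s + t)
      in sph_angle (proj0 m) m u)"

definition oriented_to_C0 :: "nat \<Rightarrow> cct \<Rightarrow> bool" where
  "oriented_to_C0 k T \<longleftrightarrow>
     (\<exists>C \<in> components (S3eq - \<Union> (cells T)).
        clifford 0 \<subseteq> C \<and> closure C \<inter> layer T (int k) \<noteq> {})"

definition ideal_eq :: "nat \<Rightarrow> cct \<Rightarrow> bool" where
  "ideal_eq k T \<longleftrightarrow>
     2 \<le> k \<and> transversal_eq k T \<and> slope (band T (k - 1)) > pi / 2 \<and> oriented_to_C0 k T"


section \<open>Ideal CCTs in the 4-sphere\<close>

definition eq_proj :: "real^5 \<Rightarrow> real^5" where
  "eq_proj x = sgn (\<chi> i. if i = 5 then 0 else x $ i)"

definition control :: "cct \<Rightarrow> cct" where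
  "control T = \<lparr> cells = image eq_proj ` cells T, chart = (\<lambda>X. eq_proj ` chart T X) \<rparr>"

definition ideal_cct :: "nat \<Rightarrow> cct \<Rightarrow> bool" where
  "ideal_cct k T \<longleftrightarrow>
     symmetric_cct k T \<and>
     \<Union> (cells T) \<subseteq> S4 - {axis 5 1, - axis 5 1} \<and>
     inj_on eq_proj (\<Union> (cells T)) \<and>
     ideal_eq k (control T)"


section \<open>The sign in the definition of symmetry\<close>

lemma r34_r12_pow4:
  "(r34 \<circ> r12) ((r34 \<circ> r12) ((r34 \<circ> r12) ((r34 \<circ> r12) x))) = (r34 \<circ> r34) ((r34 \<circ> r34) x)"
proof -
  have comm: "r34 (r12 y) = r12 (r34 y)" for y
    by (simp add: vec_eq_iff r34_def r12_def)
  have four: "r12 (r12 (r12 (r12 y))) = y" for y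
    by (simp add: vec_eq_iff r12_def)
  show ?thesis
    by (simp add: comm four)
qed

lemma translate_orbit: "image (image ((+) w)) (orbit c) = orbit ((+) w ` c)"
proof -
  have "(+) w ` ((+) l ` c) = (+) l ` ((+) w ` c)" for l
    by (simp add: image_image add.left_commute)
  then show ?thesis
    unfolding orbit_def by (auto simp: image_iff) metis+
qed

lemma no_cct_with_opposite_sign:
  assumes "is_cct k T"
    and A: "corresponds k T (r34 \<circ> r34) ((+) (vector [-1, 1, 0]))"
    and B: "corresponds k T (r34 \<circ> r12) ((+) (vector [0, -1, 1]))"
  shows False
proof -
  have vertex: "orbit {v} \<in> torus k" if "csum v = 0" for v
  proof -
    have "unit_cell v {} = {v}"
      by (auto simp: unit_cell_def vec_eq_iff)
    then have "{v} \<in> strip k"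
      unfolding strip_def using that by (force intro!: exI[of _ v] exI[of _ "{}"])
    then show ?thesis
      by (simp add: torus_def)
  qed
  have A': "(r34 \<circ> r34) ` chart T (orbit {v}) = chart T (orbit {vector [-1, 1, 0] + v})"
    if "csum v = 0" for v
    using A vertex[OF that] by (simp add: corresponds_def translate_orbit)
  have B': "(r34 \<circ> r12) ` chart T (orbit {v}) = chart T (orbit {vector [0, -1, 1] + v})"
    if "csum v = 0" for v
    using B vertex[OF that] by (simp add: corresponds_def translate_orbit)
  let ?a = "vector [-1, 1, 0] :: int^3" and ?b = "vector [0, -1, 1] :: int^3"
  let ?P = "chart T (orbit {0})"
  have c: "csum 0 = 0" "csum (?a + v) = csum v" "csum (?b + v) = csum v" for v
    by (simp_all add: csum_def)
  have "chart T (orbit {?a + (?a + 0)}) = (r34 \<circ> r34) ` (r34 \<circ> r34) ` ?P"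
    by (simp only: A' c)
  also have "\<dots> = (r34 \<circ> r12) ` (r34 \<circ> r12) ` (r34 \<circ> r12) ` (r34 \<circ> r12) ` ?P"
    unfolding image_image r34_r12_pow4 ..
  also have "\<dots> = chart T (orbit {?b + (?b + (?b + (?b + 0)))})"
    by (simp only: B' c)
  finally have eq: "chart T (orbit {?a + (?a + 0)}) = chart T (orbit {?b + (?b + (?b + (?b + 0)))})" .
  have inj: "inj_on (chart T) (torus k)"
    using assms(1) by (auto simp: is_cct_def bij_betw_def)
  have "orbit {?a + (?a + 0)} = orbit {?b + (?b + (?b + (?b + 0)))}"
    by (rule inj_onD[OF inj eq]; rule vertex; simp only: c)
  moreover have "{?a + (?a + 0)} \<in> orbit {?a + (?a + 0)}"
    unfolding orbit_def Lam_def
    by (auto intro!: exI[of _ "0::int^3"] exI[of _ "0::int"] simp: vec_eq_iff)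
  ultimately obtain p q :: int where
    "?a + (?a + 0) = (p *s vector [3, -3, 0] + q *s vector [-2, -2, 4]) + (?b + (?b + (?b + (?b + 0))))"
    unfolding orbit_def Lam_def by auto
  then have "-2 = 3 * p - 2 * q" "0 = 4 * q + 4"
    by (simp_all add: vec_eq_iff forall_3)
  then show False
    by presburger
qed

end

theory Submission
  imports Defs
begin

text \<open>
  Write points of 5-space as triples of two complex numbers and a real number. By symmetry, and after
  rescaling the vertices by positive factors, the vertex of an ideal CCT at a lattice point \<^term>\<open>v\<close> of
  layer \<^term>\<open>m\<close> has the components \<open>\<i>^(v3) * Z m\<close>, \<open>\<plusminus> exp (\<i> * pi/3 * (v1 - v2))\<close> and \<open>e m\<close>.
  Planarity of the squares turns \<open>Z\<close> and \<open>e\<close> into solutions of one linear recurrence with constant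
  coefficients: \<open>Z m = A * (E m + \<i> * t * E (m+1))\<close> and \<open>e m = s * h m\<close> with \<open>h m = t * E (m+1) - E m\<close>,
  where \<open>E m - 2 * (1+t) * E (m+1) + t * E (m+2) = 0\<close>, \<open>t > 0\<close>, and \<open>E\<close> is positive from layer 1 on.
  Transversality makes the Casoratian of \<open>E\<close> positive, so \<open>E\<close> either grows or decays quickly.
  The orientation excludes decay, because three consecutive layers form a graph over the Clifford torus, which
  separates the sphere. Continuing the recurrence by one more term gives the vertices of the new layer.

  The extended complex is embedded because \<open>h\<close> is a convex lifting: for every cube, the linear function
  that agrees with \<open>h\<close> on its vertices is smaller than \<open>h\<close> at all other vertices. The same fact makes
  the projection to the equator injective, since the last coordinate is a multiple of \<open>h\<close>.
\<close>

text \<open>Recurrence and symmetry prescribe the new layer; the difficulty is global. The new cubes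
  must avoid all other cubes in the 4-sphere and after projection to the equator. One supporting
  functional per cube replaces a comparison of pairs of cubes. It ignores the fifth coordinate, so
  one inequality serves the extension, its control CCT and the injectivity of
  \<open>eq_proj\<close>.

  The functional has three parameters, fixed by the lowest vertex of the cube and its neighbours.
  Its defect against the lifting is examined for each quarter-turn of the first coordinate. For two
  of them it solves the layer recurrence with values \<mu>, \<mu>/2, \<mu> on the cube; for the
  other two it is bounded by means of the Casoratian.

  Width at least 3 serves three purposes: the given complex contains a whole cube, whose
  combinatorial type the new cubes copy; every cell of the wider strip lies in a cube; and below the
  top layer there is a full band of three layers, which decides the orientation. The value of
  \<open>E\<close> at layer 0 may have either sign, so arguments that need positivity treat the
  lowest band separately.\<close>

lemma exhaust_5: fixes x :: 5 shows "x = 1 \<or> x = 2 \<or> x = 3 \<or> x = 4 \<or> x = 5"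
proof (induct x)
  case (of_int z)
  then have "0 \<le> z" and "z < 5" by simp_all
  then have "z = 0 \<or> z = 1 \<or> z = 2 \<or> z = 3 \<or> z = 4" by arith
  then show ?case by auto
qed

lemma forall_5: "(\<forall>i::5. P i) \<longleftrightarrow> P 1 \<and> P 2 \<and> P 3 \<and> P 4 \<and> P 5"
  by (metis exhaust_5)

lemma UNIV_5: "UNIV = {1, 2, 3, 4, 5::5}"
  using exhaust_5 by auto

lemma sum_5: "sum f (UNIV::5 set) = f 1 + f 2 + f 3 + f 4 + f 5"
  unfolding UNIV_5 by (simp add: ac_simps)

section \<open>Two complex coordinates and a height on five-space\<close>

definition zc :: "real^5 => complex" where "zc x = Complex (x $ 1) (x $ 2)"

definition wc :: "real^5 => complex" where "wc x = Complex (x $ 3) (x $ 4)"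

definition mk :: "complex => complex => real => real^5" where
  "mk z w e = (\<chi> i. if i = 1 then Re z else if i = 2 then Im z else if i = 3 then Re w
                    else if i = 4 then Im w else e)"

lemma mk_simps [simp]: "zc (mk z w e) = z" "wc (mk z w e) = w" "mk z w e $ 5 = e"
  by (simp_all add: zc_def wc_def mk_def)

lemma mk_eta [simp]: "mk (zc x) (wc x) (x $ 5) = x"
  by (simp add: vec_eq_iff forall_5 mk_def zc_def wc_def)

lemma eq5_iff: "x = y \<longleftrightarrow> zc x = zc y \<and> wc x = wc y \<and> x $ 5 = y $ 5"
  by (metis mk_eta)

lemma linear_zc: "linear zc" and linear_wc: "linear wc"
  by (auto intro!: linearI simp: zc_def wc_def complex_eq_iff)

lemma zc_simps [simp]: "zc (x + y) = zc x + zc y" "zc (x - y) = zc x - zc y"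
    "zc (a *\<^sub>R x) = a *\<^sub>R zc x" "zc 0 = 0" "zc (- x) = - zc x"
  and wc_simps [simp]: "wc (x + y) = wc x + wc y" "wc (x - y) = wc x - wc y"
    "wc (a *\<^sub>R x) = a *\<^sub>R wc x" "wc 0 = 0" "wc (- x) = - wc x"
  by (auto simp: zc_def wc_def complex_eq_iff)

lemma zc_sum: "zc (sum f A) = (\<Sum>i\<in>A. zc (f i))"
  and wc_sum: "wc (sum f A) = (\<Sum>i\<in>A. wc (f i))"
  by (simp_all add: linear_sum[OF linear_zc] linear_sum[OF linear_wc])

lemma inner5: "x \<bullet> y = zc x \<bullet> zc y + wc x \<bullet> wc y + x $ 5 * y $ 5" for x y :: "real^5"
  by (simp add: inner_vec_def sum_5 zc_def wc_def inner_complex_def)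

lemma norm5: "(norm x)\<^sup>2 = (norm (zc x))\<^sup>2 + (norm (wc x))\<^sup>2 + (x $ 5)\<^sup>2" for x :: "real^5"
  unfolding power2_norm_eq_inner inner5 by (simp add: power2_eq_square)

lemma continuous_zc: "continuous_on S zc" and continuous_wc: "continuous_on S wc"
  using linear_zc linear_wc linear_continuous_on linear_conv_bounded_linear by blast+

lemma mk_add: "mk z w e + mk z' w' e' = mk (z + z') (w + w') (e + e')"
  and mk_scale: "a *\<^sub>R mk z w e = mk (a *\<^sub>R z) (a *\<^sub>R w) (a * e)"
  by (simp_all add: eq5_iff)

text \<open>The linear part of \<open>eq_proj\<close>, which is \<open>sgn\<close> after it. A
  linear map lets cones and convex hulls be projected before they are normalised.\<close>

definition flat :: "real^5 => real^5" where "flat x = mk (zc x) (wc x) 0"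

lemma linear_flat: "linear flat"
  by (auto intro!: linearI simp: flat_def eq5_iff)

lemma flat_mk [simp]: "flat (mk z w e) = mk z w 0"
  by (simp add: flat_def)

lemma eq_proj_flat: "eq_proj x = sgn (flat x)"
proof -
  have "(\<chi> i. if i = 5 then 0 else x $ i) = flat x"
    by (simp add: vec_eq_iff forall_5 flat_def mk_def zc_def wc_def)
  then show ?thesis by (simp add: eq_proj_def)
qed

lemma part_flat: "part12 y = mk (zc y) 0 0" "part34 y = mk 0 (wc y) 0"
  by (simp_all add: vec_eq_iff forall_5 part12_def part34_def mk_def zc_def wc_def)

lemma norm_mk: "norm (mk z w e) = sqrt ((norm z)\<^sup>2 + (norm w)\<^sup>2 + e\<^sup>2)"
  by (metis mk_simps norm5 norm_ge_zero real_sqrt_unique)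

lemma norm_mk0 [simp]: "norm (mk z 0 0) = norm z" "norm (mk 0 w 0) = norm w"
  by (simp_all add: norm_mk)

lemma S3eq_iff: "x \<in> S3eq \<longleftrightarrow> norm x = 1 \<and> x $ 5 = 0"
  by (simp add: S3eq_def S4_def)

lemma clifford0_iff: "x \<in> clifford 0 \<longleftrightarrow> x \<in> S3eq \<and> wc x = 0"
proof -
  have "(x $ 1)\<^sup>2 + (x $ 2)\<^sup>2 = 1" if "x \<in> S3eq" "wc x = 0"
    using that norm5[of x] by (simp add: S3eq_iff cmod_def zc_def)
  then show ?thesis by (auto simp: clifford_def wc_def complex_eq_iff)
qed

lemma clifford2_iff: "x \<in> clifford 2 \<longleftrightarrow> x \<in> S3eq \<and> zc x = 0"
proof -
  have "(x $ 3)\<^sup>2 + (x $ 4)\<^sup>2 = 1" if "x \<in> S3eq" "zc x = 0"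
    using that norm5[of x] by (simp add: S3eq_iff cmod_def wc_def)
  then show ?thesis by (auto simp: clifford_def zc_def complex_eq_iff)
qed

lemma r12_mk: "r12 x = mk (\<i> * zc x) (wc x) (x $ 5)"
  by (simp add: vec_eq_iff forall_5 r12_def mk_def zc_def wc_def)

lemma r34_mk: "r34 x = mk (zc x) (cis (pi/3) * wc x) (x $ 5)"
  by (simp add: vec_eq_iff forall_5 r34_def mk_def zc_def wc_def algebra_simps)

lemma s4_mk: "s4 x = mk (zc x) (cnj (wc x)) (x $ 5)"
  by (simp add: vec_eq_iff forall_5 s4_def mk_def zc_def wc_def)

section \<open>Cones over finite families and spherical hulls\<close>

text \<open>Coefficients are indexed by lattice points and not by the points \<open>f v\<close>, so
  supports can be compared before \<open>f\<close> is known to be injective on a cell. Cones also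
  absorb positive rescaling of the vertices, which makes the later normalisation harmless.\<close>

definition pcone :: "('i => real^5) => 'i set => (real^5) set" where
  "pcone f c = {x. \<exists>a. (\<forall>v\<in>c. 0 \<le> a v) \<and> x = (\<Sum>v\<in>c. a v *\<^sub>R f v)}"

lemma pconeI: "(!!v. v \<in> c ==> 0 \<le> a v) ==> (\<Sum>v\<in>c. a v *\<^sub>R f v) \<in> pcone f c"
  unfolding pcone_def by blast

lemma pconeE:
  assumes "x \<in> pcone f c"
  obtains a where "\<forall>v\<in>c. 0 \<le> a v" "x = (\<Sum>v\<in>c. a v *\<^sub>R f v)"
  using assms unfolding pcone_def by blast

lemma pcone_scale: assumes "x \<in> pcone f c" "0 \<le> r" shows "r *\<^sub>R x \<in> pcone f c"
proof -
  obtain a where a: "\<forall>v\<in>c. 0 \<le> a v" "x = (\<Sum>v\<in>c. a v *\<^sub>R f v)" using assms(1) by (rule pconeE)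
  have "(\<Sum>v\<in>c. (r * a v) *\<^sub>R f v) \<in> pcone f c" using a(1) assms(2) by (intro pconeI) auto
  then show ?thesis by (simp add: a(2) scaleR_sum_right)
qed

lemma pcone_gen: "finite c ==> v \<in> c ==> f v \<in> pcone f c"
  unfolding pcone_def
  by (rule CollectI, rule exI[of _ "\<lambda>u. if u = v then 1 else 0"])
     (auto simp: if_distrib[of "\<lambda>a. a *\<^sub>R _"] cong: if_cong)

lemma pcone_mono: assumes "finite d" "c \<subseteq> d" shows "pcone f c \<subseteq> pcone f d"
proof
  fix x assume "x \<in> pcone f c"
  then obtain a where a: "\<forall>v\<in>c. 0 \<le> a v" "x = (\<Sum>v\<in>c. a v *\<^sub>R f v)" by (auto simp: pcone_def)
  have "x = (\<Sum>v\<in>d. (if v \<in> c then a v else 0) *\<^sub>R f v)"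
    unfolding a(2) using assms by (intro sum.mono_neutral_cong_left) auto
  also have "\<dots> \<in> pcone f d" using a(1) by (intro pconeI) auto
  finally show "x \<in> pcone f d" .
qed

lemma pcone_inner_nonneg: "x \<in> pcone f c ==> (!!v. v \<in> c ==> 0 \<le> b \<bullet> f v) ==> 0 \<le> b \<bullet> x"
  by (auto simp: pcone_def inner_sum_right intro!: sum_nonneg)

lemma pcone_add: assumes "x \<in> pcone f c" "y \<in> pcone f c" shows "x + y \<in> pcone f c"
proof -
  obtain a b where "\<forall>i\<in>c. 0 \<le> a i" "x = (\<Sum>i\<in>c. a i *\<^sub>R f i)"
    "\<forall>i\<in>c. 0 \<le> b i" "y = (\<Sum>i\<in>c. b i *\<^sub>R f i)" using assms by (auto simp: pcone_def)
  then show ?thesis unfolding pcone_def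
    by (intro CollectI exI[of _ "\<lambda>i. a i + b i"]) (auto simp: sum.distrib scaleR_left_distrib)
qed

lemma pcone_0: "0 \<in> pcone f c"
  unfolding pcone_def by (intro CollectI exI[of _ "\<lambda>_. 0"]) auto

lemma pcone_sum: "(!!i. i \<in> A ==> g i \<in> pcone f c) ==> sum g A \<in> pcone f c"
  by (induction A rule: infinite_finite_induct) (auto intro: pcone_add pcone_0)

lemma pcone_convex_hull: "convex hull (f ` c) \<subseteq> pcone f c" if "finite c"
  by (rule hull_minimal) (use that in \<open>auto intro!: convexI pcone_add pcone_scale pcone_gen\<close>)

definition hemi :: "('i => real^5) => 'i set => bool" where
  "hemi f c \<longleftrightarrow> (\<exists>g. \<forall>v\<in>c. 0 < g \<bullet> f v)"

lemma hemi_mono: "hemi f d ==> c \<subseteq> d ==> hemi f c"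
  unfolding hemi_def by blast

lemma pcone_pos:
  assumes "finite c" "\<forall>v\<in>c. 0 < g \<bullet> f v" "x \<in> pcone f c" "x \<noteq> 0" shows "0 < g \<bullet> x"
proof -
  obtain a where a: "\<forall>v\<in>c. 0 \<le> a v" "x = (\<Sum>v\<in>c. a v *\<^sub>R f v)" using assms(3) by (auto simp: pcone_def)
  obtain v where v: "v \<in> c" "a v \<noteq> 0"
    using assms(4) a(2) by (metis (no_types, lifting) scale_zero_left sum.neutral)
  have "0 < a v * (g \<bullet> f v)" using v a assms(2) by (simp add: order_less_le)
  also have "\<dots> \<le> (\<Sum>v\<in>c. a v * (g \<bullet> f v))"
    using v a assms by (intro member_le_sum) (auto simp: less_imp_le)
  finally show ?thesis by (simp add: a(2) inner_sum_right)
qed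

text \<open>Radial projection turns convex combinations into arbitrary nonnegative ones, and the
  hemisphere functional keeps 0 out of the hull.\<close>

lemma sph_hull_iff:
  assumes "finite c" "hemi f c"
  shows "x \<in> sph_hull (f ` c) \<longleftrightarrow> norm x = 1 \<and> x \<in> pcone f c"
proof
  obtain g where g: "\<forall>v\<in>c. 0 < g \<bullet> f v" using assms(2) by (auto simp: hemi_def)
  {
    assume "x \<in> sph_hull (f ` c)"
    then obtain y where y: "y \<in> convex hull (f ` c)" "x = sgn y" by (auto simp: sph_hull_def)
    have "convex hull (f ` c) \<subseteq> {y. 0 < g \<bullet> y}"
      using g by (intro hull_minimal) (auto simp: convex_halfspace_gt)
    then have "y \<noteq> 0" using y(1) by auto
    then show "norm x = 1 \<and> x \<in> pcone f c"
      using y pcone_convex_hull[OF assms(1)] pcone_scale[of y f c "inverse (norm y)"]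
      by (auto simp: sgn_div_norm norm_sgn)
  }
  assume x: "norm x = 1 \<and> x \<in> pcone f c"
  then obtain a where a: "\<forall>v\<in>c. 0 \<le> a v" "x = (\<Sum>v\<in>c. a v *\<^sub>R f v)" by (auto simp: pcone_def)
  \<comment> \<open>Dividing by the total weight returns to a convex combination; the weight is
    nonzero because \<open>x\<close> has norm 1.\<close>
  define s where "s = sum a c"
  have "s \<noteq> 0"
  proof
    assume "s = 0"
    then have "\<forall>v\<in>c. a v = 0" using a(1) assms(1) by (auto simp: s_def sum_nonneg_eq_0_iff)
    then show False using a(2) x by auto
  qed
  then have s: "s > 0" using a(1) by (simp add: s_def sum_nonneg order_less_le)
  have "(\<Sum>v\<in>c. (a v / s) *\<^sub>R f v) \<in> convex hull (f ` c)"
    using assms(1) s a(1)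
    by (intro convex_sum) (auto simp: hull_inc s_def[symmetric] sum_divide_distrib[symmetric])
  moreover have "(\<Sum>v\<in>c. (a v / s) *\<^sub>R f v) = (1/s) *\<^sub>R x"
    unfolding a(2) by (simp add: scaleR_sum_right divide_inverse mult.commute)
  moreover have "sgn ((1/s) *\<^sub>R x) = x" using s x by (simp add: sgn_div_norm)
  ultimately show "x \<in> sph_hull (f ` c)" unfolding sph_hull_def by (metis image_eqI)
qed

lemma sgn_pcone: assumes "finite c" "hemi f c" "x \<in> pcone f c" "x \<noteq> 0"
  shows "sgn x \<in> sph_hull (f ` c)"
  using assms pcone_scale[of x f c "inverse (norm x)"]
  by (auto simp: sph_hull_iff sgn_div_norm)

lemma hemi_nonzero: "hemi f c ==> v \<in> c ==> f v \<noteq> 0"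
  by (auto simp: hemi_def)

text \<open>Complementary slackness: where a functional that is nonnegative on the generators
  vanishes, every term of a representation vanishes, so only generators in its zero set carry
  weight.\<close>

lemma face_sph_hull:
  assumes c: "finite c" "hemi f c"
  shows "sph_face F (sph_hull (f ` c)) \<longleftrightarrow>
    (\<exists>b. (\<forall>v\<in>c. 0 \<le> b \<bullet> f v) \<and> F = sph_hull (f ` {v\<in>c. b \<bullet> f v = 0}))" (is "?L \<longleftrightarrow> ?R")
proof -
  have key: "sph_hull (f ` {v\<in>c. b \<bullet> f v = 0}) = {x \<in> sph_hull (f ` c). b \<bullet> x = 0}"
    if b: "\<forall>v\<in>c. 0 \<le> b \<bullet> f v" for b
  proof -
    let ?d = "{v\<in>c. b \<bullet> f v = 0}"
    have d: "finite ?d" "hemi f ?d" "?d \<subseteq> c" using c by (auto intro: hemi_mono)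
    have "x \<in> pcone f ?d \<longleftrightarrow> x \<in> pcone f c \<and> b \<bullet> x = 0" for x
    proof safe
      assume "x \<in> pcone f ?d"
      then show "x \<in> pcone f c" "b \<bullet> x = 0"
        using pcone_mono[OF c(1) d(3)] by (auto simp: pcone_def inner_sum_right)
    next
      assume "x \<in> pcone f c" and bx: "b \<bullet> x = 0"
      then obtain a where a: "\<forall>v\<in>c. 0 \<le> a v" "x = (\<Sum>v\<in>c. a v *\<^sub>R f v)" by (auto simp: pcone_def)
      have "(\<Sum>v\<in>c. a v * (b \<bullet> f v)) = 0" using bx by (simp add: a(2) inner_sum_right)
      then have z: "\<forall>v\<in>c. a v * (b \<bullet> f v) = 0"
        using a b c(1) by (subst (asm) sum_nonneg_eq_0_iff) auto
      have "x = (\<Sum>v\<in>?d. a v *\<^sub>R f v)"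
        unfolding a(2) using z c(1) by (intro sum.mono_neutral_right) auto
      then show "x \<in> pcone f ?d" using a(1) by (auto simp: pcone_def)
    qed
    then show ?thesis using sph_hull_iff[OF c] sph_hull_iff[OF d(1,2)] by blast
  qed
  have nn: "0 \<le> b \<bullet> f v" if "\<forall>x\<in>sph_hull (f ` c). 0 \<le> b \<bullet> x" "v \<in> c" for b v
  proof -
    have "sgn (f v) \<in> sph_hull (f ` c)"
      by (rule sgn_pcone[OF c pcone_gen[where f=f, OF c(1) that(2)] hemi_nonzero[OF c(2) that(2)]])
    then have "0 \<le> b \<bullet> sgn (f v)" using that(1) by blast
    then show ?thesis using hemi_nonzero[OF c(2) that(2)]
      by (simp add: sgn_div_norm zero_le_mult_iff inner_scaleR_right divide_inverse)
  qed
  show ?thesis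
  proof
    assume ?L
    then obtain b where "\<forall>x\<in>sph_hull (f ` c). 0 \<le> b \<bullet> x" "F = {x \<in> sph_hull (f ` c). b \<bullet> x = 0}"
      by (auto simp: sph_face_def)
    then show ?R using nn key by blast
  next
    assume ?R
    then obtain b where b: "\<forall>v\<in>c. 0 \<le> b \<bullet> f v" "F = sph_hull (f ` {v\<in>c. b \<bullet> f v = 0})" by blast
    have "\<forall>x\<in>sph_hull (f ` c). 0 \<le> b \<bullet> x"
      using b(1) pcone_inner_nonneg[of _ f c b] sph_hull_iff[OF c] by blast
    then show ?L using b key unfolding sph_face_def by blast
  qed
qed

lemma sph_polytope_hull:
  assumes c: "finite c" "hemi f c"
  shows "sph_polytope (sph_hull (f ` c))"
proof -
  obtain g where g: "\<forall>v\<in>c. 0 < g \<bullet> f v" using c(2) by (auto simp: hemi_def)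
  let ?h = "\<lambda>v. sgn (f v)"
  have nz: "v \<in> c ==> f v \<noteq> 0" for v using g by auto
  have g': "\<forall>v\<in>c. 0 < g \<bullet> ?h v" using g nz by (auto simp: sgn_div_norm)
  then have h: "hemi ?h c" by (auto simp: hemi_def)
  have "pcone f c = pcone ?h c"
  proof safe
    fix x assume "x \<in> pcone f c"
    then obtain a where a: "\<forall>v\<in>c. 0 \<le> a v" "x = (\<Sum>v\<in>c. a v *\<^sub>R f v)" by (auto simp: pcone_def)
    then have "x = (\<Sum>v\<in>c. (a v * norm (f v)) *\<^sub>R ?h v)"
      using nz by (auto simp: sgn_div_norm intro!: sum.cong)
    then show "x \<in> pcone ?h c" using a(1) by (auto simp: pcone_def intro!: exI[of _ "\<lambda>v. a v * norm (f v)"])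
  next
    fix x assume "x \<in> pcone ?h c"
    then obtain a where a: "\<forall>v\<in>c. 0 \<le> a v" "x = (\<Sum>v\<in>c. a v *\<^sub>R ?h v)" by (auto simp: pcone_def)
    then have "x = (\<Sum>v\<in>c. (a v / norm (f v)) *\<^sub>R f v)"
      using nz by (auto simp: sgn_div_norm divide_inverse intro!: sum.cong)
    then show "x \<in> pcone f c" using a(1) by (auto simp: pcone_def intro!: exI[of _ "\<lambda>v. a v / norm (f v)"])
  qed
  then have "sph_hull (f ` c) = sph_hull (?h ` c)" using sph_hull_iff[OF c] sph_hull_iff[OF c(1) h] by blast
  then show ?thesis unfolding sph_polytope_def using c(1) g' nz
    by (intro exI[of _ "?h ` c"] exI[of _ g]) (auto simp: S4_def norm_sgn)
qed

lemma sph_hull_rescale: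
  assumes "finite c" "hemi f c" "\<forall>v\<in>c. 0 < r v \<and> h v = r v *\<^sub>R f v"
  shows "sph_hull (h ` c) = sph_hull (f ` c)" "hemi h c"
proof -
  show h: "hemi h c" using assms(2,3) unfolding hemi_def by (metis inner_scaleR_right mult_pos_pos)
  have "pcone f c = pcone h c"
  proof safe
    fix x assume "x \<in> pcone f c"
    then obtain a where a: "\<forall>v\<in>c. 0 \<le> a v" "x = (\<Sum>v\<in>c. a v *\<^sub>R f v)" by (auto simp: pcone_def)
    then have "x = (\<Sum>v\<in>c. (a v / r v) *\<^sub>R h v)"
      using assms(3) by (auto intro!: sum.cong)
    then show "x \<in> pcone h c" using a(1) assms(3)
      by (auto simp: pcone_def less_imp_le intro!: exI[of _ "\<lambda>v. a v / r v"])
  next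
    fix x assume "x \<in> pcone h c"
    then obtain a where a: "\<forall>v\<in>c. 0 \<le> a v" "x = (\<Sum>v\<in>c. a v *\<^sub>R h v)" by (auto simp: pcone_def)
    then have "x = (\<Sum>v\<in>c. (a v * r v) *\<^sub>R f v)" using assms(3) by (auto intro!: sum.cong)
    then show "x \<in> pcone f c" using a(1) assms(3)
      by (auto simp: pcone_def less_imp_le intro!: exI[of _ "\<lambda>v. a v * r v"])
  qed
  then show "sph_hull (h ` c) = sph_hull (f ` c)" using sph_hull_iff[OF assms(1,2)] sph_hull_iff[OF assms(1) h] by blast
qed

lemma eq_proj_sph_hull: "eq_proj ` sph_hull (f ` c) = sph_hull ((flat \<circ> f) ` c)"
proof -
  have "eq_proj (sgn y) = sgn (flat y)" for y
    by (cases "y = 0")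
       (auto simp: eq_proj_flat sgn_div_norm linear_scale[OF linear_flat] linear_0[OF linear_flat])
  then have "eq_proj ` sgn ` H = sgn ` flat ` H" for H by (simp add: image_image)
  moreover have "flat ` (convex hull (f ` c)) = convex hull (flat ` f ` c)"
    by (rule convex_hull_linear_image[OF linear_flat])
  ultimately show ?thesis unfolding sph_hull_def image_comp[symmetric] by simp
qed

lemma isometry_sph_hull:
  assumes "linear g" "!!x. norm (g x) = norm x"
  shows "g ` sph_hull V = sph_hull (g ` V)"
proof -
  have "g (sgn y) = sgn (g y)" for y
    by (simp add: sgn_div_norm linear_scale[OF assms(1)] assms(2))
  then show ?thesis
    unfolding sph_hull_def by (simp add: image_image convex_hull_linear_image[OF assms(1), symmetric])
qed

text \<open>A vertex of maximal norm, after scaling into an affine hyperplane, is exposed. Together with a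
  functional bounding the polytope this shows that every spherical polytope is the hull of its
  vertices.\<close>

lemma sph_polytope_vertices:
  assumes Q: "sph_polytope Q"
  defines "X \<equiv> {x. sph_face {x} Q}"
  shows "finite X" "X \<subseteq> Q" "Q = sph_hull X" "hemi (\<lambda>x. x) X" "Q \<noteq> {} ==> X \<noteq> {}"
proof -
  obtain V a where V: "finite V" "V \<subseteq> S4" "\<forall>v\<in>V. 0 < a \<bullet> v" "Q = sph_hull V"
    using Q by (auto simp: sph_polytope_def)
  define f where "f = (\<lambda>v::real^5. v)"
  have fV: "f ` V = V" by (simp add: f_def)
  have hV: "hemi f V" using V by (auto simp: hemi_def f_def)
  note hull = sph_hull_iff[OF V(1) hV, unfolded fV]
  show XQ: "X \<subseteq> Q" unfolding X_def sph_face_def by blast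
  have vn: "norm v = 1" if "v \<in> V" for v using V(2) that by (auto simp: S4_def)
  have single: "sph_hull (f ` {v}) = {v}" if "v \<in> V" for v
    using vn[OF that] by (auto simp: sph_hull_def f_def sgn_div_norm)
  have XV: "X \<subseteq> V"
  proof
    fix x assume "x \<in> X"
    then obtain b where b: "\<forall>v\<in>V. 0 \<le> b \<bullet> f v" "{x} = sph_hull (f ` {v\<in>V. b \<bullet> f v = 0})"
      using face_sph_hull[OF V(1) hV, of "{x}"] V(4) by (auto simp: X_def fV)
    let ?d = "{v\<in>V. b \<bullet> f v = 0}"
    have "?d \<noteq> {}"
    proof
      assume e: "?d = {}"
      show False using b(2) unfolding e by (simp add: sph_hull_def)
    qed
    then obtain v where v: "v \<in> ?d" by blast
    have d: "finite ?d" "hemi f ?d" using V(1) hemi_mono[OF hV] by auto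
    have "v = sgn (f v)" using vn v by (simp add: f_def sgn_div_norm)
    also have "\<dots> \<in> sph_hull (f ` ?d)"
      by (rule sgn_pcone[OF d pcone_gen[where f=f, OF d(1) v] hemi_nonzero[OF d(2) v]])
    finally have "v \<in> sph_hull (f ` ?d)" .
    then show "x \<in> V" using b(2) v by auto
  qed
  then show fX: "finite X" using V(1) finite_subset by blast
  show hX: "hemi (\<lambda>x. x) X" using hemi_mono[OF hV XV] by (simp add: f_def)
  have exposed: "\<exists>v\<in>V. v \<in> X \<and> b \<bullet> v \<le> \<beta> * (a \<bullet> v)"
    if "v0 \<in> V" "b \<bullet> v0 \<le> \<beta> * (a \<bullet> v0)" for b \<beta> v0
  proof -
    define r where "r v = (b \<bullet> v) / (a \<bullet> v)" for v
    define m where "m = Min (r ` V)"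
    define G where "G = {v\<in>V. r v = m}"
    have m: "m \<in> r ` V" "\<forall>v\<in>V. m \<le> r v" proof -
      have "finite (r ` V)" "r ` V \<noteq> {}" using V(1) that(1) by blast+
      from Min_in[OF this] Min_le[OF this(1)] show "m \<in> r ` V" "\<forall>v\<in>V. m \<le> r v" by (auto simp: m_def)
    qed
    then have "G \<noteq> {}" "finite G" using V(1) by (auto simp: G_def)
    define n where "n v = norm ((1 / (a \<bullet> v)) *\<^sub>R v)" for v :: "real^5"
    obtain v1 where v1: "v1 \<in> G" "\<forall>v\<in>G. n v \<le> n v1"
    proof -
      have "finite (n ` G)" "n ` G \<noteq> {}" using \<open>G \<noteq> {}\<close> \<open>finite G\<close> by blast+
      from Max_in[OF this] Max_ge[OF this(1)]
      have "Max (n ` G) \<in> n ` G" "\<forall>v\<in>G. n v \<le> Max (n ` G)" by auto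
      then show ?thesis using that by (metis imageE)
    qed
    define u where "u v = (1 / (a \<bullet> v)) *\<^sub>R v" for v :: "real^5"
    have v1V: "v1 \<in> V" using v1 by (auto simp: G_def)
    have au: "a \<bullet> u v = 1" if "v \<in> V" for v using V(3) that by (auto simp: u_def)
    \<comment> \<open>On the hyperplane \<open>a \<bullet> x = 1\<close>, \<open>p\<close> cuts out
      the tangent plane to the sphere through \<open>u v1\<close>; maximality of the norm makes it
      positive at the other points of \<open>G\<close>. On \<open>V\<close> the functional
      \<open>q\<close> vanishes exactly at \<open>G\<close>, so \<open>N *\<^sub>R q + p\<close>
      with large \<open>N\<close> is positive on \<open>V\<close> except at
      \<open>v1\<close>.\<close>
    define p where "p = (norm (u v1))\<^sup>2 *\<^sub>R a - u v1"
    define q where "q = b - m *\<^sub>R a"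
    have qpos: "q \<bullet> v \<ge> 0" "q \<bullet> v = 0 \<longleftrightarrow> v \<in> G" if "v \<in> V" for v
    proof -
      have "a \<bullet> v > 0" using V(3) that by auto
      then have "q \<bullet> v = (r v - m) * (a \<bullet> v)"
        by (simp add: q_def r_def inner_diff_left algebra_simps)
      moreover have "m \<le> r v" using m that by auto
      ultimately show "q \<bullet> v \<ge> 0" "q \<bullet> v = 0 \<longleftrightarrow> v \<in> G"
        using \<open>a \<bullet> v > 0\<close> that by (auto simp: G_def)
    qed
    have ppos: "p \<bullet> v > 0" if "v \<in> G" "v \<noteq> v1" for v
    proof -
      have vV: "v \<in> V" and av: "a \<bullet> v > 0" using that V(3) by (auto simp: G_def)
      have nle: "norm (u v) \<le> norm (u v1)" using v1(2) that(1) by (auto simp: n_def u_def)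
      have ne: "u v \<noteq> u v1"
      proof
        assume "u v = u v1"
        then have "sgn (u v) = sgn (u v1)" by simp
        moreover have "sgn (u x) = x" if "x \<in> V" for x
        proof -
          have "a \<bullet> x > 0" using V(3) that by auto
          then show ?thesis using vn[OF that] by (simp add: u_def sgn_scaleR sgn_div_norm)
        qed
        ultimately show False using that(2) vV v1V by simp
      qed
      have "u v1 \<bullet> u v < (norm (u v1))\<^sup>2"
      proof (rule ccontr)
        assume A: "\<not> ?thesis"
        have "(norm (u v - u v1))\<^sup>2 = (norm (u v))\<^sup>2 - 2 * (u v1 \<bullet> u v) + (norm (u v1))\<^sup>2"
          by (simp add: power2_norm_eq_inner inner_diff_left inner_diff_right inner_commute)
        also have "\<dots> \<le> 0" using A power_mono[OF nle norm_ge_zero, of 2] by linarith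
        finally show False using ne by simp
      qed
      then have "p \<bullet> u v > 0" using au[OF vV] by (simp add: p_def inner_diff_left)
      then show ?thesis using av by (simp add: u_def zero_less_divide_iff)
    qed
    have p1: "p \<bullet> v1 = 0"
    proof -
      have "p \<bullet> u v1 = 0" using au[OF v1V]
        by (simp add: p_def inner_diff_left power2_norm_eq_inner)
      then show ?thesis using V(3) v1V by (auto simp: u_def)
    qed
    have "\<exists>N. \<forall>v\<in>V - G. 0 < N * (q \<bullet> v) + p \<bullet> v"
    proof -
      define N where "N = 1 + (\<Sum>v\<in>V - G. \<bar>p \<bullet> v\<bar> / (q \<bullet> v))"
      have "0 < N * (q \<bullet> v) + p \<bullet> v" if v: "v \<in> V - G" for v
      proof -
        have qv: "q \<bullet> v > 0" using qpos[of v] v by (auto simp: order_less_le)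
        have "\<bar>p \<bullet> v\<bar> / (q \<bullet> v) \<le> (\<Sum>v\<in>V - G. \<bar>p \<bullet> v\<bar> / (q \<bullet> v))"
          using v V(1) qpos(1) by (intro member_le_sum) auto
        then have "\<bar>p \<bullet> v\<bar> / (q \<bullet> v) < N" by (simp add: N_def)
        then have "\<bar>p \<bullet> v\<bar> < N * (q \<bullet> v)" using qv by (simp add: divide_less_eq)
        then show ?thesis by linarith
      qed
      then show ?thesis by blast
    qed
    then obtain N where N: "\<forall>v\<in>V - G. 0 < N * (q \<bullet> v) + p \<bullet> v" by blast
    define c where "c = N *\<^sub>R q + p"
    have cv: "c \<bullet> v = N * (q \<bullet> v) + p \<bullet> v" for v by (simp add: c_def inner_add_left)
    have cpos: "0 < c \<bullet> v" if "v \<in> V" "v \<noteq> v1" for v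
    proof (cases "v \<in> G")
      case True then show ?thesis using cv ppos[OF True that(2)] qpos[OF that(1)] by simp
    next
      case False then show ?thesis using cv N that by auto
    qed
    have c1: "c \<bullet> v1 = 0" using cv p1 qpos[OF v1V] v1(1) by simp
    have "{v\<in>V. c \<bullet> f v = 0} = {v1}" using cpos c1 v1V by (force simp: f_def)
    then have "{v1} = sph_hull (f ` {v\<in>V. c \<bullet> f v = 0})" using single[OF v1V] by simp
    moreover have "\<forall>v\<in>V. 0 \<le> c \<bullet> f v" using cpos c1 by (metis f_def less_imp_le order_refl)
    ultimately have "sph_face {v1} Q"
      using face_sph_hull[OF V(1) hV, of "{v1}"] unfolding V(4) fV by blast
    moreover have "b \<bullet> v1 \<le> \<beta> * (a \<bullet> v1)"
    proof -
      have "r v1 = m" using v1 by (auto simp: G_def)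
      also have "m \<le> r v0" using m that(1) by auto
      also have "\<dots> \<le> \<beta>" using that V(3) by (simp add: r_def divide_le_eq)
      finally show ?thesis using V(3) v1V by (simp add: r_def divide_le_eq)
    qed
    ultimately show ?thesis using v1V by (auto simp: X_def)
  qed
  show "X \<noteq> {}" if "Q \<noteq> {}"
  proof -
    have "V \<noteq> {}" using that V(4) by (auto simp: sph_hull_def)
    then obtain v where "v \<in> V" by blast
    then show ?thesis using exposed[of v 0 0] by auto
  qed
  show "Q = sph_hull X"
  proof
    have "X \<subseteq> V" by fact
    then show "sph_hull X \<subseteq> Q" unfolding V(4) sph_hull_def by (intro image_mono hull_mono)
    define K where "K = convex hull ((\<lambda>v. (1 / (a \<bullet> v)) *\<^sub>R v) ` X)"
    \<comment> \<open>A point outside \<open>K\<close> would be strictly separated from it, and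
      \<open>exposed\<close> would yield a vertex of \<open>Q\<close> on the wrong side.\<close>
    have VK: "(1 / (a \<bullet> v)) *\<^sub>R v \<in> K" if v: "v \<in> V" for v
    proof (rule ccontr)
      assume "(1 / (a \<bullet> v)) *\<^sub>R v \<notin> K"
      moreover have "closed K" "convex K" using fX
        by (auto simp: K_def finite_imp_compact_convex_hull compact_imp_closed)
      ultimately obtain d \<beta> where d: "d \<bullet> ((1 / (a \<bullet> v)) *\<^sub>R v) < \<beta>" "\<forall>x\<in>K. \<beta> < d \<bullet> x"
        using separating_hyperplane_closed_point[of K "(1 / (a \<bullet> v)) *\<^sub>R v"] by auto
      have av: "a \<bullet> v > 0" using V(3) v by auto
      have "d \<bullet> v \<le> \<beta> * (a \<bullet> v)" using d(1) av by (simp add: field_simps)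
      then obtain x where x: "x \<in> V" "x \<in> X" "d \<bullet> x \<le> \<beta> * (a \<bullet> x)" using exposed v by blast
      have "(1 / (a \<bullet> x)) *\<^sub>R x \<in> K" unfolding K_def using x by (auto intro: hull_inc)
      then have "\<beta> < d \<bullet> ((1 / (a \<bullet> x)) *\<^sub>R x)" using d by auto
      then show False using x V(3) by (auto simp: field_simps)
    qed
    have KX: "K \<subseteq> pcone (\<lambda>x. x) X"
    proof -
      have "K \<subseteq> pcone (\<lambda>v. (1 / (a \<bullet> v)) *\<^sub>R v) X" unfolding K_def by (rule pcone_convex_hull[OF fX])
      also have "\<dots> \<subseteq> pcone (\<lambda>x. x) X"
      proof
        fix x assume "x \<in> pcone (\<lambda>v. (1 / (a \<bullet> v)) *\<^sub>R v) X"
        then obtain s where s: "\<forall>v\<in>X. 0 \<le> s v" "x = (\<Sum>v\<in>X. s v *\<^sub>R (1 / (a \<bullet> v)) *\<^sub>R v)"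
          by (auto simp: pcone_def)
        then show "x \<in> pcone (\<lambda>x. x) X" using V(3) XV
          by (auto simp: pcone_def less_imp_le intro!: exI[of _ "\<lambda>v. s v / (a \<bullet> v)"] divide_nonneg_pos)
      qed
      finally show ?thesis .
    qed
    show "Q \<subseteq> sph_hull X"
    proof
      fix x assume "x \<in> Q"
      then have nx: "norm x = 1" and "x \<in> pcone f V" using hull V(4) by auto
      then obtain s where s: "\<forall>v\<in>V. 0 \<le> s v" "x = (\<Sum>v\<in>V. s v *\<^sub>R v)" by (auto simp: pcone_def f_def)
      have "x \<in> pcone (\<lambda>x. x) X" unfolding s(2)
      proof (rule pcone_sum)
        fix v assume v: "v \<in> V"
        then have av: "a \<bullet> v > 0" using V(3) by auto
        have "v = (a \<bullet> v) *\<^sub>R ((1 / (a \<bullet> v)) *\<^sub>R v)" using av by simp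
        then have "v \<in> pcone (\<lambda>x. x) X" using KX VK[OF v] pcone_scale av by (metis less_imp_le subsetD)
        then show "s v *\<^sub>R v \<in> pcone (\<lambda>x. x) X" using s(1) v pcone_scale by blast
      qed
      then show "x \<in> sph_hull X" using nx sph_hull_iff[OF fX hX] by simp
    qed
  qed
qed

section \<open>Cells of the cubical tiling\<close>

definition is_cell :: "(int^3) set => bool" where
  "is_cell c \<longleftrightarrow> (\<exists>v J. c = unit_cell v J)"

lemma csum_add [simp]: "csum (v + w) = csum v + csum w"
  and csum_diff [simp]: "csum (v - w) = csum v - csum w"
  and csum_uminus [simp]: "csum (- v) = - csum v"
  and csum_vector [simp]: "csum (vector [a, b, c]) = a + b + c"
  by (simp_all add: csum_def)

lemma LamE:
  assumes "l \<in> Lam"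
  obtains a b where "l $ 1 = 3 * a - 2 * b" "l $ 2 = - 3 * a - 2 * b" "l $ 3 = 4 * b"
proof -
  obtain a b where "l = a *s vector [3, -3, 0] + b *s vector [-2, -2, 4]"
    using assms unfolding Lam_def by blast
  then show ?thesis using that[of a b] by simp
qed

lemma LamI:
  assumes "l $ 1 = 3 * a - 2 * b" "l $ 2 = - 3 * a - 2 * b" "l $ 3 = 4 * b"
  shows "l \<in> Lam"
proof -
  have "l = a *s vector [3, -3, 0] + b *s vector [-2, -2, 4]"
    using assms by (simp add: vec_eq_iff forall_3)
  then show ?thesis unfolding Lam_def by blast
qed

lemma Lam_0 [simp]: "0 \<in> Lam"
  by (rule LamI[of _ 0 0]) auto

lemma Lam_add: "l \<in> Lam ==> m \<in> Lam ==> l + m \<in> Lam"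
  by (elim LamE, rule_tac a="a + aa" and b="b + ba" in LamI) (auto simp: algebra_simps)

lemma Lam_uminus: "l \<in> Lam ==> - l \<in> Lam"
  by (elim LamE, rule_tac a="- a" and b="- b" in LamI) (auto simp: algebra_simps)

lemma Lam_diff: "l \<in> Lam ==> m \<in> Lam ==> l - m \<in> Lam"
  using Lam_add[OF _ Lam_uminus] by (metis diff_conv_add_uminus)

lemma Lam_csum [simp]: "l \<in> Lam ==> csum l = 0"
  by (elim LamE) (simp add: csum_def)

text \<open>A nonzero vector of \<open>Lam\<close> has third coordinate at least 4 or, if that one
  is 0, first coordinate at least 3 in absolute value. Hence a cell, whose coordinates vary by at
  most 1, never meets a proper translate of itself.\<close>

lemma Lam_small: assumes "l \<in> Lam" "!!i. \<bar>l $ i\<bar> \<le> 2" shows "l = 0"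
proof -
  obtain a b where l: "l $ 1 = 3 * a - 2 * b" "l $ 2 = - 3 * a - 2 * b" "l $ 3 = 4 * b"
    using assms(1) by (rule LamE)
  have "b = 0" using assms(2)[of 3] l by presburger
  moreover have "a = 0" using assms(2)[of 1] l \<open>b = 0\<close> by presburger
  ultimately show ?thesis using l by (simp add: vec_eq_iff forall_3)
qed

lemma unit_cell_translate: "(+) l ` unit_cell v J = unit_cell (l + v) J"
proof safe
  fix x assume "x \<in> unit_cell v J"
  then show "l + x \<in> unit_cell (l + v) J" by (auto simp: unit_cell_def)
next
  fix x assume "x \<in> unit_cell (l + v) J"
  then have "x - l \<in> unit_cell v J" by (auto simp: unit_cell_def algebra_simps)
  then show "x \<in> (+) l ` unit_cell v J" by (intro image_eqI[of _ _ "x - l"]) auto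
qed

lemma is_cell_translate: "is_cell c ==> is_cell ((+) l ` c)"
  unfolding is_cell_def by (metis unit_cell_translate)

lemma finite_box: "finite {v::int^3. \<forall>i. lo \<le> v $ i \<and> v $ i \<le> hi}"
proof -
  have "{v::int^3. \<forall>i. lo \<le> v $ i \<and> v $ i \<le> hi} \<subseteq> (\<lambda>(a,b,c). vector [a,b,c]) ` ({lo..hi} \<times> {lo..hi} \<times> {lo..hi})"
  proof
    fix v :: "int^3" assume "v \<in> {v. \<forall>i. lo \<le> v $ i \<and> v $ i \<le> hi}"
    moreover have "v = vector [v$1, v$2, v$3]" by (simp add: vec_eq_iff forall_3)
    ultimately show "v \<in> (\<lambda>(a,b,c). vector [a,b,c]) ` ({lo..hi} \<times> {lo..hi} \<times> {lo..hi})"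
      by (intro image_eqI[of _ _ "(v$1, v$2, v$3)"]) auto
  qed
  then show ?thesis by (rule finite_subset) auto
qed

lemma cell_diff: "is_cell c ==> u \<in> c ==> w \<in> c ==> \<bar>u $ i - w $ i\<bar> \<le> 1"
proof -
  assume "is_cell c" "u \<in> c" "w \<in> c"
  then obtain v J where "u \<in> unit_cell v J" "w \<in> unit_cell v J" unfolding is_cell_def by blast
  then have "u $ i = v $ i \<or> u $ i = v $ i + 1" "w $ i = v $ i \<or> w $ i = v $ i + 1"
    unfolding unit_cell_def by blast+
  then show ?thesis by auto
qed

lemma unit_cell_base: "v \<in> unit_cell v J"
  by (simp add: unit_cell_def)

lemma cell_nonempty: "is_cell c ==> c \<noteq> {}"
  unfolding is_cell_def using unit_cell_base by blast

lemma cell_finite: assumes "is_cell c" shows "finite c"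
proof -
  obtain v where v: "v \<in> c" using cell_nonempty[OF assms] by blast
  define lo where "lo = Min (range (($) v)) - 1"
  define hi where "hi = Max (range (($) v)) + 1"
  have "c \<subseteq> {w. \<forall>i. lo \<le> w $ i \<and> w $ i \<le> hi}"
  proof safe
    fix w i assume "w \<in> c"
    then have "\<bar>w $ i - v $ i\<bar> \<le> 1" using cell_diff[OF assms] v by blast
    moreover have "Min (range (($) v)) \<le> v $ i" "v $ i \<le> Max (range (($) v))" by auto
    ultimately show "lo \<le> w $ i" "w $ i \<le> hi" unfolding lo_def hi_def by linarith+
  qed
  then show ?thesis using finite_box finite_subset by blast
qed

lemma is_cell_singleton [simp]: "is_cell {v}"
proof -
  have "{v} = unit_cell v {}" by (auto simp: unit_cell_def vec_eq_iff)
  then show ?thesis unfolding is_cell_def by blast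
qed

lemma is_cell_Int:
  assumes "is_cell c" "is_cell d" "c \<inter> d \<noteq> {}" shows "is_cell (c \<inter> d)"
proof -
  obtain v J w K where c: "c = unit_cell v J" and d: "d = unit_cell w K"
    using assms unfolding is_cell_def by blast
  \<comment> \<open>In each coordinate two points or unit intervals that meet have the higher base
    in common; a whole interval survives only if both are intervals with the same base.\<close>
  define u where "u = (\<chi> i. max (v $ i) (w $ i))"
  define L where "L = {i \<in> J \<inter> K. v $ i = w $ i}"
  obtain x where x: "x \<in> c" "x \<in> d" using assms(3) by blast
  have "y \<in> c \<inter> d \<longleftrightarrow> y \<in> unit_cell u L" for y
  proof -
    have "((y$i = v$i \<or> i \<in> J \<and> y$i = v$i + 1) \<and> (y$i = w$i \<or> i \<in> K \<and> y$i = w$i + 1))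
       \<longleftrightarrow> (y$i = u$i \<or> i \<in> L \<and> y$i = u$i + 1)" for i
    proof -
      have "x$i = v$i \<or> i \<in> J \<and> x$i = v$i + 1" "x$i = w$i \<or> i \<in> K \<and> x$i = w$i + 1"
        using x by (auto simp: c d unit_cell_def)
      then show ?thesis by (auto simp: u_def L_def max_def)
    qed
    then show ?thesis unfolding c d unit_cell_def by blast
  qed
  then show ?thesis unfolding is_cell_def by blast
qed

lemma strip_iff: "c \<in> strip k \<longleftrightarrow> is_cell c \<and> (\<forall>w\<in>c. 0 \<le> csum w \<and> csum w \<le> int k)"
  unfolding strip_def is_cell_def by blast

lemma strip_cell: "c \<in> strip k ==> is_cell c" by (simp add: strip_iff)

lemma strip_sub: "d \<in> strip k ==> is_cell c ==> c \<subseteq> d ==> c \<in> strip k"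
  by (auto simp: strip_iff)

lemma strip_singleton: "{v} \<in> strip k \<longleftrightarrow> 0 \<le> csum v \<and> csum v \<le> int k"
  by (auto simp: strip_iff)

lemma strip_translate: "c \<in> strip k ==> csum l = 0 ==> (+) l ` c \<in> strip k"
  by (auto simp: strip_iff is_cell_translate)

lemma orbit_self: "c \<in> orbit c"
  unfolding orbit_def by (rule CollectI, rule exI[of _ 0]) auto

lemma orbit_translate: assumes "l \<in> Lam" shows "orbit ((+) l ` c) = orbit c"
proof -
  have 1: "(+) m ` (+) l ` c = (+) (m + l) ` c" for m by (simp add: image_image add.assoc)
  have 2: "(+) m ` c = (+) (m - l) ` (+) l ` c" for m by (simp add: image_image)
  show ?thesis
  proof
    show "orbit ((+) l ` c) \<subseteq> orbit c" unfolding orbit_def using 1 Lam_add[OF _ assms] by blast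
    show "orbit c \<subseteq> orbit ((+) l ` c)" unfolding orbit_def using 2 Lam_diff[OF _ assms] by blast
  qed
qed

lemma orbit_singleton_translate: "l \<in> Lam ==> orbit {l + v} = orbit {v}"
  using orbit_translate[of l "{v}"] by simp

lemma orbit_memD: "d \<in> orbit c ==> \<exists>l\<in>Lam. d = (+) l ` c"
  unfolding orbit_def by blast

lemma torus_le_iff: "torus_le (orbit c) (orbit d) \<longleftrightarrow> (\<exists>l\<in>Lam. (+) l ` c \<subseteq> d)"
proof
  assume "torus_le (orbit c) (orbit d)"
  then obtain c1 d1 where "c1 \<in> orbit c" "d1 \<in> orbit d" "c1 \<subseteq> d1" unfolding torus_le_def by blast
  then obtain l m where lm: "l \<in> Lam" "m \<in> Lam" "(+) l ` c \<subseteq> (+) m ` d"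
    using orbit_memD[of c1 c] orbit_memD[of d1 d] by blast
  have "(+) (l - m) ` c \<subseteq> d"
  proof
    fix x assume "x \<in> (+) (l - m) ` c"
    then obtain y where y: "y \<in> c" "x = l - m + y" by blast
    then have "l + y \<in> (+) m ` d" using lm(3) by blast
    then obtain z where "z \<in> d" "l + y = m + z" by blast
    then have "x = z" using y by (simp add: algebra_simps)
    then show "x \<in> d" using \<open>z \<in> d\<close> by simp
  qed
  then show "\<exists>l\<in>Lam. (+) l ` c \<subseteq> d" using Lam_diff lm by blast
next
  assume "\<exists>l\<in>Lam. (+) l ` c \<subseteq> d"
  then obtain l where l: "l \<in> Lam" "(+) l ` c \<subseteq> d" by blast
  then have "(+) l ` c \<in> orbit c" unfolding orbit_def by blast
  then show "torus_le (orbit c) (orbit d)" unfolding torus_le_def using orbit_self[of d] l(2) by blast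
qed

lemma torusE: assumes "X \<in> torus k" obtains c where "c \<in> strip k" "X = orbit c"
  using assms unfolding torus_def by blast

lemma torusI: "c \<in> strip k ==> orbit c \<in> torus k"
  unfolding torus_def by blast

text \<open>Two translations that both make \<open>c\<close> meet \<open>d\<close> differ by a
  vector with entries at most 2, so they agree. This turns translations found vertex by vertex into
  one translation of the whole cell.\<close>

lemma Lam_unique:
  assumes "is_cell c" "is_cell d" "l \<in> Lam" "m \<in> Lam" "v \<in> c" "w \<in> c" "l + v \<in> d" "m + w \<in> d"
  shows "l = m"
proof -
  have "\<bar>(l - m) $ i\<bar> \<le> 2" for i
    using cell_diff[OF assms(1,5,6), of i] cell_diff[OF assms(2,7,8), of i] by simp
  then have "l - m = 0" using Lam_small Lam_diff assms(3,4) by blast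
  then show ?thesis by simp
qed

lemma finite_torus: "finite (torus k)"
proof -
  let ?B = "{v::int^3. \<forall>i. - 8 \<le> v $ i \<and> v $ i \<le> int k + 8}"
  have "torus k \<subseteq> (\<lambda>(v, J). orbit (unit_cell v J)) ` (?B \<times> UNIV)"
  proof
    fix X assume "X \<in> torus k"
    then obtain c where c: "c \<in> strip k" "X = orbit c" by (rule torusE)
    then obtain v J where v: "c = unit_cell v J" unfolding strip_iff is_cell_def by blast
    then have s: "0 \<le> csum v" "csum v \<le> int k" using c(1) unit_cell_base by (auto simp: strip_iff)
    \<comment> \<open>Translation by \<open>Lam\<close> reduces the third coordinate modulo 4 and
      then the first modulo 3; the layer sum bounds the second.\<close>
    define b where "b = v $ 3 div 4"
    define a where "a = (v $ 1 + 2 * b) div 3"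
    define l :: "int^3" where "l = vector [- 3 * a + 2 * b, 3 * a + 2 * b, - 4 * b]"
    have l: "l \<in> Lam" by (rule LamI[of _ "-a" "-b"]) (simp_all add: l_def)
    have 1: "0 \<le> (l + v) $ 1" "(l + v) $ 1 \<le> 2" by (simp_all add: l_def a_def)
    have 3: "0 \<le> (l + v) $ 3" "(l + v) $ 3 \<le> 3" by (simp_all add: l_def b_def)
    have "csum (l + v) = csum v" using l by simp
    then have "(l + v) $ 1 + (l + v) $ 2 + (l + v) $ 3 = csum v" by (simp only: csum_def)
    then have "l + v \<in> ?B" using 1 3 s unfolding mem_Collect_eq forall_3 by linarith
    moreover have "X = orbit (unit_cell (l + v) J)"
      using orbit_translate[OF l, of c] c(2) by (simp add: v unit_cell_translate)
    ultimately show "X \<in> (\<lambda>(v, J). orbit (unit_cell v J)) ` (?B \<times> UNIV)" by auto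
  qed
  then show ?thesis by (rule finite_subset) (auto simp: finite_box)
qed

section \<open>Complexes spanned by a periodic family of vertices\<close>

text \<open>The faces of the cone over \<^term>\<open>P ` c\<close> are exactly the cones over the subcells of \<^term>\<open>c\<close>.\<close>

definition convex_cell :: "(int^3 => real^5) => (int^3) set => bool" where
  "convex_cell P c \<longleftrightarrow> hemi P c \<and>
     (\<forall>b. (\<forall>v\<in>c. 0 \<le> b \<bullet> P v) --> {v\<in>c. b \<bullet> P v = 0} = {} \<or> is_cell {v\<in>c. b \<bullet> P v = 0}) \<and>
     (\<forall>c'. is_cell c' \<and> c' \<subseteq> c --> (\<exists>b. (\<forall>v\<in>c. 0 \<le> b \<bullet> P v) \<and> {v\<in>c. b \<bullet> P v = 0} = c'))"

text \<open>The last clause says through supports that two cones meet in a common face: a point of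
  both cones puts weight only on vertices of \<open>c\<close> that have a translate in
  \<open>d\<close>. This form survives rescaling of the vertices and is what the convex lifting
  proves directly.\<close>

definition embedded :: "(int^3 => real^5) => nat => bool" where
  "embedded P k \<longleftrightarrow> (\<forall>l\<in>Lam. \<forall>v. P (l + v) = P v) \<and>
     (\<forall>c\<in>strip k. convex_cell P c \<and> sph_cube (sph_hull (P ` c))) \<and>
     (\<forall>c\<in>strip k. \<forall>d\<in>strip k. \<forall>a b. (\<forall>v\<in>c. 0 \<le> a v) \<and> (\<forall>v\<in>d. 0 \<le> b v) \<and>
        (\<Sum>v\<in>c. a v *\<^sub>R P v) = (\<Sum>v\<in>d. b v *\<^sub>R P v) -->
        (\<forall>v\<in>c. 0 < a v --> (\<exists>l\<in>Lam. l + v \<in> d)))"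

text \<open>The union over an orbit avoids the choice of a representative; periodicity of
  \<open>P\<close> makes it the hull of any one cell of the orbit. The empty cell is added because
  it is a face of every cell.\<close>

definition cone_model :: "(int^3 => real^5) => nat => cct" where
  "cone_model P k =
     \<lparr> cells = insert {} ((\<lambda>X. sph_hull (P ` \<Union> X)) ` torus k), chart = (\<lambda>X. sph_hull (P ` \<Union> X)) \<rparr>"

lemma convex_cell_hemi: "convex_cell P c ==> hemi P c"
  by (simp add: convex_cell_def)

lemma convex_cell_zero:
  "convex_cell P c ==> \<forall>v\<in>c. 0 \<le> b \<bullet> P v ==> {v\<in>c. b \<bullet> P v = 0} = {} \<or> is_cell {v\<in>c. b \<bullet> P v = 0}"
  by (simp only: convex_cell_def)

lemma convex_cell_expose:
  assumes "convex_cell P c" "is_cell c'" "c' \<subseteq> c"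
  obtains b where "\<forall>v\<in>c. 0 \<le> b \<bullet> P v" "{v\<in>c. b \<bullet> P v = 0} = c'"
proof -
  have "\<forall>c'. is_cell c' \<and> c' \<subseteq> c --> (\<exists>b. (\<forall>v\<in>c. 0 \<le> b \<bullet> P v) \<and> {v\<in>c. b \<bullet> P v = 0} = c')"
    using assms(1) unfolding convex_cell_def by (elim conjE)
  then have "\<exists>b. (\<forall>v\<in>c. 0 \<le> b \<bullet> P v) \<and> {v\<in>c. b \<bullet> P v = 0} = c'" using assms(2,3) by simp
  then show ?thesis using that by (elim exE conjE)
qed

lemma embedded_periodic: "embedded P k ==> \<forall>l\<in>Lam. \<forall>v. P (l + v) = P v"
  unfolding embedded_def by (elim conjE)

lemma embedded_cell:
  assumes "embedded P k" "c \<in> strip k"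
  shows "convex_cell P c" "sph_cube (sph_hull (P ` c))" "hemi P c" "is_cell c" "finite c"
proof -
  have "\<forall>c\<in>strip k. convex_cell P c \<and> sph_cube (sph_hull (P ` c))"
    using assms(1) unfolding embedded_def by (elim conjE)
  then show 1: "convex_cell P c" "sph_cube (sph_hull (P ` c))" using assms(2) by auto
  show "hemi P c" using convex_cell_hemi[OF 1(1)] .
  show "is_cell c" using strip_cell[OF assms(2)] .
  then show "finite c" by (rule cell_finite)
qed

lemma embedded_support:
  assumes "embedded P k" "c \<in> strip k" "d \<in> strip k" "\<forall>v\<in>c. 0 \<le> a v" "\<forall>v\<in>d. 0 \<le> b v"
    "(\<Sum>v\<in>c. a v *\<^sub>R P v) = (\<Sum>v\<in>d. b v *\<^sub>R P v)" "v \<in> c" "0 < a v"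
  shows "\<exists>l\<in>Lam. l + v \<in> d"
proof -
  have "\<forall>c\<in>strip k. \<forall>d\<in>strip k. \<forall>a b. (\<forall>v\<in>c. 0 \<le> a v) \<and> (\<forall>v\<in>d. 0 \<le> b v) \<and>
        (\<Sum>v\<in>c. a v *\<^sub>R P v) = (\<Sum>v\<in>d. b v *\<^sub>R P v) -->
        (\<forall>v\<in>c. 0 < a v --> (\<exists>l\<in>Lam. l + v \<in> d))"
    using assms(1) unfolding embedded_def by (elim conjE)
  from this[rule_format, OF assms(2,3), of a b v] show ?thesis using assms(4-8) by simp
qed

lemma embeddedI:
  assumes "\<forall>l\<in>Lam. \<forall>v. P (l + v) = P v"
    "!!c. c \<in> strip k ==> convex_cell P c" "!!c. c \<in> strip k ==> sph_cube (sph_hull (P ` c))"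
    "!!c d a b v. c \<in> strip k ==> d \<in> strip k ==> \<forall>v\<in>c. 0 \<le> a v ==> \<forall>v\<in>d. 0 \<le> b v ==>
       (\<Sum>v\<in>c. a v *\<^sub>R P v) = (\<Sum>v\<in>d. b v *\<^sub>R P v) ==> v \<in> c ==> 0 < a v ==> \<exists>l\<in>Lam. l + v \<in> d"
  shows "embedded P k"
  unfolding embedded_def using assms(1) assms(2,3) assms(4) by (intro conjI ballI allI impI) (assumption | simp | blast)+

lemma sph_hull_empty [simp]: "sph_hull {} = {}"
  by (simp add: sph_hull_def)

lemma sph_hull_mono: "V \<subseteq> W ==> sph_hull V \<subseteq> sph_hull W"
  unfolding sph_hull_def by (intro image_mono hull_mono)

lemma image_Union_orbit:
  assumes "\<forall>l\<in>Lam. \<forall>v. P (l + v) = P v"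
  shows "P ` \<Union> (orbit c) = P ` c"
proof
  show "P ` c \<subseteq> P ` \<Union> (orbit c)" using orbit_self by blast
  show "P ` \<Union> (orbit c) \<subseteq> P ` c"
  proof
    fix x assume "x \<in> P ` \<Union> (orbit c)"
    then obtain d y where "d \<in> orbit c" "y \<in> d" "x = P y" by blast
    then show "x \<in> P ` c" using assms orbit_memD by force
  qed
qed

lemma image_translate: "\<forall>l\<in>Lam. \<forall>v. P (l + v) = P v ==> l \<in> Lam ==> P ` (+) l ` c = P ` c"
  by (auto simp: image_image)

section \<open>Faces and intersections of the cells of a periodic family\<close>

lemma convex_cell_hull_mono:
  assumes "convex_cell P c" "is_cell c" "is_cell c1" "c1 \<subseteq> c" "is_cell c2" "c2 \<subseteq> c"
  shows "sph_hull (P ` c1) \<subseteq> sph_hull (P ` c2) \<longleftrightarrow> c1 \<subseteq> c2"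
proof
  assume "c1 \<subseteq> c2" then show "sph_hull (P ` c1) \<subseteq> sph_hull (P ` c2)" by (intro sph_hull_mono image_mono)
next
  assume sub: "sph_hull (P ` c1) \<subseteq> sph_hull (P ` c2)"
  have h: "hemi P c" using assms(1) by (rule convex_cell_hemi)
  have f: "finite c1" "finite c2" using assms cell_finite by auto
  have h12: "hemi P c1" "hemi P c2" using h hemi_mono assms by blast+
  \<comment> \<open>The functional that exposes \<open>c2\<close> in \<open>c\<close> also vanishes
    at every vertex of \<open>c1\<close>, which forces these vertices into
    \<open>c2\<close>.\<close>
  obtain b where b: "\<forall>v\<in>c. 0 \<le> b \<bullet> P v" "{v\<in>c. b \<bullet> P v = 0} = c2"
    using convex_cell_expose[OF assms(1,5,6)] .
  show "c1 \<subseteq> c2"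
  proof
    fix v assume v: "v \<in> c1"
    have "sgn (P v) \<in> sph_hull (P ` c1)"
      by (rule sgn_pcone[OF f(1) h12(1) pcone_gen[where f=P, OF f(1) v] hemi_nonzero[OF h12(1) v]])
    then have "sgn (P v) \<in> pcone P c2" using sub sph_hull_iff[OF f(2) h12(2)] by blast
    then obtain a where "sgn (P v) = (\<Sum>u\<in>c2. a u *\<^sub>R P u)" by (rule pconeE)
    then have "b \<bullet> sgn (P v) = (\<Sum>u\<in>c2. a u * (b \<bullet> P u))" by (simp add: inner_sum_right)
    also have "\<dots> = 0" using b(2) by (intro sum.neutral) auto
    finally have "b \<bullet> P v = 0" using hemi_nonzero[OF h12(1) v] by (simp add: sgn_div_norm)
    then show "v \<in> c2" using b(2) v assms(4) by blast
  qed
qed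

lemma convex_cell_faces:
  assumes "convex_cell P c" "is_cell c"
  shows "sph_face F (sph_hull (P ` c)) \<longleftrightarrow> F = {} \<or> (\<exists>c'. is_cell c' \<and> c' \<subseteq> c \<and> F = sph_hull (P ` c'))"
    (is "?L \<longleftrightarrow> ?R")
proof -
  have f: "finite c" using assms cell_finite by auto
  have h: "hemi P c" using assms(1) by (rule convex_cell_hemi)
  note F = face_sph_hull[OF f h, of F]
  show ?thesis
  proof
    assume ?L
    then obtain b where b: "\<forall>v\<in>c. 0 \<le> b \<bullet> P v" "F = sph_hull (P ` {v\<in>c. b \<bullet> P v = 0})" using F by blast
    then consider "{v\<in>c. b \<bullet> P v = 0} = {}" | "is_cell {v\<in>c. b \<bullet> P v = 0}"
      using convex_cell_zero[OF assms(1)] by blast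
    then show ?R
    proof cases
      case 1
      have "F = {}" unfolding b(2) 1 by simp
      then show ?thesis ..
    next
      case 2 then show ?thesis using b(2) by blast
    qed
  next
    assume ?R
    then show ?L
    proof
      assume e: "F = {}"
      obtain g where g: "\<forall>v\<in>c. 0 < g \<bullet> P v" using h by (auto simp: hemi_def)
      then have z: "{v\<in>c. g \<bullet> P v = 0} = {}" by auto
      have "F = sph_hull (P ` {v\<in>c. g \<bullet> P v = 0})" unfolding z e by simp
      moreover have "\<forall>v\<in>c. 0 \<le> g \<bullet> P v" using g by (auto intro: less_imp_le)
      ultimately show ?L using F by blast
    next
      assume "\<exists>c'. is_cell c' \<and> c' \<subseteq> c \<and> F = sph_hull (P ` c')"
      then obtain c' where c': "is_cell c'" "c' \<subseteq> c" "F = sph_hull (P ` c')" by blast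
      obtain b where "\<forall>v\<in>c. 0 \<le> b \<bullet> P v" "{v\<in>c. b \<bullet> P v = 0} = c'"
        using convex_cell_expose[OF assms(1) c'(1,2)] .
      then show ?L using F c'(3) by blast
    qed
  qed
qed

lemma convex_cell_hull_nonempty:
  assumes "convex_cell P c" "is_cell c" shows "sph_hull (P ` c) \<noteq> {}"
proof -
  obtain v where "v \<in> c" using assms(2) cell_nonempty by blast
  then have "P v \<in> convex hull (P ` c)" by (auto intro: hull_inc)
  then show ?thesis unfolding sph_hull_def by blast
qed

lemma embedded_hull_le:
  assumes E: "embedded P k" and c: "c \<in> strip k" and d: "d \<in> strip k"
  shows "sph_hull (P ` c) \<subseteq> sph_hull (P ` d) \<longleftrightarrow> (\<exists>l\<in>Lam. (+) l ` c \<subseteq> d)"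
proof
  assume "\<exists>l\<in>Lam. (+) l ` c \<subseteq> d"
  then obtain l where l: "l \<in> Lam" "(+) l ` c \<subseteq> d" by blast
  have "P ` c = P ` (+) l ` c" using image_translate[OF embedded_periodic[OF E] l(1)] by simp
  also have "\<dots> \<subseteq> P ` d" using l by blast
  finally show "sph_hull (P ` c) \<subseteq> sph_hull (P ` d)" by (rule sph_hull_mono)
next
  assume sub: "sph_hull (P ` c) \<subseteq> sph_hull (P ` d)"
  have cc: "is_cell c" "is_cell d" using c d strip_cell by auto
  have f: "finite c" "finite d" using cc cell_finite by auto
  have h: "hemi P c" "hemi P d" using embedded_cell(3)[OF E] c d by auto
  obtain g where g: "\<forall>v\<in>c. 0 < g \<bullet> P v" using h by (auto simp: hemi_def)
  \<comment> \<open>All weights are positive, so the support clause applies to every vertex of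
    \<open>c\<close> at once.\<close>
  define x where "x = (\<Sum>v\<in>c. 1 *\<^sub>R P v)"
  have xc: "x \<in> pcone P c" unfolding x_def by (rule pconeI) simp
  have "c \<noteq> {}" using cc cell_nonempty by blast
  then have "0 < g \<bullet> x" unfolding x_def using g f(1) by (simp add: inner_sum_right sum_pos)
  then have x0: "x \<noteq> 0" by auto
  have "sgn x \<in> pcone P d" using sub sgn_pcone[OF f(1) h(1) xc x0] sph_hull_iff[OF f(2) h(2)] by blast
  then have "norm x *\<^sub>R sgn x \<in> pcone P d" by (rule pcone_scale) simp
  then have "x \<in> pcone P d" using x0 by (simp add: sgn_div_norm)
  then obtain b where b: "\<forall>v\<in>d. 0 \<le> b v" "x = (\<Sum>v\<in>d. b v *\<^sub>R P v)" by (rule pconeE)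
  have ex: "\<exists>l\<in>Lam. l + v \<in> d" if "v \<in> c" for v
    using embedded_support[OF E c d _ b(1) b(2)[unfolded x_def] that] by simp
  obtain v0 where v0: "v0 \<in> c" using \<open>c \<noteq> {}\<close> by blast
  then obtain l where l: "l \<in> Lam" "l + v0 \<in> d" using ex by blast
  have "l + v \<in> d" if "v \<in> c" for v
    using ex[OF that] Lam_unique[OF cc l(1) _ v0 that l(2)] by blast
  then show "\<exists>l\<in>Lam. (+) l ` c \<subseteq> d" using l(1) by blast
qed

lemma chart_cone_model:
  assumes "embedded P k"
  shows "chart (cone_model P k') (orbit c) = sph_hull (P ` c)"
  by (simp add: cone_model_def image_Union_orbit[OF embedded_periodic[OF assms]])

lemma cells_cone_model:
  assumes "\<forall>l\<in>Lam. \<forall>v. P (l + v) = P v"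
  shows "cells (cone_model P k) = insert {} ((\<lambda>c. sph_hull (P ` c)) ` strip k)"
  using image_Union_orbit[OF assms] unfolding cone_model_def torus_def by (simp add: image_image)

text \<open>By \<open>Lam_unique\<close> at most one translate of \<open>d\<close> meets
  \<open>c\<close>. Supports of common points lie in the intersection of \<open>c\<close> with that
  translate, and a subcell of \<open>c\<close> spans an exposed face.\<close>

lemma embedded_Int:
  assumes E: "embedded P k" and c: "c \<in> strip k" and d: "d \<in> strip k"
  shows "sph_face (sph_hull (P ` c) \<inter> sph_hull (P ` d)) (sph_hull (P ` c))"
proof -
  have inv: "\<forall>l\<in>Lam. \<forall>v. P (l + v) = P v" using embedded_periodic[OF E] .
  have cc: "is_cell c" "is_cell d" using c d strip_cell by auto
  have f: "finite c" "finite d" using cc cell_finite by auto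
  have con: "convex_cell P c" "convex_cell P d" using embedded_cell(1)[OF E] c d by auto
  have h: "hemi P c" "hemi P d" using embedded_cell(3)[OF E] c d by auto
  have supp: "\<exists>l\<in>Lam. l + v \<in> d"
    if that: "v \<in> c" "0 < a v" "\<forall>v\<in>c. 0 \<le> a v" and pc: "(\<Sum>v\<in>c. a v *\<^sub>R P v) \<in> pcone P d" for a v
  proof -
    obtain b where "\<forall>v\<in>d. 0 \<le> b v" "(\<Sum>v\<in>c. a v *\<^sub>R P v) = (\<Sum>v\<in>d. b v *\<^sub>R P v)"
      using pc by (rule pconeE)
    then show ?thesis using embedded_support[OF E c d that(3) _ _ that(1,2)] by blast
  qed
  show ?thesis
  proof (cases "\<exists>l\<in>Lam. \<exists>v\<in>c. l + v \<in> d")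
    case False
    have "sph_hull (P ` c) \<inter> sph_hull (P ` d) = {}"
    proof (rule ccontr)
      assume "\<not> ?thesis"
      then obtain x where x: "norm x = 1" "x \<in> pcone P c" "x \<in> pcone P d"
        using sph_hull_iff[OF f(1) h(1)] sph_hull_iff[OF f(2) h(2)] by blast
      obtain a where a: "\<forall>v\<in>c. 0 \<le> a v" "x = (\<Sum>v\<in>c. a v *\<^sub>R P v)" using x(2) by (rule pconeE)
      have "a v = 0" if "v \<in> c" for v
      proof (rule ccontr)
        assume "a v \<noteq> 0"
        then have "0 < a v" using a(1) that by (auto simp: order_less_le)
        then show False using supp[of v a, OF that _ a(1)] a(2) x(3) False that by blast
      qed
      then show False using a(2) x(1) by simp
    qed
    then show ?thesis using convex_cell_faces[OF con(1) cc(1)] by blast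
  next
    case True
    then obtain l v0 where l: "l \<in> Lam" "v0 \<in> c" "l + v0 \<in> d" by blast
    define d' where "d' = (+) (- l) ` d"
    have Pd: "P ` d' = P ` d" unfolding d'_def using image_translate[OF inv Lam_uminus[OF l(1)]] .
    have mem: "v \<in> d' \<longleftrightarrow> l + v \<in> d" for v unfolding d'_def by (force simp: image_iff)
    have e: "is_cell (c \<inter> d')"
      using is_cell_Int[OF cc(1) is_cell_translate[OF cc(2), of "-l"]] l mem by (auto simp: d'_def)
    have "sph_hull (P ` c) \<inter> sph_hull (P ` d) = sph_hull (P ` (c \<inter> d'))"
    proof
      have "P ` (c \<inter> d') \<subseteq> P ` c" "P ` (c \<inter> d') \<subseteq> P ` d" using Pd by blast+
      then show "sph_hull (P ` (c \<inter> d')) \<subseteq> sph_hull (P ` c) \<inter> sph_hull (P ` d)"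
        using sph_hull_mono by blast
      show "sph_hull (P ` c) \<inter> sph_hull (P ` d) \<subseteq> sph_hull (P ` (c \<inter> d'))"
      proof
        fix x assume "x \<in> sph_hull (P ` c) \<inter> sph_hull (P ` d)"
        then have x: "norm x = 1" "x \<in> pcone P c" "x \<in> pcone P d"
          using sph_hull_iff[OF f(1) h(1)] sph_hull_iff[OF f(2) h(2)] by blast+
        obtain a where a: "\<forall>v\<in>c. 0 \<le> a v" "x = (\<Sum>v\<in>c. a v *\<^sub>R P v)" using x(2) by (rule pconeE)
        have "a v = 0" if v: "v \<in> c - c \<inter> d'" for v
        proof (rule ccontr)
          assume "a v \<noteq> 0"
          then have "0 < a v" using a(1) v by (auto simp: order_less_le)
          then obtain m where "m \<in> Lam" "m + v \<in> d" using supp[of v a, OF _ _ a(1)] a(2) x(3) v by blast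
          then have "l + v \<in> d" using Lam_unique[OF cc l(1) _ l(2) _ l(3), of m v] v by blast
          then show False using v mem by blast
        qed
        then have "x = (\<Sum>v\<in>c \<inter> d'. a v *\<^sub>R P v)"
          unfolding a(2) using f(1) by (intro sum.mono_neutral_right) auto
        also have "\<dots> \<in> pcone P (c \<inter> d')" using a(1) by (intro pconeI) auto
        finally show "x \<in> sph_hull (P ` (c \<inter> d'))"
          using x(1) sph_hull_iff[of "c \<inter> d'" P x] f(1) hemi_mono[OF h(1)] by blast
      qed
    qed
    then show ?thesis using convex_cell_faces[OF con(1) cc(1)] e by blast
  qed
qed

lemma is_cct_cone_model:
  assumes E: "embedded P k" shows "is_cct k (cone_model P k)"
proof -
  let ?H = "\<lambda>c. sph_hull (P ` c)"
  have inv: "\<forall>l\<in>Lam. \<forall>v. P (l + v) = P v" using embedded_periodic[OF E] .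
  have con: "convex_cell P c" "is_cell c" "finite c" "hemi P c" if "c \<in> strip k" for c
    using embedded_cell[OF E that] by auto
  note cells = cells_cone_model[OF inv, of k]
  note le = embedded_hull_le[OF E]
  have empty_face: "sph_face {} F" if "F \<in> cells (cone_model P k)" for F
  proof -
    consider "F = {}" | c where "c \<in> strip k" "F = ?H c" using \<open>F \<in> cells (cone_model P k)\<close> unfolding cells by blast
    then show ?thesis
    proof cases
      case 1 then show ?thesis unfolding sph_face_def by auto
    next
      case 2 then show ?thesis using convex_cell_faces con by blast
    qed
  qed
  have "polytopal_complex (cells (cone_model P k))"
    unfolding polytopal_complex_def
  proof (intro conjI ballI allI impI)
    show "finite (cells (cone_model P k))" unfolding cone_model_def using finite_torus by simp
  next
    fix F assume "F \<in> cells (cone_model P k)"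
    then consider "F = {}" | c where "c \<in> strip k" "F = ?H c" unfolding cells by blast
    then show "sph_polytope F"
    proof cases
      case 1 then show ?thesis unfolding sph_polytope_def by (intro exI[of _ "{}"]) auto
    next
      case 2 then show ?thesis using sph_polytope_hull con by blast
    qed
  next
    fix F G assume F: "F \<in> cells (cone_model P k)" "sph_face G F"
    then consider "F = {}" | c where "c \<in> strip k" "F = ?H c" unfolding cells by blast
    then show "G \<in> cells (cone_model P k)"
    proof cases
      case 1 then show ?thesis using F(2) unfolding cells sph_face_def by auto
    next
      case 2
      then have "G = {} \<or> (\<exists>c'. is_cell c' \<and> c' \<subseteq> c \<and> G = ?H c')"
        using convex_cell_faces con F(2) by blast
      then show ?thesis unfolding cells using strip_sub 2(1) by blast
    qed
  next
    fix F G assume FG: "F \<in> cells (cone_model P k)" "G \<in> cells (cone_model P k)"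
    then consider "F \<inter> G = {}" | c d where "c \<in> strip k" "F = ?H c" "d \<in> strip k" "G = ?H d"
      unfolding cells by blast
    note cs = this
    show "sph_face (F \<inter> G) F"
      using cs by cases (use empty_face FG embedded_Int[OF E] in \<open>auto\<close>)
    show "sph_face (F \<inter> G) G"
      using cs
    proof cases
      case 1 then show ?thesis using empty_face FG by simp
    next
      case 2 then show ?thesis using embedded_Int[OF E 2(3,1)] by (simp add: Int_commute)
    qed
  qed
  moreover have "sph_cube F" if "F \<in> cells (cone_model P k)" "F \<noteq> {}" for F
    using that embedded_cell(2)[OF E] unfolding cells by blast
  ultimately have "cubical_complex (cells (cone_model P k))" unfolding cubical_complex_def by blast
  moreover have "bij_betw (chart (cone_model P k)) (torus k) (cells (cone_model P k) - {{}})"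
    unfolding bij_betw_def
  proof
    show "inj_on (chart (cone_model P k)) (torus k)"
    proof (rule inj_onI)
      fix X Y assume "X \<in> torus k" "Y \<in> torus k" and eq: "chart (cone_model P k) X = chart (cone_model P k) Y"
      then obtain c d where c: "c \<in> strip k" "X = orbit c" and d: "d \<in> strip k" "Y = orbit d"
        by (meson torusE)
      have "?H c = ?H d" using eq c d by (simp add: chart_cone_model[OF E])
      then obtain l m where lm: "l \<in> Lam" "(+) l ` c \<subseteq> d" "m \<in> Lam" "(+) m ` d \<subseteq> c"
        using le[OF c(1) d(1)] le[OF d(1) c(1)] by blast
      have inj: "inj_on ((+) w) A" for w :: "int^3" and A by (simp add: inj_on_def)
      \<comment> \<open>Inclusions up to translation in both directions give equal cardinalities, so
        the translate of \<open>c\<close> is all of \<open>d\<close>.\<close>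
      have "card d \<le> card c" using card_mono[OF con(3)[OF c(1)] lm(4)] card_image[OF inj] by metis
      then have "(+) l ` c = d" using card_subset_eq[OF con(3)[OF d(1)] lm(2)]
        card_mono[OF con(3)[OF d(1)] lm(2)] card_image[OF inj, of l c] by simp
      then show "X = Y" using c d orbit_translate[OF lm(1), of c] by simp
    qed
    show "chart (cone_model P k) ` torus k = cells (cone_model P k) - {{}}"
      unfolding cells torus_def image_image chart_cone_model[OF E]
      using convex_cell_hull_nonempty con by fastforce
  qed
  moreover have "torus_le X Y \<longleftrightarrow> chart (cone_model P k) X \<subseteq> chart (cone_model P k) Y"
    if XY: "X \<in> torus k" "Y \<in> torus k" for X Y
  proof -
    obtain c d where c: "c \<in> strip k" "X = orbit c" and d: "d \<in> strip k" "Y = orbit d"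
      using XY by (meson torusE)
    then show ?thesis using le[OF c(1) d(1)] by (simp add: chart_cone_model[OF E] torus_le_iff)
  qed
  ultimately show ?thesis unfolding is_cct_def by blast
qed

section \<open>Every CCT comes from a periodic vertex family\<close>

definition vertex :: "cct => int^3 => real^5" where
  "vertex T v = the_elem (chart T (orbit {v}))"

text \<open>Converse of \<open>is_cct_cone_model\<close>. The chart is an order isomorphism and the
  complex is closed under faces, so the faces of a cell are the charts of its subcells. Charts of
  single lattice points are points, and \<open>sph_polytope_vertices\<close> recovers every cell
  from these.\<close>

lemma cct_embedded:
  assumes T: "is_cct k T"
  shows "embedded (vertex T) k"
    and "!!c. c \<in> strip k ==> chart T (orbit c) = sph_hull (vertex T ` c)"
    and "cells T = cells (cone_model (vertex T) k)"
    and "!!v. {v} \<in> strip k ==> chart T (orbit {v}) = {vertex T v}"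
proof -
  let ?X = "vertex T" and ?ch = "\<lambda>c. chart T (orbit c)"
  have comp: "polytopal_complex (cells T)" and cube: "!!F. F \<in> cells T ==> F \<noteq> {} ==> sph_cube F"
    using T unfolding is_cct_def cubical_complex_def by auto
  have bij: "bij_betw (chart T) (torus k) (cells T - {{}})" using T by (simp add: is_cct_def)
  have le: "?ch c \<subseteq> ?ch d \<longleftrightarrow> (\<exists>l\<in>Lam. (+) l ` c \<subseteq> d)" if "c \<in> strip k" "d \<in> strip k" for c d
    using T that torusI torus_le_iff unfolding is_cct_def by metis
  have cell: "?ch c \<in> cells T" "?ch c \<noteq> {}" if "c \<in> strip k" for c
    using bij torusI[OF that] unfolding bij_betw_def by blast+
  have poly: "sph_polytope (?ch c)" if "c \<in> strip k" for c
    using comp cell that unfolding polytopal_complex_def by blast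
  have subf: "?ch c \<subseteq> ?ch d" if "d \<in> strip k" "is_cell c" "c \<subseteq> d" for c d
    using le[OF strip_sub[OF that] that(1)] that(3) by (auto intro!: bexI[of _ 0])
  \<comment> \<open>In one direction the order of the torus locates a face as a translated subcell.
    In the other a subcell is the intersection of two cells of the complex, hence a face.\<close>
  have face: "sph_face F (?ch d) \<longleftrightarrow> F = {} \<or> (\<exists>c. is_cell c \<and> c \<subseteq> d \<and> F = ?ch c)"
    if d: "d \<in> strip k" for d F
  proof
    assume F: "sph_face F (?ch d)"
    then have FT: "F \<in> cells T" using comp cell(1)[OF d] unfolding polytopal_complex_def by blast
    show "F = {} \<or> (\<exists>c. is_cell c \<and> c \<subseteq> d \<and> F = ?ch c)"
    proof (cases "F = {}")
      case False
      then have "F \<in> chart T ` torus k" using FT bij unfolding bij_betw_def by blast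
      then obtain c0 where c0: "c0 \<in> strip k" "F = ?ch c0" by (auto elim: torusE)
      have "F \<subseteq> ?ch d" using F unfolding sph_face_def by blast
      then obtain l where l: "l \<in> Lam" "(+) l ` c0 \<subseteq> d" using le[OF c0(1) d] c0(2) by blast
      have "?ch ((+) l ` c0) = F" using orbit_translate[OF l(1)] c0 by simp
      then show ?thesis using is_cell_translate[OF strip_cell[OF c0(1)]] l(2) by blast
    qed simp
  next
    assume "F = {} \<or> (\<exists>c. is_cell c \<and> c \<subseteq> d \<and> F = ?ch c)"
    then show "sph_face F (?ch d)"
    proof
      assume "F = {}"
      obtain V a where V: "finite V" "\<forall>v\<in>V. 0 < a \<bullet> v" "?ch d = sph_hull V"
        using poly[OF d] unfolding sph_polytope_def by blast
      have h: "hemi (\<lambda>x. x) V" using V by (auto simp: hemi_def)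
      have "0 < a \<bullet> x" if "x \<in> ?ch d" for x
        using that sph_hull_iff[OF V(1) h] pcone_pos[OF V(1), of a "\<lambda>x. x" x] V by fastforce
      then show ?thesis unfolding sph_face_def \<open>F = {}\<close> by (intro exI[of _ a]) force
    next
      assume "\<exists>c. is_cell c \<and> c \<subseteq> d \<and> F = ?ch c"
      then obtain c where c: "is_cell c" "c \<subseteq> d" "F = ?ch c" by blast
      have cs: "c \<in> strip k" using strip_sub[OF d c(1,2)] .
      have "sph_face (?ch c \<inter> ?ch d) (?ch d)"
        using comp cell(1) cs d unfolding polytopal_complex_def by blast
      moreover have "?ch c \<inter> ?ch d = F" using subf[OF d c(1,2)] c(3) by blast
      ultimately show ?thesis by simp
    qed
  qed
  show vert: "?ch {v} = {?X v}" if v: "{v} \<in> strip k" for v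
  proof -
    have "{x. sph_face {x} (?ch {v})} \<noteq> {}" using sph_polytope_vertices(5)[OF poly[OF v]] cell(2)[OF v] .
    then obtain x where "sph_face {x} (?ch {v})" by blast
    then obtain c where c: "is_cell c" "c \<subseteq> {v}" "{x} = ?ch c" using face[OF v] by blast
    then have "c = {v}" using cell_nonempty by blast
    then have "?ch {v} = {x}" using c(3) by simp
    then show ?thesis by (simp add: vertex_def)
  qed
  have sing: "{v} \<in> strip k" if "d \<in> strip k" "v \<in> d" for d v
    using strip_sub[OF that(1)] that(2) by simp
  have hull0: "?ch d = sph_hull (?X ` d) \<and> hemi ?X d" if d: "d \<in> strip k" for d
  proof -
    have "{x. sph_face {x} (?ch d)} = ?X ` d"
    proof safe
      fix x assume "sph_face {x} (?ch d)"
      then obtain c where c: "is_cell c" "c \<subseteq> d" "{x} = ?ch c" using face[OF d] by blast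
      then obtain v where v: "v \<in> c" using cell_nonempty by blast
      have "?ch {v} \<subseteq> ?ch c" using subf[OF strip_sub[OF d c(1,2)], of "{v}"] v by simp
      have vd: "v \<in> d" using c(2) v by blast
      have "{?X v} \<subseteq> {x}" using \<open>?ch {v} \<subseteq> ?ch c\<close> unfolding vert[OF sing[OF d vd]] c(3) .
      then have "x = ?X v" by simp
      then show "x \<in> ?X ` d" using c v by blast
    next
      fix v assume v: "v \<in> d"
      have "is_cell {v} \<and> {v} \<subseteq> d \<and> ?ch {v} = ?ch {v}" using v by simp
      then have "sph_face (?ch {v}) (?ch d)" unfolding face[OF d] by blast
      then show "sph_face {?X v} (?ch d)" unfolding vert[OF sing[OF d v]] .
    qed
    then have "?ch d = sph_hull (?X ` d)" "hemi (\<lambda>x. x) (?X ` d)"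
      using sph_polytope_vertices(3,4)[OF poly[OF d]] by simp_all
    then show ?thesis unfolding hemi_def by blast
  qed
  then show hull: "?ch d = sph_hull (?X ` d)" if "d \<in> strip k" for d using that by blast
  have hemi: "hemi ?X d" if "d \<in> strip k" for d using that hull0 by blast
  have fin: "finite d" if "d \<in> strip k" for d using that strip_cell cell_finite by blast
  have norm1: "norm (?X v) = 1" if v: "{v} \<in> strip k" for v
  proof -
    have "?X v \<in> sph_hull (?X ` {v})" using vert[OF v] hull[OF v] by blast
    then show ?thesis using sph_hull_iff[OF fin[OF v] hemi[OF v]] by blast
  qed
  \<comment> \<open>A vertex in the zero set lies in the hull of \<open>c\<close> and so has a
    translate in \<open>c\<close>. Both points belong to the single cell \<open>d\<close>, hence the
    translation is 0.\<close>
  have zero: "{v\<in>d. b \<bullet> ?X v = 0} = c"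
    if d: "d \<in> strip k" and c: "is_cell c" "c \<subseteq> d" and b: "\<forall>v\<in>d. 0 \<le> b \<bullet> ?X v"
      and eq: "sph_hull (?X ` {v\<in>d. b \<bullet> ?X v = 0}) = ?ch c" for b c d
  proof -
    let ?Z = "{v\<in>d. b \<bullet> ?X v = 0}"
    have Z: "finite ?Z" "hemi ?X ?Z" using fin[OF d] hemi_mono[OF hemi[OF d]] by auto
    have cs: "c \<in> strip k" using strip_sub[OF d c] .
    show ?thesis
    proof safe
      fix v assume v: "v \<in> d" "b \<bullet> ?X v = 0"
      have "?X v \<in> pcone ?X ?Z" using pcone_gen[OF Z(1), of v ?X] v by simp
      then have "?X v \<in> ?ch c" using eq sph_hull_iff[OF Z] norm1[OF sing[OF d v(1)]] by blast
      then have "?ch {v} \<subseteq> ?ch c" using vert[OF sing[OF d v(1)]] by simp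
      then obtain l where l: "l \<in> Lam" "l + v \<in> c" using le[OF sing[OF d v(1)] cs] by auto
      have "l = 0" using Lam_unique[OF strip_cell[OF d] strip_cell[OF d] l(1) Lam_0 v(1) v(1)] l c v by auto
      then show "v \<in> c" using l by simp
    next
      fix v assume v: "v \<in> c"
      then show vd: "v \<in> d" using c by blast
      have "?X v \<in> ?ch c" using vert[OF sing[OF cs v]] subf[OF cs, of "{v}"] v by auto
      then have "?X v \<in> pcone ?X ?Z" using eq sph_hull_iff[OF Z] by blast
      then obtain a where "?X v = (\<Sum>u\<in>?Z. a u *\<^sub>R ?X u)" by (rule pconeE)
      then have "b \<bullet> ?X v = (\<Sum>u\<in>?Z. a u * (b \<bullet> ?X u))" by (simp add: inner_sum_right)
      then show "b \<bullet> ?X v = 0" by simp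
    qed
  qed
  have con: "convex_cell ?X d" if d: "d \<in> strip k" for d
    unfolding convex_cell_def
  proof (intro conjI allI impI)
    show "hemi ?X d" using hemi[OF d] .
  next
    fix b assume b: "\<forall>v\<in>d. 0 \<le> b \<bullet> ?X v"
    let ?Z = "{v\<in>d. b \<bullet> ?X v = 0}"
    have "sph_face (sph_hull (?X ` ?Z)) (?ch d)"
      unfolding hull[OF d] using face_sph_hull[OF fin[OF d] hemi[OF d]] b by blast
    then consider "sph_hull (?X ` ?Z) = {}" | c where "is_cell c" "c \<subseteq> d" "sph_hull (?X ` ?Z) = ?ch c"
      using face[OF d] by blast
    then show "?Z = {} \<or> is_cell ?Z"
    proof cases
      case 1
      then have "convex hull (?X ` ?Z) = {}" unfolding sph_hull_def by simp
      then show ?thesis by simp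
    next
      case 2
      then show ?thesis using zero[OF d 2(1,2) b 2(3)] by simp
    qed
  next
    fix c assume c: "is_cell c \<and> c \<subseteq> d"
    then have "sph_face (?ch c) (?ch d)" unfolding face[OF d] by blast
    then have "sph_face (?ch c) (sph_hull (?X ` d))" unfolding hull[OF d] .
    then obtain b where b: "\<forall>v\<in>d. 0 \<le> b \<bullet> ?X v" "?ch c = sph_hull (?X ` {v\<in>d. b \<bullet> ?X v = 0})"
      using face_sph_hull[OF fin[OF d] hemi[OF d]] by blast
    then show "\<exists>b. (\<forall>v\<in>d. 0 \<le> b \<bullet> ?X v) \<and> {v\<in>d. b \<bullet> ?X v = 0} = c"
      using zero[OF d _ _ b(1) b(2)[symmetric]] c by blast
  qed
  have inv: "\<forall>l\<in>Lam. \<forall>v. ?X (l + v) = ?X v"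
    by (simp add: vertex_def orbit_singleton_translate)
  have supp: "\<exists>l\<in>Lam. l + v \<in> d"
    if c: "c \<in> strip k" and d: "d \<in> strip k" and a: "\<forall>v\<in>c. 0 \<le> a v" and b: "\<forall>v\<in>d. 0 \<le> b v"
      and eq: "(\<Sum>v\<in>c. a v *\<^sub>R ?X v) = (\<Sum>v\<in>d. b v *\<^sub>R ?X v)" and v: "v \<in> c" "0 < a v" for c d a b v
  proof -
    define x where "x = (\<Sum>v\<in>c. a v *\<^sub>R ?X v)"
    obtain g where g: "\<forall>v\<in>c. 0 < g \<bullet> ?X v" using hemi[OF c] by (auto simp: hemi_def)
    have "0 < a v * (g \<bullet> ?X v)" using v g by simp
    also have "\<dots> \<le> (\<Sum>v\<in>c. a v * (g \<bullet> ?X v))"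
      using v a g fin[OF c] by (intro member_le_sum) (auto simp: less_imp_le)
    also have "\<dots> = g \<bullet> x" by (simp add: x_def inner_sum_right)
    finally have x0: "x \<noteq> 0" by auto
    have "x \<in> pcone ?X c" "x \<in> pcone ?X d" unfolding x_def using a pconeI[of c a ?X] eq b pconeI[of d b ?X] by auto
    then have sx: "sgn x \<in> ?ch c \<inter> ?ch d"
      using hull c d sgn_pcone[OF fin[OF c] hemi[OF c] _ x0] sgn_pcone[OF fin[OF d] hemi[OF d] _ x0] by simp
    have f1: "sph_face (?ch c \<inter> ?ch d) (?ch c)"
      using comp cell(1) c d unfolding polytopal_complex_def by blast
    then have "?ch c \<inter> ?ch d = {} \<or> (\<exists>e. is_cell e \<and> e \<subseteq> c \<and> ?ch c \<inter> ?ch d = ?ch e)"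
      unfolding face[OF c] .
    moreover have "?ch c \<inter> ?ch d \<noteq> {}" using sx by (metis empty_iff)
    ultimately obtain e where e: "is_cell e" "e \<subseteq> c" "?ch c \<inter> ?ch d = ?ch e" by (elim disjE exE conjE) auto
    have es: "e \<in> strip k" using strip_sub[OF c e(1,2)] .
    have "?ch e \<subseteq> ?ch d" using e(3) by blast
    then obtain l where l: "l \<in> Lam" "(+) l ` e \<subseteq> d" using le[OF es d] by blast
    \<comment> \<open>The intersection of the two cells is the cell over \<open>e\<close>, and the
      functional exposing \<open>e\<close> in \<open>c\<close> annihilates every vertex that carries
      weight in \<open>x\<close>.\<close>
    obtain \<beta> where \<beta>: "\<forall>v\<in>c. 0 \<le> \<beta> \<bullet> ?X v" "{v\<in>c. \<beta> \<bullet> ?X v = 0} = e"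
      using convex_cell_expose[OF con[OF c] e(1,2)] .
    have "sgn x \<in> pcone ?X e" using sx e(3) hull[OF es] sph_hull_iff[OF fin[OF es] hemi[OF es]] by blast
    then obtain s where "sgn x = (\<Sum>u\<in>e. s u *\<^sub>R ?X u)" by (rule pconeE)
    then have "\<beta> \<bullet> sgn x = (\<Sum>u\<in>e. s u * (\<beta> \<bullet> ?X u))" by (simp add: inner_sum_right)
    also have "\<dots> = 0" using \<beta>(2) by (intro sum.neutral) auto
    finally have "\<beta> \<bullet> x = 0" using x0 by (simp add: sgn_div_norm)
    then have "(\<Sum>v\<in>c. a v * (\<beta> \<bullet> ?X v)) = 0" by (simp add: x_def inner_sum_right)
    then have "\<forall>v\<in>c. a v * (\<beta> \<bullet> ?X v) = 0"
      using a \<beta>(1) fin[OF c] by (subst (asm) sum_nonneg_eq_0_iff) auto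
    then have "\<beta> \<bullet> ?X v = 0" using v by auto
    then have "v \<in> e" using \<beta>(2) v by blast
    then show ?thesis using l by blast
  qed
  have "sph_cube (sph_hull (?X ` c))" if "c \<in> strip k" for c
    using cube[OF cell[OF that]] hull[OF that] by simp
  from embeddedI[OF inv con this supp] show E: "embedded ?X k" by assumption
  have "{} \<in> cells T"
  proof -
    have "{0} \<in> strip k" by (simp add: strip_singleton csum_def)
    then have "sph_face {} (?ch {0})" "?ch {0} \<in> cells T" using face[of "{0}" "{}"] cell(1) by simp_all
    then show ?thesis using comp unfolding polytopal_complex_def by (elim conjE) metis
  qed
  moreover have "cells T - {{}} = (\<lambda>c. sph_hull (?X ` c)) ` strip k"
  proof -
    have "cells T - {{}} = chart T ` torus k" using bij unfolding bij_betw_def by blast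
    also have "\<dots> = (\<lambda>c. ?ch c) ` strip k" by (simp add: torus_def image_image)
    also have "\<dots> = (\<lambda>c. sph_hull (?X ` c)) ` strip k" using hull by (intro image_cong) auto
    finally show ?thesis .
  qed
  ultimately show "cells T = cells (cone_model ?X k)" unfolding cells_cone_model[OF inv] by blast
qed

lemma convex_cell_rescale:
  assumes "\<forall>v\<in>c. 0 < r v \<and> Q v = r v *\<^sub>R P v" "convex_cell P c"
  shows "convex_cell Q c"
proof -
  have s: "(0 \<le> b \<bullet> Q v) = (0 \<le> b \<bullet> P v)" "(b \<bullet> Q v = 0) = (b \<bullet> P v = 0)" "(0 < b \<bullet> Q v) = (0 < b \<bullet> P v)"
    if "v \<in> c" for b v using assms(1) that by (auto simp: zero_le_mult_iff zero_less_mult_iff)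
  have Z: "{v\<in>c. b \<bullet> Q v = 0} = {v\<in>c. b \<bullet> P v = 0}" for b using s by blast
  have N: "(\<forall>v\<in>c. 0 \<le> b \<bullet> Q v) = (\<forall>v\<in>c. 0 \<le> b \<bullet> P v)" for b using s by blast
  have H: "hemi Q c = hemi P c" unfolding hemi_def using s by blast
  show ?thesis using assms(2) unfolding convex_cell_def Z N H .
qed

lemma embedded_rescale:
  assumes E: "embedded P k" and r: "!!v. {v} \<in> strip k ==> 0 < r v \<and> Q v = r v *\<^sub>R P v"
    and inv: "\<forall>l\<in>Lam. \<forall>v. Q (l + v) = Q v"
  shows "embedded Q k" "!!c. c \<in> strip k ==> sph_hull (Q ` c) = sph_hull (P ` c)"
proof -
  have rc: "\<forall>v\<in>c. 0 < r v \<and> Q v = r v *\<^sub>R P v" if "c \<in> strip k" for c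
    using r strip_sub[OF that] by simp
  have con: "convex_cell P c" "finite c" "hemi P c" if "c \<in> strip k" for c
    using embedded_cell[OF E that] by auto
  show hull: "sph_hull (Q ` c) = sph_hull (P ` c)" if "c \<in> strip k" for c
    using sph_hull_rescale(1)[OF con(2,3)[OF that] rc[OF that]] .
  have supp: "\<exists>l\<in>Lam. l + v \<in> d"
    if c: "c \<in> strip k" and d: "d \<in> strip k" and a: "\<forall>v\<in>c. 0 \<le> a v" and b: "\<forall>v\<in>d. 0 \<le> b v"
      and eq: "(\<Sum>v\<in>c. a v *\<^sub>R Q v) = (\<Sum>v\<in>d. b v *\<^sub>R Q v)" and v: "v \<in> c" "0 < a v" for c d a b v
  proof -
    have "(\<Sum>v\<in>c. (a v * r v) *\<^sub>R P v) = (\<Sum>v\<in>c. a v *\<^sub>R Q v)" using rc[OF c] by (intro sum.cong) auto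
    moreover have "(\<Sum>v\<in>d. (b v * r v) *\<^sub>R P v) = (\<Sum>v\<in>d. b v *\<^sub>R Q v)" using rc[OF d] by (intro sum.cong) auto
    ultimately have eq': "(\<Sum>v\<in>c. (a v * r v) *\<^sub>R P v) = (\<Sum>v\<in>d. (b v * r v) *\<^sub>R P v)" using eq by simp
    have "\<forall>v\<in>c. 0 \<le> a v * r v" "\<forall>v\<in>d. 0 \<le> b v * r v" "0 < a v * r v"
      using a b rc[OF c] rc[OF d] v by (auto simp: less_imp_le)
    then show ?thesis using embedded_support[OF E c d _ _ eq' v(1)] by blast
  qed
  have cb: "sph_cube (sph_hull (Q ` c))" if "c \<in> strip k" for c
    using embedded_cell(2)[OF E that] hull[OF that] by simp
  have cv: "convex_cell Q c" if "c \<in> strip k" for c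
    using convex_cell_rescale[OF rc[OF that] con(1)[OF that]] .
  from embeddedI[OF inv cv cb supp] show "embedded Q k" by assumption
qed

section \<open>Operations on the complexes\<close>

text \<open>Radial projection to the equator commutes with spherical hulls, so the control CCT is
  again a cone model, over the flattened vertices.\<close>

lemma control_cone_model: "control (cone_model P k) = cone_model (flat \<circ> P) k"
proof -
  have "eq_proj ` sph_hull (P ` A) = sph_hull ((flat \<circ> P) ` A)" for A
    by (rule eq_proj_sph_hull)
  then show ?thesis unfolding control_def cone_model_def by (simp add: image_image)
qed

lemma Union_image_image: "\<Union> (image (image f) X) = f ` \<Union> X"
  by blast

lemma corresponds_cone_model:
  assumes inv: "\<forall>l\<in>Lam. \<forall>v. P (l + v) = P v"
    and g: "linear g" "!!x. norm (g x) = norm x" and gf: "!!v. 0 \<le> csum v ==> csum v \<le> int k ==> g (P v) = P (f v)"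
    and f: "!!c. c \<in> strip k ==> f ` c \<in> strip k"
    and f': "!!c. c \<in> strip k ==> f' ` c \<in> strip k" "!!v. f (f' v) = v"
    and fo: "!!c. image (image f) (orbit c) = orbit (f ` c)"
  shows "corresponds k (cone_model P k) g f"
proof -
  let ?H = "\<lambda>c. sph_hull (P ` c)"
  have gH: "g ` ?H c = ?H (f ` c)" if c: "c \<in> strip k" for c
  proof -
    have "g ` P ` c = P ` f ` c"
      using gf c by (force simp: image_image strip_iff intro!: image_cong)
    then show ?thesis using isometry_sph_hull[OF g, of "P ` c"] by simp
  qed
  have chart: "chart (cone_model P k) (orbit c) = ?H c" for c
    by (simp add: cone_model_def image_Union_orbit[OF inv])
  have "image g ` cells (cone_model P k) = cells (cone_model P k)"
    unfolding cells_cone_model[OF inv]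
  proof -
    have "image g ` (?H ` strip k) = ?H ` strip k"
    proof safe
      fix c assume "c \<in> strip k" then show "g ` ?H c \<in> ?H ` strip k" using gH f by blast
    next
      fix c assume c: "c \<in> strip k"
      have "f ` f' ` c = c" using f'(2) by (simp add: image_image)
      then have "?H c = g ` ?H (f' ` c)" using gH[OF f'(1)[OF c]] by simp
      then show "?H c \<in> image g ` (?H ` strip k)" using f'(1)[OF c] by blast
    qed
    then show "image g ` insert {} (?H ` strip k) = insert {} (?H ` strip k)" by simp
  qed
  moreover have "g ` chart (cone_model P k) X = chart (cone_model P k) (image (image f) X)" if X: "X \<in> torus k" for X
  proof -
    obtain c where c: "c \<in> strip k" "X = orbit c" using X by (rule torusE)
    then show ?thesis using gH[OF c(1)] by (simp add: fo chart)
  qed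
  ultimately show ?thesis unfolding corresponds_def by blast
qed

lemma layer_cone_model:
  assumes E: "embedded P k" and l: "0 \<le> l" "l \<le> int k"
  shows "layer (cone_model P k) l = (\<lambda>v. sgn (P v)) ` {v. csum v = l}"
proof -
  have "chart (cone_model P k) (orbit {v}) = {sgn (P v)}" for v
    using chart_cone_model[OF E, of k "{v}"] by (simp add: sph_hull_def)
  then show ?thesis unfolding layer_def by auto
qed

lemma restrict_cone_model:
  assumes E: "embedded P k" and I: "I \<subseteq> {0..int k}"
  shows "restrict_cells (cone_model P k) I =
    insert {} ((\<lambda>c. sph_hull (P ` c)) ` {c \<in> strip k. \<forall>v\<in>c. csum v \<in> I})"
proof -
  have inv: "\<forall>l\<in>Lam. \<forall>v. P (l + v) = P v" using embedded_periodic[OF E] .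
  let ?W = "\<Union>l\<in>I. layer (cone_model P k) l"
  have W: "?W = (\<lambda>v. sgn (P v)) ` {v. csum v \<in> I}"
  proof -
    have "?W = (\<Union>l\<in>I. (\<lambda>v. sgn (P v)) ` {v. csum v = l})"
      using I by (intro SUP_cong refl layer_cone_model[OF E]) auto
    then show ?thesis by blast
  qed
  have con: "convex_cell P c" "is_cell c" "finite c" "hemi P c" if "c \<in> strip k" for c
    using embedded_cell[OF E that] by auto
  have pt: "sph_hull (P ` {v}) = {sgn (P v)}" for v by (simp add: sph_hull_def)
  have vf: "{x. sph_face {x} (sph_hull (P ` c))} = (\<lambda>v. sgn (P v)) ` c" if c: "c \<in> strip k" for c
  proof safe
    fix x assume "sph_face {x} (sph_hull (P ` c))"
    then obtain c' where c': "is_cell c'" "c' \<subseteq> c" "{x} = sph_hull (P ` c')"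
      using convex_cell_faces[OF con(1,2)[OF c]] by blast
    then obtain v where "v \<in> c'" using cell_nonempty by blast
    then have "sph_hull (P ` {v}) \<subseteq> {x}" using c'(3) by (metis empty_subsetI image_mono insert_subset sph_hull_mono)
    then show "x \<in> (\<lambda>v. sgn (P v)) ` c" using pt \<open>v \<in> c'\<close> c'(2) by auto
  next
    fix v assume "v \<in> c"
    then show "sph_face {sgn (P v)} (sph_hull (P ` c))"
      using convex_cell_faces[OF con(1,2)[OF c], of "{sgn (P v)}"] pt[of v] by (metis empty_subsetI insert_subset is_cell_singleton)
  qed
  have key: "(\<forall>x. sph_face {x} (sph_hull (P ` c)) --> x \<in> ?W) \<longleftrightarrow> (\<forall>v\<in>c. csum v \<in> I)" if c: "c \<in> strip k" for c
  proof
    assume A: "\<forall>x. sph_face {x} (sph_hull (P ` c)) --> x \<in> ?W"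
    show "\<forall>v\<in>c. csum v \<in> I"
    proof
      fix v assume v: "v \<in> c"
      then have "sgn (P v) \<in> ?W" using A vf[OF c] by blast
      then obtain w where w: "csum w \<in> I" "sgn (P v) = sgn (P w)" unfolding W by blast
      have s: "{v} \<in> strip k" "{w} \<in> strip k"
        using c v w I by (auto simp: strip_iff subset_iff)
      have "sph_hull (P ` {v}) \<subseteq> sph_hull (P ` {w})" using pt w by simp
      \<comment> \<open>Equal normalised vertices differ by an element of \<open>Lam\<close>, which
        preserves layers; so the layer of a geometric vertex is well defined.\<close>
      then obtain l where "l \<in> Lam" "l + v = w" using embedded_hull_le[OF E s] by auto
      then show "csum v \<in> I" using w(1) by auto
    qed
  next
    assume "\<forall>v\<in>c. csum v \<in> I" then show "\<forall>x. sph_face {x} (sph_hull (P ` c)) --> x \<in> ?W"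
      using vf[OF c] unfolding W by blast
  qed
  have emp: "\<forall>x. sph_face {x} {} --> x \<in> ?W" unfolding sph_face_def by blast
  show ?thesis
    unfolding restrict_cells_def induced_subcomplex_def cells_cone_model[OF inv] using key emp by blast
qed

text \<open>The shift along the third axis carries layers 0, 1, 2 to the three layers of the band,
  so the band is the cone model of the shifted family.\<close>

lemma band_cone_model:
  assumes E: "embedded P k" and i: "1 \<le> i" "i + 1 \<le> k"
  defines "t \<equiv> vector [0, 0, int i - 1]"
  shows "band (cone_model P k) i = cone_model (P \<circ> (+) t) 2" "embedded (P \<circ> (+) t) 2"
    "\<Union> (cells (band (cone_model P k) i)) =
       (\<Union>c\<in>{c \<in> strip k. \<forall>v\<in>c. csum v \<in> {int i - 1, int i, int i + 1}}. sph_hull (P ` c))"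
proof -
  have inv: "\<forall>l\<in>Lam. \<forall>v. P (l + v) = P v" using embedded_periodic[OF E] .
  have inv': "\<forall>l\<in>Lam. \<forall>v. (P \<circ> (+) t) (l + v) = (P \<circ> (+) t) v"
    using inv by (simp add: add.left_commute[of t])
  have ct: "csum t = int i - 1" by (simp add: t_def)
  let ?I = "{int i - 1, int i, int i + 1}"
  have I: "?I \<subseteq> {0..int k}" using i by auto
  have tr: "(+) t ` c \<in> strip k \<and> (\<forall>v\<in>(+) t ` c. csum v \<in> ?I)" if "c \<in> strip 2" for c
    using that i is_cell_translate[of c t] by (auto simp: strip_iff ct)
  have tr': "\<exists>c\<in>strip 2. d = (+) t ` c" if d: "d \<in> strip k" "\<forall>v\<in>d. csum v \<in> ?I" for d
  proof
    show "d = (+) t ` (+) (- t) ` d" by (simp add: image_image)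
    show "(+) (- t) ` d \<in> strip 2" using d is_cell_translate[of d "-t"] by (force simp: strip_iff ct)
  qed
  have cells: "restrict_cells (cone_model P k) ?I = cells (cone_model (P \<circ> (+) t) 2)"
  proof -
    have "{c \<in> strip k. \<forall>v\<in>c. csum v \<in> ?I} = image ((+) t) ` strip 2"
    proof
      show "{c \<in> strip k. \<forall>v\<in>c. csum v \<in> ?I} \<subseteq> image ((+) t) ` strip 2"
      proof
        fix d assume "d \<in> {c \<in> strip k. \<forall>v\<in>c. csum v \<in> ?I}"
        then obtain c where "c \<in> strip 2" "d = (+) t ` c" using tr'[of d] by auto
        then show "d \<in> image ((+) t) ` strip 2" by (rule_tac image_eqI)
      qed
      show "image ((+) t) ` strip 2 \<subseteq> {c \<in> strip k. \<forall>v\<in>c. csum v \<in> ?I}"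
        using tr by (intro image_subsetI) simp
    qed
    then show ?thesis
      unfolding restrict_cone_model[OF E I] cells_cone_model[OF inv'] by (simp only: image_image image_comp o_def)
  qed
  moreover have "(\<lambda>X. sph_hull (P ` \<Union> (image (image ((+) t)) X))) = (\<lambda>X. sph_hull ((P \<circ> (+) t) ` \<Union> X))"
    by (simp only: Union_image_image image_comp)
  ultimately show b: "band (cone_model P k) i = cone_model (P \<circ> (+) t) 2"
    unfolding band_def t_def[symmetric] by (simp add: cone_model_def)
  show "\<Union> (cells (band (cone_model P k) i)) =
       (\<Union>c\<in>{c \<in> strip k. \<forall>v\<in>c. csum v \<in> ?I}. sph_hull (P ` c))"
    unfolding band_def using restrict_cone_model[OF E I] by simp
  have sh: "((+) t ` c \<in> strip k)" if "c \<in> strip 2" for c using tr that by blast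
  have sumt: "(\<Sum>v\<in>c. a v *\<^sub>R (P \<circ> (+) t) v) = (\<Sum>v\<in>(+) t ` c. a (v - t) *\<^sub>R P v)" for a c
    by (subst sum.reindex) (auto simp: inj_on_def)
  have con: "convex_cell (P \<circ> (+) t) c" if c: "c \<in> strip 2" for c
  proof -
    have C: "convex_cell P ((+) t ` c)" using embedded_cell(1)[OF E sh[OF c]] .
    have Z: "{v\<in>(+) t ` c. b \<bullet> P v = 0} = (+) t ` {v\<in>c. b \<bullet> (P \<circ> (+) t) v = 0}" for b by auto
    have tt: "is_cell ((+) t ` d) = is_cell d" for d
      using is_cell_translate[of d t] is_cell_translate[of "(+) t ` d" "-t"] by (auto simp: image_image)
    show ?thesis unfolding convex_cell_def
    proof (intro conjI allI impI)
      show "hemi (P \<circ> (+) t) c" using convex_cell_hemi[OF C] unfolding hemi_def by auto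
    next
      fix b assume "\<forall>v\<in>c. 0 \<le> b \<bullet> (P \<circ> (+) t) v"
      then have "\<forall>v\<in>(+) t ` c. 0 \<le> b \<bullet> P v" by auto
      then have "{v\<in>(+) t ` c. b \<bullet> P v = 0} = {} \<or> is_cell {v\<in>(+) t ` c. b \<bullet> P v = 0}"
        by (rule convex_cell_zero[OF C])
      then show "{v\<in>c. b \<bullet> (P \<circ> (+) t) v = 0} = {} \<or> is_cell {v\<in>c. b \<bullet> (P \<circ> (+) t) v = 0}"
        unfolding Z tt by blast
    next
      fix c' assume c': "is_cell c' \<and> c' \<subseteq> c"
      then have c2: "is_cell ((+) t ` c')" "(+) t ` c' \<subseteq> (+) t ` c" using tt by auto
      obtain b where b: "\<forall>v\<in>(+) t ` c. 0 \<le> b \<bullet> P v" "{v\<in>(+) t ` c. b \<bullet> P v = 0} = (+) t ` c'"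
        using convex_cell_expose[OF C c2] .
      have "{v\<in>c. b \<bullet> (P \<circ> (+) t) v = 0} = c'" using b(2) unfolding Z by (auto simp: inj_image_eq_iff inj_def)
      then show "\<exists>b. (\<forall>v\<in>c. 0 \<le> b \<bullet> (P \<circ> (+) t) v) \<and> {v\<in>c. b \<bullet> (P \<circ> (+) t) v = 0} = c'"
        using b(1) by (intro exI[of _ b]) auto
    qed
  qed
  have supp: "\<exists>l\<in>Lam. l + v \<in> d"
    if c: "c \<in> strip 2" and d: "d \<in> strip 2" and a: "\<forall>v\<in>c. 0 \<le> a v" and b: "\<forall>v\<in>d. 0 \<le> b v"
      and eq: "(\<Sum>v\<in>c. a v *\<^sub>R (P \<circ> (+) t) v) = (\<Sum>v\<in>d. b v *\<^sub>R (P \<circ> (+) t) v)" and v: "v \<in> c" "0 < a v" for c d a b v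
  proof -
    have "\<exists>l\<in>Lam. l + (t + v) \<in> (+) t ` d"
      by (rule embedded_support[OF E sh[OF c] sh[OF d] _ _ eq[unfolded sumt]]) (use a b v in auto)
    then show ?thesis by (metis (no_types, lifting) add.left_commute add_left_imp_eq image_iff)
  qed
  have "sph_cube (sph_hull ((P \<circ> (+) t) ` c))" if "c \<in> strip 2" for c
    using embedded_cell(2)[OF E sh[OF that]] by (simp add: image_comp)
  from embeddedI[OF inv' con this supp] show "embedded (P \<circ> (+) t) 2" by assumption
qed

section \<open>Symmetric families of vertices\<close>

definition ii :: "int => complex" where "ii n = cis (pi / 2 * of_int n)"

definition om :: "int => complex" where "om n = cis (pi / 3 * of_int n)"

lemma ii_add: "ii (m + n) = ii m * ii n" and om_add: "om (m + n) = om m * om n"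
  by (simp_all add: ii_def om_def cis_mult distrib_left)

lemma ii_simps [simp]: "ii 0 = 1" "ii 1 = \<i>" "ii (-1) = - \<i>" "ii 2 = -1" "norm (ii n) = 1"
  by (simp_all add: ii_def complex_eq_iff)

lemma ii_nonzero [simp]: "ii n \<noteq> 0"
  by (simp add: ii_def cis_neq_zero)

lemma om_simps [simp]: "om 0 = 1" "norm (om n) = 1" "om n \<noteq> 0" "cnj (om n) = om (- n)"
  by (simp_all add: om_def cis_cnj cis_neq_zero)

lemma om_1: "om 1 = Complex (1/2) (sqrt 3 / 2)"
  by (simp add: om_def complex_eq_iff cos_60 sin_60)

lemma om_m1: "om (-1) = Complex (1/2) (- sqrt 3 / 2)"
  by (simp add: om_def complex_eq_iff cos_60 sin_60)

lemma ii_period: "ii (4 * b + n) = ii n"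
proof -
  have "pi / 2 * real_of_int (4 * b) = 2 * pi * of_int b" by simp
  then have "ii (4 * b) = 1" unfolding ii_def by (simp only: cis_multiple_2pi Ints_of_int)
  then show ?thesis by (simp add: ii_add)
qed

lemma om_period: "om (6 * a + n) = om n"
proof -
  have "pi / 3 * real_of_int (6 * a) = 2 * pi * of_int a" by simp
  then have "om (6 * a) = 1" unfolding om_def by (simp only: cis_multiple_2pi Ints_of_int)
  then show ?thesis by (simp add: om_add)
qed

text \<open>The layer, \<open>v $ 3\<close> modulo 4 and \<open>v $ 1 - v $ 2\<close> modulo 6 are
  constant on orbits of \<open>Lam\<close>, and the prescribed symmetries act on the last two by
  unit steps and a change of sign. \<open>nat\<close> alters only negative layers, which no strip
  contains.\<close>

definition gv :: "(nat => complex) => (nat => real) => real => int^3 => real^5" where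
  "gv Z e \<eta> v = mk (ii (v $ 3) * Z (nat (csum v))) (\<eta> *\<^sub>R om (v $ 1 - v $ 2)) (e (nat (csum v)))"

lemma gv_periodic: "\<forall>l\<in>Lam. \<forall>v. gv Z e \<eta> (l + v) = gv Z e \<eta> v"
proof (intro ballI allI)
  fix l v assume l: "l \<in> Lam"
  then obtain a b where ab: "l $ 1 = 3 * a - 2 * b" "l $ 2 = - 3 * a - 2 * b" "l $ 3 = 4 * b"
    by (rule LamE)
  have "(l + v) $ 1 - (l + v) $ 2 = 6 * a + (v $ 1 - v $ 2)" using ab by simp
  moreover have "(l + v) $ 3 = 4 * b + v $ 3" using ab by simp
  ultimately show "gv Z e \<eta> (l + v) = gv Z e \<eta> v"
    using l by (simp only: gv_def ii_period om_period csum_add Lam_csum add_0)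
qed

lemma flat_gv: "flat \<circ> gv Z e \<eta> = gv Z (\<lambda>_. 0) \<eta>"
  by (simp add: gv_def fun_eq_iff)

lemma swap12_simps [simp]: "swap12 v $ 1 = v $ 2" "swap12 v $ 2 = v $ 1" "swap12 v $ 3 = v $ 3"
  "csum (swap12 v) = csum v" "swap12 (swap12 v) = v" "swap12 (v + w) = swap12 v + swap12 w"
  by (simp_all add: swap12_def csum_def vec_eq_iff forall_3)

lemma ab_shift:
  "(vector [1, -1, 0] + v) $ 1 - (vector [1, -1, 0] + v) $ 2 = 1 + (1 + (v $ 1 - v $ 2))"
  "(vector [1, -1, 0] + v) $ 3 = v $ 3" "csum (vector [1, -1, 0] + v) = csum v"
  "(vector [0, -1, 1] + v) $ 1 - (vector [0, -1, 1] + v) $ 2 = 1 + (v $ 1 - v $ 2)"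
  "(vector [0, -1, 1] + v) $ 3 = 1 + v $ 3" "csum (vector [0, -1, 1] + v) = csum v"
  for v :: "int^3"
  by simp_all

lemma gv_symmetries:
  "s4 (gv Z e \<eta> v) = gv Z e \<eta> (swap12 v)"
  "(r34 \<circ> r34) (gv Z e \<eta> v) = gv Z e \<eta> (vector [1, -1, 0] + v)"
  "(r34 \<circ> r12) (gv Z e \<eta> v) = gv Z e \<eta> (vector [0, -1, 1] + v)"
proof -
  have o1: "cis (pi/3) = om 1" by (simp add: om_def)
  show "s4 (gv Z e \<eta> v) = gv Z e \<eta> (swap12 v)" by (simp add: gv_def s4_mk)
  show "(r34 \<circ> r34) (gv Z e \<eta> v) = gv Z e \<eta> (vector [1, -1, 0] + v)"
    unfolding gv_def ab_shift om_add ii_add by (simp add: r34_mk o1)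
  show "(r34 \<circ> r12) (gv Z e \<eta> v) = gv Z e \<eta> (vector [0, -1, 1] + v)"
    unfolding gv_def ab_shift om_add ii_add by (simp add: r34_mk r12_mk o1 mult.assoc)
qed

lemma isometries:
  "linear s4" "linear (r34 \<circ> r34)" "linear (r34 \<circ> r12)"
  "norm (s4 x) = norm x" "norm ((r34 \<circ> r34) x) = norm x" "norm ((r34 \<circ> r12) x) = norm x"
proof -
  have 1: "linear s4" "linear r34" "linear r12"
    by (auto intro!: linearI simp: s4_mk r34_mk r12_mk eq5_iff algebra_simps)
  then show "linear s4" "linear (r34 \<circ> r34)" "linear (r34 \<circ> r12)" by (auto intro: linear_compose)
  have "norm (s4 x) = norm x" "norm (r34 x) = norm x" "norm (r12 x) = norm x" for x
    using norm_mk[of "zc x" "wc x" "x $ 5"] by (simp_all add: s4_mk r34_mk r12_mk norm_mk norm_mult)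
  then show "norm (s4 x) = norm x" "norm ((r34 \<circ> r34) x) = norm x" "norm ((r34 \<circ> r12) x) = norm x" by simp_all
qed

lemma swap12_cell: assumes "is_cell c" shows "is_cell (swap12 ` c)"
proof -
  obtain v J where c: "c = unit_cell v J" using assms unfolding is_cell_def by blast
  define K :: "3 set" where "K = {i. (i = 1 \<and> 2 \<in> J) \<or> (i = 2 \<and> 1 \<in> J) \<or> (i = 3 \<and> 3 \<in> J)}"
  have K: "1 \<in> K \<longleftrightarrow> 2 \<in> J" "2 \<in> K \<longleftrightarrow> 1 \<in> J" "3 \<in> K \<longleftrightarrow> 3 \<in> J" by (auto simp: K_def)
  have "w \<in> swap12 ` c \<longleftrightarrow> w \<in> unit_cell (swap12 v) K" for w
  proof -
    have "w \<in> swap12 ` c \<longleftrightarrow> swap12 w \<in> c" by (metis image_iff swap12_simps(5))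
    also have "\<dots> \<longleftrightarrow> w \<in> unit_cell (swap12 v) K"
      unfolding c unit_cell_def mem_Collect_eq forall_3 K swap12_simps by blast
    finally show ?thesis .
  qed
  then show ?thesis unfolding is_cell_def by blast
qed

lemma swap12_Lam: assumes "l \<in> Lam" shows "swap12 l \<in> Lam"
proof -
  obtain a b where "l $ 1 = 3 * a - 2 * b" "l $ 2 = - 3 * a - 2 * b" "l $ 3 = 4 * b"
    using assms by (rule LamE)
  then show ?thesis by (intro LamI[of _ "- a" b]) simp_all
qed

lemma swap12_orbit: "image (image swap12) (orbit c) = orbit (swap12 ` c)"
proof -
  have "swap12 ` (+) l ` c = (+) (swap12 l) ` swap12 ` c" for l by (simp add: image_image)
  then have "image swap12 ` {(+) l ` c |l. l \<in> Lam} = {(+) (swap12 l) ` swap12 ` c |l. l \<in> Lam}" by blast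
  also have "\<dots> = {(+) l ` swap12 ` c |l. l \<in> Lam}"
  proof safe
    fix l assume "l \<in> Lam"
    then show "\<exists>la. (+) (swap12 l) ` swap12 ` c = (+) la ` swap12 ` c \<and> la \<in> Lam" using swap12_Lam by blast
    show "\<exists>la. (+) l ` swap12 ` c = (+) (swap12 la) ` swap12 ` c \<and> la \<in> Lam"
      using \<open>l \<in> Lam\<close> swap12_Lam by (intro exI[of _ "swap12 l"]) simp
  qed
  finally show ?thesis unfolding orbit_def .
qed

lemma symmetric_cone_model:
  assumes E: "embedded P k"
    and "!!v. s4 (P v) = P (swap12 v)"
    and "!!v. (r34 \<circ> r34) (P v) = P (vector [1, -1, 0] + v)"
    and "!!v. (r34 \<circ> r12) (P v) = P (vector [0, -1, 1] + v)"
  shows "symmetric_cct k (cone_model P k)"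
proof -
  have inv: "\<forall>l\<in>Lam. \<forall>v. P (l + v) = P v" using embedded_periodic[OF E] .
  have sw: "swap12 ` c \<in> strip k" if "c \<in> strip k" for c
    using that swap12_cell by (auto simp: strip_iff)
  have "corresponds k (cone_model P k) s4 swap12"
    by (rule corresponds_cone_model[OF inv isometries(1,4) _ sw, where f'=swap12])
       (use assms(2) sw swap12_orbit in auto)
  moreover have tr: "corresponds k (cone_model P k) g ((+) w)"
    if g: "linear g" "!!x. norm (g x) = norm x" "!!v. g (P v) = P (w + v)" and w: "csum w = 0" for g w
  proof -
    have mw: "(+) (- w) ` c \<in> strip k" if "c \<in> strip k" for c using strip_translate[OF that, of "- w"] w by simp
    show ?thesis
      by (rule corresponds_cone_model[OF inv g(1,2) _ strip_translate[OF _ w] mw])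
         (use g(3) translate_orbit in simp_all)
  qed
  moreover have "corresponds k (cone_model P k) (r34 \<circ> r34) ((+) (vector [1, -1, 0]))"
    by (rule tr[OF isometries(2,5) assms(3)]) simp
  moreover have "corresponds k (cone_model P k) (r34 \<circ> r12) ((+) (vector [0, -1, 1]))"
    by (rule tr[OF isometries(3,6) assms(4)]) simp
  ultimately show ?thesis unfolding symmetric_cct_def using is_cct_cone_model[OF E] by blast
qed

lemma symmetric_band:
  assumes E: "embedded (gv Z e \<eta>) k" and i: "1 \<le> i" "i + 1 \<le> k"
  shows "symmetric_cct 2 (band (cone_model (gv Z e \<eta>) k) i)"
proof -
  let ?t = "vector [0, 0, int i - 1] :: int^3" and ?P = "gv Z e \<eta>"
  have sw: "swap12 ?t = ?t" by (simp add: vec_eq_iff forall_3)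
  show ?thesis unfolding band_cone_model(1)[OF E i]
  proof (rule symmetric_cone_model[OF band_cone_model(2)[OF E i]])
    fix v
    show "s4 ((?P \<circ> (+) ?t) v) = (?P \<circ> (+) ?t) (swap12 v)"
      by (simp add: gv_symmetries(1) sw)
    show "(r34 \<circ> r34) ((?P \<circ> (+) ?t) v) = (?P \<circ> (+) ?t) (vector [1, - 1, 0] + v)"
      using gv_symmetries(2)[of Z e \<eta> "?t + v"] by (simp add: add.left_commute)
    show "(r34 \<circ> r12) ((?P \<circ> (+) ?t) v) = (?P \<circ> (+) ?t) (vector [0, - 1, 1] + v)"
      using gv_symmetries(3)[of Z e \<eta> "?t + v"] by (simp add: add.left_commute)
  qed
qed

section \<open>Normal form of symmetric and of ideal CCTs\<close>

lemma symmetric_vertex: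
  assumes "symmetric_cct k T" "{v} \<in> strip k"
  shows "s4 (vertex T v) = vertex T (swap12 v)"
    "(r34 \<circ> r34) (vertex T v) = vertex T (vector [1, -1, 0] + v)"
    "(r34 \<circ> r12) (vertex T v) = vertex T (vector [0, -1, 1] + v)"
proof -
  have T: "is_cct k T" using assms(1) by (simp add: symmetric_cct_def)
  note vert = cct_embedded(4)[OF T]
  have gen: "g (vertex T v) = vertex T (f v)"
    if "corresponds k T g f" "image (image f) (orbit {v}) = orbit {f v}" "csum (f v) = csum v" for g f
  proof -
    have fv: "{f v} \<in> strip k" using assms(2) that(3) by (simp add: strip_singleton)
    have "g ` chart T (orbit {v}) = chart T (orbit {f v})"
      using that torusI[OF assms(2)] unfolding corresponds_def by metis
    then have "g ` {vertex T v} = {vertex T (f v)}" unfolding vert[OF assms(2)] vert[OF fv] .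
    then show ?thesis by simp
  qed
  have c: "corresponds k T s4 swap12" "corresponds k T (r34 \<circ> r34) ((+) (vector [1, -1, 0]))"
    "corresponds k T (r34 \<circ> r12) ((+) (vector [0, -1, 1]))"
    using assms(1) unfolding symmetric_cct_def by blast+
  show "s4 (vertex T v) = vertex T (swap12 v)"
    by (rule gen[OF c(1)]) (simp_all add: swap12_orbit)
  show "(r34 \<circ> r34) (vertex T v) = vertex T (vector [1, -1, 0] + v)"
    by (rule gen[OF c(2)]) (simp_all add: translate_orbit)
  show "(r34 \<circ> r12) (vertex T v) = vertex T (vector [0, -1, 1] + v)"
    by (rule gen[OF c(3)]) (simp_all add: translate_orbit)
qed

text \<open>The translations by \<open>(1,-1,0)\<close> and \<open>(0,-1,1)\<close> act transitively
  on each layer, so the vertex at \<open>(0,0,csum v)\<close> determines all others. The reflection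
  fixes this lattice point, which makes its second complex coordinate real.\<close>

lemma symmetric_vertex_form:
  assumes T: "symmetric_cct k T" and v: "{v} \<in> strip k"
  defines "x \<equiv> vertex T (vector [0, 0, csum v])"
  shows "vertex T v = mk (ii (v $ 3 - csum v) * zc x) (om (v $ 1 - v $ 2) * wc x) (x $ 5)"
    and "Im (wc x) = 0"
proof -
  let ?X = "vertex T"
  \<comment> \<open>\<open>F\<close> transforms like the vertices under both generators, and the
    isometries are injective; so agreement with \<open>F\<close> passes along the generators in both
    directions.\<close>
  define F where "F v = mk (ii (v $ 3 - csum v) * zc (?X (vector [0, 0, csum v])))
     (om (v $ 1 - v $ 2) * wc (?X (vector [0, 0, csum v]))) (?X (vector [0, 0, csum v]) $ 5)" for v
  let ?a = "vector [1, -1, 0] :: int^3" and ?b = "vector [0, -1, 1] :: int^3"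
  have inj: "inj (r34 \<circ> r34)" "inj (r34 \<circ> r12)"
    by (auto intro!: injI simp: r34_mk r12_mk eq5_iff cis_neq_zero)
  have o1: "cis (pi/3) = om 1" by (simp add: om_def)
  have F: "(r34 \<circ> r34) (F v) = F (?a + v)" "(r34 \<circ> r12) (F v) = F (?b + v)" for v
  proof -
    have s: "(?b + v) $ 3 - csum (?b + v) = 1 + (v $ 3 - csum v)" by simp
    show "(r34 \<circ> r34) (F v) = F (?a + v)"
      unfolding F_def ab_shift om_add by (simp add: r34_mk o1 mult.assoc)
    show "(r34 \<circ> r12) (F v) = F (?b + v)"
      unfolding F_def s unfolding ab_shift om_add ii_add by (simp add: r34_mk r12_mk o1 mult.assoc)
  qed
  have step: "?X (?a + v) = F (?a + v) \<longleftrightarrow> ?X v = F v" "?X (?b + v) = F (?b + v) \<longleftrightarrow> ?X v = F v"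
    if "{v} \<in> strip k" for v
    using symmetric_vertex(2,3)[OF T that] F inj by (metis injD)+
  have st: "{w + v} \<in> strip k \<longleftrightarrow> {v} \<in> strip k" if "csum w = 0" for v w
    using that by (simp add: strip_singleton)
  have A: "?X (p *s ?a + v) = F (p *s ?a + v) \<longleftrightarrow> ?X v = F v" if v: "{v} \<in> strip k" for p v
  proof (induction p rule: int_induct[where k=0])
    case (step1 p)
    have e: "(p + 1) *s ?a + v = ?a + (p *s ?a + v)" by (simp add: vec_eq_iff forall_3)
    have "{p *s ?a + v} \<in> strip k" using st[of "p *s ?a" v] v by (simp add: csum_def)
    from step(1)[OF this] show ?case unfolding e using step1(2) by blast
  next
    case (step2 p)
    have e: "p *s ?a + v = ?a + ((p - 1) *s ?a + v)" by (simp add: vec_eq_iff forall_3)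
    have "{(p - 1) *s ?a + v} \<in> strip k" using st[of "(p - 1) *s ?a" v] v by (simp add: csum_def)
    from step(1)[OF this] show ?case using step2(2) unfolding e by blast
  qed (simp add: vec_eq_iff)
  have B: "?X (p *s ?b + v) = F (p *s ?b + v) \<longleftrightarrow> ?X v = F v" if v: "{v} \<in> strip k" for p v
  proof (induction p rule: int_induct[where k=0])
    case (step1 p)
    have e: "(p + 1) *s ?b + v = ?b + (p *s ?b + v)" by (simp add: vec_eq_iff forall_3)
    have "{p *s ?b + v} \<in> strip k" using st[of "p *s ?b" v] v by (simp add: csum_def)
    from step(2)[OF this] show ?case unfolding e using step1(2) by blast
  next
    case (step2 p)
    have e: "p *s ?b + v = ?b + ((p - 1) *s ?b + v)" by (simp add: vec_eq_iff forall_3)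
    have "{(p - 1) *s ?b + v} \<in> strip k" using st[of "(p - 1) *s ?b" v] v by (simp add: csum_def)
    from step(2)[OF this] show ?case using step2(2) unfolding e by blast
  qed (simp add: vec_eq_iff)
  let ?o = "vector [0, 0, csum v] :: int^3"
  have os: "{?o} \<in> strip k" using v by (simp add: strip_singleton)
  have "v = (v $ 1) *s ?a + ((v $ 3 - csum v) *s ?b + ?o)"
    by (simp add: vec_eq_iff forall_3 csum_def)
  moreover have "?X ?o = F ?o" by (simp add: F_def)
  moreover have "{(v $ 3 - csum v) *s ?b + ?o} \<in> strip k" using st[OF _, of "(v $ 3 - csum v) *s ?b" ?o] os by (simp add: csum_def)
  ultimately have "?X v = F v" using A B os by metis
  then show "vertex T v = mk (ii (v $ 3 - csum v) * zc x) (om (v $ 1 - v $ 2) * wc x) (x $ 5)"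
    by (simp add: F_def x_def)
  have "swap12 ?o = ?o" by (simp add: vec_eq_iff forall_3)
  then have "s4 x = x" using symmetric_vertex(1)[OF T os] by (simp add: x_def)
  then have "cnj (wc x) = wc x" by (simp add: s4_mk eq5_iff)
  then show "Im (wc x) = 0" by (simp add: complex_eq_iff)
qed

lemma restrict_cells_cong:
  assumes "cells T = cells T'" "!!v. csum v \<in> I ==> chart T (orbit {v}) = chart T' (orbit {v})"
  shows "restrict_cells T I = restrict_cells T' I"
proof -
  have "layer T l = layer T' l" if "l \<in> I" for l
    unfolding layer_def using assms(2) that by metis
  then have "(\<Union>l\<in>I. layer T l) = (\<Union>l\<in>I. layer T' l)" by simp
  then show ?thesis unfolding restrict_cells_def assms(1) by simp
qed

lemma restrict_control:
  assumes T: "is_cct k T" and E: "embedded P k" and I: "I \<subseteq> {0..int k}"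
    and cells: "cells T = cells (cone_model P k)"
    and ch: "!!v. {v} \<in> strip k ==> chart T (orbit {v}) = sph_hull (P ` {v})"
  shows "restrict_cells T I = restrict_cells (cone_model P k) I"
proof (rule restrict_cells_cong[OF cells])
  fix v assume "csum v \<in> I"
  then have "{v} \<in> strip k" using I by (auto simp: strip_singleton)
  then show "chart T (orbit {v}) = chart (cone_model P k) (orbit {v})"
    using ch chart_cone_model[OF E] by simp
qed

text \<open>Transversality keeps the control CCT off \<open>clifford 0\<close>, so the second
  complex coordinate never vanishes. Dividing each layer by its modulus leaves a sign \<eta> common
  to all layers, and one family then describes the CCT and, with height 0, its control.\<close>

lemma ideal_normal_form:
  assumes I: "ideal_cct k T" and k: "3 \<le> k"
  obtains Z e \<eta> where "\<eta> = 1 \<or> \<eta> = (-1::real)"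
    "embedded (gv Z e \<eta>) k" "embedded (gv Z (\<lambda>_. 0) \<eta>) k"
    "!!c. c \<in> strip k ==> chart T (orbit c) = sph_hull (gv Z e \<eta> ` c)"
    "cells T = cells (cone_model (gv Z e \<eta>) k)"
    "cells (control T) = cells (cone_model (gv Z (\<lambda>_. 0) \<eta>) k)"
    "!!v. {v} \<in> strip k ==> chart (control T) (orbit {v}) = sph_hull (gv Z (\<lambda>_. 0) \<eta> ` {v})"
proof -
  let ?X = "vertex T" and ?Y = "vertex (control T)"
  have sym: "symmetric_cct k T" using I by (simp add: ideal_cct_def)
  then have T: "is_cct k T" by (simp add: symmetric_cct_def)
  have tr: "transversal_eq k (control T)" using I by (simp add: ideal_cct_def ideal_eq_def)
  then have C: "is_cct k (control T)" by (simp add: transversal_eq_def symmetric_cct_def)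
  note X = cct_embedded[OF T] and Y = cct_embedded[OF C]
  have chC: "chart (control T) (orbit c) = sph_hull ((flat \<circ> ?X) ` c)" if "c \<in> strip k" for c
    using X(2)[OF that] eq_proj_sph_hull[of ?X c] by (simp add: control_def)
  have YX: "?Y v = sgn (flat (?X v))" if "{v} \<in> strip k" for v
  proof -
    have "{?Y v} = {sgn (flat (?X v))}"
      using Y(4)[OF that] chC[OF that] by (simp add: sph_hull_def)
    then show ?thesis by simp
  qed
  define x where "x m = ?X (vector [0, 0, int m])" for m
  define w where "w m = Re (wc (x m))" for m
  have xs: "{vector [0, 0, int m]} \<in> strip k" if "m \<le> k" for m using that by (simp add: strip_singleton)
  have wx: "wc (x m) = of_real (w m)" if "m \<le> k" for m
    using symmetric_vertex_form(2)[OF sym xs[OF that]] by (simp add: x_def w_def complex_eq_iff)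
  have avoid: "p \<in> S3eq \<and> wc p \<noteq> 0"
    if c: "c \<in> strip k" "\<forall>v\<in>c. csum v \<in> {int i - 1, int i, int i + 1}" and i: "1 \<le> i" "i + 1 \<le> k"
      and p: "p \<in> sph_hull ((flat \<circ> ?X) ` c)" for c i p
  proof -
    let ?I = "{int i - 1, int i, int i + 1}"
    have II: "?I \<subseteq> {0..int k}" using i by auto
    have "restrict_cells (control T) ?I = restrict_cells (cone_model ?Y k) ?I"
      by (rule restrict_control[OF C Y(1) II Y(3)]) (use Y(2) in simp)
    then have "sph_hull (?Y ` c) \<in> cells (band (control T) i)"
      unfolding band_def using restrict_cone_model[OF Y(1) II] c by simp
    then have "p \<in> \<Union> (cells (band (control T) i))" using p chC[OF c(1)] Y(2)[OF c(1)] by auto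
    moreover have "transversal2 (band (control T) i)" using tr i by (simp add: transversal_eq_def)
    ultimately have "p \<in> S3eq - (clifford 0 \<union> clifford 2)" unfolding transversal2_def by blast
    then show ?thesis using clifford0_iff by blast
  qed
  \<comment> \<open>The middle layer of a band that contains layer \<open>m\<close> and, for
    \<open>m < k\<close>, also layer \<open>m + 1\<close>; layers 0 and \<open>k\<close> cannot be
    centres and are shifted inwards.\<close>
  define idx where "idx m = (if m = 0 then 1 else if m < k then m else k - 1)" for m
  have idx: "1 \<le> idx m" "idx m + 1 \<le> k" for m using k by (auto simp: idx_def)
  have w0: "w m \<noteq> 0" if m: "m \<le> k" for m
  proof -
    let ?v = "vector [0, 0, int m] :: int^3"
    have "\<forall>v\<in>{?v}. csum v \<in> {int (idx m) - 1, int (idx m), int (idx m) + 1}"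
      using m k by (auto simp: idx_def)
    moreover have "sgn (flat (?X ?v)) \<in> sph_hull ((flat \<circ> ?X) ` {?v})" by (simp add: sph_hull_def)
    ultimately have "wc (sgn (flat (x m))) \<noteq> 0"
      using avoid[OF xs[OF m] _ idx[of m]] unfolding x_def by blast
    then show ?thesis using wx[OF m] by (auto simp: sgn_div_norm flat_def)
  qed
  have wpos: "0 < w m * w (Suc m)" if m: "Suc m \<le> k" for m
  proof (rule ccontr)
    assume neg: "\<not> 0 < w m * w (Suc m)"
    let ?v = "vector [0, 0, int m] :: int^3" and ?u = "vector [0, 0, int (Suc m)] :: int^3"
    have c: "{?v, ?u} = unit_cell ?v {3}"
      by (auto simp: unit_cell_def vec_eq_iff forall_3)
    then have "is_cell {?v, ?u}" unfolding is_cell_def by blast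
    then have cs: "{?v, ?u} \<in> strip k" using m by (auto simp: strip_iff)
    have I: "\<forall>v\<in>{?v, ?u}. csum v \<in> {int (idx m) - 1, int (idx m), int (idx m) + 1}"
      using m k by (auto simp: idx_def)
    \<comment> \<open>The weights at which an edge with opposite signs at its ends would meet
      \<open>clifford 0\<close>.\<close>
    define s where "s = \<bar>w (Suc m)\<bar> / (\<bar>w m\<bar> + \<bar>w (Suc m)\<bar>)"
    define t where "t = \<bar>w m\<bar> / (\<bar>w m\<bar> + \<bar>w (Suc m)\<bar>)"
    have pos: "\<bar>w m\<bar> + \<bar>w (Suc m)\<bar> > 0" using w0[of m] m by simp
    have st: "0 \<le> s" "0 \<le> t" "s + t = 1"
      using pos by (auto simp: s_def t_def add_divide_distrib[symmetric])
    have sw: "s * w m + t * w (Suc m) = 0"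
    proof -
      have "w m * w (Suc m) < 0" using neg w0[of m] w0[of "Suc m"] m by (simp add: not_less order_less_le)
      then have "\<bar>w (Suc m)\<bar> * w m + \<bar>w m\<bar> * w (Suc m) = 0" by (auto simp: abs_if mult_less_0_iff)
      then show ?thesis by (simp add: s_def t_def add_divide_distrib[symmetric])
    qed
    define p where "p = s *\<^sub>R flat (x m) + t *\<^sub>R flat (x (Suc m))"
    have "p \<in> convex hull ((flat \<circ> ?X) ` {?v, ?u})"
      unfolding p_def x_def by (rule convexD[OF convex_convex_hull _ _ st]) (auto intro: hull_inc)
    then have "sgn p \<in> sph_hull ((flat \<circ> ?X) ` {?v, ?u})" unfolding sph_hull_def by blast
    then have "wc (sgn p) \<noteq> 0" using avoid[OF cs I idx] by blast
    moreover have "wc p = 0" using sw wx[of m] wx[of "Suc m"] m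
      by (simp add: p_def flat_def complex_eq_iff)
    ultimately show False by (simp add: sgn_div_norm)
  qed
  define \<eta> where "\<eta> = sgn (w 0)"
  have \<eta>: "\<eta> = 1 \<or> \<eta> = -1" using w0[of 0] by (simp add: \<eta>_def sgn_real_def)
  have w\<eta>: "w m = \<eta> * \<bar>w m\<bar>" if "m \<le> k" for m
    using that
  proof (induction m)
    case 0 then show ?case by (simp add: \<eta>_def sgn_mult_abs)
  next
    case (Suc m)
    have "w m = \<eta> * \<bar>w m\<bar>" "0 < w m * w (Suc m)" using Suc wpos by auto
    then show ?case using \<eta> by (auto simp: abs_if zero_less_mult_iff split: if_splits)
  qed
  \<comment> \<open>\<open>ii (- int m)\<close> undoes the turn that \<open>gv\<close> attaches to
    the lattice point \<open>(0,0,m)\<close>.\<close>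
  define Z where "Z m = (ii (- int m) * zc (x m)) / of_real \<bar>w m\<bar>" for m
  define e where "e m = x m $ 5 / \<bar>w m\<bar>" for m
  define r where "r v = \<bar>w (nat (csum v))\<bar>" for v :: "int^3"
  have XP: "0 < r v \<and> ?X v = r v *\<^sub>R gv Z e \<eta> v" if v: "{v} \<in> strip k" for v
  proof -
    define m where "m = nat (csum v)"
    have m: "csum v = int m" "m \<le> k" using v by (auto simp: strip_singleton m_def)
    have r: "r v = \<bar>w m\<bar>" "r v > 0" using w0[OF m(2)] by (auto simp: r_def m_def)
    have "wc (x m) = \<eta> *\<^sub>R of_real \<bar>w m\<bar>" using wx[OF m(2)] w\<eta>[OF m(2)]
      by (simp add: scaleR_conv_of_real flip: of_real_mult)
    then have 1: "om (v $ 1 - v $ 2) * wc (x m) = r v *\<^sub>R (\<eta> *\<^sub>R om (v $ 1 - v $ 2))"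
      using r(1) by (simp add: scaleR_conv_of_real mult_ac)
    have "ii (v $ 3 - int m) = ii (v $ 3) * ii (- int m)" by (simp flip: ii_add)
    then have 2: "ii (v $ 3 - int m) * zc (x m) = r v *\<^sub>R (ii (v $ 3) * Z m)"
      using r by (simp add: Z_def scaleR_conv_of_real)
    have 3: "x m $ 5 = r v * e m" using r by (simp add: e_def)
    have "?X v = mk (ii (v $ 3 - int m) * zc (x m)) (om (v $ 1 - v $ 2) * wc (x m)) (x m $ 5)"
      using symmetric_vertex_form(1)[OF sym v] by (simp add: m(1) x_def)
    then have "?X v = r v *\<^sub>R gv Z e \<eta> v" unfolding 1 2 3 gv_def m_def[symmetric] by (simp add: mk_scale)
    then show ?thesis using r(2) by simp
  qed
  have PX: "0 < 1 / r v \<and> gv Z e \<eta> v = (1 / r v) *\<^sub>R ?X v" if "{v} \<in> strip k" for v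
    using XP[OF that] by simp
  have P: "embedded (gv Z e \<eta>) k" "!!c. c \<in> strip k ==> sph_hull (gv Z e \<eta> ` c) = sph_hull (?X ` c)"
    by (rule embedded_rescale[OF X(1) PX gv_periodic]; assumption)+
  have fl: "gv Z (\<lambda>_. 0) \<eta> v = flat (gv Z e \<eta> v)" for v using fun_cong[OF flat_gv, of Z e \<eta> v] by simp
  \<comment> \<open>The vertices of the control CCT have been renormalised by the projection, so
    their factor differs from the one for \<open>T\<close>; both are positive.\<close>
  have PY: "0 < norm (flat (?X v)) / r v \<and> gv Z (\<lambda>_. 0) \<eta> v = (norm (flat (?X v)) / r v) *\<^sub>R ?Y v"
    if v: "{v} \<in> strip k" for v
  proof -
    have r: "r v > 0" "?X v = r v *\<^sub>R gv Z e \<eta> v" using XP[OF v] by auto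
    have "wc (flat (?X v)) \<noteq> 0" using r \<eta> by (auto simp: flat_def gv_def)
    then have n: "norm (flat (?X v)) > 0" by auto
    have "flat (?X v) = r v *\<^sub>R flat (gv Z e \<eta> v)" using r(2) by (simp add: linear_scale[OF linear_flat])
    then have "gv Z (\<lambda>_. 0) \<eta> v = (1 / r v) *\<^sub>R flat (?X v)" unfolding fl using r(1) by simp
    also have "\<dots> = (norm (flat (?X v)) / r v) *\<^sub>R ?Y v" unfolding YX[OF v] using n by (simp add: sgn_div_norm)
    finally show ?thesis using n r(1) by simp
  qed
  have Q: "embedded (gv Z (\<lambda>_. 0) \<eta>) k"
    "!!c. c \<in> strip k ==> sph_hull (gv Z (\<lambda>_. 0) \<eta> ` c) = sph_hull (?Y ` c)"
    by (rule embedded_rescale[OF Y(1) PY gv_periodic]; assumption)+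
  have cP: "cells (cone_model (gv Z e \<eta>) k) = cells (cone_model ?X k)"
    unfolding cells_cone_model[OF gv_periodic] cells_cone_model[OF embedded_periodic[OF X(1)]] using P(2) by simp
  have cQ: "cells (cone_model (gv Z (\<lambda>_. 0) \<eta>) k) = cells (cone_model ?Y k)"
    unfolding cells_cone_model[OF gv_periodic] cells_cone_model[OF embedded_periodic[OF Y(1)]] using Q(2) by simp
  show ?thesis
  proof (rule that[of \<eta> Z e])
    show "\<eta> = 1 \<or> \<eta> = -1" by (rule \<eta>)
    show "embedded (gv Z e \<eta>) k" by (rule P(1))
    show "embedded (gv Z (\<lambda>_. 0) \<eta>) k" by (rule Q(1))
    show "chart T (orbit c) = sph_hull (gv Z e \<eta> ` c)" if "c \<in> strip k" for c using X(2) P(2) that by simp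
    show "cells T = cells (cone_model (gv Z e \<eta>) k)" using X(3) cP by simp
    show "cells (control T) = cells (cone_model (gv Z (\<lambda>_. 0) \<eta>) k)" using Y(3) cQ by simp
    show "chart (control T) (orbit {v}) = sph_hull (gv Z (\<lambda>_. 0) \<eta> ` {v})" if "{v} \<in> strip k" for v
      using Y(2)[OF that] Q(2)[OF that] by simp
  qed
qed

section \<open>Planarity of the squares\<close>

lemma dual4:
  fixes p q r s :: "real^5"
  assumes ind: "!!a b c d. a *\<^sub>R p + b *\<^sub>R q + c *\<^sub>R r + d *\<^sub>R s = 0 ==> a = 0 \<and> b = 0 \<and> c = 0 \<and> d = 0"
  obtains f where "f \<bullet> p = a" "f \<bullet> q = b" "f \<bullet> r = c" "f \<bullet> s = d"
proof -
  have ne: "p \<noteq> q" "p \<noteq> r" "p \<noteq> s" "q \<noteq> r" "q \<noteq> s" "r \<noteq> s"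
    using ind[of 1 "-1" 0 0] ind[of 1 0 "-1" 0] ind[of 1 0 0 "-1"] ind[of 0 1 "-1" 0]
      ind[of 0 1 0 "-1"] ind[of 0 0 1 "-1"] by auto
  have "independent {p, q, r, s}"
  proof (rule ccontr)
    assume "\<not> ?thesis"
    then obtain u where u: "\<exists>v\<in>{p, q, r, s}. u v \<noteq> 0" "(\<Sum>v\<in>{p, q, r, s}. u v *\<^sub>R v) = 0"
      using real_vector.dependent_finite[of "{p, q, r, s}"] by auto
    then show False using ind[of "u p" "u q" "u r" "u s"] ne by (auto simp: add.assoc)
  qed
  from linear_independent_extend[OF this, of "\<lambda>x. if x = p then a else if x = q then b else if x = r then c else d"]
  obtain g :: "real^5 => real" where g: "linear g"
    "\<forall>x\<in>{p, q, r, s}. g x = (if x = p then a else if x = q then b else if x = r then c else d)"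
    by (elim exE conjE)
  have "adjoint g 1 \<bullet> x = g x" for x using adjoint_works[OF g(1), of x 1] by (simp add: inner_commute)
  then show ?thesis using g(2) ne by (intro that[of "adjoint g 1"]) auto
qed

abbreviation ax :: "3 => int^3" where "ax i \<equiv> axis i 1"

lemma unit_cell_edge: "unit_cell v {i} = {v, v + ax i}"
proof -
  have "w \<in> unit_cell v {i} \<longleftrightarrow> w = v \<or> w = v + ax i" for w
    by (auto simp: unit_cell_def vec_eq_iff axis_def)
  then show ?thesis by blast
qed

lemma unit_cell_square: assumes "i \<noteq> j" shows "unit_cell v {i, j} = {v, v + ax i, v + ax j, v + ax i + ax j}"
proof -
  have "w \<in> unit_cell v {i, j} \<longleftrightarrow> w = v \<or> w = v + ax i \<or> w = v + ax j \<or> w = v + ax i + ax j" for w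
  proof
    assume w: "w \<in> unit_cell v {i, j}"
    then have k: "w $ k = v $ k" if "k \<noteq> i" "k \<noteq> j" for k using that by (auto simp: unit_cell_def)
    have "w $ i = v $ i \<or> w $ i = v $ i + 1" "w $ j = v $ j \<or> w $ j = v $ j + 1"
      using w by (auto simp: unit_cell_def)
    then show "w = v \<or> w = v + ax i \<or> w = v + ax j \<or> w = v + ax i + ax j"
      using k assms unfolding vec_eq_iff by (auto simp: axis_def) metis+
  next
    assume "w = v \<or> w = v + ax i \<or> w = v + ax j \<or> w = v + ax i + ax j"
    then show "w \<in> unit_cell v {i, j}" using assms by (auto simp: unit_cell_def axis_def split: if_splits)
  qed
  then show ?thesis by blast
qed

lemma is_cell_unit [simp]: "is_cell (unit_cell v J)"
  unfolding is_cell_def by blast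

lemma cell_mix: "is_cell c ==> u \<in> c ==> w \<in> c ==> (!!i. x $ i = u $ i \<or> x $ i = w $ i) ==> x \<in> c"
  unfolding is_cell_def unit_cell_def by (smt (verit) mem_Collect_eq)

lemma csum_ax [simp]: "csum (ax i) = 1"
  by (simp add: csum_def axis_def) (metis exhaust_3)

text \<open>If the four vertices were independent, a functional could expose a diagonal, which is no
  cell; so a linear relation exists. Exposing an edge forces opposite signs at the two ends of the
  opposite edge, and three edges fix all signs.\<close>

lemma square_relation:
  assumes C: "convex_cell P (unit_cell v {i, j})" and ij: "i \<noteq> j"
  shows "\<exists>\<alpha> \<beta> \<gamma> \<delta>. 0 < \<alpha> \<and> 0 < \<beta> \<and> 0 < \<gamma> \<and> 0 < \<delta> \<and>
    \<alpha> *\<^sub>R P v + \<delta> *\<^sub>R P (v + ax i + ax j) = \<beta> *\<^sub>R P (v + ax i) + \<gamma> *\<^sub>R P (v + ax j)"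
proof -
  let ?c = "unit_cell v {i, j}"
  let ?A = v and ?B = "v + ax i" and ?C = "v + ax j" and ?D = "v + ax i + ax j"
  have sq: "?c = {?A, ?B, ?C, ?D}" by (rule unit_cell_square[OF ij])
  have ne: "?A \<noteq> ?B" "?A \<noteq> ?C" "?A \<noteq> ?D" "?B \<noteq> ?C" "?B \<noteq> ?D" "?C \<noteq> ?D"
    using ij by (auto simp: vec_eq_iff axis_def)
  have edges: "is_cell {?A, ?B}" "is_cell {?A, ?C}" "is_cell {?B, ?D}" "is_cell {?C, ?D}"
    using is_cell_unit[of ?A "{i}"] is_cell_unit[of ?A "{j}"] is_cell_unit[of ?B "{j}"] is_cell_unit[of ?C "{i}"]
    unfolding unit_cell_edge by (simp_all add: add_ac)
  have "\<exists>a b c d. a *\<^sub>R P ?A + b *\<^sub>R P ?B + c *\<^sub>R P ?C + d *\<^sub>R P ?D = 0 \<and> \<not> (a = 0 \<and> b = 0 \<and> c = 0 \<and> d = 0)"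
  proof (rule ccontr)
    assume "\<not> ?thesis"
    then have "a *\<^sub>R P ?A + b *\<^sub>R P ?B + c *\<^sub>R P ?C + d *\<^sub>R P ?D = 0 ==> a = 0 \<and> b = 0 \<and> c = 0 \<and> d = 0" for a b c d
      by blast
    then obtain f where f: "f \<bullet> P ?A = 0" "f \<bullet> P ?B = 1" "f \<bullet> P ?C = 1" "f \<bullet> P ?D = 0"
      using dual4[of "P ?A" "P ?B" "P ?C" "P ?D" 0 1 1 0] by blast
    then have "{v\<in>?c. f \<bullet> P v = 0} = {?A, ?D}" "\<forall>v\<in>?c. 0 \<le> f \<bullet> P v" unfolding sq using ij by auto
    then have "is_cell {?A, ?D}" using convex_cell_zero[OF C, of f] by auto
    then have "?B \<in> {?A, ?D}" by (rule cell_mix[of _ ?A ?D]) (use ij in \<open>auto simp: axis_def\<close>)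
    then have "?B = ?A \<or> ?B = ?D" by simp
    then show False using ne(1,5) by metis
  qed
  then obtain a b c d where rel: "a *\<^sub>R P ?A + b *\<^sub>R P ?B + c *\<^sub>R P ?C + d *\<^sub>R P ?D = 0"
    and nz: "\<not> (a = 0 \<and> b = 0 \<and> c = 0 \<and> d = 0)" by blast
  have expose: "\<exists>f. f \<bullet> P x = 0 \<and> f \<bullet> P y = 0 \<and> 0 < f \<bullet> P z \<and> 0 < f \<bullet> P u"
    if xy: "is_cell {x, y}" and s: "?c = {x, y, z, u}" and n: "z \<noteq> x" "z \<noteq> y" "u \<noteq> x" "u \<noteq> y" for x y z u
  proof -
    obtain f where f: "\<forall>v\<in>?c. 0 \<le> f \<bullet> P v" "{v\<in>?c. f \<bullet> P v = 0} = {x, y}"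
      using convex_cell_expose[OF C xy] s by blast
    have "z \<notin> {v\<in>?c. f \<bullet> P v = 0}" "u \<notin> {v\<in>?c. f \<bullet> P v = 0}" "x \<in> {v\<in>?c. f \<bullet> P v = 0}" "y \<in> {v\<in>?c. f \<bullet> P v = 0}"
      unfolding f(2) using n by auto
    moreover have "0 \<le> f \<bullet> P z" "0 \<le> f \<bullet> P u" "z \<in> ?c" "u \<in> ?c" using f(1) s by auto
    ultimately show ?thesis by (intro exI[of _ f]) auto
  qed
  have sgn: "(p > 0 --> q < 0) \<and> (p < 0 --> q > 0) \<and> (p = 0 --> q = 0)"
    if "p * x + q * y = 0" "0 < x" "0 < y" for p q x y :: real
  proof -
    have "q * y = - (p * x)" using that by simp
    then have "q = - (p * (x / y))" using that by (simp add: field_simps)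
    moreover have "x / y > 0" using that by simp
    ultimately show ?thesis by (metis mult_eq_0_iff mult_pos_pos mult_neg_pos neg_0_less_iff_less neg_less_0_iff_less neg_0_equal_iff_equal)
  qed
  have rel': "a * (f \<bullet> P ?A) + b * (f \<bullet> P ?B) + c * (f \<bullet> P ?C) + d * (f \<bullet> P ?D) = 0" for f
    using arg_cong[OF rel, of "\<lambda>x. f \<bullet> x"] by (simp add: inner_add_right)
  have sq2: "?c = {?A, ?C, ?B, ?D}" "?c = {?B, ?D, ?A, ?C}" unfolding sq by auto
  obtain f1 where "f1 \<bullet> P ?A = 0 \<and> f1 \<bullet> P ?B = 0 \<and> 0 < f1 \<bullet> P ?C \<and> 0 < f1 \<bullet> P ?D"
    using expose[OF edges(1) sq ne(2,4)[symmetric] ne(3,5)[symmetric]] by blast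
  then have 1: "(c > 0 --> d < 0) \<and> (c < 0 --> d > 0) \<and> (c = 0 --> d = 0)"
    using rel'[of f1] sgn[of c "f1 \<bullet> P ?C" d "f1 \<bullet> P ?D"] by simp
  obtain f2 where "f2 \<bullet> P ?A = 0 \<and> f2 \<bullet> P ?C = 0 \<and> 0 < f2 \<bullet> P ?B \<and> 0 < f2 \<bullet> P ?D"
    using expose[OF edges(2) sq2(1) ne(1)[symmetric] ne(4) ne(3,6)[symmetric]] by blast
  then have 2: "(b > 0 --> d < 0) \<and> (b < 0 --> d > 0) \<and> (b = 0 --> d = 0)"
    using rel'[of f2] sgn[of b "f2 \<bullet> P ?B" d "f2 \<bullet> P ?D"] by simp
  obtain f3 where "f3 \<bullet> P ?B = 0 \<and> f3 \<bullet> P ?D = 0 \<and> 0 < f3 \<bullet> P ?A \<and> 0 < f3 \<bullet> P ?C"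
    using expose[OF edges(3) sq2(2) ne(1,3) ne(4)[symmetric] ne(6)] by blast
  then have 3: "(a > 0 --> c < 0) \<and> (a < 0 --> c > 0) \<and> (a = 0 --> c = 0)"
    using rel'[of f3] sgn[of a "f3 \<bullet> P ?A" c "f3 \<bullet> P ?C"] by simp
  consider "a > 0" "d > 0" "b < 0" "c < 0" | "a < 0" "d < 0" "b > 0" "c > 0"
    using 1 2 3 nz by (metis linorder_neqE_linordered_idom not_less_iff_gr_or_eq)
  then show ?thesis
  proof cases
    case 1
    have "a *\<^sub>R P ?A + d *\<^sub>R P ?D = (- b) *\<^sub>R P ?B + (- c) *\<^sub>R P ?C"
    proof -
      have "a *\<^sub>R P ?A + d *\<^sub>R P ?D - ((- b) *\<^sub>R P ?B + (- c) *\<^sub>R P ?C) = 0" using rel by (simp add: algebra_simps)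
      then show ?thesis by simp
    qed
    then show ?thesis using 1 by (intro exI[of _ a] exI[of _ "-b"] exI[of _ "-c"] exI[of _ d]) simp
  next
    case 2
    have "(- a) *\<^sub>R P ?A + (- d) *\<^sub>R P ?D = b *\<^sub>R P ?B + c *\<^sub>R P ?C"
    proof -
      have "b *\<^sub>R P ?B + c *\<^sub>R P ?C - ((- a) *\<^sub>R P ?A + (- d) *\<^sub>R P ?D) = 0" using rel by (simp add: algebra_simps)
      then show ?thesis by simp
    qed
    then show ?thesis using 2 by (intro exI[of _ "-a"] exI[of _ b] exI[of _ c] exI[of _ "-d"]) simp
  qed
qed

text \<open>The second complex coordinates are \<eta> times known sixth roots of unity. Comparing
  them in the relation of a square fixes all but one ratio: \<tau> for the square in directions 1
  and 2, \<kappa> for the one in directions 1 and 3.\<close>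

lemma band_relations:
  assumes E: "embedded (gv Z e \<eta>) k" and \<eta>: "\<eta> \<noteq> 0" and m: "m + 2 \<le> k"
  shows "\<exists>\<tau>. 0 < \<tau> \<and> Z m + of_real \<tau> * Z (m+2) = of_real (2 * (1+\<tau>)) * Z (m+1) \<and>
           e m + \<tau> * e (m+2) = 2 * (1+\<tau>) * e (m+1)"
    and "\<exists>\<kappa>. 0 < \<kappa> \<and> \<i> * Z (m+2) - Z (m+1) = of_real \<kappa> * (\<i> * Z (m+1) - Z m) \<and>
           e (m+2) - e (m+1) = \<kappa> * (e (m+1) - e m)"
proof -
  let ?v = "vector [0, 0, int m] :: int^3" and ?P = "gv Z e \<eta>"
  have sq: "convex_cell ?P (unit_cell ?v {i, j})" if "i \<noteq> j" for i j
  proof -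
    have "unit_cell ?v {i, j} \<in> strip k"
      unfolding strip_iff unit_cell_square[OF that] using is_cell_unit[of ?v "{i,j}"] m unit_cell_square[OF that, of ?v]
      by auto
    then show ?thesis using embedded_cell(1)[OF E] by blast
  qed
  have a3: "ax 1 $ 1 = 1" "ax 1 $ 2 = 0" "ax 1 $ 3 = 0" "ax 2 $ 1 = 0" "ax 2 $ 2 = 1" "ax 2 $ 3 = 0"
    "ax 3 $ 1 = 0" "ax 3 $ 2 = 0" "ax 3 $ 3 = 1"
    by (auto simp: axis_def)
  have i1: "ii (int m + 1) = ii m * \<i>" by (simp add: ii_add)
  have P: "?P ?v = mk (ii m * Z m) (\<eta> *\<^sub>R 1) (e m)"
    "?P (?v + ax 1) = mk (ii m * Z (m+1)) (\<eta> *\<^sub>R om 1) (e (m+1))"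
    "?P (?v + ax 2) = mk (ii m * Z (m+1)) (\<eta> *\<^sub>R om (-1)) (e (m+1))"
    "?P (?v + ax 3) = mk (ii m * (\<i> * Z (m+1))) (\<eta> *\<^sub>R 1) (e (m+1))"
    "?P (?v + ax 1 + ax 2) = mk (ii m * Z (m+2)) (\<eta> *\<^sub>R 1) (e (m+2))"
    "?P (?v + ax 1 + ax 3) = mk (ii m * (\<i> * Z (m+2))) (\<eta> *\<^sub>R om 1) (e (m+2))"
    by (simp_all add: gv_def a3 i1 nat_add_distrib mult.assoc)
  obtain \<alpha> \<beta> \<gamma> \<delta> where A: "0 < \<alpha>" "0 < \<beta>" "0 < \<gamma>" "0 < \<delta>"
    "\<alpha> *\<^sub>R ?P ?v + \<delta> *\<^sub>R ?P (?v + ax 1 + ax 2) = \<beta> *\<^sub>R ?P (?v + ax 1) + \<gamma> *\<^sub>R ?P (?v + ax 2)"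
    using square_relation[OF sq[of 1 2]] by auto
  have "\<eta> * (\<alpha> + \<delta>) = \<eta> * (\<beta> * Re (om 1) + \<gamma> * Re (om (-1)))" "\<eta> * 0 = \<eta> * (\<beta> * Im (om 1) + \<gamma> * Im (om (-1)))"
    using arg_cong[OF A(5)[unfolded P], of wc] by (simp_all add: complex_eq_iff algebra_simps)
  then have W: "\<alpha> + \<delta> = \<beta> * Re (om 1) + \<gamma> * Re (om (-1))" "0 = \<beta> * Im (om 1) + \<gamma> * Im (om (-1))"
    using \<eta> unfolding mult_cancel_left by blast+
  then have bc: "\<beta> = \<gamma>" "\<alpha> + \<delta> = \<beta>" by (simp_all add: om_1 om_m1)
  have "ii m * (\<alpha> *\<^sub>R Z m + \<delta> *\<^sub>R Z (m+2)) = ii m * (\<beta> *\<^sub>R Z (m+1) + \<gamma> *\<^sub>R Z (m+1))"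
    using arg_cong[OF A(5)[unfolded P], of zc] by (simp add: algebra_simps)
  then have "\<alpha> *\<^sub>R Z m + \<delta> *\<^sub>R Z (m+2) = \<beta> *\<^sub>R Z (m+1) + \<gamma> *\<^sub>R Z (m+1)"
    unfolding mult_cancel_left by simp
  then have "\<alpha> *\<^sub>R Z m + \<delta> *\<^sub>R Z (m+2) = (2 * (\<alpha> + \<delta>)) *\<^sub>R Z (m+1)"
    unfolding scaleR_left_distrib[symmetric] using bc by simp
  then have z: "of_real \<alpha> * Z m + of_real \<delta> * Z (m+2) = of_real (2 * (\<alpha> + \<delta>)) * Z (m+1)"
    by (simp only: scaleR_conv_of_real)
  have e1: "\<alpha> * e m + \<delta> * e (m+2) = 2 * (\<alpha> + \<delta>) * e (m+1)"
    using arg_cong[OF A(5)[unfolded P], of "\<lambda>x. x $ 5"] bc by (simp add: algebra_simps)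
  show "\<exists>\<tau>. 0 < \<tau> \<and> Z m + of_real \<tau> * Z (m+2) = of_real (2 * (1+\<tau>)) * Z (m+1) \<and>
           e m + \<tau> * e (m+2) = 2 * (1+\<tau>) * e (m+1)"
  proof (intro exI[of _ "\<delta> / \<alpha>"] conjI)
    show "0 < \<delta> / \<alpha>" using A by simp
    show "Z m + of_real (\<delta> / \<alpha>) * Z (m+2) = of_real (2 * (1+\<delta> / \<alpha>)) * Z (m+1)"
      using z A(1) by (simp add: field_simps)
    show "e m + \<delta> / \<alpha> * e (m+2) = 2 * (1+\<delta> / \<alpha>) * e (m+1)" using e1 A(1) by (simp add: field_simps)
  qed
  obtain \<alpha> \<beta> \<gamma> \<delta> where A: "0 < \<alpha>" "0 < \<beta>" "0 < \<gamma>" "0 < \<delta>"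
    "\<alpha> *\<^sub>R ?P ?v + \<delta> *\<^sub>R ?P (?v + ax 1 + ax 3) = \<beta> *\<^sub>R ?P (?v + ax 1) + \<gamma> *\<^sub>R ?P (?v + ax 3)"
    using square_relation[OF sq[of 1 3]] by auto
  have "\<eta> * (\<alpha> + \<delta> * Re (om 1)) = \<eta> * (\<beta> * Re (om 1) + \<gamma>)" "\<eta> * (\<delta> * Im (om 1)) = \<eta> * (\<beta> * Im (om 1))"
    using arg_cong[OF A(5)[unfolded P], of wc] by (simp_all add: complex_eq_iff algebra_simps)
  then have W: "\<alpha> + \<delta> * Re (om 1) = \<beta> * Re (om 1) + \<gamma>" "\<delta> * Im (om 1) = \<beta> * Im (om 1)"
    using \<eta> unfolding mult_cancel_left by blast+
  then have bc: "\<beta> = \<delta>" "\<gamma> = \<alpha>" by (simp_all add: om_1)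
  have "ii m * (\<alpha> *\<^sub>R Z m + \<delta> *\<^sub>R (\<i> * Z (m+2))) = ii m * (\<delta> *\<^sub>R Z (m+1) + \<alpha> *\<^sub>R (\<i> * Z (m+1)))"
    using arg_cong[OF A(5)[unfolded P], of zc] bc by (simp add: algebra_simps)
  then have "\<alpha> *\<^sub>R Z m + \<delta> *\<^sub>R (\<i> * Z (m+2)) = \<delta> *\<^sub>R Z (m+1) + \<alpha> *\<^sub>R (\<i> * Z (m+1))"
    unfolding mult_cancel_left by simp
  then have z: "of_real \<alpha> * Z m + of_real \<delta> * (\<i> * Z (m+2)) = of_real \<delta> * Z (m+1) + of_real \<alpha> * (\<i> * Z (m+1))"
    by (simp only: scaleR_conv_of_real)
  have e1: "\<alpha> * e m + \<delta> * e (m+2) = \<delta> * e (m+1) + \<alpha> * e (m+1)"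
    using arg_cong[OF A(5)[unfolded P], of "\<lambda>x. x $ 5"] bc by (simp add: algebra_simps)
  show "\<exists>\<kappa>. 0 < \<kappa> \<and> \<i> * Z (m+2) - Z (m+1) = of_real \<kappa> * (\<i> * Z (m+1) - Z m) \<and>
           e (m+2) - e (m+1) = \<kappa> * (e (m+1) - e m)"
  proof (intro exI[of _ "\<alpha> / \<delta>"] conjI)
    show "0 < \<alpha> / \<delta>" using A by simp
    show "\<i> * Z (m+2) - Z (m+1) = of_real (\<alpha> / \<delta>) * (\<i> * Z (m+1) - Z m)"
      using z A(4) by (simp add: field_simps)
    show "e (m+2) - e (m+1) = \<alpha> / \<delta> * (e (m+1) - e m)" using e1 A(4) by (simp add: field_simps)
  qed
qed

section \<open>The recurrence behind a transversal torus\<close>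

lemma proj1_mk: "proj1 y = mk ((1 / (sqrt 2 * norm (zc y))) *\<^sub>R zc y) ((1 / (sqrt 2 * norm (wc y))) *\<^sub>R wc y) 0"
  by (simp add: proj1_def part_flat mk_scale mk_add)

lemma proj1_eqI:
  assumes "zc y = a *\<^sub>R zc x" "wc y = b *\<^sub>R wc x" "0 < a" "0 < b"
  shows "proj1 y = proj1 x"
proof -
  have "(1 / (sqrt 2 * norm (a *\<^sub>R z))) *\<^sub>R (a *\<^sub>R z) = (1 / (sqrt 2 * norm z)) *\<^sub>R z" if "0 < a" for a and z :: complex
    using that by (cases "z = 0") (simp_all add: field_simps)
  then show ?thesis using assms by (simp add: proj1_mk)
qed

lemma proj1_eqD:
  assumes "proj1 y = proj1 x" "zc y \<noteq> 0" "wc y \<noteq> 0" "zc x \<noteq> 0" "wc x \<noteq> 0"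
  shows "\<exists>a b. 0 < a \<and> 0 < b \<and> zc y = a *\<^sub>R zc x \<and> wc y = b *\<^sub>R wc x"
proof -
  have *: "z = (norm z / norm u) *\<^sub>R u"
    if "(1 / (sqrt 2 * norm z)) *\<^sub>R z = (1 / (sqrt 2 * norm u)) *\<^sub>R u" "z \<noteq> 0" "u \<noteq> 0" for z u :: complex
  proof -
    have "z = (sqrt 2 * norm z) *\<^sub>R ((1 / (sqrt 2 * norm z)) *\<^sub>R z)" using that(2) by simp
    also have "\<dots> = (norm z / norm u) *\<^sub>R u" unfolding that(1) using that by simp
    finally show ?thesis .
  qed
  have "zc (proj1 y) = zc (proj1 x)" "wc (proj1 y) = wc (proj1 x)" using assms(1) by simp_all
  then show ?thesis
    using *[of "zc y" "zc x"] *[of "wc y" "wc x"] assms(2-5) unfolding proj1_mk mk_simps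
    by (intro exI[of _ "norm (zc y) / norm (zc x)"] exI[of _ "norm (wc y) / norm (wc x)"]) simp
qed

abbreviation layers3 :: "nat => nat => (int^3) set set" where
  "layers3 k i \<equiv> {c \<in> strip k. \<forall>v\<in>c. csum v \<in> {int i - 1, int i, int i + 1}}"

lemma flat_pcone: "x \<in> pcone (gv Z e \<eta>) c ==> flat x \<in> pcone (gv Z (\<lambda>_. 0) \<eta>) c"
proof -
  assume "x \<in> pcone (gv Z e \<eta>) c"
  then obtain a where a: "\<forall>v\<in>c. 0 \<le> a v" "x = (\<Sum>v\<in>c. a v *\<^sub>R gv Z e \<eta> v)" by (rule pconeE)
  have "flat x = (\<Sum>v\<in>c. a v *\<^sub>R flat (gv Z e \<eta> v))"
    unfolding a(2) by (simp add: linear_sum[OF linear_flat] linear_scale[OF linear_flat])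
  also have "\<dots> = (\<Sum>v\<in>c. a v *\<^sub>R gv Z (\<lambda>_. 0) \<eta> v)"
    using fun_cong[OF flat_gv, of Z e \<eta>] by (simp add: o_def)
  also have "\<dots> \<in> pcone (gv Z (\<lambda>_. 0) \<eta>) c" using a(1) by (intro pconeI) auto
  finally show ?thesis .
qed

text \<open>\<open>proj1\<close> forgets independent positive factors of the two complex
  coordinates, and \<open>eq_proj\<close> forgets the height. Injectivity of both makes cone points
  with parallel complex coordinates proportional.\<close>

lemma transversal_coincide:
  assumes P: "embedded (gv Z e \<eta>) k" and Q: "embedded (gv Z (\<lambda>_. 0) \<eta>) k"
    and inj1: "inj_on proj1 (\<Union>c\<in>layers3 k i. sph_hull (gv Z (\<lambda>_. 0) \<eta> ` c))"
    and injp: "inj_on eq_proj (\<Union>c\<in>strip k. sph_hull (gv Z e \<eta> ` c))"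
    and c: "c \<in> layers3 k i" "d \<in> layers3 k i"
    and x: "x \<in> pcone (gv Z e \<eta>) c" "y \<in> pcone (gv Z e \<eta>) d" "wc x \<noteq> 0"
    and par: "zc y = a *\<^sub>R zc x" "wc y = b *\<^sub>R wc x" "0 < a" "0 < b"
  shows "\<exists>r>0. y = r *\<^sub>R x"
proof -
  have cd: "c \<in> strip k" "d \<in> strip k" using c by auto
  have wy: "wc y \<noteq> 0" using par x(3) by simp
  have fx: "flat x \<noteq> 0" "x \<noteq> 0" and fy: "flat y \<noteq> 0" "y \<noteq> 0" using x(3) wy by (auto simp: flat_def eq5_iff)
  have sx: "sgn (flat x) \<in> sph_hull (gv Z (\<lambda>_. 0) \<eta> ` c)" "sgn (flat y) \<in> sph_hull (gv Z (\<lambda>_. 0) \<eta> ` d)"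
    using sgn_pcone[OF embedded_cell(5,3)[OF Q cd(1)] flat_pcone[OF x(1)] fx(1)]
      sgn_pcone[OF embedded_cell(5,3)[OF Q cd(2)] flat_pcone[OF x(2)] fy(1)] by auto
  have n: "norm (flat x) > 0" "norm (flat y) > 0" using fx fy by auto
  have "proj1 (sgn (flat y)) = proj1 (sgn (flat x))"
    by (rule proj1_eqI[of _ "a * norm (flat x) / norm (flat y)" _ "b * norm (flat x) / norm (flat y)"])
       (use par n in \<open>auto simp: sgn_div_norm flat_def field_simps\<close>)
  then have "sgn (flat y) = sgn (flat x)" using inj_onD[OF inj1] sx c by blast
  moreover have "eq_proj (sgn u) = sgn (flat u)" if "u \<noteq> 0" for u
    using that by (simp add: eq_proj_flat sgn_div_norm linear_scale[OF linear_flat])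
  ultimately have "eq_proj (sgn y) = eq_proj (sgn x)" using fx fy by simp
  moreover have "sgn x \<in> sph_hull (gv Z e \<eta> ` c)" "sgn y \<in> sph_hull (gv Z e \<eta> ` d)"
    using sgn_pcone[OF embedded_cell(5,3)[OF P cd(1)] x(1) fx(2)]
      sgn_pcone[OF embedded_cell(5,3)[OF P cd(2)] x(2) fy(2)] by auto
  ultimately have "sgn y = sgn x" using inj_onD[OF injp] cd by blast
  then have "norm y *\<^sub>R sgn y = norm y *\<^sub>R sgn x" by simp
  then have "y = (norm y / norm x) *\<^sub>R x" using fx fy by (simp add: sgn_div_norm divide_inverse)
  then show ?thesis using fx fy by (intro exI[of _ "norm y / norm x"]) simp
qed

lemma layers3_edge: "m + 2 \<le> k ==> csum v = int m ==> unit_cell v {i} \<in> layers3 k (Suc m)"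
  unfolding strip_iff using is_cell_unit[of v "{i}"] by (auto simp: unit_cell_edge)

lemma layers3_square: "m + 2 \<le> k ==> csum v = int m ==> i \<noteq> j ==> unit_cell v {i, j} \<in> layers3 k (Suc m)"
  unfolding strip_iff using is_cell_unit[of v "{i, j}"] by (auto simp: unit_cell_square)

lemma gv_star:
  defines "v \<equiv> \<lambda>m. vector [0, 0, int m] :: int^3"
  shows "gv Z e \<eta> (v m) = mk (ii m * Z m) (\<eta> *\<^sub>R 1) (e m)"
    "gv Z e \<eta> (v m + ax 1) = mk (ii m * Z (m+1)) (\<eta> *\<^sub>R om 1) (e (m+1))"
    "gv Z e \<eta> (v m + ax 2) = mk (ii m * Z (m+1)) (\<eta> *\<^sub>R om (-1)) (e (m+1))"
    "gv Z e \<eta> (v m + ax 3) = mk (ii m * (\<i> * Z (m+1))) (\<eta> *\<^sub>R 1) (e (m+1))"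
proof -
  have a3: "ax 1 $ 1 = 1" "ax 1 $ 2 = 0" "ax 1 $ 3 = 0" "ax 2 $ 1 = 0" "ax 2 $ 2 = 1" "ax 2 $ 3 = 0"
    "ax 3 $ 1 = 0" "ax 3 $ 2 = 0" "ax 3 $ 3 = 1"
    by (auto simp: axis_def)
  have i1: "ii (int m + 1) = ii m * \<i>" by (simp add: ii_add)
  show "gv Z e \<eta> (v m) = mk (ii m * Z m) (\<eta> *\<^sub>R 1) (e m)"
    "gv Z e \<eta> (v m + ax 1) = mk (ii m * Z (m+1)) (\<eta> *\<^sub>R om 1) (e (m+1))"
    "gv Z e \<eta> (v m + ax 2) = mk (ii m * Z (m+1)) (\<eta> *\<^sub>R om (-1)) (e (m+1))"
    "gv Z e \<eta> (v m + ax 3) = mk (ii m * (\<i> * Z (m+1))) (\<eta> *\<^sub>R 1) (e (m+1))"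
    by (simp_all add: v_def gv_def a3 i1 nat_add_distrib mult.assoc)
qed

text \<open>The centre of the edge pair \<^term>\<open>P (v + ax 1) + P (v + ax 2)\<close> and a point of the edge from
  \<^term>\<open>P v\<close> to \<^term>\<open>P (v + ax 3)\<close> lie over the same point of the Clifford torus unless the
  Casoratian is positive.\<close>

lemma casoratian_pos:
  assumes P: "embedded (gv Z e \<eta>) k" and Q: "embedded (gv Z (\<lambda>_. 0) \<eta>) k" and \<eta>: "\<eta> = 1 \<or> \<eta> = (-1::real)"
    and inj1: "inj_on proj1 (\<Union>c\<in>layers3 k (Suc m). sph_hull (gv Z (\<lambda>_. 0) \<eta> ` c))"
    and injp: "inj_on eq_proj (\<Union>c\<in>strip k. sph_hull (gv Z e \<eta> ` c))"
    and m: "m + 2 \<le> k" and \<tau>: "0 < \<tau>" and A: "A \<noteq> 0"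
    and Z: "Z m = A * Complex E0 (\<tau> * E1)" "Z (m+1) = A * Complex E1 (\<tau> * E2)" and E: "0 < E1" "0 < E2"
  shows "0 < E1\<^sup>2 - E0 * E2"
proof (rule ccontr)
  assume neg: "\<not> ?thesis"
  then have "E1\<^sup>2 \<le> E0 * E2" by simp
  moreover have "0 < E1\<^sup>2" using E by simp
  ultimately have "0 < E0 * E2" by linarith
  then have E0: "0 < E0" using E by (simp add: zero_less_mult_iff)
  let ?v = "vector [0, 0, int m] :: int^3" and ?P = "gv Z e \<eta>"
  \<comment> \<open>The three weights solve the complex equation \<open>key\<close>.
    \<open>l\<close> and \<open>t\<close> are positive, and \<open>u\<close> is nonnegative because
    the Casoratian is assumed nonpositive.\<close>
  define l where "l = E1\<^sup>2 + \<tau>\<^sup>2 * E2\<^sup>2"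
  define u where "u = \<tau> * (E0 * E2 - E1\<^sup>2)"
  define t where "t = E0 * E1 + \<tau>\<^sup>2 * E1 * E2"
  have pos: "0 < l" "0 \<le> u" "0 < t" using E E0 \<tau> neg by (simp_all add: l_def u_def t_def add_pos_pos)
  have key: "of_real l * Complex E0 (\<tau> * E1) + of_real u * (\<i> * Complex E1 (\<tau> * E2)) = of_real t * Complex E1 (\<tau> * E2)"
    by (simp add: complex_eq_iff l_def u_def t_def) (simp add: algebra_simps power2_eq_square)
  let ?c = "unit_cell ?v {1, 2}" and ?d = "unit_cell ?v {3}"
  have c: "?c \<in> layers3 k (Suc m)" "?d \<in> layers3 k (Suc m)"
    using layers3_square[OF m, of ?v 1 2] layers3_edge[OF m, of ?v 3] by simp_all
  define x where "x = (\<Sum>w\<in>?c. (if w = ?v + ax 1 \<or> w = ?v + ax 2 then 1 else 0) *\<^sub>R ?P w)"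
  define y where "y = (\<Sum>w\<in>?d. (if w = ?v then l else u) *\<^sub>R ?P w)"
  have xc: "x \<in> pcone ?P ?c" unfolding x_def by (rule pconeI) simp
  have yd: "y \<in> pcone ?P ?d" unfolding y_def using pos by (intro pconeI) simp
  have ne: "ax 3 \<noteq> 0" "ax 1 \<noteq> ax 2" "ax 1 \<noteq> 0" "ax 2 \<noteq> 0" "ax 1 + ax 2 \<noteq> 0" "ax 1 + ax 2 \<noteq> ax 1" "ax 1 + ax 2 \<noteq> ax 2"
    by (auto simp: vec_eq_iff forall_3 axis_def)
  have x': "x = ?P (?v + ax 1) + ?P (?v + ax 2)"
    unfolding x_def unit_cell_square[of 1 2, simplified] using ne by (simp add: add.assoc)
  have y': "y = l *\<^sub>R ?P ?v + u *\<^sub>R ?P (?v + ax 3)"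
    unfolding y_def unit_cell_edge using ne by simp
  have zx: "zc x = ii m * (2 * Z (m+1))" and wx: "wc x = \<eta> *\<^sub>R 1"
    unfolding x' gv_star by (simp_all add: algebra_simps complex_eq_iff om_1 om_m1)
  have wy: "wc y = (l + u) *\<^sub>R wc x" unfolding y' gv_star wx by (simp add: algebra_simps)
  have "zc y = l *\<^sub>R (ii m * Z m) + u *\<^sub>R (ii m * (\<i> * Z (m+1)))"
    unfolding y' gv_star by simp
  also have "\<dots> = ii m * (of_real l * Z m + of_real u * (\<i> * Z (m+1)))"
    by (simp add: scaleR_conv_of_real algebra_simps)
  also have "of_real l * Z m + of_real u * (\<i> * Z (m+1)) =
     A * (of_real l * Complex E0 (\<tau> * E1) + of_real u * (\<i> * Complex E1 (\<tau> * E2)))"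
    unfolding Z by (simp add: algebra_simps)
  also have "\<dots> = of_real t * Z (m+1)" unfolding key Z by (simp add: algebra_simps)
  finally have zy: "zc y = (t / 2) *\<^sub>R zc x" unfolding zx by (simp add: scaleR_conv_of_real algebra_simps)
  have "wc x \<noteq> 0" using wx \<eta> by auto
  from transversal_coincide[OF P Q inj1 injp c xc yd this zy wy] pos
  obtain r where r: "r > 0" "y = r *\<^sub>R x" by (auto simp: add_pos_nonneg)
  \<comment> \<open>For proportional points the support clause moves \<open>?v + ax 1\<close> into
    the edge. Comparing layers puts \<open>ax 3 - ax 1\<close> into \<open>Lam\<close>, whose third
    coordinates are multiples of 4.\<close>
  have "\<exists>l'\<in>Lam. l' + (?v + ax 1) \<in> ?d"
  proof (rule embedded_support[OF P])
    show "?c \<in> strip k" "?d \<in> strip k" using c by auto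
    show "\<forall>w\<in>?c. 0 \<le> (if w = ?v + ax 1 \<or> w = ?v + ax 2 then r else 0)" using r by simp
    show "\<forall>w\<in>?d. 0 \<le> (if w = ?v then l else u)" using pos by simp
    show "(\<Sum>w\<in>?c. (if w = ?v + ax 1 \<or> w = ?v + ax 2 then r else 0) *\<^sub>R ?P w) = (\<Sum>w\<in>?d. (if w = ?v then l else u) *\<^sub>R ?P w)"
    proof -
      have "(\<Sum>w\<in>?c. (if w = ?v + ax 1 \<or> w = ?v + ax 2 then r else 0) *\<^sub>R ?P w) = r *\<^sub>R x"
        unfolding x_def scaleR_sum_right by (intro sum.cong) auto
      then show ?thesis using r(2) y_def by simp
    qed
    show "?v + ax 1 \<in> ?c" by (simp add: unit_cell_square)
    show "0 < (if ?v + ax 1 = ?v + ax 1 \<or> ?v + ax 1 = ?v + ax 2 then r else 0)" using r by simp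
  qed
  then obtain l' where l': "l' \<in> Lam" "l' + (?v + ax 1) = ?v \<or> l' + (?v + ax 1) = ?v + ax 3"
    by (auto simp: unit_cell_edge)
  have "csum (l' + (?v + ax 1)) = int m + 1" using l'(1) by simp
  then have "l' + (?v + ax 1) = ?v + ax 3" using l'(2) by (metis add_cancel_left_right csum_add csum_vector add_0 zero_neq_one)
  then have "l' = ax 3 - ax 1" by (simp add: algebra_simps)
  then have "l' $ 3 = 1" by (simp add: axis_def)
  then show False using l'(1) by (elim LamE) presburger
qed

text \<open>Otherwise the two ends of an edge in direction 3 would lie over the same point of the
  equator.\<close>

lemma layer_step_nonzero:
  assumes P: "embedded (gv Z e \<eta>) k" and k: "1 \<le> k"
    and injp: "inj_on eq_proj (\<Union>c\<in>strip k. sph_hull (gv Z e \<eta> ` c))"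
  shows "\<i> * Z 1 \<noteq> Z 0"
proof
  assume eq: "\<i> * Z 1 = Z 0"
  let ?v = "vector [0, 0, int 0] :: int^3" and ?P = "gv Z e \<eta>"
  have s: "{?v} \<in> strip k" "{?v + ax 3} \<in> strip k" using k by (simp_all add: strip_singleton)
  have "flat (?P ?v) = flat (?P (?v + ax 3))" unfolding gv_star using eq by simp
  then have "eq_proj (sgn (?P ?v)) = eq_proj (sgn (?P (?v + ax 3)))"
    using hemi_nonzero[OF embedded_cell(3)[OF P s(1)]] hemi_nonzero[OF embedded_cell(3)[OF P s(2)]]
    by (simp add: eq_proj_flat sgn_div_norm linear_scale[OF linear_flat])
  moreover have "sgn (?P w) \<in> sph_hull (?P ` {w})" for w by (simp add: sph_hull_def)
  ultimately have "sgn (?P ?v) = sgn (?P (?v + ax 3))" using inj_onD[OF injp] s by blast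
  then have "sph_hull (?P ` {?v}) \<subseteq> sph_hull (?P ` {?v + ax 3})" by (simp add: sph_hull_def)
  then obtain l where "l \<in> Lam" "l + ?v = ?v + ax 3" using embedded_hull_le[OF P s] by auto
  then have "csum ?v = csum (?v + ax 3)" by (metis Lam_csum add_0 csum_add)
  then show False by simp
qed

section \<open>Layer sequences and the constancy of their coefficients\<close>

definition seq_ok :: "real => (nat => real) => bool" where
  "seq_ok \<tau> E \<longleftrightarrow> 0 < \<tau> \<and> (\<forall>m. \<tau> * E (m+2) = 2 * (1+\<tau>) * E (m+1) - E m)"

definition seqZ :: "complex => real => (nat => real) => nat => complex" where
  "seqZ A \<tau> E m = A * Complex (E m) (\<tau> * E (m+1))"

text \<open>Its increments are \<open>(1+\<tau>) * E (m+1)\<close>, with the same ratios as those of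
  the first coordinates, so it satisfies the planarity conditions for heights. By
  \<open>normal_sequence\<close> it is the only possible height up to a factor.\<close>

definition seqh :: "real => (nat => real) => nat => real" where
  "seqh \<tau> E m = \<tau> * E (m+1) - E m"

fun lin_rec :: "real => real => real => nat => real" where
  "lin_rec \<tau> a b 0 = a"
| "lin_rec \<tau> a b (Suc 0) = b"
| "lin_rec \<tau> a b (Suc (Suc n)) = (2 * (1+\<tau>) * lin_rec \<tau> a b (Suc n) - lin_rec \<tau> a b n) / \<tau>"

lemma seq_ok_lin_rec: "0 < \<tau> ==> seq_ok \<tau> (lin_rec \<tau> a b)"
  by (simp add: seq_ok_def)

text \<open>Each square has its own ratio; the point is that the \<open>\<tau> m\<close> agree.
  Consecutive bands share two layers, and unequal ratios would make the Casoratian negative.\<close>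

lemma normal_sequence:
  fixes Z :: "nat => complex" and e :: "nat => real"
  assumes P: "embedded (gv Z e \<eta>) k" and Q: "embedded (gv Z (\<lambda>_. 0) \<eta>) k" and \<eta>: "\<eta> = 1 \<or> \<eta> = (-1::real)" and k: "2 \<le> k"
    and inj1: "!!i. 1 \<le> i ==> i + 1 \<le> k ==> inj_on proj1 (\<Union>c\<in>layers3 k i. sph_hull (gv Z (\<lambda>_. 0) \<eta> ` c))"
    and injp: "inj_on eq_proj (\<Union>c\<in>strip k. sph_hull (gv Z e \<eta> ` c))"
  obtains A \<tau> E s where "A \<noteq> 0" "seq_ok \<tau> E" "!!m. m \<le> k ==> Z m = seqZ A \<tau> E m"
    "!!m. m \<le> k ==> e m = s * seqh \<tau> E m" "!!m. m < k ==> 0 < E (m+1)" "0 < (E 1)\<^sup>2 - E 0 * E 2"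
proof -
  have \<eta>0: "\<eta> \<noteq> 0" using \<eta> by auto
  have "\<exists>\<tau>. \<forall>m. m + 2 \<le> k --> 0 < \<tau> m \<and> Z m + of_real (\<tau> m) * Z (m+2) = of_real (2 * (1+\<tau> m)) * Z (m+1) \<and>
           e m + \<tau> m * e (m+2) = 2 * (1+\<tau> m) * e (m+1)"
    using band_relations(1)[OF P \<eta>0] by metis
  then obtain \<tau> where \<tau>: "!!m. m + 2 \<le> k ==> 0 < \<tau> m"
    "!!m. m + 2 \<le> k ==> Z m + of_real (\<tau> m) * Z (m+2) = of_real (2 * (1+\<tau> m)) * Z (m+1)"
    "!!m. m + 2 \<le> k ==> e m + \<tau> m * e (m+2) = 2 * (1+\<tau> m) * e (m+1)" by blast
  have "\<exists>\<kappa>. \<forall>m. m + 2 \<le> k --> 0 < \<kappa> m \<and> \<i> * Z (m+2) - Z (m+1) = of_real (\<kappa> m) * (\<i> * Z (m+1) - Z m) \<and>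
           e (m+2) - e (m+1) = \<kappa> m * (e (m+1) - e m)"
    using band_relations(2)[OF P \<eta>0] by metis
  then obtain \<kappa> where \<kappa>: "!!m. m + 2 \<le> k ==> 0 < \<kappa> m"
    "!!m. m + 2 \<le> k ==> \<i> * Z (m+2) - Z (m+1) = of_real (\<kappa> m) * (\<i> * Z (m+1) - Z m)"
    "!!m. m + 2 \<le> k ==> e (m+2) - e (m+1) = \<kappa> m * (e (m+1) - e m)" by blast
  \<comment> \<open>All differences \<open>\<i> * Z (m+1) - Z m\<close> are positive multiples
    \<open>D m\<close> of the first one, so dividing by it makes them real.\<close>
  define G where "G = \<i> * Z 1 - Z 0"
  have G: "G \<noteq> 0" using layer_step_nonzero[OF P _ injp] k by (simp add: G_def)
  define D where "D m = (\<Prod>j<m. \<kappa> j)" for m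
  have D0: "D 0 = 1" and DS: "D (Suc m) = \<kappa> m * D m" for m by (simp_all add: D_def)
  have g: "\<i> * Z (m+1) - Z m = of_real (D m) * G \<and> e (m+1) - e m = D m * (e 1 - e 0) \<and> 0 < D m" if "m < k" for m
    using that
  proof (induction m)
    case 0 then show ?case by (simp add: D0 G_def)
  next
    case (Suc m)
    then have "m + 2 \<le> k" by simp
    then show ?case using Suc \<kappa>[of m] by (simp add: DS mult_ac)
  qed
  define \<xi> where "\<xi> m = Z m / G" for m
  define p where "p m = Re (\<xi> m)" for m
  define q where "q m = Im (\<xi> m)" for m
  have pq: "p (m+1) = q m \<and> q (m+1) = - (p m + D m)" if m: "m < k" for m
  proof -
    have "\<i> * Z (m+1) = Z m + of_real (D m) * G" using g[OF m] by (simp add: algebra_simps)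
    then have "\<i> * \<xi> (m+1) = \<xi> m + of_real (D m)" using G by (simp add: \<xi>_def field_simps)
    then show ?thesis unfolding complex_eq_iff p_def q_def by (simp add: algebra_simps)
  qed
  have RI: "p m + \<tau> m * p (m+2) = 2 * (1 + \<tau> m) * p (m+1)" "q m + \<tau> m * q (m+2) = 2 * (1 + \<tau> m) * q (m+1)"
    if m: "m + 2 \<le> k" for m
  proof -
    have "\<xi> m + of_real (\<tau> m) * \<xi> (m+2) = of_real (2 * (1 + \<tau> m)) * \<xi> (m+1)"
      using \<tau>(2)[OF m] unfolding \<xi>_def by (metis add_divide_distrib times_divide_eq_right)
    then show "p m + \<tau> m * p (m+2) = 2 * (1 + \<tau> m) * p (m+1)" "q m + \<tau> m * q (m+2) = 2 * (1 + \<tau> m) * q (m+1)"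
      unfolding complex_eq_iff p_def q_def by simp_all
  qed
  \<comment> \<open>The real and imaginary parts of the relation in directions 1 and 2, with layers
    \<open>m + 1\<close> and \<open>m + 2\<close> eliminated through the real differences.\<close>
  have R: "p m - \<tau> m * (p m + D m) = 2 * (1 + \<tau> m) * q m"
    and J: "q m - \<tau> m * (q m + D (m+1)) = - (2 * (1 + \<tau> m) * (p m + D m))" if m: "m + 2 \<le> k" for m
  proof -
    have s: "p (m+1) = q m" "q (m+1) = - (p m + D m)" "p (m+2) = - (p m + D m)" "q (m+2) = - (q m + D (m+1))"
      using pq[of m] pq[of "m+1"] m by simp_all
    show "p m - \<tau> m * (p m + D m) = 2 * (1 + \<tau> m) * q m"
      "q m - \<tau> m * (q m + D (m+1)) = - (2 * (1 + \<tau> m) * (p m + D m))"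
      using RI[OF m] unfolding s by (simp_all add: algebra_simps)
  qed
  \<comment> \<open>The complex coefficient that remains when \<open>R\<close> and \<open>J\<close>
    are solved: multiplication by \<open>cc (\<tau> m)\<close> turns \<open>\<xi> m\<close> into
    explicit real combinations of \<open>D m\<close> and \<open>D (m+1)\<close>.\<close>
  define cc where "cc t = Complex (- 2 * (1+t)) (1 - t)" for t
  have cc0: "cc t \<noteq> 0" if "t > 0" for t using that by (auto simp: cc_def complex_eq_iff)
  define F where "F m = 2 * (1 + \<tau> m) * D m - \<tau> m * D (m+1)" for m
  have ZF: "Z m = G / cc (\<tau> m) * Complex (F m) (\<tau> m * D m)" "Z (m+1) = G / cc (\<tau> m) * Complex (D m) (\<tau> m * D (m+1))"
    if m: "m + 2 \<le> k" for m
  proof -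
    have "cc (\<tau> m) * \<xi> m = Complex (F m) (\<tau> m * D m)"
      using R[OF m] J[OF m] unfolding complex_eq_iff
      by (simp add: cc_def F_def algebra_simps flip: p_def q_def)
    then show "Z m = G / cc (\<tau> m) * Complex (F m) (\<tau> m * D m)"
      using G cc0[OF \<tau>(1)[OF m]] by (simp add: \<xi>_def field_simps)
    have pq1: "p (m+1) = q m" "q (m+1) = - (p m + D m)" using pq[of m] m by auto
    have "cc (\<tau> m) * \<xi> (m+1) = Complex (D m) (\<tau> m * D (m+1))"
      unfolding complex_eq_iff times_complex.sel p_def[symmetric] q_def[symmetric] pq1
      using R[OF m] J[OF m] by (simp add: cc_def algebra_simps)
    then show "Z (m+1) = G / cc (\<tau> m) * Complex (D m) (\<tau> m * D (m+1))"
      using G cc0[OF \<tau>(1)[OF m]] by (simp add: \<xi>_def field_simps)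
  qed
  have W: "0 < (D m)\<^sup>2 - F m * D (m+1)" if m: "m + 2 \<le> k" for m
    by (rule casoratian_pos[OF P Q \<eta> inj1 injp m \<tau>(1)[OF m] _ ZF[OF m]])
       (use g m G cc0[OF \<tau>(1)[OF m]] in auto)
  have \<tau>step: "\<tau> (Suc m) = \<tau> m \<and> F (Suc m) = D m" if m: "Suc m + 2 \<le> k" for m
  proof -
    have m': "m + 2 \<le> k" using m by simp
    define t where "t = \<tau> m"
    have t: "t > 0" using \<tau>(1)[OF m'] by (simp add: t_def)
    have D: "D m > 0" "D (m+1) > 0" using g m by auto
    have 0: "p (m+1) = q m" "q (m+1) = - (p m + D m)" using pq[of m] m by auto
    have 1: "- (1 - t) * q (m+1) - D m = 2 * (1 + t) * p (m+1)"
      unfolding 0 using R[OF m'] by (simp add: t_def algebra_simps)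
    have 2: "(1 - t) * p (m+1) - t * D (m+1) = 2 * (1 + t) * q (m+1)"
      unfolding 0 using J[OF m'] by (simp add: t_def algebra_simps)
    have 3: "p (m+1) - \<tau> (m+1) * (p (m+1) + D (m+1)) = 2 * (1 + \<tau> (m+1)) * q (m+1)" using R[of "m+1"] m by simp
    \<comment> \<open>Relations 2 and 3 are one linear equation, taken at \<open>t\<close> and at
      \<open>\<tau> (m+1)\<close>; subtraction isolates the difference of the two ratios.\<close>
    have "(\<tau> (m+1) - t) * (p (m+1) + D (m+1) + 2 * q (m+1)) = 0" using 2 3 by (simp add: algebra_simps)
    moreover have "p (m+1) + D (m+1) + 2 * q (m+1) \<noteq> 0"
    proof
      assume z: "p (m+1) + D (m+1) + 2 * q (m+1) = 0"
      have "p (m+1) - 2 * q (m+1) = t * (p (m+1) + D (m+1) + 2 * q (m+1))" using 2 by (simp add: algebra_simps)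
      then have pp: "p (m+1) = 2 * q (m+1)" "D (m+1) = - 4 * q (m+1)" using z by simp_all
      \<comment> \<open>In the degenerate case consecutive differences have this fixed ratio, and
        the Casoratian becomes a negative multiple of a square.\<close>
      have "4 * D m = (5 + 3 * t) * D (m+1)" using 1 pp by (simp add: algebra_simps)
      then have Dm: "D m = (5 + 3 * t) * D (m+1) / 4" by simp
      have "(D m)\<^sup>2 - F m * D (m+1) = (D (m+1))\<^sup>2 * (- 15 - 18 * t - 15 * t\<^sup>2) / 16"
        unfolding F_def t_def[symmetric] Dm by (simp add: power2_eq_square field_simps)
      also have "\<dots> < 0"
      proof -
        have "- 15 - 18 * t - 15 * t\<^sup>2 < 0" using t zero_le_power2[of t] by linarith
        moreover have "0 < (D (m+1))\<^sup>2" using D by simp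
        ultimately have "(D (m+1))\<^sup>2 * (- 15 - 18 * t - 15 * t\<^sup>2) < 0" by (rule mult_pos_neg[rotated])
        then show ?thesis by simp
      qed
      finally show False using W[OF m'] by simp
    qed
    ultimately have tt: "\<tau> (m+1) = t" by simp
    have "Complex (F (m+1)) (t * D (m+1)) = Complex (D m) (t * D (m+1))"
      using ZF(1)[of "m+1"] ZF(2)[OF m'] m tt G cc0[OF t] by (simp add: t_def)
    then show ?thesis using tt by (simp add: t_def)
  qed
  define t where "t = \<tau> 0"
  have t: "t > 0" using \<tau>(1)[of 0] k by (simp add: t_def)
  have \<tau>c: "\<tau> m = t" if "m + 2 \<le> k" for m
    using that by (induction m) (use \<tau>step in \<open>auto simp: t_def\<close>)
  \<comment> \<open>\<open>E\<close> is \<open>D\<close> shifted by one layer and continued by the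
    recurrence at both ends: \<open>E (m+1) = D m\<close> below the top, and
    \<open>E 0 = F 0\<close>, whose sign is not controlled.\<close>
  define E where "E = lin_rec t (F 0) 1"
  have ok: "seq_ok t E" unfolding E_def by (rule seq_ok_lin_rec[OF t])
  then have rec: "t * E (m+2) = 2 * (1+t) * E (m+1) - E m" for m by (simp add: seq_ok_def)
  have ED: "E m = (if m = 0 then F 0 else D (m-1)) \<and> E (m+1) = D m" if "m < k" for m
    using that
  proof (induction m)
    case 0 then show ?case by (simp add: E_def D0)
  next
    case (Suc m)
    then have m: "m + 2 \<le> k" by simp
    have IH: "E m = (if m = 0 then F 0 else D (m-1))" "E (m+1) = D m" using Suc by auto
    have "E m = F m"
    proof (cases m)
      case 0 then show ?thesis using IH by simp
    next
      case (Suc j) then show ?thesis using IH \<tau>step[of j] m by simp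
    qed
    then have "t * E (m+2) = t * D (m+1)" using rec[of m] IH(2) \<tau>c[OF m] by (simp add: F_def)
    then show ?case using IH(2) t by simp
  qed
  define A where "A = G / cc t"
  have A: "A \<noteq> 0" using G cc0[OF t] by (simp add: A_def)
  have Zm: "Z m = seqZ A t E m" if "m \<le> k" for m
    using that
  proof (induction m)
    case 0
    have "Z 0 = A * Complex (F 0) (t * D 0)" using ZF(1)[of 0] k by (simp add: A_def t_def)
    then show ?case using ED[of 0] k by (simp add: seqZ_def)
  next
    case (Suc m)
    have "\<i> * Z (m+1) = Z m + of_real (D m) * G" using g[of m] Suc by (simp add: algebra_simps)
    also have "\<dots> = A * (Complex (E m) (t * E (m+1)) + of_real (E (m+1)) * cc t)"
      using Suc ED[of m] cc0[OF t] by (simp add: seqZ_def A_def algebra_simps)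
    also have "Complex (E m) (t * E (m+1)) + of_real (E (m+1)) * cc t = \<i> * Complex (E (m+1)) (t * E (m+2))"
      using rec[of m] by (simp add: complex_eq_iff cc_def algebra_simps)
    finally have "\<i> * Z (m+1) = \<i> * (A * Complex (E (m+1)) (t * E (m+2)))" by (simp add: algebra_simps)
    then show ?case by (simp add: seqZ_def)
  qed
  \<comment> \<open>\<open>seqh\<close> rises by \<open>1 + t\<close> from layer 0 to layer 1, since
    \<open>E 1 = 1\<close>.\<close>
  define s where "s = (e 1 - e 0) / (1 + t)"
  have s: "e 1 - e 0 = s * (1 + t)" using t by (simp add: s_def)
  have em: "e m = s * seqh t E m" if "m \<le> k" for m
    using that
  proof (induction m)
    case 0
    have e1: "e 1 = e 0 + s * (1 + t)" using s by simp
    have e2: "e 2 = e 1 + D 1 * (s * (1 + t))" using g[of 1] k s by (simp add: numeral_2_eq_2)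
    have e012: "e 0 + t * e 2 = 2 * (1 + t) * e 1" using \<tau>(3)[of 0] k by (simp add: t_def numeral_2_eq_2)
    have "(1 + t) * e 0 = (1 + t) * (s * (t * D 1 - (2 + t)))"
      using e012 unfolding e2 e1 by (simp add: algebra_simps)
    then have "e 0 = s * (t * D 1 - (2 + t))" using t by simp
    moreover have "seqh t E 0 = t * D 1 - (2 + t)"
      using ED[of 0] k by (simp add: seqh_def F_def D0 t_def[symmetric] algebra_simps)
    ultimately show ?case by simp
  next
    case (Suc m)
    have "e (m+1) = e m + E (m+1) * (s * (1 + t))" using g[of m] Suc ED[of m] s by (simp add: algebra_simps)
    also have "\<dots> = s * (t * E (m+1) - E m + (1 + t) * E (m+1))" using Suc by (simp add: seqh_def algebra_simps)
    also have "t * E (m+1) - E m + (1 + t) * E (m+1) = t * E (m+2) - E (m+1)" using rec[of m] by (simp add: algebra_simps)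
    finally show ?case by (simp add: seqh_def)
  qed
  have "0 < (E 1)\<^sup>2 - E 0 * E 2"
    using W[of 0] ED[of 0] ED[of 1] k by (simp add: numeral_2_eq_2)
  then show ?thesis using that[of A t E s] A ok Zm em ED g by auto
qed

section \<open>The Casoratian of a layer sequence\<close>

lemma seq_rec: "seq_ok \<tau> E ==> \<tau> * E (m+2) = 2 * (1+\<tau>) * E (m+1) - E m"
  and seq_pos: "seq_ok \<tau> E ==> 0 < \<tau>"
  by (auto simp: seq_ok_def)

text \<open>Discrete Wronskian of \<open>E\<close> and its shift. The recurrence multiplies it by a
  constant at each step, so its sign is the same in all layers.\<close>

definition cas :: "(nat => real) => nat => real" where
  "cas E m = (E (m+1))\<^sup>2 - E m * E (m+2)"

lemma cas_step: assumes "seq_ok \<tau> E" shows "\<tau> * cas E (Suc m) = cas E m"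
proof -
  have 1: "E m = 2 * (1+\<tau>) * E (m+1) - \<tau> * E (m+2)" using seq_rec[OF assms, of m] by simp
  have 2: "\<tau> * E (m+3) = 2 * (1+\<tau>) * E (m+2) - E (m+1)"
    using seq_rec[OF assms, of "m+1"] by (simp add: numeral_3_eq_3)
  have "\<tau> * cas E (Suc m) = \<tau> * (E (m+2))\<^sup>2 - E (m+1) * (\<tau> * E (m+3))"
    by (simp add: cas_def algebra_simps numeral_3_eq_3)
  also have "\<dots> = cas E m" unfolding cas_def 1 2 by (simp add: power2_eq_square algebra_simps)
  finally show ?thesis .
qed

lemma cas_pos: assumes "seq_ok \<tau> E" "0 < cas E 0" shows "0 < cas E m"
proof (induction m)
  case (Suc m)
  then have "0 < \<tau> * cas E (Suc m)" using cas_step[OF assms(1)] by simp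
  then show ?case using seq_pos[OF assms(1)] by (simp add: zero_less_mult_iff)
qed (rule assms(2))

lemma cas_quadratic: assumes "seq_ok \<tau> E"
  shows "cas E m = \<tau> * (E (m+2))\<^sup>2 - 2 * (1+\<tau>) * E (m+1) * E (m+2) + (E (m+1))\<^sup>2"
proof -
  have 1: "E m = 2 * (1+\<tau>) * E (m+1) - \<tau> * E (m+2)" using seq_rec[OF assms, of m] by simp
  show ?thesis unfolding cas_def 1 by (simp add: power2_eq_square algebra_simps)
qed

text \<open>As a quadratic form in two consecutive terms, the Casoratian splits into two brackets
  with positive weights; positivity needs a positive bracket. The alternatives are the growing and
  the decaying regime.\<close>

lemma cas_dichotomy:
  assumes "seq_ok \<tau> E" "0 < cas E m" "0 < E (m+1)" "0 < E (m+2)"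
  shows "(1+\<tau>) * E (m+1) < \<tau> * E (m+2) \<or> (1+\<tau>) * E (m+2) < E (m+1)"
proof (rule ccontr)
  assume A: "\<not> ?thesis"
  have "cas E m = E (m+2) * (\<tau> * E (m+2) - (1+\<tau>) * E (m+1)) + E (m+1) * (E (m+1) - (1+\<tau>) * E (m+2))"
    unfolding cas_quadratic[OF assms(1)] by (simp add: power2_eq_square algebra_simps)
  also have "\<dots> \<le> 0" using A assms(3,4)
    by (intro add_nonpos_nonpos mult_nonneg_nonpos) auto
  finally show False using assms(2) by simp
qed

section \<open>Plane fans\<close>

text \<open>Planar cross product: positive when \<open>v\<close> lies less than a half-turn
  counterclockwise from \<open>u\<close>.\<close>

definition cr :: "complex => complex => real" where "cr u v = Re u * Im v - Im u * Re v"

lemma cr_simps: "cr (u + v) w = cr u w + cr v w" "cr u (v + w) = cr u v + cr u w"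
  "cr (a *\<^sub>R u) v = a * cr u v" "cr u (a *\<^sub>R v) = a * cr u v" "cr (- u) v = - cr u v" "cr u (- v) = - cr u v"
  "cr u u = 0" "cr (u - v) w = cr u w - cr v w" "cr u (v - w) = cr u v - cr u w"
  by (simp_all add: cr_def algebra_simps)

lemma cr_swap: "cr u v = - cr v u"
  by (simp add: cr_def)

text \<open>Bilinear expansion gives four nonnegative terms, so all vanish; only the shared endpoint
  \<open>P' = Q\<close> survives.\<close>

lemma fan_pair:
  assumes pos: "0 < cr P Q" "0 < cr P Q'" "0 < cr P' Q'" "0 < cr P' Q \<or> P' = Q"
    and a: "0 \<le> a" "0 \<le> b" "a + b = 1" "0 \<le> a'" "0 \<le> b'" "a' + b' = 1"
    and z: "cr (a *\<^sub>R P + b *\<^sub>R P') (a' *\<^sub>R Q + b' *\<^sub>R Q') = 0"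
  shows "a *\<^sub>R P + b *\<^sub>R P' = a' *\<^sub>R Q + b' *\<^sub>R Q'"
proof -
  have s: "a * a' * cr P Q + a * b' * cr P Q' + b * a' * cr P' Q + b * b' * cr P' Q' = 0"
    using z by (simp add: cr_simps algebra_simps)
  have n: "0 \<le> cr P' Q" using pos(4) by (auto simp: cr_simps)
  have nn: "0 \<le> a * a' * cr P Q" "0 \<le> a * b' * cr P Q'" "0 \<le> b * a' * cr P' Q" "0 \<le> b * b' * cr P' Q'"
    using a pos n by simp_all
  then have "a * a' * cr P Q = 0" "a * b' * cr P Q' = 0" "b * a' * cr P' Q = 0" "b * b' * cr P' Q' = 0"
    using s by linarith+
  then have *: "a * a' = 0" "a * b' = 0" "b * b' = 0" "b * a' = 0 \<or> P' = Q" using pos by auto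
  have "a = a * a' + a * b'" using a(6) by (metis distrib_left mult.right_neutral)
  then have "a = 0" using * by simp
  then have "b = 1" using a by simp
  then have "b' = 0" using * by simp
  then have "a' = 1" using a by simp
  then show ?thesis using \<open>a = 0\<close> \<open>b = 1\<close> \<open>b' = 0\<close> * by auto
qed

text \<open>The same expansion for two sides whose outer ends are antipodal; they share only the
  line through this antipodal pair.\<close>

lemma fan_wrap:
  assumes pos: "0 < cr P Q" "0 < cr P' Q" "0 < cr P P'"
    and a: "0 \<le> a" "0 \<le> b" "a + b = 1" "0 \<le> a'" "0 \<le> b'" "a' + b' = 1"
    and z: "cr (a *\<^sub>R P + b *\<^sub>R P') (a' *\<^sub>R Q + b' *\<^sub>R (- P)) = 0"
  shows "a' *\<^sub>R Q + b' *\<^sub>R (- P) = - (a *\<^sub>R P + b *\<^sub>R P')"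
proof -
  have s: "a * a' * cr P Q + b * a' * cr P' Q + b * b' * cr P P' = 0"
    using z cr_swap[of P' P] by (simp add: cr_simps algebra_simps)
  have nn: "0 \<le> a * a' * cr P Q" "0 \<le> b * a' * cr P' Q" "0 \<le> b * b' * cr P P'" using a pos by simp_all
  then have "a * a' * cr P Q = 0" "b * a' * cr P' Q = 0" "b * b' * cr P P' = 0" using s by linarith+
  then have *: "a * a' = 0" "b * a' = 0" "b * b' = 0" using pos by auto
  have "a' = a * a' + b * a'" using a(3) by (metis distrib_right mult.left_neutral)
  then have "a' = 0" using * by simp
  then have "b' = 1" using a by simp
  then have "b = 0" using * by simp
  then have "a = 1" using a by simp
  then show ?thesis using \<open>a' = 0\<close> \<open>b' = 1\<close> \<open>b = 0\<close> by simp
qed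

lemma fan_same:
  assumes pos: "0 < cr P P' \<or> P = P'"
    and a: "a + b = 1" "a' + b' = 1"
    and z: "cr (a *\<^sub>R P + b *\<^sub>R P') (a' *\<^sub>R P + b' *\<^sub>R P') = 0"
  shows "a *\<^sub>R P + b *\<^sub>R P' = a' *\<^sub>R P + b' *\<^sub>R P'"
proof (cases "P = P'")
  case True then show ?thesis using a by (simp flip: scaleR_left_distrib)
next
  case False
  have "(a * b' - b * a') * cr P P' = 0"
    using z cr_swap[of P' P] by (simp add: cr_simps algebra_simps)
  then have "a * b' = b * a'" using pos False by simp
  then have "a = a'" using a by (metis add.commute distrib_left mult.commute mult.right_neutral)
  then show ?thesis using a by simp
qed

text \<open>Sides 0 to 3 of an octagon symmetric about 0. The last of them closes up at
  \<open>- V 0\<close>, and the remaining sides are the negatives of these.\<close>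

definition fan_seg :: "(nat => complex) => nat => real => complex" where
  "fan_seg V n r = (1 - r) *\<^sub>R V n + r *\<^sub>R (if n = 3 then - V 0 else V (Suc n))"

text \<open>Counterclockwise order inside an open half-plane. Side 2 may shrink to a point, as it
  does for \<open>oct\<close> with \<open>y = 0\<close>.\<close>

definition fan_ok :: "(nat => complex) => bool" where
  "fan_ok V \<longleftrightarrow> 0 < cr (V 0) (V 1) \<and> 0 < cr (V 0) (V 2) \<and> 0 < cr (V 0) (V 3) \<and>
     0 < cr (V 1) (V 2) \<and> 0 < cr (V 1) (V 3) \<and> (0 < cr (V 2) (V 3) \<or> V 2 = V 3)"

text \<open>Points of two sides on a common line through 0 are equal or opposite, because the
  vertices are in counterclockwise order within a half-turn. Hence a ray meets the octagon
  once.\<close>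

lemma fan_unique:
  assumes V: "fan_ok V" and n: "n \<le> 3" "n' \<le> 3" and r: "0 \<le> r" "r \<le> 1" "0 \<le> r'" "r' \<le> 1"
    and \<sigma>: "\<sigma> = 1 \<or> \<sigma> = (-1::real)" "\<sigma>' = 1 \<or> \<sigma>' = (-1::real)" and t: "0 < t"
    and eq: "\<sigma>' *\<^sub>R fan_seg V n' r' = t *\<^sub>R (\<sigma> *\<^sub>R fan_seg V n r)" and nz: "fan_seg V n r \<noteq> 0"
  shows "t = 1"
proof -
  have V': "0 < cr (V 0) (V 1)" "0 < cr (V 0) (V 2)" "0 < cr (V 0) (V 3)" "0 < cr (V 1) (V 2)"
    "0 < cr (V 1) (V 3)" "0 < cr (V 2) (V 3) \<or> V 2 = V 3" using V by (auto simp: fan_ok_def)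
  have core: "fan_seg V b s = fan_seg V a q \<or> fan_seg V b s = - fan_seg V a q"
    if ab: "a \<le> b" "b \<le> 3" and qs: "0 \<le> q" "q \<le> 1" "0 \<le> s" "s \<le> 1" and z: "cr (fan_seg V a q) (fan_seg V b s) = 0" for a b q s
  proof -
    have c: "0 \<le> 1 - q" "0 \<le> q" "1 - q + q = 1" "0 \<le> 1 - s" "0 \<le> s" "1 - s + s = 1" using qs by auto
    have m0: "cr u (- V 0) = cr (V 0) u" for u using cr_swap[of u "V 0"] by (simp add: cr_simps)
    consider "a = b" "b = 0" | "a = b" "b = 1" | "a = b" "b = 2" | "a = b" "b = 3" | "a = 0" "b = 1" | "a = 0" "b = 2"
      | "a = 0" "b = 3" | "a = 1" "b = 2" | "a = 1" "b = 3" | "a = 2" "b = 3"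
    proof -
      have "a = 0 \<or> a = 1 \<or> a = 2 \<or> a = 3" "b = 0 \<or> b = 1 \<or> b = 2 \<or> b = 3" using ab by linarith+
      then show ?thesis using ab that by (elim disjE) simp_all
    qed
    then show ?thesis
    proof cases
      case 1 with z fan_same[OF _ c(3,6), of "V 0" "V 1"] V'(1) show ?thesis by (simp add: fan_seg_def)
    next
      case 2 with z fan_same[OF _ c(3,6), of "V 1" "V 2"] V'(4) show ?thesis by (simp add: fan_seg_def numeral_2_eq_2)
    next
      case 3 with z fan_same[OF _ c(3,6), of "V 2" "V 3"] V'(6) show ?thesis by (simp add: fan_seg_def numeral_3_eq_3 numeral_2_eq_2)
    next
      case 4 with z fan_same[OF _ c(3,6), of "V 3" "- V 0"] V'(3) show ?thesis by (simp add: fan_seg_def m0)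
    next
      case 5 with z fan_pair[OF _ _ _ _ c, of "V 0" "V 1" "V 2" "V 1"] V' show ?thesis by (simp add: fan_seg_def numeral_2_eq_2)
    next
      case 6 with z fan_pair[OF _ _ _ _ c, of "V 0" "V 2" "V 3" "V 1"] V' show ?thesis by (simp add: fan_seg_def numeral_3_eq_3 numeral_2_eq_2)
    next
      case 7 with z fan_wrap[OF _ _ _ c, of "V 0" "V 3" "V 1"] V' show ?thesis by (simp add: fan_seg_def)
    next
      case 8
      show ?thesis
      proof (cases "V 2 = V 3")
        case True
        then have "fan_seg V b s = 0 *\<^sub>R V 1 + 1 *\<^sub>R V 2" using 8 by (simp add: fan_seg_def numeral_3_eq_3 numeral_2_eq_2 flip: scaleR_left_distrib)
        with z fan_same[of "V 1" "V 2" "1-q" q 0 1] V'(4) 8 show ?thesis by (simp add: fan_seg_def numeral_2_eq_2)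
      next
        case False
        with 8 z fan_pair[OF _ _ _ _ c, of "V 1" "V 2" "V 3" "V 2"] V' show ?thesis by (auto simp add: fan_seg_def numeral_3_eq_3 numeral_2_eq_2)
      qed
    next
      case 9 with z fan_pair[OF _ _ _ _ c, of "V 1" "V 3" "- V 0" "V 2"] V' m0 show ?thesis by (simp add: fan_seg_def numeral_2_eq_2)
    next
      case 10
      show ?thesis
      proof (cases "V 2 = V 3")
        case True
        then have "fan_seg V a q = 1 *\<^sub>R V 3 + 0 *\<^sub>R (- V 0)" using 10 by (simp add: fan_seg_def numeral_3_eq_3 numeral_2_eq_2 flip: scaleR_left_distrib)
        with z fan_same[of "V 3" "- V 0" 1 0 "1-s" s] V'(3) 10 show ?thesis by (simp add: fan_seg_def m0)
      next
        case False
        with 10 z fan_pair[OF _ _ _ _ c, of "V 2" "V 3" "- V 0" "V 3"] V' m0 show ?thesis by (simp add: fan_seg_def numeral_3_eq_3 numeral_2_eq_2)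
      qed
    qed
  qed
  let ?p = "fan_seg V n r" and ?q = "fan_seg V n' r'"
  have "\<sigma>' * \<sigma>' = 1" using \<sigma> by auto
  then have "?q = (\<sigma>' * t * \<sigma>) *\<^sub>R ?p" using arg_cong[OF eq, of "\<lambda>x. \<sigma>' *\<^sub>R x"] by (simp add: mult.assoc)
  then have q: "?q = (\<sigma>' * \<sigma> * t) *\<^sub>R ?p" by (simp add: mult_ac)
  then have z: "cr ?p ?q = 0" "cr ?q ?p = 0" by (simp_all add: cr_simps)
  have "?q = ?p \<or> ?q = - ?p"
  proof (cases "n \<le> n'")
    case True then show ?thesis using core[OF True n(2) r z(1)] by blast
  next
    case False
    then have "?p = ?q \<or> ?p = - ?q" using core[of n' n r' r] n r z by simp
    then show ?thesis by auto
  qed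
  then have "(\<sigma>' * \<sigma> * t) *\<^sub>R ?p = 1 *\<^sub>R ?p \<or> (\<sigma>' * \<sigma> * t) *\<^sub>R ?p = (-1) *\<^sub>R ?p" using q by simp
  then have "\<sigma>' * \<sigma> * t = 1 \<or> \<sigma>' * \<sigma> * t = -1" using nz unfolding scaleR_cancel_right by blast
  then show ?thesis using \<sigma> t by auto
qed

text \<open>Cramer's rule writes \<open>z\<close> in the basis \<open>P\<close>, \<open>P'\<close>,
  and the sign conditions make both coefficients nonnegative.\<close>

lemma cone_seg:
  assumes "0 < cr P P'" "0 \<le> cr P z" "cr P' z \<le> 0" "z \<noteq> 0"
  obtains t r where "0 < t" "0 \<le> r" "r \<le> 1" "t *\<^sub>R z = (1 - r) *\<^sub>R P + r *\<^sub>R P'"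
proof -
  define \<alpha> where "\<alpha> = - cr P' z / cr P P'"
  define \<beta> where "\<beta> = cr P z / cr P P'"
  have ab: "0 \<le> \<alpha>" "0 \<le> \<beta>" unfolding \<alpha>_def \<beta>_def using assms by (auto intro: divide_nonneg_pos divide_nonpos_pos)
  have "cr P P' *\<^sub>R z = (- cr P' z) *\<^sub>R P + cr P z *\<^sub>R P'"
    by (simp add: cr_def complex_eq_iff algebra_simps)
  then have "(1 / cr P P') *\<^sub>R (cr P P' *\<^sub>R z) = (1 / cr P P') *\<^sub>R ((- cr P' z) *\<^sub>R P + cr P z *\<^sub>R P')" by simp
  then have z: "z = \<alpha> *\<^sub>R P + \<beta> *\<^sub>R P'" using assms(1) by (simp add: \<alpha>_def \<beta>_def scaleR_right_diff_distrib)
  then have s: "0 < \<alpha> + \<beta>" using assms(4) ab by (metis add.right_neutral add_nonneg_eq_0_iff add_nonneg_nonneg order_less_le scale_zero_left)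
  have "(1 / (\<alpha> + \<beta>)) *\<^sub>R z = (1 - \<beta> / (\<alpha> + \<beta>)) *\<^sub>R P + (\<beta> / (\<alpha> + \<beta>)) *\<^sub>R P'"
    using s by (subst z) (simp add: scaleR_right_distrib field_simps)
  then show ?thesis using s ab by (intro that[of "1 / (\<alpha> + \<beta>)" "\<beta> / (\<alpha> + \<beta>)"]) auto
qed

lemma fan_complete:
  assumes V: "fan_ok V" and z: "z \<noteq> 0"
  obtains t \<sigma> n r where "0 < t" "\<sigma> = 1 \<or> \<sigma> = (-1::real)" "n \<le> 3" "0 \<le> r" "r \<le> 1" "t *\<^sub>R z = \<sigma> *\<^sub>R fan_seg V n r"
proof -
  have V': "0 < cr (V 0) (V 1)" "0 < cr (V 0) (V 2)" "0 < cr (V 0) (V 3)" "0 < cr (V 1) (V 2)"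
    "0 < cr (V 1) (V 3)" "0 < cr (V 2) (V 3) \<or> V 2 = V 3" using V by (auto simp: fan_ok_def)
  have half: "\<exists>t n r. 0 < t \<and> n \<le> 3 \<and> 0 \<le> r \<and> r \<le> 1 \<and> t *\<^sub>R u = fan_seg V n r" if u: "0 \<le> cr (V 0) u" "u \<noteq> 0" for u
  proof -
    have m0: "cr (V 3) (- V 0) > 0" "cr (- V 0) u \<le> 0" using V'(3) u cr_swap[of "V 3" "V 0"] by (simp_all add: cr_simps)
    consider "cr (V 1) u \<le> 0" | "0 < cr (V 1) u" "cr (V 2) u \<le> 0" | "0 < cr (V 2) u" "cr (V 3) u \<le> 0" | "0 < cr (V 3) u"
      by linarith
    then show ?thesis
    proof cases
      case 1
      obtain t r where "0 < t" "0 \<le> r" "r \<le> 1" "t *\<^sub>R u = (1 - r) *\<^sub>R V 0 + r *\<^sub>R V 1" using cone_seg[OF V'(1) u(1) 1 u(2)] .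
      then show ?thesis by (intro exI[of _ t] exI[of _ 0] exI[of _ r]) (simp add: fan_seg_def)
    next
      case 2
      obtain t r where "0 < t" "0 \<le> r" "r \<le> 1" "t *\<^sub>R u = (1 - r) *\<^sub>R V 1 + r *\<^sub>R V 2" using cone_seg[OF V'(4) _ 2(2) u(2)] 2(1) by auto
      then show ?thesis by (intro exI[of _ t] exI[of _ 1] exI[of _ r]) (simp add: fan_seg_def numeral_2_eq_2)
    next
      case 3
      then have "V 2 \<noteq> V 3" by auto
      then have p: "0 < cr (V 2) (V 3)" using V'(6) by blast
      obtain t r where "0 < t" "0 \<le> r" "r \<le> 1" "t *\<^sub>R u = (1 - r) *\<^sub>R V 2 + r *\<^sub>R V 3" using cone_seg[OF p _ 3(2) u(2)] 3(1) by auto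
      then show ?thesis by (intro exI[of _ t] exI[of _ 2] exI[of _ r]) (simp add: fan_seg_def numeral_2_eq_2 numeral_3_eq_3)
    next
      case 4
      obtain t r where "0 < t" "0 \<le> r" "r \<le> 1" "t *\<^sub>R u = (1 - r) *\<^sub>R V 3 + r *\<^sub>R (- V 0)" using cone_seg[OF m0(1) _ m0(2) u(2)] 4 by auto
      then show ?thesis by (intro exI[of _ t] exI[of _ 3] exI[of _ r]) (simp add: fan_seg_def)
    qed
  qed
  show ?thesis
  proof (cases "0 \<le> cr (V 0) z")
    case True
    then show ?thesis using half[OF True z] that[of _ 1] by auto
  next
    case False
    then have "0 \<le> cr (V 0) (- z)" by (simp add: cr_simps)
    then obtain t n r where "0 < t" "n \<le> 3" "0 \<le> r" "r \<le> 1" "t *\<^sub>R (- z) = fan_seg V n r" using half[of "- z"] z by auto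
    moreover from this have "t *\<^sub>R z = (-1) *\<^sub>R fan_seg V n r" by (simp add: minus_equation_iff[of "t *\<^sub>R z"])
    ultimately show ?thesis using that[of t "-1" n r] by blast
  qed
qed

section \<open>Three consecutive layers over the Clifford torus\<close>

lemma pcone_square:
  assumes "i \<noteq> j"
  shows "x \<in> pcone P (unit_cell v {i, j}) \<longleftrightarrow> (\<exists>\<alpha> \<beta> \<gamma> \<delta>. 0 \<le> \<alpha> \<and> 0 \<le> \<beta> \<and> 0 \<le> \<gamma> \<and> 0 \<le> \<delta> \<and>
    x = \<alpha> *\<^sub>R P v + \<beta> *\<^sub>R P (v + ax i) + \<gamma> *\<^sub>R P (v + ax j) + \<delta> *\<^sub>R P (v + ax i + ax j))" (is "_ \<longleftrightarrow> ?R")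
proof -
  let ?A = v and ?B = "v + ax i" and ?C = "v + ax j" and ?D = "v + ax i + ax j"
  have ne: "?A \<noteq> ?B" "?A \<noteq> ?C" "?A \<noteq> ?D" "?B \<noteq> ?C" "?B \<noteq> ?D" "?C \<noteq> ?D"
    using assms by (auto simp: vec_eq_iff axis_def)
  have s: "(\<Sum>w\<in>unit_cell v {i, j}. f w) = f ?A + f ?B + f ?C + f ?D" for f :: "int^3 => real^5"
    unfolding unit_cell_square[OF assms] using ne by (simp add: add.assoc)
  show ?thesis
  proof
    assume "x \<in> pcone P (unit_cell v {i, j})"
    then obtain a where a: "\<forall>w\<in>unit_cell v {i, j}. 0 \<le> a w" "x = (\<Sum>w\<in>unit_cell v {i, j}. a w *\<^sub>R P w)" by (rule pconeE)
    then show ?R unfolding s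
      by (intro exI[of _ "a ?A"] exI[of _ "a ?B"] exI[of _ "a ?C"] exI[of _ "a ?D"]) (simp add: unit_cell_square[OF assms])
  next
    assume ?R
    then obtain \<alpha> \<beta> \<gamma> \<delta> where c: "0 \<le> \<alpha>" "0 \<le> \<beta>" "0 \<le> \<gamma>" "0 \<le> \<delta>"
      "x = \<alpha> *\<^sub>R P v + \<beta> *\<^sub>R P (v + ax i) + \<gamma> *\<^sub>R P (v + ax j) + \<delta> *\<^sub>R P (v + ax i + ax j)" by blast
    define a where "a w = (if w = ?A then \<alpha> else if w = ?B then \<beta> else if w = ?C then \<gamma> else \<delta>)" for w
    have "a ?A = \<alpha>" "a ?B = \<beta>" "a ?C = \<gamma>" "a ?D = \<delta>" using ne by (simp_all add: a_def)
    then have "x = (\<Sum>w\<in>unit_cell v {i, j}. a w *\<^sub>R P w)" unfolding s c(5) by simp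
    moreover have "(\<Sum>w\<in>unit_cell v {i, j}. a w *\<^sub>R P w) \<in> pcone P (unit_cell v {i, j})"
      using c by (intro pconeI) (simp add: a_def)
    ultimately show "x \<in> pcone P (unit_cell v {i, j})" by simp
  qed
qed

text \<open>Three consecutive layers contain no cube, so the cell has at most two directions. If its
  lowest vertex lies above layer \<open>m\<close>, the base is moved down along directions that the
  cell lacks.\<close>

lemma layers3_sub_square:
  assumes c: "c \<in> layers3 k (Suc m)"
  obtains v i j where "csum v = int m" "i \<noteq> j" "c \<subseteq> unit_cell v {i, j}" "(i, j) \<in> {(1, 2), (1, 3), (2, 3)}"
proof -
  obtain v0 J where v0: "c = unit_cell v0 J" using c by (auto simp: strip_iff is_cell_def)
  have L: "csum w \<in> {int m, int m + 1, int m + 2}" if "w \<in> c" for w using c that by auto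
  define top where "top = (\<chi> i. if i \<in> J then v0 $ i + 1 else v0 $ i)"
  have tb: "v0 \<in> c" "top \<in> c" unfolding v0 by (auto simp: unit_cell_def top_def)
  have sub: "c \<subseteq> unit_cell v K" if "!!i. i \<in> J ==> i \<in> K \<and> v $ i = v0 $ i" "!!i. i \<notin> J ==> v0 $ i = v $ i \<or> i \<in> K \<and> v0 $ i = v $ i + 1" for v K
  proof
    fix w assume "w \<in> c"
    then have w: "w $ i = v0 $ i \<or> i \<in> J \<and> w $ i = v0 $ i + 1" for i by (simp add: v0 unit_cell_def)
    have "w $ i = v $ i \<or> i \<in> K \<and> w $ i = v $ i + 1" for i
      using w[of i] that(1)[of i] that(2)[of i] by (cases "i \<in> J") auto
    then show "w \<in> unit_cell v K" by (simp add: unit_cell_def)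
  qed
  have Jsub: "J \<subseteq> S" if "1 \<in> J ==> 1 \<in> S" "2 \<in> J ==> 2 \<in> S" "3 \<in> J ==> 3 \<in> S" for S
  proof
    fix x assume "x \<in> J"
    then show "x \<in> S" using that exhaust_3[of x] by auto
  qed
  have ct: "csum top = csum v0 + of_bool (1 \<in> J) + of_bool (2 \<in> J) + of_bool (3 \<in> J)"
    by (simp add: csum_def top_def)
  have rng: "csum v0 \<in> {int m, int m + 1, int m + 2}" "csum top \<le> int m + 2" using L tb by force+
  have J3: "\<not> (1 \<in> J \<and> 2 \<in> J \<and> 3 \<in> J)" using rng ct by auto
  have P: "\<exists>i j. (i, j) \<in> {(1, 2), (1, 3), (2, 3)} \<and> J \<subseteq> {i, j}"
  proof -
    consider "3 \<notin> J" | "2 \<notin> J" | "1 \<notin> J" using J3 by blast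
    then have "J \<subseteq> {1, 2} \<or> J \<subseteq> {1, 3} \<or> J \<subseteq> {2, 3}"
    proof cases
      case 1 have "J \<subseteq> {1, 2}" by (rule Jsub) (use 1 in auto) then show ?thesis ..
    next
      case 2 have "J \<subseteq> {1, 3}" by (rule Jsub) (use 2 in auto) then show ?thesis by blast
    next
      case 3 have "J \<subseteq> {2, 3}" by (rule Jsub) (use 3 in auto) then show ?thesis by blast
    qed
    then show ?thesis by blast
  qed
  have ax: "(ax i) $ j = (if i = j then 1 else 0)" for i j by (simp add: axis_def)
  consider "csum v0 = int m" | "csum v0 = int m + 1" | "csum v0 = int m + 2" using rng by auto
  then show ?thesis
  proof cases
    case 1
    obtain i j where ij: "(i, j) \<in> {(1, 2), (1, 3), (2::3, 3)}" "J \<subseteq> {i, j}" using P by blast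
    have "c \<subseteq> unit_cell v0 {i, j}" using ij(2) by (intro sub) auto
    then show ?thesis using that[of v0 i j] 1 ij(1) by auto
  next
    case 2
    have "of_bool (1 \<in> J) + of_bool (2 \<in> J) + of_bool (3 \<in> J) \<le> (1::int)" using rng(2) ct 2 by linarith
    then consider "2 \<notin> J" "3 \<notin> J" | "1 \<notin> J" "3 \<notin> J" | "1 \<notin> J" "2 \<notin> J"
      by (cases "1 \<in> J"; cases "2 \<in> J"; cases "3 \<in> J") auto
    then consider "J \<subseteq> {1}" | "J \<subseteq> {2}" | "J \<subseteq> {3}"
    proof cases
      case 1 have "J \<subseteq> {1}" by (rule Jsub) (use 1 in auto) then show ?thesis using that by blast
    next
      case 2 have "J \<subseteq> {2}" by (rule Jsub) (use 2 in auto) then show ?thesis using that by blast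
    next
      case 3 have "J \<subseteq> {3}" by (rule Jsub) (use 3 in auto) then show ?thesis using that by blast
    qed
    then show ?thesis
    proof cases
      case 1
      have "c \<subseteq> unit_cell (v0 - ax 2) {1, 2}" using 1 by (intro sub) (auto simp: ax)
      then show ?thesis using that[of "v0 - ax 2" 1 2] 2 by simp
    next
      case a: 2
      have "c \<subseteq> unit_cell (v0 - ax 1) {1, 2}" using a by (intro sub) (auto simp: ax)
      then show ?thesis using that[of "v0 - ax 1" 1 2] 2 by simp
    next
      case 3
      have "c \<subseteq> unit_cell (v0 - ax 1) {1, 3}" using 3 by (intro sub) (auto simp: ax)
      then show ?thesis using that[of "v0 - ax 1" 1 3] 2 by simp
    qed
  next
    case 3
    have "of_bool (1 \<in> J) + of_bool (2 \<in> J) + of_bool (3 \<in> J) \<le> (0::int)" using rng(2) ct 3 by linarith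
    then have n: "1 \<notin> J" "2 \<notin> J" "3 \<notin> J"
      by (cases "1 \<in> J"; cases "2 \<in> J"; cases "3 \<in> J"; simp)+
    have "J \<subseteq> {}" by (rule Jsub) (use n in auto)
    then have "c \<subseteq> unit_cell (v0 - ax 1 - ax 2) {1, 2}" by (intro sub) (auto simp: ax)
    then show ?thesis using that[of "v0 - ax 1 - ax 2" 1 2] 3 by simp
  qed
qed

lemma ii_parity: assumes "even (a - b)" shows "\<exists>\<sigma>. (\<sigma> = 1 \<or> \<sigma> = (-1::real)) \<and> ii a = of_real \<sigma> * ii b"
proof -
  obtain n where n: "a = b + 2 * n" using assms by (metis diff_add_cancel add.commute evenE)
  have "ii (2 * n) = cis (pi * of_int n)" by (simp add: ii_def)
  also have "\<dots> = 1 \<or> \<dots> = -1"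
  proof (cases "even n")
    case True
    then obtain j where "n = 2 * j" by blast
    then have "pi * real_of_int n = 2 * pi * of_int j" by simp
    then show ?thesis by (simp only: cis_multiple_2pi Ints_of_int) simp
  next
    case False
    then obtain j where "n = 2 * j + 1" by (metis oddE)
    then have "pi * real_of_int n = 2 * pi * of_int j + pi" by (simp add: algebra_simps)
    then have "cis (pi * real_of_int n) = cis (2 * pi * of_int j) * cis pi" by (simp only: cis_mult)
    then show ?thesis by (simp only: cis_multiple_2pi Ints_of_int) simp
  qed
  finally have "ii (2 * n) = 1 \<or> ii (2 * n) = -1" .
  then show ?thesis unfolding n ii_add by (auto intro: exI[of _ 1] exI[of _ "-1"])
qed

definition seqY :: "real => (nat => real) => nat => complex" where
  "seqY \<tau> E m = Complex (E m) (\<tau> * E (m+1))"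

text \<open>Up to a fixed complex factor, the fibre of layers \<open>m\<close>, \<open>m+1\<close>,
  \<open>m+2\<close> over the second coordinate \<open>x + y * om 1\<close>. Sides 0 and 2 come from
  squares in directions 1 and 2, side 1 from directions 1 and 3, side 3 from directions 2 and 3. The
  opposite sides come from vertices turned by a half-turn in the first coordinate.\<close>

definition oct :: "real => (nat => real) => nat => real => real => nat => complex" where
  "oct \<tau> E m x y n =
     (if n = 0 then x *\<^sub>R seqY \<tau> E (m+2) + y *\<^sub>R seqY \<tau> E (m+1)
      else if n = 1 then x *\<^sub>R seqY \<tau> E m + y *\<^sub>R seqY \<tau> E (m+1)
      else if n = 2 then \<i> * (x *\<^sub>R seqY \<tau> E (m+1) + y *\<^sub>R seqY \<tau> E (m+2))
      else \<i> * (x *\<^sub>R seqY \<tau> E (m+1) + y *\<^sub>R seqY \<tau> E m))"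

text \<open>The fixed direction of all differences \<open>\<i> * Y (m+1) - Y m\<close> for
  \<open>Y = seqY \<tau> E\<close>; it is the constant \<open>cc\<close> in the proof of
  \<open>normal_sequence\<close>.\<close>

definition seqc :: "real => complex" where "seqc \<tau> = Complex (- 2 * (1+\<tau>)) (1 - \<tau>)"

lemma seqY_step: assumes "seq_ok \<tau> E"
  shows "\<i> * seqY \<tau> E (m+1) = seqY \<tau> E m + E (m+1) *\<^sub>R seqc \<tau>"
  using seq_rec[OF assms, of m] by (simp add: seqY_def seqc_def complex_eq_iff algebra_simps)

lemma seqY_rec: assumes "seq_ok \<tau> E"
  shows "seqY \<tau> E m + \<tau> *\<^sub>R seqY \<tau> E (m+2) = (2 * (1+\<tau>)) *\<^sub>R seqY \<tau> E (m+1)"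
proof -
  have "\<tau> * E (m+3) = 2 * (1+\<tau>) * E (m+2) - E (m+1)"
    using seq_rec[OF assms, of "m+1"] by (simp add: numeral_3_eq_3)
  then have "\<tau> * (\<tau> * E (m+3)) = \<tau> * (2 * (1+\<tau>) * E (m+2) - E (m+1))" by simp
  then show ?thesis using seq_rec[OF assms, of m]
    by (simp add: seqY_def complex_eq_iff numeral_3_eq_3 algebra_simps)
qed

text \<open>Cross products among the \<open>seqY\<close> are positive multiples of Casoratians.
  Those with one factor \<open>\<i>\<close> are inner products of vectors in the open first
  quadrant, which uses positivity of all of \<open>E m\<close> to \<open>E (m+3)\<close>.\<close>

lemma oct_fan:
  assumes ok: "seq_ok \<tau> E" and W: "0 < cas E 0"
    and E: "0 < E m" "0 < E (m+1)" "0 < E (m+2)" "0 < E (m+3)" and xy: "0 < x" "0 \<le> y"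
  shows "fan_ok (oct \<tau> E m x y)"
proof -
  have \<tau>: "0 < \<tau>" using seq_pos[OF ok] .
  let ?a0 = "seqY \<tau> E m" and ?a1 = "seqY \<tau> E (m+1)" and ?a2 = "seqY \<tau> E (m+2)"
  have c10: "0 < cr ?a1 ?a0"
  proof -
    have "cr ?a1 ?a0 = \<tau> * cas E m" by (simp add: cr_def seqY_def cas_def power2_eq_square algebra_simps)
    then show ?thesis using \<tau> cas_pos[OF ok W] by simp
  qed
  have c21: "0 < cr ?a2 ?a1"
  proof -
    have "cr ?a2 ?a1 = \<tau> * cas E (m+1)" by (simp add: cr_def seqY_def cas_def power2_eq_square algebra_simps)
    then show ?thesis using \<tau> cas_pos[OF ok W] by simp
  qed
  have c20: "0 < cr ?a2 ?a0"
  proof -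
    have "?a0 = (2 * (1+\<tau>)) *\<^sub>R ?a1 - \<tau> *\<^sub>R ?a2" using seqY_rec[OF ok, of m] by (simp add: algebra_simps)
    then have "cr ?a2 ?a0 = 2 * (1+\<tau>) * cr ?a2 ?a1" by (simp only: cr_simps)
    then show ?thesis using c21 \<tau> by simp
  qed
  have pos: "0 < Re (x *\<^sub>R seqY \<tau> E p + y *\<^sub>R seqY \<tau> E q)" "0 < Im (x *\<^sub>R seqY \<tau> E p + y *\<^sub>R seqY \<tau> E q)"
    if "p \<in> {m, m+1, m+2}" "q \<in> {m, m+1, m+2}" for p q
  proof -
    have "0 < E p" "0 < E q" "0 < E (p+1)" "0 < E (q+1)" using that E by (auto simp: numeral_3_eq_3 numeral_2_eq_2)
    then show "0 < Re (x *\<^sub>R seqY \<tau> E p + y *\<^sub>R seqY \<tau> E q)" "0 < Im (x *\<^sub>R seqY \<tau> E p + y *\<^sub>R seqY \<tau> E q)"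
      using xy \<tau> by (auto simp: seqY_def intro!: add_pos_nonneg)
  qed
  have cri: "cr u (\<i> * v) = Re u * Re v + Im u * Im v" for u v by (simp add: cr_def)
  have o: "oct \<tau> E m x y 0 = x *\<^sub>R ?a2 + y *\<^sub>R ?a1" "oct \<tau> E m x y 1 = x *\<^sub>R ?a0 + y *\<^sub>R ?a1"
    "oct \<tau> E m x y 2 = \<i> * (x *\<^sub>R ?a1 + y *\<^sub>R ?a2)" "oct \<tau> E m x y 3 = \<i> * (x *\<^sub>R ?a1 + y *\<^sub>R ?a0)"
    by (simp_all add: oct_def)
  have 1: "0 < cr (x *\<^sub>R ?a2 + y *\<^sub>R ?a1) (x *\<^sub>R ?a0 + y *\<^sub>R ?a1)"
  proof -
    have "cr (x *\<^sub>R ?a2 + y *\<^sub>R ?a1) (x *\<^sub>R ?a0 + y *\<^sub>R ?a1) = x * x * cr ?a2 ?a0 + x * y * (cr ?a2 ?a1 + cr ?a1 ?a0)"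
      by (simp add: cr_simps algebra_simps)
    then show ?thesis using c10 c21 c20 xy by (simp add: add_pos_nonneg)
  qed
  have 2: "0 < cr (\<i> * (x *\<^sub>R ?a1 + y *\<^sub>R ?a2)) (\<i> * (x *\<^sub>R ?a1 + y *\<^sub>R ?a0)) \<or> \<i> * (x *\<^sub>R ?a1 + y *\<^sub>R ?a2) = \<i> * (x *\<^sub>R ?a1 + y *\<^sub>R ?a0)"
  proof (cases "y = 0")
    case False
    have ii: "cr (\<i> * u) (\<i> * v) = cr u v" for u v by (simp add: cr_def)
    have "cr (x *\<^sub>R ?a1 + y *\<^sub>R ?a2) (x *\<^sub>R ?a1 + y *\<^sub>R ?a0) = y * y * cr ?a2 ?a0 + x * y * (cr ?a2 ?a1 + cr ?a1 ?a0)"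
      by (simp add: cr_simps algebra_simps)
    moreover have "0 < y" using False xy by simp
    ultimately show ?thesis unfolding ii using c10 c21 c20 xy by (simp add: add_pos_nonneg)
  qed simp
  have q: "0 < cr u (\<i> * v)" if "0 < Re u" "0 < Im u" "0 < Re v" "0 < Im v" for u v
    unfolding cri using that by (simp add: add_pos_pos)
  have "0 < cr (x *\<^sub>R ?a2 + y *\<^sub>R ?a1) (\<i> * (x *\<^sub>R ?a1 + y *\<^sub>R ?a2))" "0 < cr (x *\<^sub>R ?a2 + y *\<^sub>R ?a1) (\<i> * (x *\<^sub>R ?a1 + y *\<^sub>R ?a0))"
    "0 < cr (x *\<^sub>R ?a0 + y *\<^sub>R ?a1) (\<i> * (x *\<^sub>R ?a1 + y *\<^sub>R ?a2))" "0 < cr (x *\<^sub>R ?a0 + y *\<^sub>R ?a1) (\<i> * (x *\<^sub>R ?a1 + y *\<^sub>R ?a0))"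
    by (rule q; rule pos; simp)+
  then show ?thesis unfolding fan_ok_def o using 1 2 by blast
qed

lemma gv_square:
  assumes "csum v = int m"
  shows "gv Z e \<eta> v = mk (ii (v$3) * Z m) (\<eta> *\<^sub>R om (v$1 - v$2)) (e m)"
    "gv Z e \<eta> (v + ax 1) = mk (ii (v$3) * Z (m+1)) (\<eta> *\<^sub>R (om (v$1 - v$2) * om 1)) (e (m+1))"
    "gv Z e \<eta> (v + ax 2) = mk (ii (v$3) * Z (m+1)) (\<eta> *\<^sub>R (om (v$1 - v$2) * om (-1))) (e (m+1))"
    "gv Z e \<eta> (v + ax 3) = mk (ii (v$3) * (\<i> * Z (m+1))) (\<eta> *\<^sub>R om (v$1 - v$2)) (e (m+1))"
    "gv Z e \<eta> (v + ax 1 + ax 2) = mk (ii (v$3) * Z (m+2)) (\<eta> *\<^sub>R om (v$1 - v$2)) (e (m+2))"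
    "gv Z e \<eta> (v + ax 1 + ax 3) = mk (ii (v$3) * (\<i> * Z (m+2))) (\<eta> *\<^sub>R (om (v$1 - v$2) * om 1)) (e (m+2))"
    "gv Z e \<eta> (v + ax 2 + ax 3) = mk (ii (v$3) * (\<i> * Z (m+2))) (\<eta> *\<^sub>R (om (v$1 - v$2) * om (-1))) (e (m+2))"
proof -
  have a3: "ax 1 $ 1 = 1" "ax 1 $ 2 = 0" "ax 1 $ 3 = 0" "ax 2 $ 1 = 0" "ax 2 $ 2 = 1" "ax 2 $ 3 = 0"
    "ax 3 $ 1 = 0" "ax 3 $ 2 = 0" "ax 3 $ 3 = 1"
    by (auto simp: axis_def)
  have i1: "ii (n + 1) = ii n * \<i>" for n by (simp add: ii_add)
  have o: "v$1 + 1 - v$2 = (v$1 - v$2) + 1" "v$1 - (v$2 + 1) = (v$1 - v$2) + (-1)" by auto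
  show "gv Z e \<eta> v = mk (ii (v$3) * Z m) (\<eta> *\<^sub>R om (v$1 - v$2)) (e m)"
    "gv Z e \<eta> (v + ax 1) = mk (ii (v$3) * Z (m+1)) (\<eta> *\<^sub>R (om (v$1 - v$2) * om 1)) (e (m+1))"
    "gv Z e \<eta> (v + ax 2) = mk (ii (v$3) * Z (m+1)) (\<eta> *\<^sub>R (om (v$1 - v$2) * om (-1))) (e (m+1))"
    "gv Z e \<eta> (v + ax 3) = mk (ii (v$3) * (\<i> * Z (m+1))) (\<eta> *\<^sub>R om (v$1 - v$2)) (e (m+1))"
    "gv Z e \<eta> (v + ax 1 + ax 2) = mk (ii (v$3) * Z (m+2)) (\<eta> *\<^sub>R om (v$1 - v$2)) (e (m+2))"
    "gv Z e \<eta> (v + ax 1 + ax 3) = mk (ii (v$3) * (\<i> * Z (m+2))) (\<eta> *\<^sub>R (om (v$1 - v$2) * om 1)) (e (m+2))"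
    "gv Z e \<eta> (v + ax 2 + ax 3) = mk (ii (v$3) * (\<i> * Z (m+2))) (\<eta> *\<^sub>R (om (v$1 - v$2) * om (-1))) (e (m+2))"
    by (simp_all only: gv_def vector_add_component a3 csum_add csum_ax assms add_0_right o om_add[of _ 1] om_add[of _ "-1"] i1 nat_int
        mult.assoc diff_zero) (simp_all add: nat_add_distrib)
qed

text \<open>A point over the wedge \<^term>\<open>w = \<eta> *\<^sub>R (om j * (of_real x + of_real y * om 1))\<close> of the second
  coordinate has its first coordinate on an octagon, which is star-shaped around the origin.\<close>

definition on_band :: "complex => real => (nat => real) => real => nat => complex => complex => bool" where
  "on_band A \<tau> E \<eta> m z w \<longleftrightarrow> (\<exists>j \<sigma> x y n r. (\<sigma> = 1 \<or> \<sigma> = (-1::real)) \<and> 0 < x \<and> 0 \<le> y \<and> n \<le> 3 \<and> 0 \<le> r \<and> r \<le> 1 \<and>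
     w = \<eta> *\<^sub>R (om j * (of_real x + of_real y * om 1)) \<and>
     z = A * ii (j + int m) * (\<sigma> *\<^sub>R fan_seg (oct \<tau> E m x y) n r))"

lemma fan_seg_oct:
  "fan_seg (oct \<tau> E m x y) 0 r = x *\<^sub>R (r *\<^sub>R seqY \<tau> E m + (1 - r) *\<^sub>R seqY \<tau> E (m+2)) + y *\<^sub>R seqY \<tau> E (m+1)"
  "fan_seg (oct \<tau> E m x y) 1 r = (1 - r) *\<^sub>R (x *\<^sub>R seqY \<tau> E m + y *\<^sub>R seqY \<tau> E (m+1))
     + r *\<^sub>R (\<i> * (x *\<^sub>R seqY \<tau> E (m+1) + y *\<^sub>R seqY \<tau> E (m+2)))"
  "fan_seg (oct \<tau> E m x y) 2 r = \<i> * (x *\<^sub>R seqY \<tau> E (m+1) + y *\<^sub>R (r *\<^sub>R seqY \<tau> E m + (1 - r) *\<^sub>R seqY \<tau> E (m+2)))"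
  "fan_seg (oct \<tau> E m x y) 3 r = \<i> * ((1 - r) *\<^sub>R (x *\<^sub>R seqY \<tau> E (m+1) + y *\<^sub>R seqY \<tau> E m)
     + r *\<^sub>R (\<i> * (x *\<^sub>R seqY \<tau> E (m+2) + y *\<^sub>R seqY \<tau> E (m+1))))"
  by (simp_all add: fan_seg_def oct_def algebra_simps numeral_2_eq_2 numeral_3_eq_3)

lemma om_pm: "om 1 * om (-1) = 1" "om 1 + om (-1) = 1"
  by (simp_all add: om_add[symmetric]) (simp add: om_1 om_m1 complex_eq_iff)

lemma band_point:
  assumes ok: "seq_ok \<tau> E" and E: "0 < E (m+1)" "0 < E (m+2)"
    and c: "c \<in> layers3 k (Suc m)" and p: "p \<in> pcone (gv Z e \<eta>) c" "p \<noteq> 0"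
    and Z: "Z m = A * seqY \<tau> E m" "Z (m+1) = A * seqY \<tau> E (m+1)" "Z (m+2) = A * seqY \<tau> E (m+2)"
    and fin: "wc p \<noteq> 0"
  shows "on_band A \<tau> E \<eta> m (zc p) (wc p)"
proof -
  have \<tau>: "0 < \<tau>" using seq_pos[OF ok] .
  let ?a0 = "seqY \<tau> E m" and ?a1 = "seqY \<tau> E (m+1)" and ?a2 = "seqY \<tau> E (m+2)" and ?g = "seqc \<tau>"
  have s1: "\<i> * ?a1 = ?a0 + E (m+1) *\<^sub>R ?g" and s2: "\<i> * ?a2 = ?a1 + E (m+2) *\<^sub>R ?g"
    using seqY_step[OF ok, of m] seqY_step[OF ok, of "m+1"] by simp_all
  obtain v i j where v: "csum v = int m" and ij: "i \<noteq> j" "c \<subseteq> unit_cell v {i, j}" "(i, j) \<in> {(1, 2), (1, 3), (2, 3)}"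
    using layers3_sub_square[OF c] .
  have "p \<in> pcone (gv Z e \<eta>) (unit_cell v {i, j})"
    using pcone_mono[OF cell_finite[OF is_cell_unit] ij(2)] p(1) by blast
  then obtain \<alpha> \<beta> \<gamma> \<delta> where co: "0 \<le> \<alpha>" "0 \<le> \<beta>" "0 \<le> \<gamma>" "0 \<le> \<delta>" and p':
    "p = \<alpha> *\<^sub>R gv Z e \<eta> v + \<beta> *\<^sub>R gv Z e \<eta> (v + ax i) + \<gamma> *\<^sub>R gv Z e \<eta> (v + ax j) + \<delta> *\<^sub>R gv Z e \<eta> (v + ax i + ax j)"
    unfolding pcone_square[OF ij(1)] by blast
  define l where "l = v$1 - v$2"
  have "even (v$3 - (l + int m))" using v unfolding l_def csum_def by presburger
  then obtain \<sigma> where \<sigma>: "\<sigma> = 1 \<or> \<sigma> = (-1::real)" "ii (v$3) = of_real \<sigma> * ii (l + int m)" using ii_parity by blast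
  have up: "ii (l + int m) = - (\<i> * ii (l + 1 + int m))" and dn: "ii (l + int m) = \<i> * ii (l - 1 + int m)"
  proof -
    have "ii (l + 1 + int m) = ii (l + int m) * ii 1" by (simp only: ii_add[symmetric]) (simp add: algebra_simps)
    then show "ii (l + int m) = - (\<i> * ii (l + 1 + int m))" by (simp add: mult.commute)
    have "ii (l + int m) = ii (l - 1 + int m) * ii 1" by (simp only: ii_add[symmetric]) (simp add: algebra_simps)
    then show "ii (l + int m) = \<i> * ii (l - 1 + int m)" by (simp add: mult.commute)
  qed
  have odn: "om l = om (l - 1) * om 1" by (simp flip: om_add)
  have oup: "om (l + 1) = om l * om 1" by (simp add: om_add)
  note G = gv_square[OF v, of Z e \<eta>, folded l_def]
  have I: "on_band A \<tau> E \<eta> m (zc p) (wc p)"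
    if "s = 1 \<or> s = (-1::real)" "0 < x" "0 \<le> y" "n \<le> 3" "0 \<le> r" "r \<le> 1"
      "wc p = \<eta> *\<^sub>R (om j' * (of_real x + of_real y * om 1))"
      "zc p = A * ii (j' + int m) * (s *\<^sub>R fan_seg (oct \<tau> E m x y) n r)" for s x y n r j'
    unfolding on_band_def using that by blast
  consider "(i, j) = (1, 2)" | "(i, j) = (1, 3)" | "(i, j) = (2, 3)" using ij(3) by blast
  then show ?thesis
  proof cases
    case 1
    then have ij': "i = 1" "j = 2" by auto
    \<comment> \<open>Planarity trades equal weights at the two middle vertices for weights at the
      lowest and the highest one. Afterwards one middle weight is 0: the square is cut into two
      triangles along its diagonal.\<close>
    define \<mu> where "\<mu> = min \<beta> \<gamma>"
    define \<alpha>' where "\<alpha>' = \<alpha> + \<mu> / (1+\<tau>)"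
    define \<delta>' where "\<delta>' = \<delta> + \<mu> * \<tau> / (1+\<tau>)"
    define \<beta>' where "\<beta>' = \<beta> - \<mu>"
    define \<gamma>' where "\<gamma>' = \<gamma> - \<mu>"
    have co': "0 \<le> \<alpha>'" "0 \<le> \<delta>'" "0 \<le> \<beta>'" "0 \<le> \<gamma>'" "\<beta>' = 0 \<or> \<gamma>' = 0"
      using co \<tau> by (auto simp: \<alpha>'_def \<delta>'_def \<beta>'_def \<gamma>'_def \<mu>_def min_def)
    have z: "zc p = A * ii (l + int m) * (\<sigma> *\<^sub>R (\<alpha>' *\<^sub>R ?a0 + (\<beta>' + \<gamma>') *\<^sub>R ?a1 + \<delta>' *\<^sub>R ?a2))"
    proof -
      have "zc p = A * ii (l + int m) * (\<sigma> *\<^sub>R (\<alpha> *\<^sub>R ?a0 + (\<beta> + \<gamma>) *\<^sub>R ?a1 + \<delta> *\<^sub>R ?a2))"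
        unfolding p' ij' G Z \<sigma>(2) zc_simps mk_simps by (simp add: scaleR_conv_of_real algebra_simps)
      also have "\<alpha> *\<^sub>R ?a0 + (\<beta> + \<gamma>) *\<^sub>R ?a1 + \<delta> *\<^sub>R ?a2 = \<alpha>' *\<^sub>R ?a0 + (\<beta>' + \<gamma>') *\<^sub>R ?a1 + \<delta>' *\<^sub>R ?a2"
      proof -
        have "a / d * (2 * d) = 2 * a" if "d \<noteq> 0" for a d :: real using that by simp
        from this[of "1+\<tau>" \<mu>] have "(2 * \<mu>) *\<^sub>R ?a1 = (\<mu> / (1+\<tau>)) *\<^sub>R ((2 * (1+\<tau>)) *\<^sub>R ?a1)"
          using \<tau> by (simp only: scaleR_scaleR)
        also have "\<dots> = (\<mu> / (1+\<tau>)) *\<^sub>R ?a0 + (\<mu> * \<tau> / (1+\<tau>)) *\<^sub>R ?a2"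
          unfolding seqY_rec[OF ok, symmetric] by (simp add: scaleR_right_distrib)
        finally show ?thesis by (simp add: \<alpha>'_def \<delta>'_def \<beta>'_def \<gamma>'_def algebra_simps)
      qed
      finally show ?thesis .
    qed
    have w: "wc p = \<eta> *\<^sub>R (om l * (of_real (\<alpha>' + \<delta>') + of_real \<beta>' * om 1 + of_real \<gamma>' * om (-1)))"
    proof -
      have "wc p = \<eta> *\<^sub>R (om l * (of_real (\<alpha> + \<delta>) + of_real \<beta> * om 1 + of_real \<gamma> * om (-1)))"
        unfolding p' ij' G wc_simps mk_simps by (simp add: scaleR_conv_of_real algebra_simps)
      also have "of_real (\<alpha> + \<delta>) + of_real \<beta> * om 1 + of_real \<gamma> * om (-1) =
          of_real (\<alpha>' + \<delta>') + of_real \<beta>' * om 1 + of_real \<gamma>' * om (-1)"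
      proof -
        have "\<mu> / (1+\<tau>) + \<mu> * \<tau> / (1+\<tau>) = (\<mu> * (1+\<tau>)) / (1+\<tau>)" by (simp add: add_divide_distrib distrib_left)
        also have "\<dots> = \<mu>" by (rule nonzero_mult_div_cancel_right) (use \<tau> in simp)
        finally have "\<mu> / (1+\<tau>) + \<mu> * \<tau> / (1+\<tau>) = \<mu>" .
        then have "\<alpha>' + \<delta>' = \<alpha> + \<delta> + \<mu>" by (simp add: \<alpha>'_def \<delta>'_def)
        moreover have "of_real \<mu> = of_real \<mu> * om 1 + of_real \<mu> * om (-1)"
          using om_pm(2) by (metis distrib_left mult.right_neutral)
        ultimately show ?thesis by (simp add: \<beta>'_def \<gamma>'_def algebra_simps)
      qed
      finally show ?thesis .
    qed
    consider "\<gamma>' = 0" "0 < \<alpha>' + \<delta>'" | "\<gamma>' = 0" "\<alpha>' = 0" "\<delta>' = 0" "0 < \<beta>'" | "\<beta>' = 0" "0 < \<gamma>'"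
    proof -
      have "\<alpha>' = 0 \<and> \<beta>' = 0 \<and> \<gamma>' = 0 \<and> \<delta>' = 0 ==> False" using w fin by simp
      then show ?thesis using that co' by (smt (verit))
    qed
    then show ?thesis
    proof cases
      case 1
      define x where "x = \<alpha>' + \<delta>'"
      have "zc p = A * ii (l + int m) * (\<sigma> *\<^sub>R fan_seg (oct \<tau> E m x \<beta>') 0 (\<alpha>' / x))"
      proof -
        have "x * (\<alpha>' / x) = \<alpha>'" "x * (1 - \<alpha>' / x) = \<delta>'" using 1 by (simp_all add: x_def field_simps)
        then have "fan_seg (oct \<tau> E m x \<beta>') 0 (\<alpha>' / x) = \<alpha>' *\<^sub>R ?a0 + \<delta>' *\<^sub>R ?a2 + \<beta>' *\<^sub>R ?a1"
          unfolding fan_seg_oct scaleR_right_distrib scaleR_scaleR by simp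
        then show ?thesis unfolding z using 1 by (simp add: add_ac)
      qed
      moreover have "\<alpha>' / x \<le> 1" "0 \<le> \<alpha>' / x" using 1 co' by (simp_all add: x_def)
      ultimately show ?thesis using I[of \<sigma> x \<beta>' 0 "\<alpha>' / x" l] 1 co' \<sigma>(1) w by (simp add: x_def)
    next
      case 2
      have "zc p = A * ii (l + 1 + int m) * ((- \<sigma>) *\<^sub>R fan_seg (oct \<tau> E m \<beta>' 0) 2 0)"
        unfolding z up fan_seg_oct using 2 by (simp add: algebra_simps)
      moreover have "wc p = \<eta> *\<^sub>R (om (l + 1) * (of_real \<beta>' + of_real 0 * om 1))"
        unfolding w oup using 2 by (simp add: algebra_simps)
      ultimately show ?thesis using I[of "- \<sigma>" \<beta>' 0 2 0 "l + 1"] 2 \<sigma>(1) by auto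
    next
      case 3
      define y where "y = \<alpha>' + \<delta>'"
      \<comment> \<open>For \<open>y = 0\<close> side 2 is a single point, and any position in the
        unit interval serves.\<close>
      define r where "r = (if y = 0 then 0 else \<alpha>' / y)"
      have yr1: "y * r = \<alpha>'" using co' by (auto simp: r_def y_def)
      then have "y * (1 - r) = \<delta>'" by (simp add: right_diff_distrib) (simp add: y_def)
      moreover have "0 \<le> r" "r \<le> 1" "0 \<le> y" using co' by (auto simp: y_def r_def divide_le_eq)
      ultimately have yr: "y * r = \<alpha>'" "y * (1 - r) = \<delta>'" "0 \<le> r" "r \<le> 1" "0 \<le> y" using yr1 by auto
      have "zc p = A * ii (l - 1 + int m) * (\<sigma> *\<^sub>R fan_seg (oct \<tau> E m \<gamma>' y) 2 r)"
      proof -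
        have "fan_seg (oct \<tau> E m \<gamma>' y) 2 r = \<i> * (\<gamma>' *\<^sub>R ?a1 + (\<alpha>' *\<^sub>R ?a0 + \<delta>' *\<^sub>R ?a2))"
          unfolding fan_seg_oct scaleR_right_distrib scaleR_scaleR yr ..
        then show ?thesis unfolding z dn using 3 by (simp add: algebra_simps)
      qed
      moreover have "wc p = \<eta> *\<^sub>R (om (l - 1) * (of_real \<gamma>' + of_real y * om 1))"
      proof -
        have "om l * om (-1) = om (l - 1)" by (simp flip: om_add)
        then have "om l * (of_real (\<alpha>' + \<delta>') + of_real \<beta>' * om 1 + of_real \<gamma>' * om (-1)) = of_real y * om l + of_real \<gamma>' * om (l - 1)"
          using 3 by (simp add: y_def algebra_simps)
        then show ?thesis unfolding w odn by (simp add: algebra_simps)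
      qed
      ultimately show ?thesis using I[of \<sigma> \<gamma>' y 2 r "l - 1"] 3 \<sigma>(1) yr by simp
    qed
  next
    case 2
    then have ij': "i = 1" "j = 3" by auto
    define x where "x = \<alpha> + \<gamma>"
    define y where "y = \<beta> + \<delta>"
    have z: "zc p = A * ii (l + int m) * (\<sigma> *\<^sub>R (\<alpha> *\<^sub>R ?a0 + \<beta> *\<^sub>R ?a1 + \<gamma> *\<^sub>R (\<i> * ?a1) + \<delta> *\<^sub>R (\<i> * ?a2)))"
      unfolding p' ij' G Z \<sigma>(2) zc_simps mk_simps by (simp add: scaleR_conv_of_real algebra_simps)
    have w: "wc p = \<eta> *\<^sub>R (om l * (of_real x + of_real y * om 1))"
      unfolding p' ij' G x_def y_def wc_simps mk_simps by (simp add: scaleR_conv_of_real algebra_simps)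
    show ?thesis
    proof (cases "0 < x")
      case True
      \<comment> \<open>By \<open>seqY_step\<close> the fibre inside this square is a segment in the
        direction \<open>seqc \<tau>\<close>. \<open>D\<close> is its length in that unit and
        \<open>r\<close> the relative position of the point.\<close>
      define D where "D = x * E (m+1) + y * E (m+2)"
      define r where "r = (\<gamma> * E (m+1) + \<delta> * E (m+2)) / D"
      have D: "0 < D" using True co E by (simp add: D_def y_def add_pos_nonneg)
      have N: "0 \<le> \<gamma> * E (m+1) + \<delta> * E (m+2)" "\<gamma> * E (m+1) + \<delta> * E (m+2) \<le> D"
        using co E by (simp_all add: D_def x_def y_def algebra_simps)
      then have r: "0 \<le> r" "r \<le> 1" "r * D = \<gamma> * E (m+1) + \<delta> * E (m+2)"
        using D by (simp_all add: r_def divide_le_eq)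
      have "fan_seg (oct \<tau> E m x y) 1 r = x *\<^sub>R ?a0 + y *\<^sub>R ?a1 + (r * D) *\<^sub>R ?g"
      proof -
        have "\<i> * (x *\<^sub>R ?a1 + y *\<^sub>R ?a2) = x *\<^sub>R (\<i> * ?a1) + y *\<^sub>R (\<i> * ?a2)" by (simp add: algebra_simps)
        also have "\<dots> = (x *\<^sub>R ?a0 + y *\<^sub>R ?a1) + D *\<^sub>R ?g" unfolding s1 s2 D_def by (simp add: algebra_simps)
        finally show ?thesis unfolding fan_seg_oct by (simp add: algebra_simps)
      qed
      also have "\<dots> = \<alpha> *\<^sub>R ?a0 + \<beta> *\<^sub>R ?a1 + \<gamma> *\<^sub>R (\<i> * ?a1) + \<delta> *\<^sub>R (\<i> * ?a2)"
        unfolding r(3) s1 s2 x_def y_def by (simp add: algebra_simps)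
      finally show ?thesis using I[of \<sigma> x y 1 r l] True co \<sigma>(1) r(1,2) w z by (simp add: y_def)
    next
      \<comment> \<open>The second coordinate lies on the far edge of the wedge. This edge belongs
        to the next wedge, where the weight \<open>y\<close> takes the place of
        \<open>x\<close>.\<close>
      case False
      then have x0: "\<alpha> = 0" "\<gamma> = 0" "x = 0" using co by (auto simp: x_def)
      have "y \<noteq> 0" using w fin x0 by auto
      then have y: "0 < y" using co by (simp add: y_def)
      define r where "r = \<delta> / y"
      have yr: "r * y = \<delta>" "(1 - r) * y = \<beta>" using y by (simp_all add: r_def left_diff_distrib) (simp add: y_def)
      have fs: "fan_seg (oct \<tau> E m y 0) 3 r = \<i> * (\<beta> *\<^sub>R ?a1 + \<delta> *\<^sub>R (\<i> * ?a2))"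
        unfolding fan_seg_oct by (simp add: yr)
      have "zc p = A * ii (l + 1 + int m) * ((- \<sigma>) *\<^sub>R fan_seg (oct \<tau> E m y 0) 3 r)"
        unfolding z up fs using x0 by (simp add: algebra_simps)
      moreover have "wc p = \<eta> *\<^sub>R (om (l + 1) * (of_real y + of_real 0 * om 1))"
        unfolding w oup using x0 by (simp add: algebra_simps)
      moreover have "0 \<le> r" "r \<le> 1" using y co by (simp_all add: r_def) (simp add: y_def)
      ultimately show ?thesis using I[of "- \<sigma>" y 0 3 r "l + 1"] y \<sigma>(1) by auto
    qed
  next
    case 3
    then have ij': "i = 2" "j = 3" by auto
    define x where "x = \<beta> + \<delta>"
    define y where "y = \<alpha> + \<gamma>"
    have z: "zc p = A * ii (l + int m) * (\<sigma> *\<^sub>R (\<alpha> *\<^sub>R ?a0 + \<beta> *\<^sub>R ?a1 + \<gamma> *\<^sub>R (\<i> * ?a1) + \<delta> *\<^sub>R (\<i> * ?a2)))"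
      unfolding p' ij' G Z \<sigma>(2) zc_simps mk_simps by (simp add: scaleR_conv_of_real algebra_simps)
    have w: "wc p = \<eta> *\<^sub>R (om (l - 1) * (of_real x + of_real y * om 1))"
    proof -
      have o1: "om l * om (-1) = om (l - 1)" by (simp flip: om_add)
      have "wc p = \<eta> *\<^sub>R (of_real x * (om l * om (-1)) + of_real y * om l)"
        unfolding p' ij' G x_def y_def wc_simps mk_simps by (simp add: scaleR_conv_of_real algebra_simps)
      then show ?thesis unfolding o1 unfolding odn by (simp add: algebra_simps)
    qed
    show ?thesis
    proof (cases "0 < x")
      case True
      define D where "D = x * E (m+2) + y * E (m+1)"
      define r where "r = (\<gamma> * E (m+1) + \<delta> * E (m+2)) / D"
      have D: "0 < D" using True co E by (simp add: D_def y_def add_pos_nonneg)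
      have N: "0 \<le> \<gamma> * E (m+1) + \<delta> * E (m+2)" "\<gamma> * E (m+1) + \<delta> * E (m+2) \<le> D"
        using co E by (simp_all add: D_def x_def y_def algebra_simps)
      then have r: "0 \<le> r" "r \<le> 1" "r * D = \<gamma> * E (m+1) + \<delta> * E (m+2)"
        using D by (simp_all add: r_def divide_le_eq)
      have "fan_seg (oct \<tau> E m x y) 3 r = \<i> * (x *\<^sub>R ?a1 + y *\<^sub>R ?a0 + (r * D) *\<^sub>R ?g)"
      proof -
        have "\<i> * (x *\<^sub>R ?a2 + y *\<^sub>R ?a1) = x *\<^sub>R (\<i> * ?a2) + y *\<^sub>R (\<i> * ?a1)" by (simp add: algebra_simps)
        also have "\<dots> = (x *\<^sub>R ?a1 + y *\<^sub>R ?a0) + D *\<^sub>R ?g" unfolding s1 s2 D_def by (simp add: algebra_simps)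
        finally show ?thesis unfolding fan_seg_oct by (simp add: algebra_simps)
      qed
      also have "x *\<^sub>R ?a1 + y *\<^sub>R ?a0 + (r * D) *\<^sub>R ?g = \<alpha> *\<^sub>R ?a0 + \<beta> *\<^sub>R ?a1 + \<gamma> *\<^sub>R (\<i> * ?a1) + \<delta> *\<^sub>R (\<i> * ?a2)"
        unfolding r(3) s1 s2 x_def y_def by (simp add: algebra_simps)
      finally have fs: "fan_seg (oct \<tau> E m x y) 3 r = \<i> * (\<alpha> *\<^sub>R ?a0 + \<beta> *\<^sub>R ?a1 + \<gamma> *\<^sub>R (\<i> * ?a1) + \<delta> *\<^sub>R (\<i> * ?a2))" .
      have "zc p = A * ii (l - 1 + int m) * (\<sigma> *\<^sub>R fan_seg (oct \<tau> E m x y) 3 r)"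
        unfolding z dn fs by (simp add: algebra_simps)
      then show ?thesis using I[of \<sigma> x y 3 r "l - 1"] True co \<sigma>(1) r(1,2) w by (simp add: y_def)
    next
      case False
      then have x0: "\<beta> = 0" "\<delta> = 0" "x = 0" using co by (auto simp: x_def)
      have "y \<noteq> 0" using w fin x0 by auto
      then have y: "0 < y" using co by (simp add: y_def)
      define r where "r = \<gamma> / y"
      have yr: "r * y = \<gamma>" "(1 - r) * y = \<alpha>" using y by (simp_all add: r_def left_diff_distrib) (simp add: y_def)
      have "fan_seg (oct \<tau> E m y 0) 1 r = \<alpha> *\<^sub>R ?a0 + \<gamma> *\<^sub>R (\<i> * ?a1)"
        unfolding fan_seg_oct by (simp add: yr)
      then have "zc p = A * ii (l + int m) * (\<sigma> *\<^sub>R fan_seg (oct \<tau> E m y 0) 1 r)"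
        unfolding z using x0 by simp
      moreover have "wc p = \<eta> *\<^sub>R (om l * (of_real y + of_real 0 * om 1))"
        unfolding w odn using x0 by (simp add: algebra_simps)
      moreover have "0 \<le> r" "r \<le> 1" using y co by (simp_all add: r_def) (simp add: y_def)
      ultimately show ?thesis using I[of \<sigma> y 0 1 r l] y \<sigma>(1) by auto
    qed
  qed
qed

lemma om_2: "om 2 = om 1 - 1" and om_3: "om 3 = -1"
proof -
  have 1: "om 1 * om 1 = om 1 - 1" by (simp add: om_1 complex_eq_iff)
  have "om 2 = om 1 * om 1" by (simp flip: om_add)
  then show 2: "om 2 = om 1 - 1" using 1 by simp
  have "om 3 = om 1 * om 2" by (simp flip: om_add)
  then show "om 3 = -1" using 1 2 by (simp add: algebra_simps)
qed

text \<open>Coordinates in the basis \<open>1\<close>, \<open>om 1\<close> of the sector of angle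
  \<open>pi/3\<close> containing \<open>w\<close>. The conditions \<open>0 < x\<close> and
  \<open>0 \<le> y\<close> make the sectors half-open, hence disjoint.\<close>

lemma om_wedge:
  assumes "w \<noteq> 0"
  obtains j x y where "0 < x" "0 \<le> y" "w = om j * (of_real x + of_real y * om 1)"
proof -
  define r where "r = norm w"
  define j where "j = \<lfloor>Arg w / (pi/3)\<rfloor>"
  define \<phi> where "\<phi> = Arg w - pi/3 * of_int j"
  have r: "0 < r" using assms by (simp add: r_def)
  have "of_int j \<le> Arg w / (pi/3)" "Arg w / (pi/3) < of_int j + 1" by (simp_all add: j_def)
  then have \<phi>: "0 \<le> \<phi>" "\<phi> < pi/3" by (simp_all add: \<phi>_def field_simps)
  have w: "w = om j * (of_real r * cis \<phi>)"
  proof -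
    have "w = of_real r * cis (Arg w)" using rcis_cmod_Arg[of w] by (simp add: rcis_def r_def)
    also have "Arg w = pi/3 * of_int j + \<phi>" by (simp add: \<phi>_def)
    finally show ?thesis by (simp add: om_def cis_mult[symmetric] mult_ac)
  qed
  define y where "y = r * sin \<phi> * 2 / sqrt 3"
  define x where "x = r * cos \<phi> - y / 2"
  have "0 \<le> sin \<phi>" using \<phi> by (intro sin_ge_zero) auto
  then have y: "0 \<le> y" using r by (simp add: y_def)
  have "0 < sin (pi/3 - \<phi>)" using \<phi> by (intro sin_gt_zero) auto
  then have "0 < sqrt 3 / 2 * cos \<phi> - 1/2 * sin \<phi>" by (simp add: sin_diff sin_60 cos_60)
  then have "0 < r * (2 / sqrt 3) * (sqrt 3 / 2 * cos \<phi> - 1/2 * sin \<phi>)" using r by simp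
  also have "\<dots> = x" by (simp add: x_def y_def field_simps)
  finally have x: "0 < x" .
  have "of_real r * cis \<phi> = of_real x + of_real y * om 1"
    by (simp add: complex_eq_iff om_1 x_def y_def)
  then have "w = om j * (of_real x + of_real y * om 1)" using w by simp
  then show ?thesis by (rule that[OF x y])
qed

lemma om_wedge_unique:
  assumes eq: "om j * (of_real x + of_real y * om 1) = om j' * (of_real x' + of_real y' * om 1)"
    and pos: "0 < x" "0 \<le> y" "0 < x'" "0 \<le> y'"
  shows "x = x'" "y = y'" "\<exists>i. j' = j + 6 * i"
proof -
  define d where "d = (j' - j) mod 6"
  define i where "i = (j' - j) div 6"
  have j': "j' = j + (6 * i + d)" by (simp add: d_def i_def)
  have "om j' = om j * om d" unfolding j' by (subst om_add) (simp only: om_period)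
  then have "om j * (of_real x + of_real y * om 1) = om j * (om d * (of_real x' + of_real y' * om 1))"
    using eq by (simp add: mult.assoc)
  then have e: "of_real x + of_real y * om 1 = om d * (of_real x' + of_real y' * om 1)"
    unfolding mult_cancel_left by simp
  have ind: "p = q \<and> s = u" if "of_real p + of_real s * om 1 = of_real q + of_real u * om 1" for p q s u
    using that by (simp add: complex_eq_iff om_1)
  have ex: "om d * (of_real x' + of_real y' * om 1) = of_real x' * om d + of_real y' * om (d + 1)"
    by (simp add: om_add algebra_simps)
  have om46: "om 4 = - om 1" "om 5 = 1 - om 1" "om 6 = 1"
    using om_3 om_2 om_add[of 3 1] om_add[of 3 2] om_add[of 3 3] by simp_all
  have "0 \<le> d" "d < 6" by (simp_all add: d_def)
  then consider "d = 0" | "d = 1" | "d = 2" | "d = 3" | "d = 4" | "d = 5" by linarith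
  then have "d = 0"
  proof cases
    case 2
    have "om d * (of_real x' + of_real y' * om 1) = of_real (- y') + of_real (x' + y') * om 1"
      unfolding ex unfolding 2 by (simp add: om_2 om_3 om46 algebra_simps)
    then show ?thesis using ind[of x y "- y'" "x' + y'"] e pos by simp
  next
    case 3
    have "om d * (of_real x' + of_real y' * om 1) = of_real (- x' - y') + of_real x' * om 1"
      unfolding ex unfolding 3 by (simp add: om_2 om_3 om46 algebra_simps)
    then show ?thesis using ind[of x y "- x' - y'" x'] e pos by simp
  next
    case 4
    have "om d * (of_real x' + of_real y' * om 1) = of_real (- x') + of_real (- y') * om 1"
      unfolding ex unfolding 4 by (simp add: om_2 om_3 om46 algebra_simps)
    then show ?thesis using ind[of x y "- x'" "- y'"] e pos by simp
  next
    case 5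
    have "om d * (of_real x' + of_real y' * om 1) = of_real y' + of_real (- x' - y') * om 1"
      unfolding ex unfolding 5 by (simp add: om_2 om_3 om46 algebra_simps)
    then show ?thesis using ind[of x y y' "- x' - y'"] e pos by simp
  next
    case 6
    have "om d * (of_real x' + of_real y' * om 1) = of_real (x' + y') + of_real (- x') * om 1"
      unfolding ex unfolding 6 by (simp add: om_2 om_3 om46 algebra_simps)
    then show ?thesis using ind[of x y "x' + y'" "- x'"] e pos by simp
  qed
  then show "x = x'" "y = y'" "\<exists>i. j' = j + 6 * i" using e ind[of x y x' y'] j' by auto
qed

lemma fan_seg_nonzero: assumes V: "fan_ok V" and n: "n \<le> 3" and r: "0 \<le> r" "r \<le> 1" shows "fan_seg V n r \<noteq> 0"
proof -
  have V': "0 < cr (V 0) (V 1)" "0 < cr (V 0) (V 2)" "0 < cr (V 0) (V 3)" "0 < cr (V 1) (V 2)"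
    "0 < cr (V 1) (V 3)" "0 < cr (V 2) (V 3) \<or> V 2 = V 3" using V by (auto simp: fan_ok_def)
  have seg: "(1 - r) *\<^sub>R P + r *\<^sub>R P' \<noteq> 0" if "0 < cr P P'" for P P'
  proof
    assume z: "(1 - r) *\<^sub>R P + r *\<^sub>R P' = 0"
    have "cr P ((1 - r) *\<^sub>R P + r *\<^sub>R P') = r * cr P P'" "cr ((1 - r) *\<^sub>R P + r *\<^sub>R P') P' = (1 - r) * cr P P'"
      by (simp_all add: cr_simps)
    then have "r * cr P P' = 0" "(1 - r) * cr P P' = 0" unfolding z by (simp_all add: cr_def)
    then show False using that by simp
  qed
  have "n = 0 \<or> n = 1 \<or> n = 2 \<or> n = 3" using n by linarith
  then show ?thesis
  proof (elim disjE)
    assume "n = 0" then show ?thesis using seg[OF V'(1)] by (simp add: fan_seg_def)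
  next
    assume "n = 1" then show ?thesis using seg[OF V'(4)] by (simp add: fan_seg_def numeral_2_eq_2)
  next
    assume n: "n = 2"
    show ?thesis
    proof (cases "V 2 = V 3")
      case True
      then have "fan_seg V n r = V 2" using n by (simp add: fan_seg_def numeral_2_eq_2 numeral_3_eq_3 flip: scaleR_left_distrib)
      then show ?thesis using V'(2) by (auto simp: cr_def)
    next
      case False
      then have "0 < cr (V 2) (V 3)" using V'(6) by blast
      from seg[OF this] show ?thesis using n by (simp add: fan_seg_def numeral_2_eq_2 numeral_3_eq_3)
    qed
  next
    assume "n = 3"
    moreover have "0 < cr (V 3) (- V 0)" using V'(3) cr_swap[of "V 3" "V 0"] by (simp add: cr_simps)
    ultimately show ?thesis using seg[of "V 3" "- V 0"] by (simp add: fan_seg_def)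
  qed
qed

text \<open>The second coordinate fixes \<open>x\<close>, \<open>y\<close> and \<open>j\<close>
  modulo 6. Changing \<open>j\<close> by 6 changes the first coordinate by at most a sign, and the
  octagon is symmetric about 0.\<close>

lemma on_band_unique:
  assumes fan: "!!x y. 0 < x ==> 0 \<le> y ==> fan_ok (oct \<tau> E m x y)" and A: "A \<noteq> 0" and \<eta>: "\<eta> \<noteq> 0"
    and 1: "on_band A \<tau> E \<eta> m z w" and 2: "on_band A \<tau> E \<eta> m (t *\<^sub>R z) w" and t: "0 < t"
  shows "t = 1"
proof -
  obtain j \<sigma> x y n r where a: "\<sigma> = 1 \<or> \<sigma> = (-1::real)" "0 < x" "0 \<le> y" "n \<le> 3" "0 \<le> r" "r \<le> 1"
     "w = \<eta> *\<^sub>R (om j * (of_real x + of_real y * om 1))"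
     "z = A * ii (j + int m) * (\<sigma> *\<^sub>R fan_seg (oct \<tau> E m x y) n r)" using 1 unfolding on_band_def by blast
  obtain j' \<sigma>' x' y' n' r' where b: "\<sigma>' = 1 \<or> \<sigma>' = (-1::real)" "0 < x'" "0 \<le> y'" "n' \<le> 3" "0 \<le> r'" "r' \<le> 1"
     "w = \<eta> *\<^sub>R (om j' * (of_real x' + of_real y' * om 1))"
     "t *\<^sub>R z = A * ii (j' + int m) * (\<sigma>' *\<^sub>R fan_seg (oct \<tau> E m x' y') n' r')" using 2 unfolding on_band_def by blast
  have "om j * (of_real x + of_real y * om 1) = om j' * (of_real x' + of_real y' * om 1)"
    using a(7) b(7) \<eta> by (metis scaleR_cancel_left)
  from om_wedge_unique[OF this a(2,3) b(2,3)] obtain i where xy: "x = x'" "y = y'" and j': "j' = j + 6 * i" by blast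
  have "even (j' + int m - (j + int m))" using j' by simp
  then obtain s where s: "s = 1 \<or> s = (-1::real)" "ii (j' + int m) = of_real s * ii (j + int m)" using ii_parity by blast
  have "A * ii (j + int m) * (t *\<^sub>R (\<sigma> *\<^sub>R fan_seg (oct \<tau> E m x y) n r)) =
        A * ii (j + int m) * ((s * \<sigma>') *\<^sub>R fan_seg (oct \<tau> E m x y) n' r')"
    using b(8) unfolding a(8) s(2) xy by (simp add: scaleR_conv_of_real mult_ac)
  then have "(s * \<sigma>') *\<^sub>R fan_seg (oct \<tau> E m x y) n' r' = t *\<^sub>R (\<sigma> *\<^sub>R fan_seg (oct \<tau> E m x y) n r)"
    using A unfolding mult_cancel_left by simp
  moreover have "s * \<sigma>' = 1 \<or> s * \<sigma>' = -1" using s(1) b(1) by auto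
  ultimately show ?thesis
    using fan_unique[OF fan[OF a(2,3)] a(4) b(4) a(5,6) b(5,6) a(1) _ t] fan_seg_nonzero[OF fan[OF a(2,3)] a(4-6)] by blast
qed

text \<open>The two choices differ by \<open>(-1,-1,2)\<close>, which adds a half-turn to the first
  coordinate and keeps the layer and the second coordinate.\<close>

lemma lattice_vertex:
  assumes \<sigma>: "\<sigma> = 1 \<or> \<sigma> = (-1::real)"
  obtains v where "csum v = int m" "v$1 - v$2 = l" "ii (v$3) = of_real \<sigma> * ii (l + int m)"
proof -
  have 2: "ii (l + int m + 2) = - ii (l + int m)" by (simp add: ii_add)
  show ?thesis using \<sigma>
  proof
    assume "\<sigma> = 1" then show ?thesis by (intro that[of "vector [0, - l, l + int m]"]) simp_all
  next
    assume "\<sigma> = -1" then show ?thesis by (intro that[of "vector [-1, -1 - l, l + int m + 2]"]) (simp_all add: 2)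
  qed
qed

text \<open>Inverse of \<open>band_point\<close>: each side of the octagon names a square and the
  weights of its four corners.\<close>

lemma band_lift:
  assumes m: "m + 2 \<le> k" and Z: "Z m = A * seqY \<tau> E m" "Z (m+1) = A * seqY \<tau> E (m+1)" "Z (m+2) = A * seqY \<tau> E (m+2)"
    and b: "\<sigma> = 1 \<or> \<sigma> = (-1::real)" "0 < x" "0 \<le> y" "n \<le> 3" "0 \<le> r" "r \<le> 1"
  obtains c p where "c \<in> layers3 k (Suc m)" "p \<in> pcone (gv Z e \<eta>) c"
    "zc p = A * ii (j + int m) * (\<sigma> *\<^sub>R fan_seg (oct \<tau> E m x y) n r)"
    "wc p = \<eta> *\<^sub>R (om j * (of_real x + of_real y * om 1))"
proof -
  let ?a0 = "seqY \<tau> E m" and ?a1 = "seqY \<tau> E (m+1)" and ?a2 = "seqY \<tau> E (m+2)"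
  have up: "ii (j + 1 + int m) = \<i> * ii (j + int m)"
  proof -
    have "ii (j + 1 + int m) = ii (j + int m) * ii 1" by (simp only: ii_add[symmetric]) (simp add: algebra_simps)
    then show ?thesis by (simp add: mult.commute)
  qed
  have oup: "om (j + 1) = om j * om 1" "om (j + 1) * om (-1) = om j" by (simp_all flip: om_add)
  note res = that
  have go: thesis if s: "csum v = int m" "i \<noteq> i'" and co: "0 \<le> \<alpha>" "0 \<le> \<beta>" "0 \<le> \<gamma>" "0 \<le> \<delta>"
    and z: "zc (\<alpha> *\<^sub>R gv Z e \<eta> v + \<beta> *\<^sub>R gv Z e \<eta> (v + ax i) + \<gamma> *\<^sub>R gv Z e \<eta> (v + ax i') + \<delta> *\<^sub>R gv Z e \<eta> (v + ax i + ax i'))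
        = A * ii (j + int m) * (\<sigma> *\<^sub>R fan_seg (oct \<tau> E m x y) n r)"
    and w: "wc (\<alpha> *\<^sub>R gv Z e \<eta> v + \<beta> *\<^sub>R gv Z e \<eta> (v + ax i) + \<gamma> *\<^sub>R gv Z e \<eta> (v + ax i') + \<delta> *\<^sub>R gv Z e \<eta> (v + ax i + ax i'))
        = \<eta> *\<^sub>R (om j * (of_real x + of_real y * om 1))" for v i i' \<alpha> \<beta> \<gamma> \<delta>
    using res[OF layers3_square[OF m s] _ z w] pcone_square[OF s(2), of _ "gv Z e \<eta>" v] co by blast
  have "n = 0 \<or> n = 1 \<or> n = 2 \<or> n = 3" using b(4) by linarith
  then show thesis
  proof (elim disjE)
    assume n: "n = 0"
    obtain v where v: "csum v = int m" "v$1 - v$2 = j" "ii (v$3) = of_real \<sigma> * ii (j + int m)" using lattice_vertex[OF b(1)] .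
    note G = gv_square[OF v(1), of Z e \<eta>, unfolded v(2,3) Z]
    show thesis
      by (rule go[OF v(1), of 1 2 "r * x" y 0 "(1 - r) * x"])
         (use b in \<open>simp_all only: G zc_simps wc_simps mk_simps n fan_seg_oct\<close>,
          simp_all add: scaleR_conv_of_real algebra_simps mult_left_le_one_le)
  next
    assume n: "n = 1"
    obtain v where v: "csum v = int m" "v$1 - v$2 = j" "ii (v$3) = of_real \<sigma> * ii (j + int m)" using lattice_vertex[OF b(1)] .
    note G = gv_square[OF v(1), of Z e \<eta>, unfolded v(2,3) Z]
    show thesis
      by (rule go[OF v(1), of 1 3 "(1 - r) * x" "(1 - r) * y" "r * x" "r * y"])
         (use b in \<open>simp_all only: G zc_simps wc_simps mk_simps n fan_seg_oct\<close>,
          simp_all add: scaleR_conv_of_real algebra_simps mult_left_le_one_le)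
  next
    assume n: "n = 2"
    obtain v where v: "csum v = int m" "v$1 - v$2 = j + 1" "ii (v$3) = of_real \<sigma> * ii (j + 1 + int m)" using lattice_vertex[OF b(1)] .
    note G = gv_square[OF v(1), of Z e \<eta>, unfolded v(2,3) Z up oup(2), unfolded oup(1)]
    show thesis
      by (rule go[OF v(1), of 1 2 "r * y" 0 x "(1 - r) * y"])
         (use b in \<open>simp_all only: G zc_simps wc_simps mk_simps n fan_seg_oct\<close>,
          simp_all add: scaleR_conv_of_real algebra_simps mult_left_le_one_le)
  next
    assume n: "n = 3"
    obtain v where v: "csum v = int m" "v$1 - v$2 = j + 1" "ii (v$3) = of_real \<sigma> * ii (j + 1 + int m)" using lattice_vertex[OF b(1)] .
    note G = gv_square[OF v(1), of Z e \<eta>, unfolded v(2,3) Z up oup(2), unfolded oup(1)]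
    show thesis
      by (rule go[OF v(1), of 2 3 "(1 - r) * y" "(1 - r) * x" "r * y" "r * x"])
         (use b in \<open>simp_all only: G zc_simps wc_simps mk_simps n fan_seg_oct\<close>,
          simp_all add: scaleR_conv_of_real algebra_simps mult_left_le_one_le)
  qed
qed

lemma band_surjective:
  assumes fan: "!!x y. 0 < x ==> 0 \<le> y ==> fan_ok (oct \<tau> E m x y)" and A: "A \<noteq> 0" and \<eta>: "\<eta> \<noteq> 0" and m: "m + 2 \<le> k"
    and Z: "Z m = A * seqY \<tau> E m" "Z (m+1) = A * seqY \<tau> E (m+1)" "Z (m+2) = A * seqY \<tau> E (m+2)"
    and zw: "z \<noteq> 0" "w \<noteq> 0"
  obtains c p t where "c \<in> layers3 k (Suc m)" "p \<in> pcone (gv Z e \<eta>) c" "0 < t" "zc p = t *\<^sub>R z" "wc p = w"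
proof -
  have "(1/\<eta>) *\<^sub>R w \<noteq> 0" using zw \<eta> by simp
  then obtain j x y where xy: "0 < x" "0 \<le> y" "(1/\<eta>) *\<^sub>R w = om j * (of_real x + of_real y * om 1)" by (rule om_wedge)
  define u where "u = z / (A * ii (j + int m))"
  have "u \<noteq> 0" using zw A by (simp add: u_def)
  then obtain t \<sigma> n r where f: "0 < t" "\<sigma> = 1 \<or> \<sigma> = (-1::real)" "n \<le> 3" "0 \<le> r" "r \<le> 1"
    "t *\<^sub>R u = \<sigma> *\<^sub>R fan_seg (oct \<tau> E m x y) n r" using fan_complete[OF fan[OF xy(1,2)]] by metis
  obtain c p where cp: "c \<in> layers3 k (Suc m)" "p \<in> pcone (gv Z e \<eta>) c"
    "zc p = A * ii (j + int m) * (\<sigma> *\<^sub>R fan_seg (oct \<tau> E m x y) n r)"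
    "wc p = \<eta> *\<^sub>R (om j * (of_real x + of_real y * om 1))"
    using band_lift[OF m Z f(2) xy(1,2) f(3-5)] .
  have "zc p = t *\<^sub>R z" unfolding cp(3) f(6)[symmetric] using A by (simp add: u_def)
  moreover have "wc p = w" unfolding cp(4) xy(3)[symmetric] using \<eta> by simp
  ultimately show ?thesis using that cp f(1) by blast
qed

section \<open>Orientation\<close>

text \<open>With \<open>u = E (m+1) - (1+\<tau>) * E (m+2)\<close> the Casoratian is
  \<open>u\<^sup>2 - (1 + \<tau> + \<tau>\<^sup>2) * (E (m+2))\<^sup>2\<close>. If the claim failed,
  \<open>u\<close> would be at most \<open>(1 - \<tau>) / 4 * E (m+2)\<close>, too small for
  positivity.\<close>

lemma inward_quotient:
  assumes ok: "seq_ok \<tau> E" and c: "0 < cas E m" and e: "0 < E (m+2)" and i: "(1+\<tau>) * E (m+2) < E (m+1)"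
  shows "(5 + 3*\<tau>) * E (m+2) < 4 * E (m+1)"
proof (rule ccontr)
  assume neg: "\<not> ?thesis"
  define u where "u = E (m+1) - (1+\<tau>) * E (m+2)"
  have \<tau>: "0 < \<tau>" using seq_pos[OF ok] .
  have u: "0 \<le> u" "u \<le> (1 - \<tau>) / 4 * E (m+2)" using i neg by (simp_all add: u_def field_simps)
  have "cas E m = u\<^sup>2 - (1 + \<tau> + \<tau>\<^sup>2) * (E (m+2))\<^sup>2"
    unfolding cas_quadratic[OF ok] u_def by (simp add: power2_eq_square algebra_simps)
  also have "u\<^sup>2 \<le> ((1 - \<tau>) / 4 * E (m+2))\<^sup>2" using u by (intro power_mono)
  also have "((1 - \<tau>) / 4 * E (m+2))\<^sup>2 = ((1 - \<tau>) / 4)\<^sup>2 * (E (m+2))\<^sup>2" by (rule power_mult_distrib)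
  also have "\<dots> \<le> (1 + \<tau> + \<tau>\<^sup>2) * (E (m+2))\<^sup>2"
    using \<tau> by (intro mult_right_mono) (simp_all add: power2_eq_square field_simps)
  finally show False using c by simp
qed

text \<open>By the recurrence, decay at one step excludes growth at the next, and
  \<open>cas_dichotomy\<close> leaves only decay.\<close>

lemma inward_step:
  assumes ok: "seq_ok \<tau> E" and c: "0 < cas E 0" and E: "!!m. m < k ==> 0 < E (m+1)" and i: "(1+\<tau>) * E 2 < E 1"
  shows "m + 2 \<le> k ==> (1+\<tau>) * E (m+2) < E (m+1)"
proof (induction m)
  case 0 then show ?case using i by (simp add: numeral_2_eq_2)
next
  case (Suc m)
  then have m: "(1+\<tau>) * E (m+2) < E (m+1)" by simp
  have "\<not> (1+\<tau>) * E (m+2) < \<tau> * E (m+3)"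
    using m seq_rec[OF ok, of "m+1"] by (simp add: numeral_3_eq_3 algebra_simps)
  then show ?case using cas_dichotomy[OF ok cas_pos[OF ok c], of "Suc m"] E[of "m+1"] E[of "m+2"] Suc
    by (simp add: numeral_3_eq_3)
qed

text \<open>In the decaying regime a vertex of layer \<open>m + 3\<close> has a shorter first
  coordinate than the band of layers \<open>m\<close> to \<open>m + 2\<close> over the same torus
  point, so it lies on the side of \<open>clifford 2\<close>. The second coordinate of a vertex is
  on the edge of a wedge, hence \<open>x = 1\<close> and \<open>y = 0\<close>.\<close>

lemma inward_top:
  assumes ok: "seq_ok \<tau> E" and W: "0 < cas E 0"
    and E: "0 < E m" "0 < E (m+1)" "0 < E (m+2)" "0 < E (m+3)"
    and i: "(1+\<tau>) * E (m+2) < E (m+1)" "(1+\<tau>) * E (m+3) < E (m+2)"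
    and n: "n \<le> 3" and r: "0 \<le> r" "r \<le> 1" and \<sigma>: "\<sigma> = 1 \<or> \<sigma> = (-1::real)" and t: "0 < t"
    and eq: "(t * \<sigma>) *\<^sub>R (\<i> * seqY \<tau> E (m+3)) = fan_seg (oct \<tau> E m 1 0) n r"
  shows "1 < t"
proof -
  have \<tau>: "0 < \<tau>" using seq_pos[OF ok] .
  have gt1: "1 < t" if "t * v = w" "v < w" "0 < w" for v w
  proof (rule ccontr)
    assume "\<not> 1 < t"
    moreover have "0 < v" using that t by (metis zero_less_mult_pos)
    ultimately have "t * v \<le> 1 * v" by (intro mult_right_mono) auto
    then show False using that by simp
  qed
  let ?a0 = "seqY \<tau> E m" and ?a1 = "seqY \<tau> E (m+1)" and ?a2 = "seqY \<tau> E (m+2)" and ?a3 = "seqY \<tau> E (m+3)" and ?c = "seqc \<tau>"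
  have E3: "\<tau> * E (m+3) = 2 * (1+\<tau>) * E (m+2) - E (m+1)"
    using seq_rec[OF ok, of "m+1"] by (simp add: numeral_3_eq_3)
  have E0: "E m = 2 * (1+\<tau>) * E (m+1) - \<tau> * E (m+2)" using seq_rec[OF ok, of m] by simp
  have s3: "\<i> * ?a3 = ?a2 + E (m+3) *\<^sub>R ?c" using seqY_step[OF ok, of "m+2"] by (simp add: numeral_3_eq_3)
  have s1: "\<i> * ?a1 = ?a0 + E (m+1) *\<^sub>R ?c" using seqY_step[OF ok, of m] by simp
  have s2: "\<i> * ?a2 = ?a1 + E (m+2) *\<^sub>R ?c" using seqY_step[OF ok, of "m+1"] by simp
  have q1: "(5 + 3*\<tau>) * E (m+2) < 4 * E (m+1)" using inward_quotient[OF ok cas_pos[OF ok W] E(3) i(1)] .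
  have q2: "(5 + 3*\<tau>) * E (m+3) < 4 * E (m+2)"
    using inward_quotient[OF ok cas_pos[OF ok W], of "m+1"] E(4) i(2) by (simp add: numeral_3_eq_3)
  have cd: "cr ?c (?a2 - ?a0) = (1+\<tau>) * (4 * E (m+1) - (5 + 3*\<tau>) * E (m+2))"
  proof -
    have "cr ?c (?a2 - ?a0) = - 2 * (1+\<tau>) * (\<tau> * E (m+3) - \<tau> * E (m+1)) - (1 - \<tau>) * (E (m+2) - E m)"
      by (simp add: cr_def seqc_def seqY_def numeral_3_eq_3)
    also have "\<dots> = (1+\<tau>) * (4 * E (m+1) - (5 + 3*\<tau>) * E (m+2))"
      unfolding E3 E0 by (simp add: algebra_simps)
    finally show ?thesis .
  qed
  then have cdpos: "0 < cr ?c (?a2 - ?a0)" using q1 \<tau> by simp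
  have c20: "0 < cr ?a2 ?a0" using oct_fan[OF ok W E, of 1 0] by (simp add: fan_ok_def oct_def)
  \<comment> \<open>Sides 0 to 2 lie in the upper half-plane, as does \<open>\<i> * ?a3\<close>, and
    this settles the sign \<sigma>. On side 3 both signs remain possible.\<close>
  have pos_im: "\<sigma> = 1" if "0 < Im (fan_seg (oct \<tau> E m 1 0) n r)"
  proof -
    have "Im ((t * \<sigma>) *\<^sub>R (\<i> * ?a3)) = t * \<sigma> * E (m+3)" by (simp add: seqY_def)
    then have "0 < t * \<sigma> * E (m+3)" using that eq by simp
    then show ?thesis using \<sigma> t E(4) by (auto simp: zero_less_mult_iff)
  qed
  have conv: "0 < (1 - r) * a + r * b" if "0 < a" "0 < b" for a b :: real
  proof (cases "r = 0")
    case False then show ?thesis using that r by (intro add_nonneg_pos) auto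
  qed (use that in simp)
  have edge01: "1 < t" if seg: "fan_seg (oct \<tau> E m 1 0) n r = (1 - q) *\<^sub>R ?a0 + q *\<^sub>R (\<i> * ?a1)" and q: "0 \<le> q" "q \<le> 1" for q
  proof -
    have "0 < Im ?a0" "0 < Im (\<i> * ?a1)" using E \<tau> by (simp_all add: seqY_def)
    then have "0 < Im (fan_seg (oct \<tau> E m 1 0) n r)" unfolding seg
    proof (cases "q = 0")
      case False then show "0 < Im ((1 - q) *\<^sub>R ?a0 + q *\<^sub>R (\<i> * ?a1))"
        using \<open>0 < Im ?a0\<close> \<open>0 < Im (\<i> * ?a1)\<close> q by (simp add: add_nonneg_pos)
    qed simp
    then have \<sigma>1: "\<sigma> = 1" by (rule pos_im)
    \<comment> \<open>The side has direction \<open>?c\<close>, so the cross product with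
      \<open>?c\<close> does not depend on the position on it.\<close>
    have "cr (fan_seg (oct \<tau> E m 1 0) n r) ?c = cr ?a0 ?c" unfolding seg s1 by (simp add: cr_simps algebra_simps)
    moreover have "cr ((t * \<sigma>) *\<^sub>R (\<i> * ?a3)) ?c = t * cr ?a2 ?c" unfolding s3 \<sigma>1 by (simp add: cr_simps)
    ultimately have tt: "t * cr ?a2 ?c = cr ?a0 ?c" using eq by simp
    have "cr ?a0 (\<i> * ?a1) = E (m+1) * cr ?a0 ?c" unfolding s1 by (simp add: cr_simps)
    moreover have "0 < cr ?a0 (\<i> * ?a1)" using E \<tau> by (simp add: cr_def seqY_def add_pos_pos)
    ultimately have p0: "0 < cr ?a0 ?c" using E(2) by (simp add: zero_less_mult_iff)
    have "cr ?a2 ?c < cr ?a0 ?c" using cdpos cr_swap[of ?c "?a2 - ?a0"] by (simp add: cr_simps)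
    then show "1 < t" by (rule gt1[OF tt _ p0])
  qed
  have "n = 0 \<or> n = 1 \<or> n = 2 \<or> n = 3" using n by linarith
  then show ?thesis
  proof (elim disjE)
    assume n: "n = 0"
    have seg: "fan_seg (oct \<tau> E m 1 0) n r = (1 - r) *\<^sub>R ?a2 + r *\<^sub>R ?a0" unfolding n fan_seg_oct by (simp add: add.commute)
    have "0 < Im ?a2" "0 < Im ?a0" using E \<tau> by (simp_all add: seqY_def numeral_3_eq_3)
    then have "0 < Im (fan_seg (oct \<tau> E m 1 0) n r)" unfolding seg using conv by simp
    then have \<sigma>1: "\<sigma> = 1" by (rule pos_im)
    have "cr (fan_seg (oct \<tau> E m 1 0) n r) (?a0 - ?a2) = cr ?a2 ?a0"
      unfolding seg using cr_swap[of ?a0 ?a2] by (simp add: cr_simps algebra_simps)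
    moreover have "cr ((t * \<sigma>) *\<^sub>R (\<i> * ?a3)) (?a0 - ?a2) = t * (cr ?a2 ?a0 - E (m+3) * cr ?c (?a2 - ?a0))"
      unfolding s3 \<sigma>1 by (simp add: cr_simps algebra_simps)
    ultimately have tt: "t * (cr ?a2 ?a0 - E (m+3) * cr ?c (?a2 - ?a0)) = cr ?a2 ?a0" using eq by simp
    define v where "v = cr ?a2 ?a0 - E (m+3) * cr ?c (?a2 - ?a0)"
    have "v < cr ?a2 ?a0" using cdpos E(4) by (simp add: v_def)
    moreover have "t * v = cr ?a2 ?a0" using tt by (simp add: v_def)
    ultimately show "1 < t" using gt1 c20 by blast
  next
    assume n: "n = 1"
    show ?thesis by (rule edge01[of r]) (use r in \<open>simp_all only: n fan_seg_oct, simp_all\<close>)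
  next
    assume n: "n = 2"
    show ?thesis by (rule edge01[of 1]) (simp_all only: n fan_seg_oct, simp_all)
  next
    assume n: "n = 3"
    have seg: "fan_seg (oct \<tau> E m 1 0) n r = \<i> * ?a1 + (r * E (m+2)) *\<^sub>R (\<i> * ?c)"
    proof -
      have "fan_seg (oct \<tau> E m 1 0) n r = \<i> * ((1 - r) *\<^sub>R ?a1 + r *\<^sub>R (\<i> * ?a2))"
        unfolding n fan_seg_oct by (simp only: scaleR_one scaleR_zero_left add_0_right)
      also have "\<dots> = \<i> * ?a1 + (r * E (m+2)) *\<^sub>R (\<i> * ?c)" unfolding s2 by (simp add: algebra_simps)
      finally show ?thesis .
    qed
    \<comment> \<open>Side 3 has direction \<open>\<i> * ?c\<close>, and crossing with that is the
      inner product with \<open>?c\<close>. A bound on the absolute value covers both signs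
      \<sigma>.\<close>
    define N where "N = - (?a2 \<bullet> ?c)"
    have Nf: "N = 2 * (1+\<tau>) * E (m+2) - \<tau> * E (m+3) * (1 - \<tau>)"
      by (simp add: N_def inner_complex_def seqY_def seqc_def numeral_3_eq_3 algebra_simps)
    have cn: "?c \<bullet> ?c = 5 + 6*\<tau> + 5*\<tau>\<^sup>2" by (simp add: inner_complex_def seqc_def power2_eq_square algebra_simps)
    have ci: "cr u (\<i> * ?c) = u \<bullet> ?c" for u by (simp add: cr_def inner_complex_def)
    have i2: "(\<i> * u) \<bullet> (\<i> * v) = u \<bullet> v" for u v by (simp add: inner_complex_def)
    have "(\<i> * ?a1) \<bullet> ?c = N"
    proof -
      have "\<i> * (\<i> * ?a2) = \<i> * ?a1 + E (m+2) *\<^sub>R (\<i> * ?c)" unfolding s2 by (simp add: algebra_simps)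
      then have "\<i> * ?a1 = - ?a2 - E (m+2) *\<^sub>R (\<i> * ?c)" by (simp add: algebra_simps)
      moreover have "(\<i> * ?c) \<bullet> ?c = 0" by (simp add: inner_complex_def)
      ultimately show ?thesis by (simp add: N_def inner_diff_left)
    qed
    moreover have "cr (fan_seg (oct \<tau> E m 1 0) n r) (\<i> * ?c) = (\<i> * ?a1) \<bullet> ?c"
      unfolding seg ci by (simp add: inner_add_left) (simp add: inner_complex_def)
    moreover have "cr ((t * \<sigma>) *\<^sub>R (\<i> * ?a3)) (\<i> * ?c) = t * \<sigma> * (E (m+3) * (?c \<bullet> ?c) - N)"
      unfolding ci s3 by (simp add: inner_add_left N_def)
    ultimately have tt: "t * (\<sigma> * (E (m+3) * (?c \<bullet> ?c) - N)) = N" using eq by simp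
    have N0: "0 < N"
    proof -
      have "E (m+3) < E (m+2)" using i(2) \<tau> E(4) by (simp add: algebra_simps) (smt (verit) mult_pos_pos)
      then have "\<tau> * E (m+3) \<le> \<tau> * E (m+2)" using \<tau> by simp
      moreover have "\<tau> * E (m+3) * (1 - \<tau>) \<le> \<tau> * E (m+3)" using \<tau> E(4) by (simp add: algebra_simps)
      moreover have "0 < E (m+2) + \<tau> * E (m+2)" using \<tau> E(3) by (simp add: add_pos_pos)
      ultimately show ?thesis unfolding Nf using E(3) by (simp add: algebra_simps)
    qed
    have "2 * N - E (m+3) * (?c \<bullet> ?c) = (1+\<tau>) * (4 * E (m+2) - (5 + 3*\<tau>) * E (m+3))"
      unfolding Nf cn by (simp add: power2_eq_square algebra_simps)
    then have "E (m+3) * (?c \<bullet> ?c) < 2 * N" using q2 \<tau> by (simp add: zero_less_mult_iff) (smt (verit) mult_pos_pos)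
    moreover have "0 < E (m+3) * (?c \<bullet> ?c)" using E(4) \<tau> unfolding cn by (simp add: add_pos_pos)
    ultimately have "\<bar>\<sigma> * (E (m+3) * (?c \<bullet> ?c) - N)\<bar> < N" using \<sigma> by auto
    then have "\<sigma> * (E (m+3) * (?c \<bullet> ?c) - N) < N" by simp
    then show "1 < t" by (rule gt1[OF tt _ N0])
  qed
qed

section \<open>Separation of the sphere by a graph over the Clifford torus\<close>

lemma compact_sph_hull:
  assumes "finite V" "0 \<notin> convex hull V" shows "compact (sph_hull V)"
proof -
  have "continuous_on (convex hull V) sgn"
    unfolding sgn_div_norm using assms(2) by (intro continuous_intros) auto
  then show ?thesis unfolding sph_hull_def
    by (rule compact_continuous_image[OF _ finite_imp_compact_convex_hull[OF assms(1)]])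
qed

lemma zero_notin_hull: assumes "finite c" "hemi f c" shows "0 \<notin> convex hull (f ` c)"
proof -
  obtain g where g: "\<forall>v\<in>c. 0 < g \<bullet> f v" using assms(2) by (auto simp: hemi_def)
  have "convex hull (f ` c) \<subseteq> {y. 0 < g \<bullet> y}"
    using g by (intro hull_minimal) (auto simp: convex_halfspace_gt)
  then show ?thesis by auto
qed

lemma finite_cells_union:
  assumes "embedded P k" "L \<subseteq> strip k"
  shows "compact (\<Union>c\<in>L. sph_hull (P ` c))"
proof -
  have "(\<lambda>c. sph_hull (P ` c)) ` L \<subseteq> cells (cone_model P k)"
    using assms(2) unfolding cells_cone_model[OF embedded_periodic[OF assms(1)]] by blast
  moreover have "finite (cells (cone_model P k))" unfolding cone_model_def using finite_torus by simp
  ultimately have "finite ((\<lambda>c. sph_hull (P ` c)) ` L)" by (rule finite_subset)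
  moreover have "compact (sph_hull (P ` c))" if "c \<in> L" for c
  proof -
    have c: "c \<in> strip k" using that assms(2) by blast
    show ?thesis using compact_sph_hull[OF finite_imageI zero_notin_hull] embedded_cell(3,5)[OF assms(1) c] by blast
  qed
  ultimately show ?thesis by (intro compact_Union) auto
qed

text \<open>A surface on which the projection to the Clifford torus is a bijection separates the points
  above it from the points below it.\<close>

lemma graph_separates:
  assumes B: "compact B" "B \<subseteq> S3eq - (clifford 0 \<union> clifford 2)" and inj: "inj_on proj1 B"
    and surj: "!!y. y \<in> S3eq ==> zc y \<noteq> 0 ==> wc y \<noteq> 0 ==> \<exists>b\<in>B. proj1 b = proj1 y"
    and C: "connected C" "C \<subseteq> S3eq - B" "clifford 0 \<subseteq> C"
    and x: "x \<in> S3eq" "x \<in> closure C" "zc x \<noteq> 0" "wc x \<noteq> 0"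
    and b: "b \<in> B" "proj1 b = proj1 x"
  shows "norm (wc x) * norm (zc b) \<le> norm (zc x) * norm (wc b)"
proof (rule ccontr)
  assume neg: "\<not> ?thesis"
  have nz: "zc y \<noteq> 0" "wc y \<noteq> 0" "y \<in> S3eq" if "y \<in> B" for y
    using B(2) that clifford0_iff clifford2_iff by blast+
  \<comment> \<open>The inverse of an injective continuous map on a compact set is continuous;
    surjectivity then gives a continuous retraction \<open>g\<close> of the sphere without the two
    circles onto \<open>B\<close>.\<close>
  define f where "f = the_inv_into B proj1"
  define D where "D = {y \<in> S3eq. zc y \<noteq> 0 \<and> wc y \<noteq> 0}"
  have BD: "B \<subseteq> D" using nz by (auto simp: D_def)
  have cp: "continuous_on D proj1"
  proof -
    have "continuous_on D (\<lambda>y. mk ((1 / (sqrt 2 * norm (zc y))) *\<^sub>R zc y) ((1 / (sqrt 2 * norm (wc y))) *\<^sub>R wc y) 0)"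
    proof -
      have lin: "linear (\<lambda>p::complex \<times> complex. mk (fst p) (snd p) 0)"
        by (auto intro!: linearI simp: eq5_iff)
      have "continuous_on D (\<lambda>y. ((1 / (sqrt 2 * norm (zc y))) *\<^sub>R zc y, (1 / (sqrt 2 * norm (wc y))) *\<^sub>R wc y))"
        by (intro continuous_intros continuous_zc continuous_wc) (auto simp: D_def)
      from continuous_on_compose2[OF linear_continuous_on[OF linear_conv_bounded_linear[THEN iffD1, OF lin]] this subset_UNIV]
      show ?thesis by simp
    qed
    then show ?thesis by (rule continuous_on_eq) (simp add: proj1_mk)
  qed
  have cf: "continuous_on (proj1 ` B) f"
    unfolding f_def by (rule continuous_on_inv_into[OF continuous_on_subset[OF cp BD] B(1)]) (use inj in \<open>simp add: the_inv_into_f_f\<close>)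
  have im: "proj1 ` D \<subseteq> proj1 ` B" proof
    fix q assume "q \<in> proj1 ` D"
    then obtain y where "y \<in> D" "q = proj1 y" by blast
    then show "q \<in> proj1 ` B" using surj[of y] unfolding D_def by (metis (mono_tags, lifting) imageI mem_Collect_eq)
  qed
  define g where "g y = f (proj1 y)" for y
  have cg: "continuous_on D g" unfolding g_def by (rule continuous_on_compose2[OF cf cp im])
  have gB: "g y \<in> B" "proj1 (g y) = proj1 y" if "y \<in> D" for y
  proof -
    have "proj1 y \<in> proj1 ` B" using im that by blast
    then show "g y \<in> B" "proj1 (g y) = proj1 y" unfolding g_def f_def
      using the_inv_into_into[OF inj _ subset_refl] f_the_inv_into_f[OF inj] by auto
  qed
  \<comment> \<open>Compares \<open>y\<close> with the point of \<open>B\<close> over the same torus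
    point: positive on the side of \<open>clifford 0\<close>, and zero only on
    \<open>B\<close>.\<close>
  define h where "h y = norm (zc y) * norm (wc (g y)) - norm (wc y) * norm (zc (g y))" for y
  have ch: "continuous_on D h" unfolding h_def
    by (intro continuous_intros continuous_on_compose2[OF continuous_zc cg] continuous_on_compose2[OF continuous_wc cg] continuous_zc continuous_wc) auto
  have h0: "y \<in> B" if yD: "y \<in> D" and hy: "h y = 0" for y
  proof -
    have gn: "zc (g y) \<noteq> 0" "wc (g y) \<noteq> 0" "g y \<in> S3eq" using nz gB(1)[OF yD] by auto
    have yn: "zc y \<noteq> 0" "wc y \<noteq> 0" "y \<in> S3eq" using yD by (auto simp: D_def)
    obtain p q where pq: "0 < p" "0 < q" "zc (g y) = p *\<^sub>R zc y" "wc (g y) = q *\<^sub>R wc y"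
      using proj1_eqD[OF gB(2)[OF yD] gn(1,2) yn(1,2)] by blast
    have "norm (zc y) * (q * norm (wc y)) = norm (wc y) * (p * norm (zc y))"
      using hy pq by (simp add: h_def)
    then have "p = q" using yn by simp
    then have "g y = p *\<^sub>R y" using pq gn yn by (simp add: eq5_iff S3eq_iff)
    moreover from this have "p = 1" using gn yn pq by (simp add: S3eq_iff)
    ultimately show ?thesis using gB(1)[OF yD] by simp
  qed
  obtain M where M: "\<forall>y\<in>B. norm (zc y) / norm (wc y) \<le> M \<and> norm (wc y) / norm (zc y) \<le> M"
  proof -
    have c: "continuous_on B (\<lambda>y. norm (zc y) / norm (wc y) + norm (wc y) / norm (zc y))"
      by (intro continuous_intros continuous_zc continuous_wc) (use nz in auto)
    obtain M where "\<forall>y\<in>B. norm (norm (zc y) / norm (wc y) + norm (wc y) / norm (zc y)) \<le> M"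
      using compact_imp_bounded[OF compact_continuous_image[OF c B(1)]] unfolding bounded_iff by auto
    then have "norm (zc y) / norm (wc y) \<le> M \<and> norm (wc y) / norm (zc y) \<le> M" if "y \<in> B" for y
      using that by (smt (verit) divide_nonneg_nonneg norm_ge_zero real_norm_def)
    then show ?thesis using that by blast
  qed
  have M': "norm (zc y) \<le> M * norm (wc y)" "norm (wc y) \<le> M * norm (zc y)" if "y \<in> B" for y
    using M nz[OF that] that by (auto simp: divide_le_eq)
  have M0: "0 < M"
  proof (rule ccontr)
    assume "\<not> 0 < M"
    then have "M * norm (wc b) \<le> 0" by (simp add: mult_nonpos_nonneg)
    then show False using M'(1)[OF b(1)] nz(1)[OF b(1)] norm_le_zero_iff[of "zc b"] by linarith
  qed
  define U where "U = {y \<in> S3eq. M * norm (wc y) < norm (zc y)} \<union> {y \<in> D. 0 < h y}"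
  define V where "V = {y \<in> S3eq. M * norm (zc y) < norm (wc y)} \<union> {y \<in> D. h y < 0}"
  have oD: "openin (top_of_set S3eq) D"
  proof -
    have "openin (top_of_set S3eq) (S3eq \<inter> (\<lambda>y. norm (zc y) * norm (wc y)) -` {0<..})"
      by (intro continuous_openin_preimage_gen continuous_intros continuous_zc continuous_wc)
    moreover have "S3eq \<inter> (\<lambda>y. norm (zc y) * norm (wc y)) -` {0<..} = D" by (auto simp: D_def zero_less_mult_iff)
    ultimately show ?thesis by simp
  qed
  have oh: "openin (top_of_set S3eq) {y \<in> D. h y \<in> W}" if "open W" for W
  proof -
    have "openin (top_of_set D) (D \<inter> h -` W)" using ch that by (rule continuous_openin_preimage_gen)
    then have "openin (top_of_set S3eq) (D \<inter> h -` W)" by (rule openin_trans[OF _ oD])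
    moreover have "D \<inter> h -` W = {y \<in> D. h y \<in> W}" by auto
    ultimately show ?thesis by simp
  qed
  have oM: "openin (top_of_set S3eq) {y \<in> S3eq. 0 < \<phi> y}" if "continuous_on S3eq \<phi>" for \<phi> :: "real^5 => real"
  proof -
    have "openin (top_of_set S3eq) (S3eq \<inter> \<phi> -` {0<..})" using that by (rule continuous_openin_preimage_gen) simp
    moreover have "S3eq \<inter> \<phi> -` {0<..} = {y \<in> S3eq. 0 < \<phi> y}" by auto
    ultimately show ?thesis by simp
  qed
  have oU: "openin (top_of_set S3eq) U"
  proof -
    have "openin (top_of_set S3eq) {y \<in> S3eq. 0 < norm (zc y) - M * norm (wc y)}"
      by (intro oM continuous_intros continuous_zc continuous_wc)
    then show ?thesis unfolding U_def using oh[of "{0<..}"] by (intro openin_Un) auto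
  qed
  have oV: "openin (top_of_set S3eq) V"
  proof -
    have "openin (top_of_set S3eq) {y \<in> S3eq. 0 < norm (wc y) - M * norm (zc y)}"
      by (intro oM continuous_intros continuous_zc continuous_wc)
    then show ?thesis unfolding V_def using oh[of "{..<0}"] by (intro openin_Un) auto
  qed
  have hM: "0 < h y" if "y \<in> D" "M * norm (wc y) < norm (zc y)" for y
  proof -
    have "norm (zc (g y)) \<le> M * norm (wc (g y))" using M'(1) gB that by blast
    then have "norm (wc y) * norm (zc (g y)) \<le> norm (wc y) * (M * norm (wc (g y)))" by (intro mult_left_mono) auto
    also have "\<dots> < norm (zc y) * norm (wc (g y))" using that(2) nz(2)[OF gB(1)[OF that(1)]] by (simp add: mult_ac)
    finally show ?thesis by (simp add: h_def)
  qed
  have hM2: "h y < 0" if "y \<in> D" "M * norm (zc y) < norm (wc y)" for y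
  proof -
    have "norm (wc (g y)) \<le> M * norm (zc (g y))" using M'(2) gB that by blast
    then have "norm (zc y) * norm (wc (g y)) \<le> norm (zc y) * (M * norm (zc (g y)))" by (intro mult_left_mono) auto
    also have "\<dots> < norm (wc y) * norm (zc (g y))" using that(2) nz(1)[OF gB(1)[OF that(1)]] by (simp add: mult_ac)
    finally show ?thesis by (simp add: h_def)
  qed
  have n0: "zc y \<noteq> 0 \<or> wc y \<noteq> 0" if "y \<in> S3eq" for y using that norm5[of y] by (auto simp: S3eq_iff)
  have "U \<inter> V = {}"
  proof -
    have False if "y \<in> U" "y \<in> V" for y
    proof (cases "y \<in> D")
      case True
      have "0 < h y" using that(1) hM[OF True] by (auto simp: U_def)
      moreover have "h y < 0" using that(2) hM2[OF True] by (auto simp: V_def)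
      ultimately show False by simp
    next
      case False
      then have 1: "M * norm (wc y) < norm (zc y)" "M * norm (zc y) < norm (wc y)" "y \<in> S3eq" using that by (auto simp: U_def V_def)
      then have "zc y = 0 \<or> wc y = 0" using False by (auto simp: D_def)
      moreover have "0 \<le> M * norm (wc y)" "0 \<le> M * norm (zc y)" using M0 by simp_all
      ultimately show False using 1 n0[of y] by auto
    qed
    then show ?thesis by blast
  qed
  have cov: "C \<subseteq> U \<union> V"
  proof
    fix y assume "y \<in> C"
    then have y: "y \<in> S3eq" "y \<notin> B" using C(2) by auto
    show "y \<in> U \<union> V"
    proof (cases "y \<in> D")
      case True
      then have "h y \<noteq> 0" using h0 y by blast
      then show ?thesis using True by (auto simp: U_def V_def)
    next
      case False
      then show ?thesis using y n0[of y] by (auto simp: U_def V_def D_def)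
    qed
  qed
  have CS: "C \<subseteq> S3eq" using C(2) by blast
  have "mk 1 0 0 \<in> clifford 0" by (simp add: clifford0_iff S3eq_iff)
  then have CU: "C \<inter> U \<noteq> {}" using C(3) by (force simp: U_def S3eq_iff)
  have xD: "x \<in> D" using x by (simp add: D_def)
  have "g x = b" using gB[OF xD] b inj inj_onD[OF inj, of "g x" b] by simp
  then have "h x < 0" using neg by (simp add: h_def)
  then have xV: "x \<in> V" using xD by (simp add: V_def)
  obtain G where G: "open G" "V = S3eq \<inter> G" using oV by (auto simp: openin_open)
  have "G \<inter> C \<noteq> {}" using x(2) xV G open_Int_closure_eq_empty[OF G(1)] by blast
  then have CV: "C \<inter> V \<noteq> {}" using G(2) CS by blast
  have "openin (top_of_set C) (C \<inter> X)" if X: "openin (top_of_set S3eq) X" for X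
  proof -
    obtain G where "open G" "X = S3eq \<inter> G" using X by (auto simp: openin_open)
    then show ?thesis using CS by (auto simp: openin_open)
  qed
  then have "openin (top_of_set C) (C \<inter> U)" "openin (top_of_set C) (C \<inter> V)" using oU oV by blast+
  then show False using C(1) cov CU CV \<open>U \<inter> V = {}\<close> unfolding connected_openin by blast
qed

text \<open>If \<open>E\<close> decayed, \<open>inward_top\<close> would put layer \<open>k\<close>
  strictly beyond the band of layers \<open>k-3\<close> to \<open>k-1\<close>, as seen from
  \<open>clifford 0\<close>. A component that contains this circle cannot cross the band, so its
  closure would miss layer \<open>k\<close>. The band is centred at \<open>k - 2\<close> in order to
  exclude layer \<open>k\<close>.\<close>

lemma oriented_outward:
  assumes Q: "embedded (gv Z (\<lambda>_. 0) \<eta>) k" and k: "3 \<le> k" and \<eta>: "\<eta> = 1 \<or> \<eta> = (-1::real)"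
    and A: "A \<noteq> 0" and ok: "seq_ok \<tau> E" and Z: "!!m. m \<le> k ==> Z m = seqZ A \<tau> E m"
    and E: "!!m. m < k ==> 0 < E (m+1)" and W: "0 < cas E 0"
    and avoid: "(\<Union>c\<in>layers3 k (k-2). sph_hull (gv Z (\<lambda>_. 0) \<eta> ` c)) \<subseteq> S3eq - (clifford 0 \<union> clifford 2)"
    and inj: "inj_on proj1 (\<Union>c\<in>layers3 k (k-2). sph_hull (gv Z (\<lambda>_. 0) \<eta> ` c))"
    and C: "C \<in> components (S3eq - \<Union> (cells (cone_model (gv Z (\<lambda>_. 0) \<eta>) k)))" "clifford 0 \<subseteq> C"
    and cl: "closure C \<inter> layer (cone_model (gv Z (\<lambda>_. 0) \<eta>) k) (int k) \<noteq> {}"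
  shows "(1+\<tau>) * E 1 < \<tau> * E 2"
proof (rule ccontr)
  assume neg: "\<not> ?thesis"
  let ?P = "gv Z (\<lambda>_. 0) \<eta>"
  have E12: "0 < E 1" "0 < E 2" using E[of 0] E[of 1] k by (simp_all add: numeral_2_eq_2)
  have inw0: "(1+\<tau>) * E 2 < E 1" using neg cas_dichotomy[OF ok W] E12 by (simp add: numeral_2_eq_2)
  have inw: "(1+\<tau>) * E (n+2) < E (n+1)" if "n + 2 \<le> k" for n by (rule inward_step[OF ok W E inw0 that])
  obtain m where m: "k = m + 3" using k by (metis add.commute le_Suc_ex)
  have km: "k - 2 = Suc m" using m by simp
  have Epos: "0 < E (m+1)" "0 < E (m+2)" "0 < E (m+3)"
    using E[of m] E[of "m+1"] E[of "m+2"] m by (simp_all add: numeral_3_eq_3)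
  have i: "(1+\<tau>) * E (m+2) < E (m+1)" "(1+\<tau>) * E (m+3) < E (m+2)"
    using inw[of m] inw[of "m+1"] m by (simp_all add: numeral_3_eq_3 numeral_2_eq_2)
  have \<tau>: "0 < \<tau>" using seq_pos[OF ok] .
  \<comment> \<open>For \<open>m = 0\<close> positivity is not among the hypotheses; under decay the
    recurrence supplies it.\<close>
  have E0: "0 < E m"
  proof -
    have "E m = (1+\<tau>) * E (m+1) + ((1+\<tau>) * E (m+1) - \<tau> * E (m+2))" using seq_rec[OF ok, of m] by (simp add: algebra_simps)
    moreover have "\<tau> * E (m+2) < (1+\<tau>) * E (m+1)"
    proof -
      have "E (m+2) < E (m+1)" using i(1) mult_pos_pos[OF \<tau> Epos(2)] unfolding distrib_right by linarith
      then have "\<tau> * E (m+2) < \<tau> * E (m+1)" using \<tau> by simp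
      then show ?thesis using Epos by (simp add: distrib_right)
    qed
    moreover have "0 < (1+\<tau>) * E (m+1)" using \<tau> Epos by simp
    ultimately show ?thesis by linarith
  qed
  have fan: "fan_ok (oct \<tau> E m x y)" if "0 < x" "0 \<le> y" for x y
    using oct_fan[OF ok W E0 Epos that] .
  have ZY: "Z n = A * seqY \<tau> E n" if "n \<le> k" for n using Z[OF that] by (simp add: seqZ_def seqY_def)
  have Z3: "Z m = A * seqY \<tau> E m" "Z (m+1) = A * seqY \<tau> E (m+1)" "Z (m+2) = A * seqY \<tau> E (m+2)"
    using ZY m by simp_all
  have \<eta>0: "\<eta> \<noteq> 0" using \<eta> by auto
  have mk2: "m + 2 \<le> k" using m by simp
  define B where "B = (\<Union>c\<in>layers3 k (Suc m). sph_hull (?P ` c))"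
  have cB: "compact B" unfolding B_def by (rule finite_cells_union[OF Q]) auto
  have BS: "B \<subseteq> S3eq - (clifford 0 \<union> clifford 2)" and iB: "inj_on proj1 B" using avoid inj unfolding km B_def by simp_all
  have lift: "\<exists>c p t. c \<in> layers3 k (Suc m) \<and> p \<in> pcone ?P c \<and> 0 < t \<and> zc p = t *\<^sub>R zc y \<and> wc p = wc y \<and> p \<noteq> 0 \<and> sgn p \<in> B \<and> proj1 (sgn p) = proj1 y"
    if y: "zc y \<noteq> 0" "wc y \<noteq> 0" for y
  proof -
    obtain c p t where c: "c \<in> layers3 k (Suc m)" "p \<in> pcone ?P c" "0 < t" "zc p = t *\<^sub>R zc y" "wc p = wc y"
      by (rule band_surjective[OF fan A \<eta>0 mk2 Z3 y])
    have p0: "p \<noteq> 0" using c(5) y by auto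
    have cs: "c \<in> strip k" using c(1) by simp
    have "sgn p \<in> sph_hull (?P ` c)" using sgn_pcone[OF embedded_cell(5,3)[OF Q cs] c(2) p0] .
    then have "sgn p \<in> B" unfolding B_def using c(1) by blast
    moreover have "proj1 (sgn p) = proj1 y"
      by (rule proj1_eqI[where a="t / norm p" and b="1 / norm p"]) (use c p0 in \<open>simp_all add: sgn_div_norm divide_inverse mult.commute\<close>)
    ultimately show ?thesis using c p0 by blast
  qed
  obtain x where x: "x \<in> closure C" "x \<in> layer (cone_model ?P k) (int k)" using cl by blast
  obtain v where v: "csum v = int k" "x = sgn (?P v)"
    using x(2) unfolding layer_cone_model[OF Q of_nat_0_le_iff order_refl] by auto
  have Pv: "zc (?P v) = ii (v$3) * (A * seqY \<tau> E k)" "wc (?P v) = \<eta> *\<^sub>R om (v$1 - v$2)" "?P v $ 5 = 0"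
    using v(1) ZY by (simp_all add: gv_def)
  have Yk: "seqY \<tau> E k \<noteq> 0" using Epos m by (simp add: seqY_def complex_eq_iff)
  have z0: "zc (?P v) \<noteq> 0" "wc (?P v) \<noteq> 0" using Pv A Yk \<eta>0 by simp_all
  obtain c p t where p: "c \<in> layers3 k (Suc m)" "p \<in> pcone ?P c" "0 < t" "zc p = t *\<^sub>R zc (?P v)" "wc p = wc (?P v)"
    "p \<noteq> 0" "sgn p \<in> B" "proj1 (sgn p) = proj1 (?P v)" using lift[OF z0] by blast
  have "1 < t"
  proof -
    have "on_band A \<tau> E \<eta> m (zc p) (wc p)"
      by (rule band_point[OF ok Epos(1,2) p(1,2,6) Z3]) (use p(5) z0 in simp)
    then obtain j \<sigma> x y n r where ob: "\<sigma> = 1 \<or> \<sigma> = (-1::real)" "0 < x" "0 \<le> y" "n \<le> 3" "0 \<le> r" "r \<le> 1"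
      "wc p = \<eta> *\<^sub>R (om j * (of_real x + of_real y * om 1))" "zc p = A * ii (j + int m) * (\<sigma> *\<^sub>R fan_seg (oct \<tau> E m x y) n r)"
      unfolding on_band_def by blast
    have "\<eta> *\<^sub>R (om j * (of_real x + of_real y * om 1)) = \<eta> *\<^sub>R om (v$1 - v$2)" using ob(7) p(5) Pv(2) by (simp only:)
    then have weq: "om j * (of_real x + of_real y * om 1) = om (v$1 - v$2) * (of_real 1 + of_real 0 * om 1)" using \<eta>0 by simp
    have xy: "x = 1" "y = 0" using om_wedge_unique(1,2)[OF weq ob(2,3)] by simp_all
    obtain i where ji: "v$1 - v$2 = j + 6 * i" using om_wedge_unique(3)[OF weq ob(2,3)] by auto
    \<comment> \<open>Layers \<open>m\<close> and \<open>m + 3\<close> have opposite parity, which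
      accounts for the extra factor \<open>\<i>\<close>.\<close>
    have "even (v$3 - (j + int m + 1))"
    proof -
      have "v$1 + v$2 + v$3 = int m + 3" using v(1) m by (simp add: csum_def)
      then have "v$3 - (j + int m + 1) = 2 * (1 - v$1 + 3 * i)" using ji by (simp add: algebra_simps)
      then show ?thesis by (metis dvd_triv_left)
    qed
    then obtain \<sigma>' where s': "\<sigma>' = 1 \<or> \<sigma>' = (-1::real)" "ii (v$3) = of_real \<sigma>' * ii (j + int m + 1)" using ii_parity by blast
    have "zc p = t *\<^sub>R (of_real \<sigma>' * (ii (j + int m) * \<i>) * (A * seqY \<tau> E k))" using p(4) Pv(1) s'(2) by (simp add: ii_add)
    then have "A * ii (j + int m) * (\<sigma> *\<^sub>R fan_seg (oct \<tau> E m 1 0) n r) = A * ii (j + int m) * ((t * \<sigma>') *\<^sub>R (\<i> * seqY \<tau> E k))"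
      using ob(8) xy by (simp add: scaleR_conv_of_real mult_ac)
    moreover have "A * ii (j + int m) \<noteq> 0" using A by simp
    ultimately have "\<sigma> *\<^sub>R fan_seg (oct \<tau> E m 1 0) n r = (t * \<sigma>') *\<^sub>R (\<i> * seqY \<tau> E k)" using mult_left_cancel by blast
    then have "\<sigma> *\<^sub>R \<sigma> *\<^sub>R fan_seg (oct \<tau> E m 1 0) n r = \<sigma> *\<^sub>R (t * \<sigma>') *\<^sub>R (\<i> * seqY \<tau> E k)" by (simp only:)
    then have "(t * (\<sigma>' * \<sigma>)) *\<^sub>R (\<i> * seqY \<tau> E (m+3)) = fan_seg (oct \<tau> E m 1 0) n r" using ob(1) m by (auto simp: mult_ac)
    from inward_top[OF ok W E0 Epos i ob(4-6) _ p(3) this] show "1 < t" using ob(1) s'(1) by auto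
  qed
  moreover have "t \<le> 1"
  proof -
    have nP: "?P v \<noteq> 0" using z0 by auto
    have CB: "C \<subseteq> S3eq - B"
    proof -
      have "B \<subseteq> \<Union> (cells (cone_model ?P k))"
        unfolding B_def cells_cone_model[OF embedded_periodic[OF Q]] by blast
      then show ?thesis using in_components_subset[OF C(1)] by blast
    qed
    have px: "proj1 (sgn p) = proj1 x"
      unfolding p(8) v(2) by (rule proj1_eqI[where a="norm (?P v)" and b="norm (?P v)"]) (use nP in \<open>simp_all add: sgn_div_norm\<close>)
    have xS: "x \<in> S3eq" using v(2) nP Pv(3) by (simp add: S3eq_iff norm_sgn) (simp add: sgn_div_norm)
    have surj: "\<exists>b\<in>B. proj1 b = proj1 y" if "zc y \<noteq> 0" "wc y \<noteq> 0" for y using lift[OF that] by blast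
    have xz: "zc x \<noteq> 0" "wc x \<noteq> 0" using v(2) z0 nP by (simp_all add: sgn_div_norm)
    have "norm (wc x) * norm (zc (sgn p)) \<le> norm (zc x) * norm (wc (sgn p))"
      by (rule graph_separates[OF cB BS iB surj in_components_connected[OF C(1)] CB C(2) xS x(1) xz p(7) px])
    then have "norm (wc (?P v)) * (t * norm (zc (?P v))) \<le> norm (zc (?P v)) * norm (wc (?P v))"
      using p(3-6) nP v(2) by (simp add: sgn_div_norm divide_simps mult_ac)
    then show ?thesis using z0 by (simp add: mult.commute[of t] mult.left_commute[of t] mult_le_cancel_left1)
  qed
  ultimately show False by simp
qed

section \<open>Convexity of the cubes\<close>

text \<open>Closure under mixing coordinates makes \<open>S\<close> a product of its coordinate
  ranges; \<open>J\<close> collects the directions in which \<open>S\<close> varies.\<close>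

lemma is_cellI:
  assumes ne: "S \<noteq> {}" and sub: "S \<subseteq> unit_cell v UNIV"
    and mix: "!!x y z. x \<in> S ==> y \<in> S ==> (!!i. z $ i = x $ i \<or> z $ i = y $ i) ==> z \<in> S"
  shows "is_cell S"
proof -
  define J where "J = {i. \<exists>x\<in>S. \<exists>y\<in>S. x $ i \<noteq> y $ i}"
  define u :: "int^3" where "u = (\<chi> i. if \<forall>x\<in>S. x $ i = v $ i + 1 then v $ i + 1 else v $ i)"
  have S01: "x $ i = v $ i \<or> x $ i = v $ i + 1" if "x \<in> S" for x i using that sub by (auto simp: unit_cell_def)
  have "S = unit_cell u J"
  proof (rule set_eqI, rule iffI)
    fix x assume x: "x \<in> S"
    have "x $ i = u $ i \<or> i \<in> J \<and> x $ i = u $ i + 1" for i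
    proof (cases "\<forall>x\<in>S. x $ i = v $ i + 1")
      case True then show ?thesis using x by (simp add: u_def)
    next
      case False
      then obtain y where y: "y \<in> S" "y $ i \<noteq> v $ i + 1" by blast
      then have "i \<in> J" if "x $ i \<noteq> v $ i" using x that S01[OF x, of i] y unfolding J_def by force
      then show ?thesis using False S01[OF x, of i] by (auto simp: u_def)
    qed
    then show "x \<in> unit_cell u J" by (simp add: unit_cell_def)
  next
    fix w assume w: "w \<in> unit_cell u J"
    have ex: "\<exists>x\<in>S. x $ i = w $ i" for i
    proof (cases "\<forall>x\<in>S. x $ i = v $ i + 1")
      case True
      then have "i \<notin> J" "u $ i = v $ i + 1" by (auto simp: J_def u_def)
      moreover have "w $ i = u $ i \<or> i \<in> J \<and> w $ i = u $ i + 1" using w by (simp add: unit_cell_def)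
      ultimately show ?thesis using True ne by auto
    next
      case False
      then obtain y where y: "y \<in> S" "y $ i = v $ i" using S01 by blast
      have ui: "u $ i = v $ i" unfolding u_def using False by auto
      show ?thesis
      proof (cases "w $ i = v $ i")
        case True then show ?thesis using y by auto
      next
        case False
        moreover have "w $ i = u $ i \<or> i \<in> J \<and> w $ i = u $ i + 1" using w by (simp add: unit_cell_def)
        ultimately have "i \<in> J" "w $ i = v $ i + 1" using ui by auto
        then obtain a b where "a \<in> S" "b \<in> S" "a $ i \<noteq> b $ i" by (auto simp: J_def)
        then show ?thesis using S01 \<open>w $ i = v $ i + 1\<close> by metis
      qed
    qed
    obtain x1 where x1: "x1 \<in> S" "x1 $ 1 = w $ 1" using ex by blast
    obtain x2 where x2: "x2 \<in> S" "x2 $ 2 = w $ 2" using ex by blast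
    obtain x3 where x3: "x3 \<in> S" "x3 $ 3 = w $ 3" using ex by blast
    have all3: "P i" if "P 1" "P 2" "P 3" for P :: "3 => bool" and i using that forall_3[of P] by blast
    define y :: "int^3" where "y = vector [w $ 1, w $ 2, x1 $ 3]"
    have "y \<in> S" by (rule mix[OF x1(1) x2(1)], rule all3) (simp_all add: y_def x1 x2)
    then show "w \<in> S" by (rule mix[OF _ x3(1)], rule_tac i=i in all3) (simp_all add: y_def x3)
  qed
  then show ?thesis by simp
qed

text \<open>\<open>B\<close> stands for the values of a functional at the corners of a cube.
  Relations with positive coefficients spread two zeros on the diagonal of a face over that face;
  for two zeros on a space diagonal, combined relations reach the whole cube.\<close>

lemma cube_zero_mix:
  fixes B :: "bool => bool => bool => real"
  assumes pos: "!!a b c. 0 \<le> B a b c" and \<tau>: "0 < \<tau>" and \<kappa>: "0 < \<kappa>" "1 < 2 * \<kappa> * (1+\<tau>)"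
    and r12: "!!c. B False False c + \<tau> * B True True c = (1+\<tau>) * (B True False c + B False True c)"
    and r13: "\<kappa> * B False False False + B True False True = \<kappa> * B False False True + B True False False"
    and r23: "\<kappa> * B False False False + B False True True = \<kappa> * B False False True + B False True False"
    and x: "B x1 x2 x3 = 0" and y: "B y1 y2 y3 = 0"
    and z: "z1 = x1 \<or> z1 = y1" "z2 = x2 \<or> z2 = y2" "z3 = x3 \<or> z3 = y3"
  shows "B z1 z2 z3 = 0"
proof -
  have two: "b = 0 \<and> c = 0" if "0 \<le> b" "0 \<le> c" "0 < \<beta>" "0 < \<gamma>" "\<beta> * b + \<gamma> * c = 0" for b c \<beta> \<gamma> :: real
    using that add_nonneg_eq_0_iff[of "\<beta> * b" "\<gamma> * c"] by auto
  let ?F = False and ?T = True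
  \<comment> \<open>The ratio for the upper faces containing direction 3, forced by consistency with
    the relations in directions 1 and 2. The second condition on \<kappa> is exactly its
    positivity.\<close>
  define \<kappa>' where "\<kappa>' = (2 * \<kappa> * (1+\<tau>) - 1) / (\<tau> * \<kappa>)"
  have \<kappa>': "0 < \<kappa>'" "\<tau> * \<kappa> * \<kappa>' = 2 * \<kappa> * (1+\<tau>) - 1" using \<kappa> \<tau> by (simp_all add: \<kappa>'_def)
  have r13': "\<kappa>' * B ?F ?T ?F + B ?T ?T ?T = \<kappa>' * B ?F ?T ?T + B ?T ?T ?F"
    and r23': "\<kappa>' * B ?T ?F ?F + B ?T ?T ?T = \<kappa>' * B ?T ?F ?T + B ?T ?T ?F"
  proof -
    let ?s = "B ?F ?F ?T - B ?F ?F ?F"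
    have d: "B ?T ?F ?T - B ?T ?F ?F = \<kappa> * ?s" "B ?F ?T ?T - B ?F ?T ?F = \<kappa> * ?s"
      using r13 r23 by (simp_all add: algebra_simps)
    have "\<tau> * (B ?T ?T ?T - B ?T ?T ?F) = (1+\<tau>) * ((B ?T ?F ?T - B ?T ?F ?F) + (B ?F ?T ?T - B ?F ?T ?F)) - ?s"
      using r12[of ?T] r12[of ?F] by (simp add: algebra_simps)
    also have "\<dots> = (2 * \<kappa> * (1+\<tau>) - 1) * ?s" unfolding d by (simp add: algebra_simps)
    also have "\<dots> = \<tau> * (\<kappa>' * (\<kappa> * ?s))" unfolding \<kappa>'(2)[symmetric] by (simp add: algebra_simps)
    finally have t: "B ?T ?T ?T - B ?T ?T ?F = \<kappa>' * (\<kappa> * ?s)" using \<tau> by simp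
    then show "\<kappa>' * B ?F ?T ?F + B ?T ?T ?T = \<kappa>' * B ?F ?T ?T + B ?T ?T ?F" unfolding d(2)[symmetric] by (simp add: algebra_simps)
    show "\<kappa>' * B ?T ?F ?F + B ?T ?T ?T = \<kappa>' * B ?T ?F ?T + B ?T ?T ?F" using t unfolding d(1)[symmetric] by (simp add: algebra_simps)
  qed
  have sq: "(a = 0 \<and> d = 0) \<longleftrightarrow> (b = 0 \<and> c = 0)" if "\<alpha> * a + \<delta> * d = \<beta> * b + \<gamma> * c" "0 \<le> a" "0 \<le> b" "0 \<le> c" "0 \<le> d" "0 < \<alpha>" "0 < \<beta>" "0 < \<gamma>" "0 < \<delta>"
    for a b c d \<alpha> \<beta> \<gamma> \<delta> :: real using that two[of b c \<beta> \<gamma>] two[of a d \<alpha> \<delta>] by auto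
  have q12: "B ?F ?F c = 0 \<and> B ?T ?T c = 0 \<longleftrightarrow> B ?T ?F c = 0 \<and> B ?F ?T c = 0" for c
    by (rule sq[where \<alpha>=1 and \<delta>=\<tau> and \<beta>="1+\<tau>" and \<gamma>="1+\<tau>"]) (use r12[of c] \<tau> pos in \<open>auto simp: distrib_left\<close>)
  have q13: "B ?F ?F ?F = 0 \<and> B ?T ?F ?T = 0 \<longleftrightarrow> B ?F ?F ?T = 0 \<and> B ?T ?F ?F = 0"
    by (rule sq[where \<alpha>=\<kappa> and \<delta>=1 and \<beta>=\<kappa> and \<gamma>=1]) (use r13 \<kappa> pos in auto)
  have q23: "B ?F ?F ?F = 0 \<and> B ?F ?T ?T = 0 \<longleftrightarrow> B ?F ?F ?T = 0 \<and> B ?F ?T ?F = 0"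
    by (rule sq[where \<alpha>=\<kappa> and \<delta>=1 and \<beta>=\<kappa> and \<gamma>=1]) (use r23 \<kappa> pos in auto)
  have q13': "B ?F ?T ?F = 0 \<and> B ?T ?T ?T = 0 \<longleftrightarrow> B ?F ?T ?T = 0 \<and> B ?T ?T ?F = 0"
    by (rule sq[where \<alpha>=\<kappa>' and \<delta>=1 and \<beta>=\<kappa>' and \<gamma>=1]) (use r13' \<kappa>' pos in auto)
  have q23': "B ?T ?F ?F = 0 \<and> B ?T ?T ?T = 0 \<longleftrightarrow> B ?T ?F ?T = 0 \<and> B ?T ?T ?F = 0"
    by (rule sq[where \<alpha>=\<kappa>' and \<delta>=1 and \<beta>=\<kappa>' and \<gamma>=1]) (use r23' \<kappa>' pos in auto)
  have s12: "B (\<not>a) b c = 0 \<and> B a (\<not>b) c = 0" if "B a b c = 0" "B (\<not>a) (\<not>b) c = 0" for a b c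
    using that q12[of c] by (cases a; cases b) auto
  have s13: "B (\<not>a) b c = 0 \<and> B a b (\<not>c) = 0" if "B a b c = 0" "B (\<not>a) b (\<not>c) = 0" for a b c
    using that q13 q13' by (cases a; cases b; cases c) auto
  have s23: "B a (\<not>b) c = 0 \<and> B a b (\<not>c) = 0" if "B a b c = 0" "B a (\<not>b) (\<not>c) = 0" for a b c
    using that q23 q23' by (cases a; cases b; cases c) auto
  have three: "b = 0 \<and> c = 0 \<and> d = 0" if "0 \<le> b" "0 \<le> c" "0 \<le> d" "0 < \<beta>" "0 < \<gamma>" "0 < \<delta>" "\<beta> * b + \<gamma> * c + \<delta> * d = 0" for b c d \<beta> \<gamma> \<delta> :: real
  proof -
    have "0 \<le> \<beta> * b" "0 \<le> \<gamma> * c" "0 \<le> \<delta> * d" using that by simp_all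
    then have "\<beta> * b = 0" "\<gamma> * c = 0" "\<delta> * d = 0" using that(7) by linarith+
    then show ?thesis using that by simp
  qed
  have full: "B ?F ?F ?F = 0 \<and> B ?T ?F ?F = 0 \<and> B ?F ?T ?F = 0 \<and> B ?F ?F ?T = 0" if ab: "B a b c = 0" "B (\<not>a) (\<not>b) (\<not>c) = 0" for a b c
  proof -
    have e13: "B ?T ?F ?T = \<kappa> * B ?F ?F ?T + B ?T ?F ?F - \<kappa> * B ?F ?F ?F" and e23: "B ?F ?T ?T = \<kappa> * B ?F ?F ?T + B ?F ?T ?F - \<kappa> * B ?F ?F ?F"
      and e12: "\<tau> * B ?T ?T ?F = (1+\<tau>) * (B ?T ?F ?F + B ?F ?T ?F) - B ?F ?F ?F"
      using r13 r23 r12[of ?F] by simp_all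
    \<comment> \<open>One relation per space diagonal: its two ends on one side, three other corners
      on the other, all coefficients positive.\<close>
    have d0: "\<tau> * B ?T ?T ?T + (\<tau> * \<kappa> * \<kappa>' + 1) * B ?F ?F ?F = (\<tau> * \<kappa> * \<kappa>') * B ?F ?F ?T + (1+\<tau>) * B ?T ?F ?F + (1+\<tau>) * B ?F ?T ?F"
    proof -
      have "\<tau> * B ?T ?T ?T = (1+\<tau>) * (B ?T ?F ?T + B ?F ?T ?T) - B ?F ?F ?T" using r12[of ?T] by simp
      moreover have "B ?T ?F ?T = \<kappa> * B ?F ?F ?T + B ?T ?F ?F - \<kappa> * B ?F ?F ?F" "B ?F ?T ?T = \<kappa> * B ?F ?F ?T + B ?F ?T ?F - \<kappa> * B ?F ?F ?F"
        using r13 r23 by simp_all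
      ultimately show ?thesis unfolding \<kappa>'(2) by (simp add: algebra_simps)
    qed
    have d1: "(1+\<tau>) * B ?F ?T ?T + (2 * (1+\<tau>)) * B ?T ?F ?F = (1+\<tau>) * B ?T ?F ?T + 1 * B ?F ?F ?F + \<tau> * B ?T ?T ?F"
      unfolding e13 e23 e12 by (simp add: algebra_simps)
    have d2: "(1+\<tau>) * B ?T ?F ?T + (2 * (1+\<tau>)) * B ?F ?T ?F = (1+\<tau>) * B ?F ?T ?T + 1 * B ?F ?F ?F + \<tau> * B ?T ?T ?F"
      unfolding e13 e23 e12 by (simp add: algebra_simps)
    have d3: "\<tau> * B ?T ?T ?F + (2 * \<kappa> * (1+\<tau>)) * B ?F ?F ?T = (1+\<tau>) * B ?T ?F ?T + (1+\<tau>) * B ?F ?T ?T + (2 * \<kappa> * (1+\<tau>) - 1) * B ?F ?F ?F"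
      unfolding e13 e23 e12 by (simp add: algebra_simps)
    consider "B ?F ?F ?F = 0" "B ?T ?T ?T = 0" | "B ?T ?F ?F = 0" "B ?F ?T ?T = 0" | "B ?F ?T ?F = 0" "B ?T ?F ?T = 0" | "B ?F ?F ?T = 0" "B ?T ?T ?F = 0"
      using ab by (cases a; cases b; cases c) auto
    then show ?thesis
    proof cases
      case 1
      then show ?thesis using d0 three[OF pos pos pos, of "\<tau> * \<kappa> * \<kappa>'" "1+\<tau>" "1+\<tau>" ?F ?F ?T ?T ?F ?F ?F ?T ?F] \<tau> \<kappa> \<kappa>' by simp
    next
      case 2
      then have "B ?T ?F ?T = 0 \<and> B ?F ?F ?F = 0 \<and> B ?T ?T ?F = 0" using d1 three[OF pos pos pos, of "1+\<tau>" 1 \<tau>] \<tau> by simp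
      then show ?thesis using 2 s12[of ?F ?F ?F] s23[of ?F ?F ?F] by simp
    next
      case 3
      then have "B ?F ?T ?T = 0 \<and> B ?F ?F ?F = 0 \<and> B ?T ?T ?F = 0" using d2 three[OF pos pos pos, of "1+\<tau>" 1 \<tau>] \<tau> by simp
      then show ?thesis using 3 s12[of ?F ?F ?F] s23[of ?F ?F ?F] by simp
    next
      case 4
      then have "B ?T ?F ?T = 0 \<and> B ?F ?T ?T = 0 \<and> B ?F ?F ?F = 0"
        using d3 three[OF pos pos pos, of "1+\<tau>" "1+\<tau>" "2 * \<kappa> * (1+\<tau>) - 1"] \<tau> \<kappa> by simp
      then show ?thesis using 4 s12[of ?F ?F ?F] by simp
    qed
  qed
  have all: "B p q r = 0" if "B a b c = 0" "B (\<not>a) (\<not>b) (\<not>c) = 0" for a b c p q r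
  proof -
    note f = full[OF that]
    have "B ?T ?T ?F = 0" using r12[of ?F] f \<tau> by simp
    moreover have "B ?T ?F ?T = 0" "B ?F ?T ?T = 0" using r13 r23 f by simp_all
    moreover from this have "B ?T ?T ?T = 0" using r12[of ?T] f \<tau> by simp
    ultimately show ?thesis using f by (cases p; cases q; cases r) simp_all
  qed
  show ?thesis
  proof (cases "y1 = x1")
    case e1: True
    show ?thesis
    proof (cases "y2 = x2 \<or> y3 = x3")
      case True then show ?thesis using x y z e1 by auto
    next
      case False
      then have "y2 = (\<not> x2)" "y3 = (\<not> x3)" by auto
      then show ?thesis using x y z e1 s23[of x1 x2 x3] by auto
    qed
  next
    case False
    then have e1: "y1 = (\<not> x1)" by auto
    consider "y2 = x2" "y3 = x3" | "y2 = x2" "y3 = (\<not> x3)" | "y2 = (\<not> x2)" "y3 = x3" | "y2 = (\<not> x2)" "y3 = (\<not> x3)" by auto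
    then show ?thesis
    proof cases
      case 1 then show ?thesis using x y z e1 by auto
    next
      case 2 then show ?thesis using x y z e1 s13[of x1 x2 x3] by auto
    next
      case 3 then show ?thesis using x y z e1 s12[of x1 x2 x3] by auto
    next
      case 4 then show ?thesis using x y e1 all[of x1 x2 x3 z1 z2 z3] by auto
    qed
  qed
qed

definition corner :: "int^3 => bool => bool => bool => int^3" where
  "corner v a b c = vector [v $ 1 + of_bool a, v $ 2 + of_bool b, v $ 3 + of_bool c]"

lemma corner_simps [simp]:
  "corner v a b c $ 1 = v $ 1 + of_bool a" "corner v a b c $ 2 = v $ 2 + of_bool b" "corner v a b c $ 3 = v $ 3 + of_bool c"
  by (simp_all add: corner_def)

lemma corner_eqs:
  "corner v False False False = v" "corner v True False False = v + ax 1" "corner v False True False = v + ax 2"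
  "corner v False False True = v + ax 3" "corner v True True False = v + ax 1 + ax 2"
  "corner v True False True = v + ax 1 + ax 3" "corner v False True True = v + ax 2 + ax 3"
  "corner v True True True = v + ax 3 + ax 1 + ax 2"
  by (simp_all add: vec_eq_iff forall_3 axis_def)

lemma cube_corner: "x \<in> unit_cell v UNIV \<longleftrightarrow> (\<exists>a b c. x = corner v a b c)"
proof
  assume "x \<in> unit_cell v UNIV"
  then have "x $ i = v $ i \<or> x $ i = v $ i + 1" for i by (simp add: unit_cell_def)
  then have "x = corner v (x $ 1 \<noteq> v $ 1) (x $ 2 \<noteq> v $ 2) (x $ 3 \<noteq> v $ 3)"
    by (simp add: vec_eq_iff forall_3) (metis add.commute)
  then show "\<exists>a b c. x = corner v a b c" by blast
qed (auto simp: unit_cell_def forall_3)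

text \<open>The corner \<open>v\<close> and its three neighbours are independent, and the relations
  express the other corners through them. Values prescribed on these four define a functional for
  each of the six facets; sums of these expose every face, and \<open>cube_zero_mix\<close> excludes
  any other zero set.\<close>

lemma cube_convex:
  fixes P :: "int^3 => real^5"
  assumes \<tau>: "0 < \<tau>" and \<kappa>: "0 < \<kappa>" "1 < 2 * \<kappa> * (1+\<tau>)"
    and r12: "P v + \<tau> *\<^sub>R P (v + ax 1 + ax 2) = (1+\<tau>) *\<^sub>R (P (v + ax 1) + P (v + ax 2))"
    and r12': "P (v + ax 3) + \<tau> *\<^sub>R P (v + ax 3 + ax 1 + ax 2) = (1+\<tau>) *\<^sub>R (P (v + ax 1 + ax 3) + P (v + ax 2 + ax 3))"
    and r13: "\<kappa> *\<^sub>R P v + P (v + ax 1 + ax 3) = \<kappa> *\<^sub>R P (v + ax 3) + P (v + ax 1)"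
    and r23: "\<kappa> *\<^sub>R P v + P (v + ax 2 + ax 3) = \<kappa> *\<^sub>R P (v + ax 3) + P (v + ax 2)"
    and ind: "!!a b c d. a *\<^sub>R P v + b *\<^sub>R P (v + ax 1) + c *\<^sub>R P (v + ax 2) + d *\<^sub>R P (v + ax 3) = 0 ==> a = 0 \<and> b = 0 \<and> c = 0 \<and> d = 0"
  shows "convex_cell P (unit_cell v UNIV)"
proof -
  let ?F = False and ?T = True and ?C = "unit_cell v UNIV"
  have R12: "f \<bullet> P (corner v ?F ?F c) + \<tau> * (f \<bullet> P (corner v ?T ?T c)) = (1+\<tau>) * (f \<bullet> P (corner v ?T ?F c) + f \<bullet> P (corner v ?F ?T c))" for f c
    using arg_cong[OF r12, of "\<lambda>x. f \<bullet> x"] arg_cong[OF r12', of "\<lambda>x. f \<bullet> x"]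
    by (cases c) (simp_all add: corner_eqs inner_simps)
  have R13: "\<kappa> * (f \<bullet> P (corner v ?F ?F ?F)) + f \<bullet> P (corner v ?T ?F ?T) = \<kappa> * (f \<bullet> P (corner v ?F ?F ?T)) + f \<bullet> P (corner v ?T ?F ?F)" for f
    using arg_cong[OF r13, of "\<lambda>x. f \<bullet> x"] by (simp add: corner_eqs inner_simps)
  have R23: "\<kappa> * (f \<bullet> P (corner v ?F ?F ?F)) + f \<bullet> P (corner v ?F ?T ?T) = \<kappa> * (f \<bullet> P (corner v ?F ?F ?T)) + f \<bullet> P (corner v ?F ?T ?F)" for f
    using arg_cong[OF r23, of "\<lambda>x. f \<bullet> x"] by (simp add: corner_eqs inner_simps)
  have dual: "\<exists>f. f \<bullet> P v = p \<and> f \<bullet> P (v + ax 1) = q \<and> f \<bullet> P (v + ax 2) = r \<and> f \<bullet> P (v + ax 3) = s" for p q r s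
    using dual4[OF ind] by metis
  have vals: "f \<bullet> P (corner v ?T ?T ?F) = ((1+\<tau>) * (f \<bullet> P (v + ax 1) + f \<bullet> P (v + ax 2)) - f \<bullet> P v) / \<tau>"
    "f \<bullet> P (corner v ?T ?F ?T) = \<kappa> * (f \<bullet> P (v + ax 3)) + f \<bullet> P (v + ax 1) - \<kappa> * (f \<bullet> P v)"
    "f \<bullet> P (corner v ?F ?T ?T) = \<kappa> * (f \<bullet> P (v + ax 3)) + f \<bullet> P (v + ax 2) - \<kappa> * (f \<bullet> P v)"
    "f \<bullet> P (corner v ?T ?T ?T) = ((1+\<tau>) * (f \<bullet> P (corner v ?T ?F ?T) + f \<bullet> P (corner v ?F ?T ?T)) - f \<bullet> P (v + ax 3)) / \<tau>" for f
  proof -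
    show "f \<bullet> P (corner v ?T ?T ?F) = ((1+\<tau>) * (f \<bullet> P (v + ax 1) + f \<bullet> P (v + ax 2)) - f \<bullet> P v) / \<tau>"
      using R12[of f ?F] \<tau> unfolding corner_eqs by (simp add: field_simps)
    show "f \<bullet> P (corner v ?T ?F ?T) = \<kappa> * (f \<bullet> P (v + ax 3)) + f \<bullet> P (v + ax 1) - \<kappa> * (f \<bullet> P v)"
      using R13[of f] unfolding corner_eqs by simp
    show "f \<bullet> P (corner v ?F ?T ?T) = \<kappa> * (f \<bullet> P (v + ax 3)) + f \<bullet> P (v + ax 2) - \<kappa> * (f \<bullet> P v)"
      using R23[of f] unfolding corner_eqs by simp
    show "f \<bullet> P (corner v ?T ?T ?T) = ((1+\<tau>) * (f \<bullet> P (corner v ?T ?F ?T) + f \<bullet> P (corner v ?F ?T ?T)) - f \<bullet> P (v + ax 3)) / \<tau>"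
      using R12[of f ?T] \<tau> unfolding corner_eqs by (simp add: field_simps)
  qed
  \<comment> \<open>\<open>y1\<close>, \<open>y2\<close>, \<open>y3\<close> cut out the facets
    through \<open>v\<close>. The values of \<open>g1\<close>, \<open>g2\<close>, \<open>g3\<close>
    are solved from the relations so that they vanish on the opposite facets.\<close>
  obtain y1 where y1: "y1 \<bullet> P v = 0" "y1 \<bullet> P (v + ax 1) = 1" "y1 \<bullet> P (v + ax 2) = 0" "y1 \<bullet> P (v + ax 3) = 0" using dual by blast
  obtain y2 where y2: "y2 \<bullet> P v = 0" "y2 \<bullet> P (v + ax 1) = 0" "y2 \<bullet> P (v + ax 2) = 1" "y2 \<bullet> P (v + ax 3) = 0" using dual by blast
  obtain y3 where y3: "y3 \<bullet> P v = 0" "y3 \<bullet> P (v + ax 1) = 0" "y3 \<bullet> P (v + ax 2) = 0" "y3 \<bullet> P (v + ax 3) = 1" using dual by blast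
  obtain g1 where g1: "g1 \<bullet> P v = 1+\<tau>" "g1 \<bullet> P (v + ax 1) = 0" "g1 \<bullet> P (v + ax 2) = 1" "g1 \<bullet> P (v + ax 3) = 1+\<tau>" using dual by blast
  obtain g2 where g2: "g2 \<bullet> P v = 1+\<tau>" "g2 \<bullet> P (v + ax 1) = 1" "g2 \<bullet> P (v + ax 2) = 0" "g2 \<bullet> P (v + ax 3) = 1+\<tau>" using dual by blast
  obtain g3 where g3: "g3 \<bullet> P v = 1" "g3 \<bullet> P (v + ax 1) = \<kappa>" "g3 \<bullet> P (v + ax 2) = \<kappa>" "g3 \<bullet> P (v + ax 3) = 0" using dual by blast
  have k2: "1 < (1+\<tau>) * (\<kappa> + \<kappa>)" "1 < \<kappa> * 2 * (1+\<tau>)" using \<kappa> by (simp_all add: algebra_simps)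
  have Y1: "0 \<le> y1 \<bullet> P (corner v a b c) \<and> (y1 \<bullet> P (corner v a b c) = 0 \<longleftrightarrow> \<not> a)" for a b c
    using \<tau> \<kappa> k2 by (cases a; cases b; cases c; simp only: vals; simp only: corner_eqs y1; simp)
  have Y2: "0 \<le> y2 \<bullet> P (corner v a b c) \<and> (y2 \<bullet> P (corner v a b c) = 0 \<longleftrightarrow> \<not> b)" for a b c
    using \<tau> \<kappa> k2 by (cases a; cases b; cases c; simp only: vals; simp only: corner_eqs y2; simp)
  have Y3: "0 \<le> y3 \<bullet> P (corner v a b c) \<and> (y3 \<bullet> P (corner v a b c) = 0 \<longleftrightarrow> \<not> c)" for a b c
    using \<tau> \<kappa> k2 by (cases a; cases b; cases c; simp only: vals; simp only: corner_eqs y3; simp)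
  have G1: "0 \<le> g1 \<bullet> P (corner v a b c) \<and> (g1 \<bullet> P (corner v a b c) = 0 \<longleftrightarrow> a)" for a b c
    using \<tau> \<kappa> k2 by (cases a; cases b; cases c; simp only: vals; simp only: corner_eqs g1; simp)
  have G2: "0 \<le> g2 \<bullet> P (corner v a b c) \<and> (g2 \<bullet> P (corner v a b c) = 0 \<longleftrightarrow> b)" for a b c
    using \<tau> \<kappa> k2 by (cases a; cases b; cases c; simp only: vals; simp only: corner_eqs g2; simp)
  have G3: "0 \<le> g3 \<bullet> P (corner v a b c) \<and> (g3 \<bullet> P (corner v a b c) = 0 \<longleftrightarrow> c)" for a b c
    using \<tau> \<kappa> k2 by (cases a; cases b; cases c; simp only: vals; simp only: corner_eqs g3; simp)
  have H: "hemi P ?C"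
  proof -
    have "0 < (y1 + g1) \<bullet> P x" if xC: "x \<in> ?C" for x
    proof -
      obtain a b c where "x = corner v a b c" using xC cube_corner by blast
      then show ?thesis using Y1[of a b c] G1[of a b c] by (cases a) (auto simp: inner_add_left add_nonneg_pos add_pos_nonneg)
    qed
    then show ?thesis unfolding hemi_def by blast
  qed
  have Z: "{x\<in>?C. f \<bullet> P x = 0} = {} \<or> is_cell {x\<in>?C. f \<bullet> P x = 0}" if f: "\<forall>x\<in>?C. 0 \<le> f \<bullet> P x" for f
  proof (cases "{x\<in>?C. f \<bullet> P x = 0} = {}")
    case False
    then have "is_cell {x\<in>?C. f \<bullet> P x = 0}"
    proof (rule is_cellI[of _ v])
      fix x y z assume x: "x \<in> {x\<in>?C. f \<bullet> P x = 0}" and y: "y \<in> {x\<in>?C. f \<bullet> P x = 0}" and z: "!!i. z $ i = x $ i \<or> z $ i = y $ i"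
      obtain x1 x2 x3 where xc: "x = corner v x1 x2 x3" using x cube_corner by blast
      obtain y1 y2 y3 where yc: "y = corner v y1 y2 y3" using y cube_corner by blast
      have zC: "z \<in> ?C" by (rule cell_mix[of _ x y]) (use x y z in auto)
      then obtain z1 z2 z3 where zc: "z = corner v z1 z2 z3" using cube_corner by blast
      have zz: "z1 = x1 \<or> z1 = y1" "z2 = x2 \<or> z2 = y2" "z3 = x3 \<or> z3 = y3"
        using z[of 1] z[of 2] z[of 3] unfolding xc yc zc by (simp_all only: corner_simps add_left_cancel of_bool_eq_iff)
      have fp: "0 \<le> f \<bullet> P (corner v a b c)" for a b c using f cube_corner by blast
      have "f \<bullet> P (corner v z1 z2 z3) = 0"
        by (rule cube_zero_mix[where B="\<lambda>a b c. f \<bullet> P (corner v a b c)", OF _ \<tau> \<kappa> R12 R13 R23 _ _ zz])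
          (use fp x y xc yc in auto)
      then show "z \<in> {x\<in>?C. f \<bullet> P x = 0}" using zC zc by simp
    qed auto
    then show ?thesis by simp
  qed simp
  have X: "\<exists>f. (\<forall>x\<in>?C. 0 \<le> f \<bullet> P x) \<and> {x\<in>?C. f \<bullet> P x = 0} = c'" if c': "is_cell c'" "c' \<subseteq> ?C" for c'
  proof -
    define lo where "lo i \<longleftrightarrow> (\<forall>x\<in>c'. x $ i = v $ i)" for i
    define hi where "hi i \<longleftrightarrow> (\<forall>x\<in>c'. x $ i \<noteq> v $ i)" for i
    define f where "f = (if lo 1 then y1 else 0) + (if lo 2 then y2 else 0) + (if lo 3 then y3 else 0)
      + (if hi 1 then g1 else 0) + (if hi 2 then g2 else 0) + (if hi 3 then g3 else 0)"
    have val: "0 \<le> f \<bullet> P (corner v a b c) \<and> (f \<bullet> P (corner v a b c) = 0 \<longleftrightarrow>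
      (lo 1 --> \<not> a) \<and> (lo 2 --> \<not> b) \<and> (lo 3 --> \<not> c) \<and> (hi 1 --> a) \<and> (hi 2 --> b) \<and> (hi 3 --> c))" for a b c
    proof -
      have part: "0 \<le> (if l then s else 0) \<bullet> p \<and> ((if l then s else 0) \<bullet> p = 0 \<longleftrightarrow> (l --> X))"
        if "0 \<le> s \<bullet> p \<and> (s \<bullet> p = 0 \<longleftrightarrow> X)" for l X and s p :: "real^5" using that by simp
      have six: "0 \<le> r1+r2+r3+r4+r5+r6 \<and> (r1+r2+r3+r4+r5+r6 = 0 \<longleftrightarrow> r1=0\<and>r2=0\<and>r3=0\<and>r4=0\<and>r5=0\<and>r6=0)"
        if "0\<le>r1" "0\<le>r2" "0\<le>r3" "0\<le>r4" "0\<le>r5" "0\<le>r6" for r1 r2 r3 r4 r5 r6 :: real using that by linarith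
      show ?thesis unfolding f_def inner_add_left
        using part[OF Y1, of "lo 1" a b c] part[OF Y2, of "lo 2" a b c] part[OF Y3, of "lo 3" a b c]
          part[OF G1, of "hi 1" a b c] part[OF G2, of "hi 2" a b c] part[OF G3, of "hi 3" a b c]
        by (intro conjI, blast intro: six[THEN conjunct1]) (subst six[THEN conjunct2]; blast)
    qed
    have "{x\<in>?C. f \<bullet> P x = 0} = c'"
    proof (rule set_eqI, rule iffI)
      fix x assume x: "x \<in> {x\<in>?C. f \<bullet> P x = 0}"
      then obtain a b c where xc: "x = corner v a b c" using cube_corner by blast
      have cc: "(lo 1 --> \<not> a) \<and> (lo 2 --> \<not> b) \<and> (lo 3 --> \<not> c) \<and> (hi 1 --> a) \<and> (hi 2 --> b) \<and> (hi 3 --> c)"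
        using x val[of a b c] xc by simp
      have 01: "y $ i = v $ i \<or> y $ i = v $ i + 1" if "y \<in> c'" for y i using that c'(2) by (auto simp: unit_cell_def)
      have ex1: "\<exists>y\<in>c'. y $ i = x $ i" if lh: "lo i --> x $ i = v $ i" "hi i --> x $ i \<noteq> v $ i" for i
      proof -
        have x01: "x $ i = v $ i \<or> x $ i = v $ i + 1" using x by (auto simp: unit_cell_def)
        show ?thesis
        proof (cases "x $ i = v $ i")
          case True then show ?thesis using lh(2) unfolding hi_def by auto
        next
          case False
          then obtain y where "y \<in> c'" "y $ i \<noteq> v $ i" using lh(1) unfolding lo_def by auto
          then show ?thesis using 01[of y i] x01 False by auto
        qed
      qed
      obtain u1 where u1: "u1 \<in> c'" "u1 $ 1 = x $ 1" using ex1[of 1] cc xc by (auto simp: of_bool_def)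
      obtain u2 where u2: "u2 \<in> c'" "u2 $ 2 = x $ 2" using ex1[of 2] cc xc by (auto simp: of_bool_def)
      obtain u3 where u3: "u3 \<in> c'" "u3 $ 3 = x $ 3" using ex1[of 3] cc xc by (auto simp: of_bool_def)
      have all3: "P i" if "P 1" "P 2" "P 3" for P :: "3 => bool" and i using that forall_3[of P] by blast
      define u :: "int^3" where "u = vector [x $ 1, x $ 2, u1 $ 3]"
      have "u \<in> c'" by (rule cell_mix[OF c'(1) u1(1) u2(1)], rule_tac i=i in all3) (simp_all add: u_def u1 u2)
      then show "x \<in> c'" by (rule cell_mix[OF c'(1) _ u3(1)], rule_tac i=i in all3) (simp_all add: u_def u3)
    next
      fix x assume x: "x \<in> c'"
      then have xC: "x \<in> ?C" using c'(2) by blast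
      then obtain a b c where xc: "x = corner v a b c" using cube_corner by blast
      have l: "x $ i = v $ i" if "lo i" for i using that x by (simp add: lo_def)
      have h: "x $ i \<noteq> v $ i" if "hi i" for i using that x by (simp add: hi_def)
      have "f \<bullet> P x = 0" unfolding xc val[of a b c, THEN conjunct2]
        using l[of 1] l[of 2] l[of 3] h[of 1] h[of 2] h[of 3] unfolding xc by (auto simp: of_bool_def split: if_splits)
      then show "x \<in> {x\<in>?C. f \<bullet> P x = 0}" using xC by simp
    qed
    moreover have "\<forall>x\<in>?C. 0 \<le> f \<bullet> P x" using val cube_corner by auto
    ultimately show ?thesis by blast
  qed
  show ?thesis unfolding convex_cell_def using H Z X by blast
qed

lemma convex_cell_sub:
  assumes C: "convex_cell P D" "is_cell D" and c: "is_cell c" "c \<subseteq> D"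
  shows "convex_cell P c"
proof -
  have fin: "finite D" using cell_finite[OF C(2)] .
  have H: "hemi P c" using hemi_mono[OF convex_cell_hemi[OF C(1)] c(2)] .
  have Z: "{v\<in>c. b \<bullet> P v = 0} = {} \<or> is_cell {v\<in>c. b \<bullet> P v = 0}" if b: "\<forall>v\<in>c. 0 \<le> b \<bullet> P v" for b
  proof -
    obtain g where g: "\<forall>v\<in>D. 0 \<le> g \<bullet> P v" "{v\<in>D. g \<bullet> P v = 0} = c" using convex_cell_expose[OF C(1) c] by blast
    have gp: "0 < g \<bullet> P v" if "v \<in> D - c" for v using g that by (metis (mono_tags, lifting) DiffE mem_Collect_eq order_le_less)
    \<comment> \<open>Large enough to make the sum positive on \<open>D - c\<close>; on
      \<open>c\<close> the functional \<open>g\<close> vanishes and nothing changes.\<close>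
    define N where "N = (\<Sum>v\<in>D - c. (\<bar>b \<bullet> P v\<bar> + 1) / (g \<bullet> P v))"
    have Np: "0 < (b + N *\<^sub>R g) \<bullet> P v" if v: "v \<in> D - c" for v
    proof -
      have "(\<bar>b \<bullet> P v\<bar> + 1) / (g \<bullet> P v) \<le> N" unfolding N_def
        by (rule member_le_sum[OF v]) (use gp fin in \<open>auto intro!: divide_nonneg_pos\<close>)
      then have "\<bar>b \<bullet> P v\<bar> + 1 \<le> N * (g \<bullet> P v)" using gp[OF v] by (simp add: divide_le_eq)
      then show ?thesis by (simp add: inner_add_left)
    qed
    have Nc: "(b + N *\<^sub>R g) \<bullet> P v = b \<bullet> P v" if "v \<in> c" for v using that g(2) by (auto simp: inner_add_left)
    have "\<forall>v\<in>D. 0 \<le> (b + N *\<^sub>R g) \<bullet> P v" using Np Nc b by (metis DiffI order_le_less)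
    then have "{v\<in>D. (b + N *\<^sub>R g) \<bullet> P v = 0} = {} \<or> is_cell {v\<in>D. (b + N *\<^sub>R g) \<bullet> P v = 0}" by (rule convex_cell_zero[OF C(1)])
    moreover have "{v\<in>D. (b + N *\<^sub>R g) \<bullet> P v = 0} = {v\<in>c. b \<bullet> P v = 0}" using Np Nc c(2) by force
    ultimately show ?thesis by simp
  qed
  have X: "\<exists>b. (\<forall>v\<in>c. 0 \<le> b \<bullet> P v) \<and> {v\<in>c. b \<bullet> P v = 0} = c'" if c': "is_cell c'" "c' \<subseteq> c" for c'
  proof -
    obtain b where b: "\<forall>v\<in>D. 0 \<le> b \<bullet> P v" "{v\<in>D. b \<bullet> P v = 0} = c'" using convex_cell_expose[OF C(1) c'(1)] c'(2) c(2) by blast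
    have "\<forall>v\<in>c. 0 \<le> b \<bullet> P v" "{v\<in>c. b \<bullet> P v = 0} = c'" using b c(2) c'(2) by auto
    then show ?thesis by blast
  qed
  show ?thesis unfolding convex_cell_def using H Z X by blast
qed

text \<open>Missing directions are added one at a time, upwards if the top layer leaves room and
  downwards otherwise. A cell that lacks a direction spans at most three layers, so with
  \<open>3 \<le> K\<close> one of the two is possible.\<close>

lemma strip_in_cube:
  assumes c: "c \<in> strip K" and K: "3 \<le> K"
  obtains v where "c \<subseteq> unit_cell v UNIV" "unit_cell v UNIV \<in> strip K"
proof -
  have "\<exists>v. unit_cell u J \<subseteq> unit_cell v UNIV \<and> unit_cell v UNIV \<in> strip K" if "unit_cell u J \<in> strip K" for u J
    using that
  proof (induction "card (- J)" arbitrary: u J rule: less_induct)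
    case less
    show ?case
    proof (cases "J = UNIV")
      case True then show ?thesis using less.prems by (intro exI[of _ u]) simp
    next
      case False
      then obtain i where i: "i \<notin> J" by blast
      have cd: "card (- insert i J) < card (- J)" using i by (intro psubset_card_mono) auto
      have m: "0 \<le> csum w" "csum w \<le> int K" if "w \<in> unit_cell u J" for w using less.prems that by (auto simp: strip_iff)
      have iw: "w $ i = u $ i" if "w \<in> unit_cell u J" for w using that i by (auto simp: unit_cell_def)
      have "\<exists>u'. unit_cell u J \<subseteq> unit_cell u' (insert i J) \<and> unit_cell u' (insert i J) \<in> strip K"
      proof (cases "\<forall>w\<in>unit_cell u J. csum w < int K")
        case True
        have "0 \<le> csum w \<and> csum w \<le> int K" if w: "w \<in> unit_cell u (insert i J)" for w
        proof (cases "w $ i = u $ i")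
          case True then have "w \<in> unit_cell u J" using w unfolding unit_cell_def mem_Collect_eq by (metis insertE)
          from m[OF this] show ?thesis by simp
        next
          case False
          have "(w - ax i) $ j = u $ j \<or> j \<in> J \<and> (w - ax i) $ j = u $ j + 1" for j
          proof -
            have "w $ j = u $ j \<or> j \<in> insert i J \<and> w $ j = u $ j + 1" using w by (simp add: unit_cell_def)
            then show ?thesis using False by (cases "j = i") (auto simp: axis_def)
          qed
          then have "w - ax i \<in> unit_cell u J" by (simp add: unit_cell_def)
          from m(1)[OF this] bspec[OF True this] show ?thesis by simp
        qed
        then have "unit_cell u (insert i J) \<in> strip K" by (simp add: strip_iff)
        moreover have "unit_cell u J \<subseteq> unit_cell u (insert i J)" by (auto simp: unit_cell_def)
        ultimately show ?thesis by blast
      next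
        case False
        then obtain w0 where w0: "w0 \<in> unit_cell u J" "csum w0 = int K" using m by force
        have ge: "1 \<le> csum w" if "w \<in> unit_cell u J" for w
        proof -
          have d: "\<bar>w0 $ j - w $ j\<bar> \<le> 1" for j using cell_diff[OF is_cell_unit w0(1) that] .
          have "w0 $ i = w $ i" using iw w0(1) that by simp
          then have "csum w0 - csum w \<le> 2"
            using d[of 1] d[of 2] d[of 3] exhaust_3[of i] by (auto simp: csum_def)
          then show ?thesis using w0(2) K by simp
        qed
        have "0 \<le> csum w \<and> csum w \<le> int K" if w: "w \<in> unit_cell (u - ax i) (insert i J)" for w
        proof (cases "w $ i = u $ i")
          case True
          have "w $ j = u $ j \<or> j \<in> J \<and> w $ j = u $ j + 1" for j
          proof -
            have "w $ j = (u - ax i) $ j \<or> j \<in> insert i J \<and> w $ j = (u - ax i) $ j + 1" using w by (simp add: unit_cell_def)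
            then show ?thesis using True by (cases "j = i") (auto simp: axis_def)
          qed
          then have "w \<in> unit_cell u J" by (simp add: unit_cell_def)
          from m[OF this] show ?thesis by simp
        next
          case False
          have "(w + ax i) $ j = u $ j \<or> j \<in> J \<and> (w + ax i) $ j = u $ j + 1" for j
          proof -
            have "w $ j = (u - ax i) $ j \<or> j \<in> insert i J \<and> w $ j = (u - ax i) $ j + 1" using w by (simp add: unit_cell_def)
            then show ?thesis using False by (cases "j = i") (auto simp: axis_def)
          qed
          then have "w + ax i \<in> unit_cell u J" by (simp add: unit_cell_def)
          from m(2)[OF this] ge[OF this] show ?thesis by simp
        qed
        then have "unit_cell (u - ax i) (insert i J) \<in> strip K" by (simp add: strip_iff)
        moreover have "unit_cell u J \<subseteq> unit_cell (u - ax i) (insert i J)"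
        proof
          fix w assume w: "w \<in> unit_cell u J"
          have "w $ j = (u - ax i) $ j \<or> j \<in> insert i J \<and> w $ j = (u - ax i) $ j + 1" for j
          proof -
            have "w $ j = u $ j \<or> j \<in> J \<and> w $ j = u $ j + 1" using w by (simp add: unit_cell_def)
            then show ?thesis using i by (cases "j = i") (auto simp: axis_def)
          qed
          then show "w \<in> unit_cell (u - ax i) (insert i J)" by (simp add: unit_cell_def)
        qed
        ultimately show ?thesis by blast
      qed
      then show ?thesis using less.hyps[OF cd] by (meson order_trans)
    qed
  qed
  moreover obtain u J where "c = unit_cell u J" using c by (auto simp: strip_iff is_cell_def)
  ultimately show ?thesis using c that by blast
qed

section \<open>The convex lifting\<close>

lemma om_values: "om j = 1 \<and> 6 dvd j \<or> Re (om j) = 1/2 \<and> (6 dvd j - 1 \<or> 6 dvd j + 1) \<or> Re (om j) = -1/2 \<and> even j \<or> Re (om j) = -1 \<and> odd j"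
proof -
  define r where "r = j mod 6"
  have jr: "om j = om r" using om_period[of "j div 6" r] by (simp add: r_def)
  have "r = 0 \<or> r = 1 \<or> r = 2 \<or> r = 3 \<or> r = 4 \<or> r = 5" unfolding r_def by presburger
  moreover have "Re (om 1) = 1/2" "Re (om 2) = -1/2" "Re (om 3) = -1" by (simp_all add: om_1 om_2 om_3)
  moreover have "om 4 = om 3 * om 1" "om 5 = om 3 * om 2" by (simp_all flip: om_add)
  moreover have "r = 0 ==> 6 dvd j" "r = 1 ==> 6 dvd j - 1" "r = 2 ==> even j" "r = 3 ==> odd j" "r = 4 ==> even j" "r = 5 ==> 6 dvd j + 1"
    unfolding r_def by presburger+
  ultimately show ?thesis unfolding jr by (elim disjE) (auto simp: om_1 om_2 om_3)
qed

lemma om_even: "even j ==> Re (om j) \<le> 1" "even j ==> Re (om j) = 1 ==> 6 dvd j"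
  and om_odd: "odd j ==> Re (om j) \<le> 1/2" "odd j ==> Re (om j) = 1/2 ==> 6 dvd j - 1 \<or> 6 dvd j + 1"
  and om_le: "Re (om j) \<le> 1"
  using om_values[of j] by (auto elim!: dvdE)

text \<open>The values at \<^verbatim>\<open>0, -1, -2, ...\<close> of the solution of the layer recurrence that is 1 at 0 and 1/2 at 1.\<close>

fun backv :: "real => nat => real" where
  "backv \<tau> 0 = 1"
| "backv \<tau> (Suc 0) = 2 + 3/2 * \<tau>"
| "backv \<tau> (Suc (Suc j)) = 2 * (1+\<tau>) * backv \<tau> (Suc j) - \<tau> * backv \<tau> j"

lemma backv_mono: assumes "0 < \<tau>" shows "1 \<le> backv \<tau> j \<and> backv \<tau> j < backv \<tau> (Suc j)"
proof (induction j)
  case 0 then show ?case using assms by simp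
next
  case (Suc j)
  have "\<tau> * backv \<tau> j < \<tau> * backv \<tau> (Suc j)" using Suc assms by simp
  moreover have "0 < (1+\<tau>) * backv \<tau> (Suc j)" using Suc assms by simp
  ultimately show ?case using Suc by (simp add: algebra_simps)
qed

text \<open>The values \<mu>, \<mu>/2, \<mu> in layers \<open>L\<close>, \<open>L+1\<close>,
  \<open>L+2\<close> match the real parts 1, 1/2, 1 of the second coordinates on a square in
  directions 1 and 2. All other layers stay strictly above \<mu>, so no further vertex can give
  equality.\<close>

lemma profile:
  assumes \<tau>: "0 < \<tau>" and rec: "!!m. s m = 2 * (1+\<tau>) * s (m+1) - \<tau> * s (m+2)" and L: "s L = \<mu>" "s (L+1) = \<mu>/2" and \<mu>: "0 < (\<mu>::real)"
  shows "j \<le> L ==> s (L - j) = \<mu> * backv \<tau> j" and "s (L+2) = \<mu>" and "m < L ==> \<mu> < s m" and "L + 3 \<le> m ==> \<mu> < s m"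
    and "0 < s m"
proof -
  have b: "j \<le> L ==> s (L - j) = \<mu> * backv \<tau> j" for j
  proof (induction j rule: induct_nat_012)
    case 1
    then have "s (L - 1) = 2 * (1+\<tau>) * s L - \<tau> * s (L+1)" using rec[of "L - 1"] by simp
    then show ?case unfolding L by (simp add: algebra_simps)
  next
    case (ge2 n)
    have "s (L - Suc (Suc n)) = 2 * (1+\<tau>) * s (L - Suc n) - \<tau> * s (L - n)"
    proof -
      have "L - Suc (Suc n) + 1 = L - Suc n" "L - Suc (Suc n) + 2 = L - n" using ge2.prems by simp_all
      then show ?thesis using rec[of "L - Suc (Suc n)"] by simp
    qed
    then show ?case using ge2 by (simp add: algebra_simps)
  qed (use L in simp)
  then show "j \<le> L ==> s (L - j) = \<mu> * backv \<tau> j" .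
  have "\<tau> * s (L+2) = \<tau> * \<mu>" using rec[of L] L by (simp add: algebra_simps)
  then show L2: "s (L+2) = \<mu>" using \<tau> by simp
  show lt: "\<mu> < s m" if "m < L" for m
  proof -
    define j where "j = L - m - 1"
    have j: "Suc j \<le> L" "m = L - Suc j" using that by (simp_all add: j_def)
    have "s m = \<mu> * backv \<tau> (Suc j)" using b[OF j(1)] j(2) by simp
    moreover have "1 < backv \<tau> (Suc j)" using backv_mono[OF \<tau>, of j] by simp
    ultimately show ?thesis using \<mu> by simp
  qed
  have up: "\<mu>/2 \<le> s (L+1+i) \<and> s (L+1+i) < s (L+2+i)" for i
  proof (induction i)
    case 0 then show ?case using L L2 \<mu> by simp
  next
    case (Suc i)
    have r: "\<tau> * s (L+2+i+1) = 2 * (1+\<tau>) * s (L+2+i) - s (L+1+i)" using rec[of "L+1+i"] by (simp add: add_ac)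
    have "0 < (1+\<tau>) * s (L+2+i)" using Suc \<mu> \<tau> by simp
    then have "\<tau> * s (L+2+i) < \<tau> * s (L+2+i+1)" unfolding r using Suc by (simp add: algebra_simps)
    then show ?case using Suc \<tau> by simp
  qed
  have gt: "\<mu> < s (L+3+i)" for i
  proof (induction i)
    case 0 show ?case using up[of 1] L2 by (simp add: numeral_3_eq_3)
  next
    case (Suc i) then show ?case using up[of "Suc (Suc i)"] by (simp add: numeral_3_eq_3)
  qed
  show "L + 3 \<le> m ==> \<mu> < s m" using gt[of "m - (L+3)"] by simp
  show "0 < s m"
  proof -
    consider "m < L" | "m = L" | "m = L+1" | "m = L+2" | "L+3 \<le> m" by linarith
    then show ?thesis using lt[of m] L L2 \<mu> gt[of "m - (L+3)"] by cases auto
  qed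
qed

lemma rising:
  assumes \<tau>: "0 < \<tau>" and rec: "!!j. v (j+2) = 2 * (1+\<tau>) * v (j+1) - \<tau> * (v j :: real)" and v: "0 \<le> v 0" "v 0 \<le> v 1"
  shows "0 \<le> v j \<and> v j \<le> v (Suc j)"
proof (induction j)
  case 0 then show ?case using v by simp
next
  case (Suc j)
  have "\<tau> * v j \<le> \<tau> * v (Suc j)" "0 \<le> (1+\<tau>) * v (Suc j)" using Suc \<tau> by simp_all
  then show ?case using Suc rec[of j] by (simp add: algebra_simps) 
qed

section \<open>Growing solutions of the layer recurrence\<close>

locale outward =
  fixes \<tau> :: real and E :: "nat => real"
  assumes ok: "seq_ok \<tau> E" and W0: "0 < cas E 0" and E1: "0 < E 1" and out1: "(1+\<tau>) * E 1 < \<tau> * E 2"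
begin

lemma tau: "0 < \<tau>" using seq_pos[OF ok] .

lemma growth: "0 < E (m+1) \<and> (1+\<tau>) * E (m+1) < \<tau> * E (m+2)"
proof (induction m)
  case 0 then show ?case using E1 out1 by (simp add: numeral_2_eq_2)
next
  case (Suc m)
  have "0 < (1+\<tau>) * E (m+1)" using Suc tau by simp
  then have "0 < \<tau> * E (m+2)" using Suc by linarith
  then have p: "0 < E (m+2)" using tau by (simp add: zero_less_mult_iff)
  have "0 < \<tau> * E (m+1)" using Suc tau by simp
  then have "E (m+1) < (1+\<tau>) * E (m+2)" using Suc p by (simp add: algebra_simps)
  then show ?case using p seq_rec[OF ok, of "m+1"] by (simp add: algebra_simps)
qed

lemma Epos: "0 < E (m+1)" "0 < E (Suc m)" and Eout: "(1+\<tau>) * E (m+1) < \<tau> * E (m+2)" using growth by auto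

lemma W: "0 < cas E m" using cas_pos[OF ok W0] .

abbreviation "h \<equiv> seqh \<tau> E"
abbreviation "Y \<equiv> seqY \<tau> E"

lemma h_alt: "h m = \<tau> * E (m+2) - (2+\<tau>) * E (m+1)"
  using seq_rec[OF ok, of m] by (simp add: seqh_def algebra_simps)

lemma W_alt: "E (m+2) * h m - cas E m = E (m+1) * (\<tau> * E (m+2) - E (m+1))"
  unfolding h_alt cas_quadratic[OF ok] by (simp add: power2_eq_square algebra_simps)

lemma Egap: "E (m+1) < \<tau> * E (m+2)"
  using Eout[of m] mult_pos_pos[OF tau Epos(1)[of m]] by (simp add: algebra_simps)

lemma h_pos: "0 < h m"
proof -
  have "0 < E (m+1) * (\<tau> * E (m+2) - E (m+1))" using Egap[of m] Epos by simp
  then have "0 < E (m+2) * h m" using W_alt[of m] W[of m] by linarith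
  then show ?thesis using Epos(1)[of "m+1"] by (simp add: zero_less_mult_iff)
qed

lemma h_step: "h (m+1) - h m = (1+\<tau>) * E (m+1)"
  using seq_rec[OF ok, of m] by (simp add: seqh_def algebra_simps)

lemma h_rec: "h m = 2 * (1+\<tau>) * h (m+1) - \<tau> * h (m+2)"
proof -
  have a: "h m = h (m+1) - (1+\<tau>) * E (m+1)" "h (m+2) = h (m+1) + (1+\<tau>) * E (m+2)" "h (m+1) = \<tau> * E (m+2) - E (m+1)"
    using h_step[of m] h_step[of "m+1"] by (simp_all add: seqh_def)
  show ?thesis unfolding a(1,2) unfolding a(3) by (simp add: algebra_simps)
qed

text \<open>The factor 2 is uniform in \<tau>; it feeds the shape of the cubes and the norm
  estimates. If it failed, the Casoratian would first push \<open>E (m+2)\<close> below half of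
  \<open>E (m+1)\<close> and then could not be positive.\<close>

lemma E_double: "2 * E (m+1) < E (m+2)"
proof -
  have "(2+\<tau>) * E (m+1) < \<tau> * E (m+2)" using h_pos[of m] unfolding h_alt by simp
  show ?thesis
  proof (rule ccontr)
    assume "\<not> ?thesis"
    then have le: "E (m+2) \<le> 2 * E (m+1)" by simp
    define d e where "d = E (m+1)" and "e = E (m+2)"
    have de: "0 < d" "0 < e" "e \<le> 2 * d" using Epos(1)[of m] Epos(1)[of "m+1"] le by (simp_all add: d_def e_def)
    have "cas E m = \<tau> * e * (e - 2 * d) + d * (d - 2 * e)"
      unfolding cas_quadratic[OF ok] d_def e_def by (simp add: power2_eq_square algebra_simps)
    moreover have "\<tau> * e * (e - 2 * d) \<le> 0" using de tau by (simp add: mult_nonneg_nonpos)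
    moreover have "2 * d \<le> \<tau> * e" using \<open>(2+\<tau>) * E (m+1) < \<tau> * E (m+2)\<close> mult_pos_pos[OF tau de(1)] unfolding d_def e_def by (simp add: algebra_simps)
    ultimately have "0 < d * (d - 2 * e)" using W[of m] by linarith
    then have "2 * e < d" using de by (simp add: zero_less_mult_iff)
    then have "0 < \<tau> * e * (2 * d - e)" "cas E m = d * (d - 2 * e) - \<tau> * e * (2 * d - e)"
      using de tau \<open>cas E m = _\<close> by (simp_all add: algebra_simps)
    moreover have "d * (d - 2*e) \<le> d * d" using de by (simp add: algebra_simps)
    moreover have "2 * d * (2 * d - e) \<le> \<tau> * e * (2 * d - e)" using \<open>2 * d \<le> \<tau> * e\<close> \<open>2*e < d\<close> de by (intro mult_right_mono) auto
    moreover have "d * d \<le> 2 * d * (2 * d - e)" using \<open>2*e < d\<close> de by (simp add: algebra_simps)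
    ultimately show False using W[of m] by linarith
  qed
qed

text \<open>Up to the factor \<tau>, the determinant of the linear system for the supporting
  functional of a cube whose lowest layer is \<open>m\<close>.\<close>

definition "qq m = (5 + 3*\<tau>) * E (m+2) - 4 * E (m+1)"

lemma qq_pos: "0 < qq m"
proof -
  have "0 < \<tau> * E (m+2)" using tau Epos(1)[of "m+1"] by simp
  then show ?thesis unfolding qq_def using E_double[of m] Epos(1)[of m] by (simp add: algebra_simps)
qed

lemma hq: "h m * qq m - 4 * cas E m = (1 + 3*\<tau>) * (E (m+2) * h m) + 4 * (1+\<tau>) * (E (m+1))\<^sup>2"
  unfolding h_alt qq_def cas_quadratic[OF ok] by (simp add: power2_eq_square algebra_simps)

lemma qq_next: "\<tau> * qq (m+1) = (10 + 12*\<tau> + 6*\<tau>\<^sup>2) * E (m+2) - (5 + 3*\<tau>) * E (m+1)"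
proof -
  have "\<tau> * qq (m+1) = (5 + 3*\<tau>) * (\<tau> * E (m+3)) - 4 * \<tau> * E (m+2)" by (simp add: qq_def algebra_simps numeral_3_eq_3)
  also have "\<tau> * E (m+3) = 2 * (1+\<tau>) * E (m+2) - E (m+1)" using seq_rec[OF ok, of "m+1"] by (simp add: numeral_3_eq_3)
  finally show ?thesis by (simp add: algebra_simps power2_eq_square)
qed

lemma qq_rec: "\<tau> * qq (m+2) = 2 * (1+\<tau>) * qq (m+1) - qq m"
proof -
  have E: "\<tau> * E (m+4) = 2 * (1+\<tau>) * E (m+3) - E (m+2)" "\<tau> * E (m+3) = 2 * (1+\<tau>) * E (m+2) - E (m+1)"
    using seq_rec[OF ok, of "m+1"] seq_rec[OF ok, of "m+2"] by (simp_all add: numeral_3_eq_3 eval_nat_numeral)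
  have L: "\<tau> * qq (m+2) = (5 + 3*\<tau>) * (\<tau> * E (m+4)) - 4 * (\<tau> * E (m+3))" by (simp add: qq_def algebra_simps eval_nat_numeral)
  have Q: "qq (m+1) = (5 + 3*\<tau>) * E (m+3) - 4 * E (m+2)" by (simp add: qq_def eval_nat_numeral)
  show ?thesis unfolding L unfolding E Q qq_def[of m] by (simp add: algebra_simps)
qed

lemma cas_shift: "\<tau>^j * cas E (m+j) = cas E m"
proof (induction j)
  case (Suc j)
  have "\<tau>^Suc j * cas E (m + Suc j) = \<tau>^j * (\<tau> * cas E (Suc (m+j)))" by simp
  then show ?case using Suc unfolding cas_step[OF ok] by simp
qed simp

lemma eh_cas: "cas E m < E (m+2) * h m"
  using W_alt[of m] Egap[of m] Epos(1)[of m] by (smt (verit) mult_pos_pos)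

text \<open>The inequality \<open>\<mu> < 2 * h m - \<mu> * backv \<tau> j\<close> of
  \<open>lifting\<close> after clearing denominators, for a cube whose lowest layer is
  \<open>m + j\<close>. As a function of \<open>j\<close> the right side solves the recurrence,
  starts above the bound and rises.\<close>

lemma rung_even: "4 * cas E m < 2 * h m * (\<tau>^j * qq (m+j)) - 4 * cas E m * backv \<tau> j"
proof -
  let ?h = "h m" and ?W = "cas E m" and ?d = "E (m+1)" and ?e = "E (m+2)"
  define v where "v j = 2 * ?h * (\<tau>^j * qq (m+j)) - 4 * ?W * backv \<tau> j" for j
  have rec: "v (j+2) = 2 * (1+\<tau>) * v (j+1) - \<tau> * v j" for j
  proof -
    have B: "backv \<tau> (j+2) = 2 * (1+\<tau>) * backv \<tau> (j+1) - \<tau> * backv \<tau> j" "backv \<tau> (Suc (j+2)) = 2 * (1+\<tau>) * backv \<tau> (Suc (j+1)) - \<tau> * backv \<tau> (Suc j)" by simp_all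
    have "\<tau>^(j+2) * qq (m+(j+2)) = \<tau>^(j+1) * (\<tau> * qq (m+j+2))" by (simp add: algebra_simps)
    also have "\<dots> = 2 * (1+\<tau>) * (\<tau>^(j+1) * qq (m+(j+1))) - \<tau> * (\<tau>^j * qq (m+j))" unfolding qq_rec by (simp add: algebra_simps)
    finally have R: "\<tau>^(j+2) * qq (m+(j+2)) = 2 * (1+\<tau>) * (\<tau>^(j+1) * qq (m+(j+1))) - \<tau> * (\<tau>^j * qq (m+j))" .
    define r0 r1 b0 b1 where "r0 = \<tau>^j * qq (m+j)" and "r1 = \<tau>^(j+1) * qq (m+(j+1))" and "b0 = backv \<tau> j" and "b1 = backv \<tau> (j+1)"
    show ?thesis unfolding v_def R B unfolding r0_def[symmetric] r1_def[symmetric] b0_def[symmetric] b1_def[symmetric] by (simp add: algebra_simps)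
  qed
  have eh: "0 < ?e * ?h" using Epos(1)[of "m+1"] h_pos[of m] by simp
  have v0: "4 * ?W < v 0"
  proof -
    have "0 < (1 + 3*\<tau>) * (?e * ?h)" "0 \<le> 4 * (1+\<tau>) * ?d\<^sup>2" using eh tau by simp_all
    moreover have "v 0 = 2 * (?h * qq m) - 4 * ?W" by (simp add: v_def)
    ultimately show ?thesis using hq[of m] by linarith
  qed
  have "v 1 - v 0 = 2 * ?h * ((5 + 9*\<tau> + 6*\<tau>\<^sup>2) * ?e - (1 + 3*\<tau>) * ?d) - (4 + 6*\<tau>) * ?W"
  proof -
    have "v 1 = 2 * ?h * (\<tau> * qq (m+1)) - 4 * ?W * (2 + 3/2 * \<tau>)" by (simp add: v_def)
    then show ?thesis unfolding qq_next by (simp add: v_def qq_def algebra_simps)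
  qed
  also have "\<dots> = (4 + 6*\<tau>) * (?e * ?h - ?W) + ?h * ((6 + 12*\<tau> + 12*\<tau>\<^sup>2) * ?e - (2 + 6*\<tau>) * ?d)" by (simp add: algebra_simps)
  finally have d: "v 1 - v 0 = (4 + 6*\<tau>) * (?e * ?h - ?W) + ?h * ((6 + 12*\<tau> + 12*\<tau>\<^sup>2) * ?e - (2 + 6*\<tau>) * ?d)" .
  have "?d < ?e" using E_double[of m] Epos(1)[of m] by simp
  then have "(2 + 6*\<tau>) * ?d \<le> (6 + 12*\<tau> + 12*\<tau>\<^sup>2) * ?e"
    using tau Epos(1)[of m] by (intro mult_mono) (auto simp: power2_eq_square)
  then have "0 \<le> ?h * ((6 + 12*\<tau> + 12*\<tau>\<^sup>2) * ?e - (2 + 6*\<tau>) * ?d)" using h_pos[of m] by simp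
  moreover have "0 \<le> (4 + 6*\<tau>) * (?e * ?h - ?W)" using tau eh_cas[of m] by simp
  ultimately have "v 0 \<le> v 1" using d by linarith
  moreover have "0 \<le> v 0" using v0 W[of m] by simp
  ultimately have "v i \<le> v (Suc i)" for i using rising[OF tau rec] by blast
  then have "v 0 \<le> v j" by (rule lift_Suc_mono_le) simp
  then have "4 * ?W < v j" using v0 by linarith
  then show ?thesis by (simp only: v_def)
qed

text \<open>The counterpart for vertices turned by three quarters. In the lowest layer of the cube
  only half the bound is available, and there parity admits only odd sixth-turns, for which half
  suffices.\<close>

lemma rung_odd: "2 * cas E m < 2 * h m * qq m - 4 * cas E m * backv \<tau> 1"
    "4 * cas E m < 2 * h m * (\<tau>^Suc j * qq (m + Suc j)) - 4 * cas E m * backv \<tau> (Suc (Suc j))"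
proof -
  let ?h = "h m" and ?W = "cas E m" and ?d = "E (m+1)" and ?e = "E (m+2)"
  define v where "v j = 2 * ?h * (\<tau>^j * qq (m+j)) - 4 * ?W * backv \<tau> (Suc j)" for j
  have rec: "v (j+2) = 2 * (1+\<tau>) * v (j+1) - \<tau> * v j" for j
  proof -
    have B: "backv \<tau> (j+2) = 2 * (1+\<tau>) * backv \<tau> (j+1) - \<tau> * backv \<tau> j" "backv \<tau> (Suc (j+2)) = 2 * (1+\<tau>) * backv \<tau> (Suc (j+1)) - \<tau> * backv \<tau> (Suc j)" by simp_all
    have "\<tau>^(j+2) * qq (m+(j+2)) = \<tau>^(j+1) * (\<tau> * qq (m+j+2))" by (simp add: algebra_simps)
    also have "\<dots> = 2 * (1+\<tau>) * (\<tau>^(j+1) * qq (m+(j+1))) - \<tau> * (\<tau>^j * qq (m+j))" unfolding qq_rec by (simp add: algebra_simps)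
    finally have R: "\<tau>^(j+2) * qq (m+(j+2)) = 2 * (1+\<tau>) * (\<tau>^(j+1) * qq (m+(j+1))) - \<tau> * (\<tau>^j * qq (m+j))" .
    define r0 r1 b0 b1 where "r0 = \<tau>^j * qq (m+j)" and "r1 = \<tau>^(j+1) * qq (m+(j+1))" and "b0 = backv \<tau> (Suc j)" and "b1 = backv \<tau> (Suc (j+1))"
    show ?thesis unfolding v_def R B unfolding r0_def[symmetric] r1_def[symmetric] b0_def[symmetric] b1_def[symmetric] by (simp add: algebra_simps)
  qed
  have ehW: "?e * ?h - ?W = ?d * (\<tau> * ?e - ?d)" by (rule W_alt)
  have v0: "2 * ?W < v 0"
  proof -
    have "v 0 - 2 * ?W = (2 + 6*\<tau>) * (?e * ?h - ?W) + 8 * (1+\<tau>) * ?d\<^sup>2" using hq[of m] by (simp add: v_def algebra_simps)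
    moreover have "0 < (2 + 6*\<tau>) * (?e * ?h - ?W)" using tau eh_cas[of m] by simp
    moreover have "0 \<le> 8 * (1+\<tau>) * ?d\<^sup>2" using tau by simp
    ultimately show ?thesis by linarith
  qed
  then show "2 * cas E m < 2 * h m * qq m - 4 * cas E m * backv \<tau> 1" by (simp add: v_def)
  have b2: "backv \<tau> (Suc (Suc 0)) = 4 + 6*\<tau> + 3*\<tau>\<^sup>2" by (simp add: algebra_simps power2_eq_square)
  have v1e: "v 1 = 2 * ?h * ((10 + 12*\<tau> + 6*\<tau>\<^sup>2) * ?e - (5 + 3*\<tau>) * ?d) - 4 * ?W * (4 + 6*\<tau> + 3*\<tau>\<^sup>2)"
    unfolding v_def using b2 qq_next[of m] by simp
  have v1: "4 * ?W < v 1"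
  proof -
    have "v 1 - 4 * ?W = (20 + 24*\<tau> + 12*\<tau>\<^sup>2) * (?e * ?h - ?W) - (10 + 6*\<tau>) * ?d * ?h" unfolding v1e by (simp add: algebra_simps)
    also have "\<dots> = ?d * ((10*\<tau> + 18*\<tau>\<^sup>2 + 12*\<tau>^3) * ?e - (2*\<tau> + 6*\<tau>\<^sup>2) * ?d)"
      unfolding ehW unfolding h_alt by (simp add: algebra_simps power2_eq_square power3_eq_cube)
    finally have "v 1 - 4 * ?W = ?d * ((10*\<tau> + 18*\<tau>\<^sup>2 + 12*\<tau>^3) * ?e - (2*\<tau> + 6*\<tau>\<^sup>2) * ?d)" .
    moreover have "(2*\<tau> + 6*\<tau>\<^sup>2) * ?d < (10*\<tau> + 18*\<tau>\<^sup>2 + 12*\<tau>^3) * ?e"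
      using tau Epos(1)[of m] E_double[of m] by (intro mult_strict_mono) (auto simp: add_pos_pos intro!: add_strict_mono less_add_same_cancel1)
    ultimately show ?thesis using Epos(1)[of m] by (smt (verit) mult_pos_pos)
  qed
  have "v 1 - v 0 = (8 + 18*\<tau> + 12*\<tau>\<^sup>2) * (?e * ?h - ?W) + 2 * (?e * ?h) - (2 + 6*\<tau>) * (?d * ?h)"
    unfolding v1e by (simp add: v_def qq_def algebra_simps power2_eq_square)
  moreover have "(2 + 6*\<tau>) * (?d * ?h) \<le> (8 + 18*\<tau> + 12*\<tau>\<^sup>2) * (?e * ?h - ?W)"
  proof -
    have "0 \<le> (1+\<tau>) * ?d" using tau Epos(1)[of m] by simp
    then have "?h \<le> \<tau> * ?e - ?d" unfolding h_alt by (simp add: algebra_simps)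
    then have "?d * ?h \<le> ?e * ?h - ?W" unfolding ehW using Epos(1)[of m] by simp
    moreover have "0 \<le> ?d * ?h" using Epos(1)[of m] h_pos[of m] by simp
    ultimately show ?thesis using tau by (intro mult_mono) (auto simp: add_nonneg_nonneg)
  qed
  moreover have "0 < ?e * ?h" using Epos(1)[of "m+1"] h_pos[of m] by simp
  ultimately have "v 0 \<le> v 1" by linarith
  moreover have "0 \<le> v 0" using v0 W[of m] by simp
  ultimately have "v i \<le> v (Suc i)" for i using rising[OF tau rec] by blast
  then have "v 1 \<le> v (Suc j)" by (rule lift_Suc_mono_le) simp
  then show "4 * cas E m < 2 * h m * (\<tau>^Suc j * qq (m + Suc j)) - 4 * cas E m * backv \<tau> (Suc (Suc j))"
    using v1 unfolding v_def by linarith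
qed

lemma h_mono: "m \<le> n ==> h m \<le> h n"
proof (rule lift_Suc_mono_le)
  fix n show "h n \<le> h (Suc n)" using h_step[of n] mult_pos_pos[of "1+\<tau>" "E (n+1)"] tau Epos(1)[of n] by (simp del: mult_pos_pos)
qed

end

section \<open>The supporting functional of a cube\<close>

lemma inner_cr: "cr u c * (\<zeta> \<bullet> y) = cr y c * (\<zeta> \<bullet> u) - cr y u * (\<zeta> \<bullet> c)"
  by (simp add: cr_def inner_complex_def algebra_simps)

lemma inner_solve: assumes "cr u c \<noteq> 0" obtains \<zeta> where "\<zeta> \<bullet> u = a" "\<zeta> \<bullet> c = b"
proof
  let ?z = "Complex ((a * Im c - b * Im u) / cr u c) ((b * Re u - a * Re c) / cr u c)"
  have "(a * Im c - b * Im u) * Re u + (b * Re u - a * Re c) * Im u = a * cr u c"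
    "(a * Im c - b * Im u) * Re c + (b * Re u - a * Re c) * Im c = b * cr u c" by (simp_all add: cr_def algebra_simps)
  then show "?z \<bullet> u = a" "?z \<bullet> c = b" using assms by (simp_all add: inner_complex_def add_divide_distrib[symmetric])
qed

lemma forward_mono:
  fixes s :: "nat => real"
  assumes \<tau>: "0 < \<tau>" and rec: "!!m. s m = 2 * (1+\<tau>) * s (m+1) - \<tau> * s (m+2)" and L: "0 \<le> s L" "s L \<le> s (L+1)" and m: "L \<le> m"
  shows "s L \<le> s m"
proof -
  have "0 \<le> s (L+i) \<and> s (L+i) \<le> s (L+Suc i)" for i
  proof (induction i)
    case (Suc i)
    have r: "\<tau> * s (L + Suc (Suc i)) = 2 * (1+\<tau>) * s (L + Suc i) - s (L+i)" using rec[of "L+i"] by simp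
    have "0 \<le> (1+\<tau>) * s (L + Suc i)" using Suc \<tau> by simp
    then have "\<tau> * s (L + Suc i) \<le> \<tau> * s (L + Suc (Suc i))" unfolding r using Suc by (simp add: algebra_simps)
    then show ?case using Suc \<tau> by simp
  qed (use L in simp)
  then have "s (L+i) \<le> s (L+Suc i)" for i by simp
  from lift_Suc_mono_le[of "\<lambda>i. s (L+i)", OF this, of 0 "m - L"] show ?thesis using m by simp
qed

text \<open>The corners of a cube modulo \<open>Lam\<close>, described by their differences from its
  base in layer, quarter-turn and sixth-turn.\<close>

definition on_cube :: "int => int => int => bool" where
  "on_cube i n j \<longleftrightarrow> (\<exists>a b c. i = of_bool a + of_bool b + of_bool c \<and> 4 dvd n - of_bool c \<and> 6 dvd j - (of_bool a - of_bool b))"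

lemma on_cube_iff: "on_cube i n j \<longleftrightarrow>
    4 dvd n \<and> (i = 0 \<and> 6 dvd j \<or> i = 1 \<and> (6 dvd j - 1 \<or> 6 dvd j + 1) \<or> i = 2 \<and> 6 dvd j)
  \<or> 4 dvd n - 1 \<and> (i = 1 \<and> 6 dvd j \<or> i = 2 \<and> (6 dvd j - 1 \<or> 6 dvd j + 1) \<or> i = 3 \<and> 6 dvd j)"
  unfolding on_cube_def by (simp add: ex_bool_eq) blast

lemma on_cube_vertex:
  assumes "on_cube (csum x - csum u) (x$3 - u$3) ((x$1 - x$2) - (u$1 - u$2))"
  shows "\<exists>l\<in>Lam. l + x \<in> unit_cell u UNIV"
proof -
  obtain a b c where c: "csum x - csum u = of_bool a + of_bool b + of_bool c" "4 dvd x$3 - u$3 - of_bool c"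
    "6 dvd (x$1 - x$2) - (u$1 - u$2) - (of_bool a - of_bool b)" using assms unfolding on_cube_def by blast
  obtain p where p: "x$3 - u$3 - of_bool c = 4 * p" using c(2) by blast
  obtain q where q: "(x$1 - x$2) - (u$1 - u$2) - (of_bool a - of_bool b) = 6 * q" using c(3) by blast
  define l where "l = corner u a b c - x"
  have "l $ 3 = 4 * (- p)" using p by (simp add: l_def)
  moreover have "l $ 1 = 3 * (- q) - 2 * (- p)" "l $ 2 = - 3 * (- q) - 2 * (- p)"
    using p q c(1) unfolding l_def csum_def vector_minus_component corner_simps by linarith+
  ultimately have "l \<in> Lam" by (intro LamI)
  moreover have "l + x \<in> unit_cell u UNIV" unfolding cube_corner l_def by auto
  ultimately show ?thesis by blast
qed

lemma vertex_on_cube: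
  assumes "x \<in> unit_cell u UNIV"
  shows "on_cube (csum x - csum u) (x$3 - u$3) ((x$1 - x$2) - (u$1 - u$2))"
proof -
  obtain a b c where "x = corner u a b c" using assms cube_corner by blast
  then show ?thesis unfolding on_cube_def by (intro exI[of _ a] exI[of _ b] exI[of _ c]) (simp add: csum_def)
qed

context outward begin

text \<open>Symmetry reduces the claim to a cube based in layer \<open>l\<close> with both turns 0.
  A reflection-invariant functional has three real parameters, in \<zeta> and \<mu>, and the corners
  \<open>v\<close>, \<open>v + ax 1\<close>, \<open>v + ax 3\<close> determine them. The parity
  condition selects the combinations of layer and turns that lattice points have.\<close>

lemma lifting:
  obtains \<zeta> \<mu> where
    "!!m n j. even (int m - int l - n - j) ==> 0 \<le> h m - \<zeta> \<bullet> (ii n * Y m) - \<mu> * Re (om j)"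
    "!!m n j. even (int m - int l - n - j) ==> h m - \<zeta> \<bullet> (ii n * Y m) - \<mu> * Re (om j) = 0 \<longleftrightarrow> on_cube (int m - int l) n j"
proof -
  let ?c = "seqc \<tau>" and ?u = "2 *\<^sub>R Y (l+1) - Y l" and ?d = "E (l+1)" and ?e = "E (l+2)"
  have El: "E l = 2 * (1+\<tau>) * ?d - \<tau> * ?e" using seq_rec[OF ok, of l] by simp
  have D: "cr ?u ?c = \<tau> * qq l"
    unfolding cr_def seqY_def seqc_def qq_def by (simp add: El algebra_simps)
  have Dp: "0 < \<tau> * qq l" using tau qq_pos[of l] by simp
  \<comment> \<open>The three corner equations with \<mu> eliminated: the first value combines
    \<open>v\<close> and \<open>v + ax 1\<close>, the second \<open>v\<close> and
    \<open>v + ax 3\<close> by \<open>h_step\<close>. \<open>D\<close> is the determinant of this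
    system.\<close>
  obtain \<zeta> where z: "\<zeta> \<bullet> ?u = 2 * h (l+1) - h l" "\<zeta> \<bullet> ?c = 1 + \<tau>" using inner_solve[of ?u ?c] D Dp by (metis less_irrefl)
  \<comment> \<open>\<open>q\<close> and \<open>p\<close> are the defects of the linear part in
    \<zeta> for quarter-turns 0 and 1. A half-turn changes its sign, so the other two turns give
    \<open>2 * h m - q m\<close> and \<open>2 * h m - p m\<close>.\<close>
  define q where "q m = h m - \<zeta> \<bullet> Y m" for m
  define p where "p m = h m - \<zeta> \<bullet> (\<i> * Y m)" for m
  define \<mu> where "\<mu> = q l"
  have "\<tau> * (qq l * \<mu>) = \<tau> * (4 * cas E l)"
  proof -
    have "\<tau> * (qq l * \<mu>) = cr ?u ?c * h l - cr ?u ?c * (\<zeta> \<bullet> Y l)" unfolding D \<mu>_def q_def by (simp add: algebra_simps)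
    also have "\<dots> = \<tau> * qq l * h l - (cr (Y l) ?c * (2 * h (l+1) - h l) - cr (Y l) ?u * (1+\<tau>))"
      unfolding inner_cr[of ?u ?c \<zeta> "Y l"] z by (simp only: D)
    also have "cr (Y l) ?c = (1 - \<tau>) * E l + 2 * \<tau> * (1+\<tau>) * ?d" by (simp add: cr_def seqY_def seqc_def algebra_simps)
    also have "cr (Y l) ?u = - (2 * \<tau> * cas E l)"
      by (simp add: cr_def seqY_def cas_def power2_eq_square algebra_simps)
    also have "h (l+1) = \<tau> * ?e - ?d" by (simp add: seqh_def)
    finally show ?thesis unfolding h_alt qq_def El cas_quadratic[OF ok] by (simp add: power2_eq_square algebra_simps)
  qed
  then have \<mu>q: "qq l * \<mu> = 4 * cas E l" using tau by simp
  have \<mu>: "0 < \<mu>"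
  proof -
    have "0 < qq l * \<mu>" using \<mu>q W[of l] by simp
    then show ?thesis using qq_pos[of l] by (simp add: zero_less_mult_iff)
  qed
  have Yr: "Y m = (2 * (1+\<tau>)) *\<^sub>R Y (m+1) - \<tau> *\<^sub>R Y (m+2)" for m using seqY_rec[OF ok, of m] by (simp add: algebra_simps)
  have qr: "q m = 2 * (1+\<tau>) * q (m+1) - \<tau> * q (m+2)" for m
  proof -
    have "\<zeta> \<bullet> Y m = 2 * (1+\<tau>) * (\<zeta> \<bullet> Y (m+1)) - \<tau> * (\<zeta> \<bullet> Y (m+2))" by (subst Yr) (simp only: inner_diff_right inner_scaleR_right)
    then show ?thesis unfolding q_def using h_rec[of m] by (simp only:) (simp add: algebra_simps)
  qed
  have pr: "p m = 2 * (1+\<tau>) * p (m+1) - \<tau> * p (m+2)" for m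
  proof -
    have "\<i> * Y m = (2 * (1+\<tau>)) *\<^sub>R (\<i> * Y (m+1)) - \<tau> *\<^sub>R (\<i> * Y (m+2))" by (subst Yr) (simp only: right_diff_distrib mult_scaleR_right)
    then have "\<zeta> \<bullet> (\<i> * Y m) = 2 * (1+\<tau>) * (\<zeta> \<bullet> (\<i> * Y (m+1))) - \<tau> * (\<zeta> \<bullet> (\<i> * Y (m+2)))" by (simp only: inner_diff_right inner_scaleR_right)
    then show ?thesis unfolding p_def using h_rec[of m] by (simp only:) (simp add: algebra_simps)
  qed
  \<comment> \<open>The value \<open>1 + \<tau>\<close> of \<zeta> on \<open>?c\<close> makes
    \<open>p\<close> a copy of \<open>q\<close> one layer up, so one profile serves both.\<close>
  have pq: "p (m+1) = q m" for m
    unfolding p_def q_def seqY_step[OF ok] using z(2) h_step[of m] by (simp add: inner_add_right algebra_simps)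
  have q0: "q l = \<mu>" "q (l+1) = \<mu>/2" using z(1) by (simp_all add: \<mu>_def q_def inner_diff_right)
  have p0: "p (l+1) = \<mu>" "p (l+1+1) = \<mu>/2" using pq[of l] pq[of "l+1"] q0 by simp_all
  note Q = profile[OF tau qr q0 \<mu>] and P = profile[OF tau pr p0 \<mu>]
  have q2: "q (l+2) = \<mu>" and p3: "p (l+3) = \<mu>" using Q(2) P(2) by (simp_all add: numeral_3_eq_3)
  have sc: "\<tau>^(l-m) * (4 * cas E l) = 4 * cas E m" "\<tau>^(l-m) * (qq l * \<mu>) = 4 * cas E m" if "m \<le> l" for m
    using cas_shift[of "l-m" m] that \<mu>q by simp_all
  have cancel: "a < b" if "\<tau>^i * (qq l * a) < \<tau>^i * (qq l * b)" for a b i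
    using that tau qq_pos[of l] by (simp add: mult_less_cancel_left)
  \<comment> \<open>From the base layer downwards this is \<open>rung_even\<close>, divided by the
    positive number \<open>\<tau>^(l-m) * qq l\<close>.\<close>
  have X1: "\<mu> < 2 * h m - q m" if "m \<le> l" for m
  proof -
    have "q m = \<mu> * backv \<tau> (l - m)" using Q(1)[of "l - m"] that by simp
    moreover have "\<mu> < 2 * h m - \<mu> * backv \<tau> (l - m)"
    proof (rule cancel[of "l-m"])
      have "\<tau>^(l-m) * (qq l * (2 * h m - \<mu> * backv \<tau> (l - m))) = 2 * h m * (\<tau>^(l-m) * qq l) - \<tau>^(l-m) * (qq l * \<mu>) * backv \<tau> (l - m)"
        by (simp add: algebra_simps)
      then show "\<tau>^(l-m) * (qq l * \<mu>) < \<tau>^(l-m) * (qq l * (2 * h m - \<mu> * backv \<tau> (l - m)))"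
        using rung_even[of m "l-m"] sc[OF that] that by simp
    qed
    ultimately show ?thesis by simp
  qed
  have h\<mu>: "\<mu> < h l" using X1[of l] q0 by simp
  \<comment> \<open>Above the base layer this defect solves the recurrence and starts without
    descending, so it never falls below its value in layer \<open>l\<close>.\<close>
  have X: "\<mu> < 2 * h m - q m" for m
  proof (cases "m \<le> l")
    case False
    have "2 * h l - q l \<le> 2 * h m - q m"
    proof (rule forward_mono[OF tau, where s="\<lambda>m. 2 * h m - q m"])
      fix m show "2 * h m - q m = 2 * (1+\<tau>) * (2 * h (m+1) - q (m+1)) - \<tau> * (2 * h (m+2) - q (m+2))"
        by (subst h_rec, subst qr) (simp add: algebra_simps)
      show "0 \<le> 2 * h l - q l" "2 * h l - q l \<le> 2 * h (l+1) - q (l+1)" using h\<mu> \<mu> q0 h_mono[of l "l+1"] by simp_all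
    qed (use False in simp)
    then show ?thesis using X1[of l] by simp
  qed (rule X1)
  have X': "\<mu> < 2 * h m - p m" if "m \<noteq> l" for m
  proof (cases "m < l")
    case True
    define j where "j = l - m - 1"
    have j: "l - m = Suc j" "l + 1 - m = Suc (Suc j)" "l = m + Suc j" using True by (simp_all add: j_def)
    have "p m = \<mu> * backv \<tau> (Suc (Suc j))" using P(1)[of "l + 1 - m"] j True by simp
    moreover have "\<mu> < 2 * h m - \<mu> * backv \<tau> (Suc (Suc j))"
    proof (rule cancel[of "l-m"])
      have "\<tau>^(l-m) * (qq l * (2 * h m - \<mu> * backv \<tau> (Suc (Suc j)))) = 2 * h m * (\<tau>^(l-m) * qq l) - \<tau>^(l-m) * (qq l * \<mu>) * backv \<tau> (Suc (Suc j))"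
        by (simp only: algebra_simps)
      then show "\<tau>^(l-m) * (qq l * \<mu>) < \<tau>^(l-m) * (qq l * (2 * h m - \<mu> * backv \<tau> (Suc (Suc j))))"
        using rung_odd(2)[of m j] sc(2)[of m] True unfolding j(1) j(3)[symmetric] by simp
    qed
    ultimately show ?thesis by simp
  next
    case False
    have "2 * h (l+1) - p (l+1) \<le> 2 * h m - p m"
    proof (rule forward_mono[OF tau, where s="\<lambda>m. 2 * h m - p m"])
      fix m show "2 * h m - p m = 2 * (1+\<tau>) * (2 * h (m+1) - p (m+1)) - \<tau> * (2 * h (m+2) - p (m+2))"
        by (subst h_rec, subst pr) (simp add: algebra_simps)
      show "0 \<le> 2 * h (l+1) - p (l+1)" "2 * h (l+1) - p (l+1) \<le> 2 * h (l+1+1) - p (l+1+1)"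
        using h\<mu> \<mu> p0 h_mono[of l "l+1"] h_mono[of "l+1" "l+1+1"] by simp_all
    qed (use False that in simp)
    then show ?thesis using h\<mu> p0 h_mono[of l "l+1"] by simp
  qed
  have Xl: "\<mu>/2 < 2 * h l - p l"
  proof -
    have "p l = \<mu> * backv \<tau> 1" using P(1)[of 1] by simp
    moreover have "\<mu>/2 < 2 * h l - \<mu> * backv \<tau> 1"
    proof (rule cancel[of 0])
      have "qq l * (2 * h l - \<mu> * backv \<tau> 1) = 2 * h l * qq l - qq l * \<mu> * backv \<tau> 1" by (simp only: algebra_simps)
      then show "\<tau>^0 * (qq l * (\<mu>/2)) < \<tau>^0 * (qq l * (2 * h l - \<mu> * backv \<tau> 1))"
        using rung_odd(1)[of l] \<mu>q by simp
    qed
    ultimately show ?thesis by simp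
  qed
  have key: "0 \<le> h m - \<zeta> \<bullet> (ii n * Y m) - \<mu> * Re (om j) \<and> (h m - \<zeta> \<bullet> (ii n * Y m) - \<mu> * Re (om j) = 0 \<longleftrightarrow> on_cube (int m - int l) n j)"
    if par: "even (int m - int l - n - j)" for m n j
  proof -
    have lt: "0 \<le> s - \<mu> * Re (om j) \<and> s - \<mu> * Re (om j) \<noteq> 0" if "\<mu> < s" for s
      using that \<mu> mult_left_mono[OF om_le[of j] less_imp_le[OF \<mu>]] by linarith
    have half: "0 \<le> s - \<mu> * Re (om j) \<and> s - \<mu> * Re (om j) \<noteq> 0" if "\<mu>/2 < s" "odd j" for s
      using that(1) mult_left_mono[OF om_odd(1)[OF that(2)] less_imp_le[OF \<mu>]] by linarith
    have ev: "0 \<le> \<mu> - \<mu> * Re (om j) \<and> (\<mu> - \<mu> * Re (om j) = 0 \<longleftrightarrow> 6 dvd j)" if "even j"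
    proof -
      have "6 dvd j ==> Re (om j) = 1" using om_period[of _ 0] by (auto elim!: dvdE)
      then show ?thesis using om_even[OF that] \<mu> by (auto simp: mult_le_cancel_left1)
    qed
    have od: "0 \<le> \<mu>/2 - \<mu> * Re (om j) \<and> (\<mu>/2 - \<mu> * Re (om j) = 0 \<longleftrightarrow> 6 dvd j - 1 \<or> 6 dvd j + 1)" if "odd j"
    proof -
      have r: "6 dvd j - 1 \<or> 6 dvd j + 1 ==> Re (om j) = 1/2"
      proof (elim disjE dvdE)
        fix k assume "j - 1 = 6 * k"
        then show "Re (om j) = 1/2" using om_period[of k 1] om_1 by (simp add: algebra_simps)
      next
        fix k assume "j + 1 = 6 * k"
        then have j: "j = 6 * k + - 1" by simp
        show "Re (om j) = 1/2" unfolding j om_period om_m1 by simp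
      qed
      have "\<mu> * Re (om j) \<le> \<mu> * (1/2)" using om_odd(1)[OF that] \<mu> by (intro mult_left_mono) auto
      moreover have "\<mu>/2 - \<mu> * Re (om j) = \<mu> * (1/2 - Re (om j))" by (simp add: algebra_simps)
      then have "\<mu>/2 - \<mu> * Re (om j) = 0 \<longleftrightarrow> Re (om j) = 1/2" using \<mu> by auto
      moreover have "Re (om j) = 1/2 \<longleftrightarrow> 6 dvd j - 1 \<or> 6 dvd j + 1" using r om_odd(2)[OF that] by blast
      ultimately show ?thesis by simp
    qed
    define r where "r = n mod 4"
    have ni: "ii n = ii r" using ii_period[of "n div 4" r] by (simp add: r_def)
    have "r = 0 \<or> r = 1 \<or> r = 2 \<or> r = 3" unfolding r_def by presburger
    then show ?thesis
    proof (elim disjE)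
      assume r0: "r = 0"
      have n4: "4 dvd n" "\<not> 4 dvd n - 1" using r0 unfolding r_def by presburger+
      have s: "h m - \<zeta> \<bullet> (ii n * Y m) = q m" by (simp add: ni r0 q_def)
      have oc: "on_cube (int m - int l) n j \<longleftrightarrow> m = l \<and> 6 dvd j \<or> m = l+1 \<and> (6 dvd j - 1 \<or> 6 dvd j + 1) \<or> m = l+2 \<and> 6 dvd j"
        unfolding on_cube_iff using n4 by auto
      consider "m < l" | "m = l" | "m = l+1" | "m = l+2" | "l+3 \<le> m" by linarith
      then show ?thesis
      proof cases
        case 1 then show ?thesis using lt[of "q m"] Q(3)[of m] unfolding s oc by simp
      next
        case 2
        have "q m = \<mu>" "even j" using 2 q0 par n4 by auto
        then show ?thesis unfolding s oc using ev 2 by simp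
      next
        case 3
        have e: "q m = \<mu>/2" and o: "odd j" using 3 q0 par n4 by auto
        have k: "(m = l \<and> 6 dvd j \<or> m = l+1 \<and> (6 dvd j - 1 \<or> 6 dvd j + 1) \<or> m = l+2 \<and> 6 dvd j) \<longleftrightarrow> (6 dvd j - 1 \<or> 6 dvd j + 1)" using 3 by auto
        show ?thesis unfolding s oc e k by (rule od[OF o])
      next
        case 4
        have "q m = \<mu>" "even j" using 4 q2 par n4 by auto
        then show ?thesis unfolding s oc using ev 4 by simp
      next
        case 5 then show ?thesis using lt[of "q m"] Q(4)[of m] unfolding s oc by simp
      qed
    next
      assume r0: "r = 1"
      have n4: "4 dvd n - 1" "\<not> 4 dvd n" "odd n" using r0 unfolding r_def by presburger+
      have s: "h m - \<zeta> \<bullet> (ii n * Y m) = p m" by (simp add: ni r0 p_def)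
      have oc: "on_cube (int m - int l) n j \<longleftrightarrow> m = l+1 \<and> 6 dvd j \<or> m = l+2 \<and> (6 dvd j - 1 \<or> 6 dvd j + 1) \<or> m = l+3 \<and> 6 dvd j"
        unfolding on_cube_iff using n4 by auto
      consider "m < l+1" | "m = l+1" | "m = l+2" | "m = l+3" | "l+1+3 \<le> m" by linarith
      then show ?thesis
      proof cases
        case 1 then show ?thesis using lt[of "p m"] P(3)[of m] unfolding s oc by simp
      next
        case 2
        have "p m = \<mu>" "even j" using 2 p0 par n4 by auto
        then show ?thesis unfolding s oc using ev 2 by simp
      next
        case 3
        have e: "p m = \<mu>/2" and o: "odd j" using 3 p0 par n4 by auto
        have k: "(m = l+1 \<and> 6 dvd j \<or> m = l+2 \<and> (6 dvd j - 1 \<or> 6 dvd j + 1) \<or> m = l+3 \<and> 6 dvd j) \<longleftrightarrow> (6 dvd j - 1 \<or> 6 dvd j + 1)" using 3 by auto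
        show ?thesis unfolding s oc e k by (rule od[OF o])
      next
        case 4
        have "p m = \<mu>" "even j" using 4 p3 par n4 by auto
        then show ?thesis unfolding s oc using ev 4 by simp
      next
        case 5 then show ?thesis using lt[of "p m"] P(4)[of m] unfolding s oc by simp
      qed
    next
      assume r0: "r = 2"
      have n4: "\<not> 4 dvd n - 1" "\<not> 4 dvd n" using r0 unfolding r_def by presburger+
      have s: "h m - \<zeta> \<bullet> (ii n * Y m) = 2 * h m - q m" by (simp add: ni r0 q_def)
      show ?thesis unfolding s on_cube_iff using n4 lt[OF X[of m]] by simp
    next
      assume r0: "r = 3"
      have n4: "\<not> 4 dvd n - 1" "\<not> 4 dvd n" "odd n" using r0 unfolding r_def by presburger+
      have "ii 3 = - \<i>" using ii_add[of 1 2] by simp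
      then have s: "h m - \<zeta> \<bullet> (ii n * Y m) = 2 * h m - p m" by (simp add: ni r0 p_def)
      show ?thesis
      proof (cases "m = l")
        case True then have "odd j" using par n4(3) by auto
        then show ?thesis unfolding s on_cube_iff using n4 half[of "2 * h m - p m"] Xl True by simp
      next
        case False then show ?thesis unfolding s on_cube_iff using n4 lt[OF X'[of m]] by simp
      qed
    qed
  qed
  then show ?thesis using that[of \<zeta> \<mu>] by blast
qed

end

section \<open>The extended complex\<close>

lemma inclusion_isomorphic_sym: assumes "inclusion_isomorphic A B" shows "inclusion_isomorphic B A"
proof -
  obtain f where f: "bij_betw f A B" "\<forall>X\<in>A. \<forall>Y\<in>A. X \<subseteq> Y \<longleftrightarrow> f X \<subseteq> f Y" using assms by (auto simp: inclusion_isomorphic_def)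
  have g: "bij_betw (inv_into A f) B A" using bij_betw_inv_into[OF f(1)] .
  have "X \<subseteq> Y \<longleftrightarrow> inv_into A f X \<subseteq> inv_into A f Y" if "X \<in> B" "Y \<in> B" for X Y
  proof -
    have "inv_into A f X \<in> A" "inv_into A f Y \<in> A" using bij_betwE[OF g] that by simp_all
    then show ?thesis using f(2) bij_betw_inv_into_right[OF f(1)] that by simp
  qed
  then show ?thesis unfolding inclusion_isomorphic_def by (intro exI[of _ "inv_into A f"] conjI ballI g)
qed

lemma inclusion_isomorphic_trans:
  assumes "inclusion_isomorphic A B" "inclusion_isomorphic B C" shows "inclusion_isomorphic A C"
proof -
  obtain f where f: "bij_betw f A B" "\<forall>X\<in>A. \<forall>Y\<in>A. X \<subseteq> Y \<longleftrightarrow> f X \<subseteq> f Y" using assms(1) by (auto simp: inclusion_isomorphic_def)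
  obtain g where g: "bij_betw g B C" "\<forall>X\<in>B. \<forall>Y\<in>B. X \<subseteq> Y \<longleftrightarrow> g X \<subseteq> g Y" using assms(2) by (auto simp: inclusion_isomorphic_def)
  have "bij_betw (g \<circ> f) A C" using bij_betw_trans[OF f(1) g(1)] .
  moreover have "X \<subseteq> Y \<longleftrightarrow> (g \<circ> f) X \<subseteq> (g \<circ> f) Y" if "X \<in> A" "Y \<in> A" for X Y
    using f g that bij_betwE[OF f(1)] by auto
  ultimately show ?thesis unfolding inclusion_isomorphic_def by (intro exI[of _ "g \<circ> f"] conjI ballI)
qed

lemma faces_isomorphic:
  assumes C: "convex_cell P c" "is_cell c"
  shows "inclusion_isomorphic {e. e = {} \<or> is_cell e \<and> e \<subseteq> c} {F. sph_face F (sph_hull (P ` c))}"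
proof -
  let ?A = "{e. e = {} \<or> is_cell e \<and> e \<subseteq> c}" and ?f = "\<lambda>e. sph_hull (P ` e)"
  have le: "?f X \<subseteq> ?f Y \<longleftrightarrow> X \<subseteq> Y" if "X \<in> ?A" "Y \<in> ?A" for X Y
  proof (cases "X = {}")
    case False
    then have X: "is_cell X" "X \<subseteq> c" using that by auto
    have ne: "?f X \<noteq> {}" using convex_cell_hull_nonempty[OF convex_cell_sub[OF C X] X(1)] .
    show ?thesis
    proof (cases "Y = {}")
      case True then show ?thesis using ne False by simp
    next
      case Yn: False
      then have Y: "is_cell Y" "Y \<subseteq> c" using that by auto
      show ?thesis by (rule convex_cell_hull_mono[OF C X Y])
    qed
  qed simp
  have "inj_on ?f ?A"
  proof (rule inj_onI)
    fix X Y assume "X \<in> ?A" "Y \<in> ?A" "?f X = ?f Y"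
    then show "X = Y" using le[of X Y] le[of Y X] by simp
  qed
  moreover have "?f ` ?A = {F. sph_face F (sph_hull (P ` c))}"
  proof (rule set_eqI)
    fix F show "F \<in> ?f ` ?A \<longleftrightarrow> F \<in> {F. sph_face F (sph_hull (P ` c))}"
      unfolding mem_Collect_eq convex_cell_faces[OF C] by (auto simp: image_iff)
  qed
  ultimately have "bij_betw ?f ?A {F. sph_face F (sph_hull (P ` c))}" by (simp add: bij_betw_def)
  then show ?thesis unfolding inclusion_isomorphic_def by (intro exI[of _ ?f] conjI ballI) (auto simp only: le)
qed

lemma subcells_translate:
  "inclusion_isomorphic {e. e = {} \<or> is_cell e \<and> e \<subseteq> c} {e. e = {} \<or> is_cell e \<and> e \<subseteq> (+) t ` c}"
proof -
  have inv: "(+) t ` (+) (- t) ` e = e" "(+) (- t) ` (+) t ` e = e" for e :: "(int^3) set" by (simp_all add: image_image)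
  have mono: "(+) t ` X \<subseteq> (+) t ` Y \<longleftrightarrow> X \<subseteq> Y" for X Y :: "(int^3) set" by (rule inj_image_subset_iff) simp
  have "bij_betw ((`) ((+) t)) {e. e = {} \<or> is_cell e \<and> e \<subseteq> c} {e. e = {} \<or> is_cell e \<and> e \<subseteq> (+) t ` c}"
  proof (rule bij_betw_byWitness[where f'="(`) ((+) (- t))"])
    show "(`) ((+) t) ` {e. e = {} \<or> is_cell e \<and> e \<subseteq> c} \<subseteq> {e. e = {} \<or> is_cell e \<and> e \<subseteq> (+) t ` c}"
      using is_cell_translate by (auto simp: mono)
    show "(`) ((+) (- t)) ` {e. e = {} \<or> is_cell e \<and> e \<subseteq> (+) t ` c} \<subseteq> {e. e = {} \<or> is_cell e \<and> e \<subseteq> c}"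
    proof (rule image_subsetI)
      fix e assume "e \<in> {e. e = {} \<or> is_cell e \<and> e \<subseteq> (+) t ` c}"
      then consider "e = {}" | "is_cell e" "e \<subseteq> (+) t ` c" by blast
      then show "(+) (- t) ` e \<in> {e. e = {} \<or> is_cell e \<and> e \<subseteq> c}"
      proof cases
        case 2
        have "(+) (- t) ` e \<subseteq> (+) (- t) ` (+) t ` c" using 2(2) by (rule image_mono)
        then have "(+) (- t) ` e \<subseteq> c" unfolding inv(2) .
        then show ?thesis using is_cell_translate[OF 2(1), of "- t"] by simp
      qed simp
    qed
  qed (simp_all only: inv, simp_all)
  then show ?thesis unfolding inclusion_isomorphic_def by (intro exI[of _ "(`) ((+) t)"] conjI ballI) (auto simp only: mono)
qed

text \<open>The faces of a convex cell form the poset of its subcells, which translation preserves.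
  So a new cell is a cube because a translate of it in the given CCT is one.\<close>

lemma sph_cube_translate:
  assumes C: "convex_cell P c" "is_cell c" and D: "convex_cell Q ((+) t ` c)" "sph_cube (sph_hull (Q ` (+) t ` c))"
  shows "sph_cube (sph_hull (P ` c))"
proof -
  have D2: "is_cell ((+) t ` c)" using is_cell_translate[OF C(2)] .
  obtain J where J: "inclusion_isomorphic {F. F face_of std_cube J} {F. sph_face F (sph_hull (Q ` (+) t ` c))}"
    using D(2) by (auto simp: sph_cube_def)
  have "inclusion_isomorphic {F. F face_of std_cube J} {F. sph_face F (sph_hull (P ` c))}"
    using inclusion_isomorphic_trans[OF inclusion_isomorphic_trans[OF inclusion_isomorphic_trans[OF J
      inclusion_isomorphic_sym[OF faces_isomorphic[OF D(1) D2]]] inclusion_isomorphic_sym[OF subcells_translate]] faces_isomorphic[OF C]] .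
  then show ?thesis unfolding sph_cube_def using sph_polytope_hull[OF cell_finite[OF C(2)] convex_cell_hemi[OF C(1)]] by blast
qed

text \<open>A cell meets at most four consecutive layers, so a shift along the third axis fits it
  into layers 0 to 3.\<close>

lemma strip_shift:
  assumes c: "c \<in> strip K" and k: "3 \<le> k"
  obtains t where "(+) t ` c \<in> strip k"
proof -
  have cell: "is_cell c" using c strip_cell by blast
  have fin: "finite (csum ` c)" "csum ` c \<noteq> {}" using cell_finite[OF cell] cell_nonempty[OF cell] by auto
  define j where "j = Min (csum ` c)"
  obtain w0 where w0: "w0 \<in> c" "csum w0 = j" using Min_in[OF fin] by (auto simp: j_def)
  define t :: "int^3" where "t = vector [0, 0, - j]"
  have "0 \<le> csum (t + w) \<and> csum (t + w) \<le> int k" if "w \<in> c" for w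
  proof -
    have "j \<le> csum w" unfolding j_def using fin(1) that by simp
    moreover have "csum w - csum w0 \<le> 3" using cell_diff[OF cell that w0(1), of 1] cell_diff[OF cell that w0(1), of 2] cell_diff[OF cell that w0(1), of 3]
      by (simp add: csum_def)
    ultimately show ?thesis using w0(2) k by (simp add: t_def)
  qed
  then have "(+) t ` c \<in> strip k" using is_cell_translate[OF cell] by (auto simp: strip_iff)
  then show ?thesis using that by blast
qed

lemma inner_cnj: "x \<bullet> y = Re (cnj x * y)" by (simp add: inner_complex_def)

lemma ii_cnj: "cnj (ii n) = ii (- n)" by (simp add: ii_def cis_cnj)

section \<open>The vertex family of the extension\<close>

locale model = outward +
  fixes A :: complex and \<eta> :: real
  assumes A: "A \<noteq> 0" and \<eta>: "\<eta> = 1 \<or> \<eta> = -1"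
begin

text \<open>The height scale is a parameter so that \<open>V s\<close> describes the extension and
  \<open>V 0\<close> its control.\<close>

definition V :: "real => int^3 => real^5" where
  "V s = gv (\<lambda>m. A * Y m) (\<lambda>m. s * h m) \<eta>"

lemma V_periodic: "\<forall>l\<in>Lam. \<forall>v. V s (l + v) = V s v" unfolding V_def by (rule gv_periodic)

lemma flat_V: "flat (V s v) = V 0 v" using flat_gv[of "\<lambda>m. A * Y m" "\<lambda>m. s * h m" \<eta>] by (simp add: V_def fun_eq_iff)

lemma V_form: "zc (V s v) = ii (v$3) * (A * Y (nat (csum v)))" "wc (V s v) = \<eta> *\<^sub>R om (v$1 - v$2)" "V s v $ 5 = s * h (nat (csum v))"
  by (simp_all add: V_def gv_def)

lemma cr_pos: "cr (2 *\<^sub>R Y (l+1) - Y l) (seqc \<tau>) = \<tau> * qq l" "0 < \<tau> * qq l"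
proof -
  have El: "E l = 2 * (1+\<tau>) * E (l+1) - \<tau> * E (l+2)" using seq_rec[OF ok, of l] by simp
  show "cr (2 *\<^sub>R Y (l+1) - Y l) (seqc \<tau>) = \<tau> * qq l"
    unfolding cr_def seqY_def seqc_def qq_def by (simp add: El algebra_simps)
  show "0 < \<tau> * qq l" using tau qq_pos by simp
qed

lemma V_square12:
  assumes "csum v = int m"
  shows "V s v + \<tau> *\<^sub>R V s (v + ax 1 + ax 2) = (1+\<tau>) *\<^sub>R (V s (v + ax 1) + V s (v + ax 2))"
proof -
  have z: "ii (v$3) * (A * Y m) + \<tau> *\<^sub>R (ii (v$3) * (A * Y (m+2))) = (1+\<tau>) *\<^sub>R (ii (v$3) * (A * Y (m+1)) + ii (v$3) * (A * Y (m+1)))"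
  proof -
    have "ii (v$3) * (A * Y m) + \<tau> *\<^sub>R (ii (v$3) * (A * Y (m+2))) = ii (v$3) * A * (Y m + \<tau> *\<^sub>R Y (m+2))" by (simp add: algebra_simps)
    then show ?thesis unfolding seqY_rec[OF ok] by (simp add: scaleR_conv_of_real algebra_simps)
  qed
  have w: "\<eta> *\<^sub>R om (v$1 - v$2) + \<tau> *\<^sub>R \<eta> *\<^sub>R om (v$1 - v$2) = (1+\<tau>) *\<^sub>R (\<eta> *\<^sub>R (om (v$1 - v$2) * om 1) + \<eta> *\<^sub>R (om (v$1 - v$2) * om (-1)))"
  proof -
    have "\<eta> *\<^sub>R (om (v$1 - v$2) * om 1) + \<eta> *\<^sub>R (om (v$1 - v$2) * om (-1)) = \<eta> *\<^sub>R (om (v$1 - v$2) * (om 1 + om (-1)))" by (simp add: algebra_simps)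
    then show ?thesis unfolding om_pm by (simp add: algebra_simps)
  qed
  have e: "s * h m + \<tau> * (s * h (m+2)) = (1+\<tau>) * (s * h (m+1) + s * h (m+1))" by (subst h_rec) (simp add: algebra_simps)
  show ?thesis unfolding V_def gv_square[OF assms] mk_add mk_scale using z w e by (simp only:)
qed

lemma V_square13:
  assumes m: "csum v = int m" and \<kappa>: "\<kappa> = E (m+2) / E (m+1)"
  shows "\<kappa> *\<^sub>R V s v + V s (v + ax 1 + ax 3) = \<kappa> *\<^sub>R V s (v + ax 3) + V s (v + ax 1)"
    "\<kappa> *\<^sub>R V s v + V s (v + ax 2 + ax 3) = \<kappa> *\<^sub>R V s (v + ax 3) + V s (v + ax 2)"
proof -
  have \<kappa>E: "\<kappa> * E (m+1) = E (m+2)" using \<kappa> Epos(1)[of m] by simp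
  have "\<kappa> *\<^sub>R (ii (v$3) * (A * Y m)) + ii (v$3) * (\<i> * (A * Y (m+2))) = ii (v$3) * A * (\<kappa> *\<^sub>R Y m + \<i> * Y (m+2))" by (simp add: algebra_simps)
  also have "\<kappa> *\<^sub>R Y m + \<i> * Y (m+2) = \<kappa> *\<^sub>R (\<i> * Y (m+1)) + Y (m+1)"
    using seqY_step[OF ok, of m] seqY_step[OF ok, of "m+1"] \<kappa>E[symmetric] by (simp add: scaleR_add_right)
  finally have z: "\<kappa> *\<^sub>R (ii (v$3) * (A * Y m)) + ii (v$3) * (\<i> * (A * Y (m+2))) = \<kappa> *\<^sub>R (ii (v$3) * (\<i> * (A * Y (m+1)))) + ii (v$3) * (A * Y (m+1))"
    by (simp add: algebra_simps)
  have e: "\<kappa> * (s * h m) + s * h (m+2) = \<kappa> * (s * h (m+1)) + s * h (m+1)"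
  proof -
    have "\<kappa> * (h (m+1) - h m) = h (m+2) - h (m+1)" unfolding h_step using h_step[of "m+1"] \<kappa>E by (simp add: algebra_simps)
    then have "s * (\<kappa> * (h (m+1) - h m)) = s * (h (m+2) - h (m+1))" by simp
    then show ?thesis by (simp add: algebra_simps)
  qed
  show "\<kappa> *\<^sub>R V s v + V s (v + ax 1 + ax 3) = \<kappa> *\<^sub>R V s (v + ax 3) + V s (v + ax 1)"
    "\<kappa> *\<^sub>R V s v + V s (v + ax 2 + ax 3) = \<kappa> *\<^sub>R V s (v + ax 3) + V s (v + ax 2)"
    unfolding V_def gv_square[OF m] mk_add mk_scale using z e by (simp_all only:)
qed

text \<open>The second coordinates give \<open>b = c\<close> and \<open>a + d = - b\<close>. What
  remains of the first is a combination of \<open>2 *\<^sub>R Y (m+1) - Y m\<close> and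
  \<open>seqc \<tau>\<close>, which are independent since \<open>qq m\<close> is positive.\<close>

lemma V_independent:
  assumes m: "csum v = int m" and eq: "a *\<^sub>R V s v + b *\<^sub>R V s (v + ax 1) + c *\<^sub>R V s (v + ax 2) + d *\<^sub>R V s (v + ax 3) = 0"
  shows "a = 0 \<and> b = 0 \<and> c = 0 \<and> d = 0"
proof -
  have "wc (a *\<^sub>R V s v + b *\<^sub>R V s (v + ax 1) + c *\<^sub>R V s (v + ax 2) + d *\<^sub>R V s (v + ax 3)) = 0" unfolding eq by simp
  then have "om (v$1 - v$2) * (\<eta> *\<^sub>R (of_real (a + d) + b *\<^sub>R om 1 + c *\<^sub>R om (-1))) = 0"
    unfolding wc_simps V_def gv_square[OF m] mk_simps by (simp add: scaleR_conv_of_real algebra_simps)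
  then have w: "of_real (a + d) + b *\<^sub>R om 1 + c *\<^sub>R om (-1) = 0" using \<eta> by auto
  have bc: "b = c" using arg_cong[OF w, of Im] by (simp add: om_1 om_m1)
  have ad: "a + d = - b" using arg_cong[OF w, of Re] bc by (simp add: om_1 om_m1)
  have "zc (a *\<^sub>R V s v + b *\<^sub>R V s (v + ax 1) + c *\<^sub>R V s (v + ax 2) + d *\<^sub>R V s (v + ax 3)) = 0" unfolding eq by simp
  then have "ii (v$3) * A * (a *\<^sub>R Y m + b *\<^sub>R Y (m+1) + c *\<^sub>R Y (m+1) + d *\<^sub>R (\<i> * Y (m+1))) = 0"
    unfolding zc_simps V_def gv_square[OF m] mk_simps by (simp add: scaleR_conv_of_real algebra_simps)
  then have "a *\<^sub>R Y m + b *\<^sub>R Y (m+1) + c *\<^sub>R Y (m+1) + d *\<^sub>R (\<i> * Y (m+1)) = 0" using A by simp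
  then have "(a + d) *\<^sub>R Y m + (b + c) *\<^sub>R Y (m+1) + (d * E (m+1)) *\<^sub>R seqc \<tau> = 0"
    unfolding seqY_step[OF ok] by (simp add: scaleR_conv_of_real algebra_simps)
  then have z: "b *\<^sub>R (2 *\<^sub>R Y (m+1) - Y m) + (d * E (m+1)) *\<^sub>R seqc \<tau> = 0"
    unfolding ad bc[symmetric] by (simp add: scaleR_conv_of_real algebra_simps)
  have "cr (b *\<^sub>R (2 *\<^sub>R Y (m+1) - Y m) + (d * E (m+1)) *\<^sub>R seqc \<tau>) (seqc \<tau>) = 0" unfolding z by (simp add: cr_def)
  then have "b * (\<tau> * qq m) = 0" unfolding cr_simps(1,3,7) cr_pos(1) by simp
  then have b0: "b = 0" by (metis cr_pos(2) less_irrefl mult_eq_0_iff)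
  then have "(d * E (m+1)) *\<^sub>R seqc \<tau> = 0" using z by simp
  moreover have "seqc \<tau> \<noteq> 0" using tau by (auto simp: seqc_def complex_eq_iff)
  ultimately have "d = 0" using Epos(1)[of m] by simp
  then show ?thesis using b0 bc ad by simp
qed

lemma V_convex: assumes "0 \<le> csum v" shows "convex_cell (V s) (unit_cell v UNIV)"
proof -
  define m where "m = nat (csum v)"
  have m: "csum v = int m" using assms by (simp add: m_def)
  have m1: "csum (v + ax 3) = int (m+1)" using m by simp
  define \<kappa> where "\<kappa> = E (m+2) / E (m+1)"
  have \<kappa>: "2 < \<kappa>" unfolding \<kappa>_def using E_double[of m] Epos(1)[of m] by (simp add: less_divide_eq)
  have "0 < \<kappa> * \<tau>" using \<kappa> tau by simp
  then have \<kappa>2: "1 < 2 * \<kappa> * (1+\<tau>)" using \<kappa> by (simp add: algebra_simps)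
  have r: "V s (v + ax 3) + \<tau> *\<^sub>R V s (v + ax 3 + ax 1 + ax 2) = (1+\<tau>) *\<^sub>R (V s (v + ax 1 + ax 3) + V s (v + ax 2 + ax 3))"
  proof -
    have c: "v + ax 3 + ax 1 = v + ax 1 + ax 3" "v + ax 3 + ax 2 = v + ax 2 + ax 3" by (simp_all add: ac_simps)
    show ?thesis using V_square12[OF m1, of s] unfolding c .
  qed
  have \<kappa>0: "0 < \<kappa>" using \<kappa> by simp
  show ?thesis
    by (rule cube_convex[OF tau \<kappa>0 \<kappa>2 V_square12[OF m] r V_square13[OF m \<kappa>_def]]) (rule V_independent[OF m], assumption)
qed

lemma V_convex_strip: assumes "c \<in> strip K" "3 \<le> K" shows "convex_cell (V s) c"
proof -
  obtain v where v: "c \<subseteq> unit_cell v UNIV" "unit_cell v UNIV \<in> strip K" by (rule strip_in_cube[OF assms])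
  have "0 \<le> csum v" using v(2) unit_cell_base[of v UNIV] by (auto simp: strip_iff)
  from convex_cell_sub[OF V_convex[OF this] is_cell_unit strip_cell[OF assms(1)] v(1)] show ?thesis .
qed

text \<open>\<open>lifting\<close>, rotated to the position of \<open>u\<close>. The functional has
  fifth component 0, so its value at \<open>V s x\<close> is the same for every \<open>s\<close>,
  and \<open>h\<close> enters as a bare number.\<close>

lemma cube_support:
  assumes u: "0 \<le> csum u"
  obtains f where "!!x s. 0 \<le> csum x ==> f \<bullet> V s x \<le> h (nat (csum x))"
    "!!x s. 0 \<le> csum x ==> f \<bullet> V s x = h (nat (csum x)) \<longleftrightarrow> (\<exists>l\<in>Lam. l + x \<in> unit_cell u UNIV)"
proof -
  define l where "l = nat (csum u)"
  have l: "csum u = int l" using u by (simp add: l_def)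
  obtain \<zeta> \<mu> where L: "!!m n j. even (int m - int l - n - j) ==> 0 \<le> h m - \<zeta> \<bullet> (ii n * Y m) - \<mu> * Re (om j)"
    "!!m n j. even (int m - int l - n - j) ==> h m - \<zeta> \<bullet> (ii n * Y m) - \<mu> * Re (om j) = 0 \<longleftrightarrow> on_cube (int m - int l) n j"
    using lifting by blast
  define f where "f = mk (\<zeta> * ii (u$3) / cnj A) ((\<mu> * \<eta>) *\<^sub>R om (u$1 - u$2)) 0"
  have val: "f \<bullet> V s x = \<zeta> \<bullet> (ii (x$3 - u$3) * Y (nat (csum x))) + \<mu> * Re (om ((x$1 - x$2) - (u$1 - u$2)))" for s x
  proof -
    have "(\<zeta> * ii (u$3) / cnj A) \<bullet> (ii (x$3) * (A * Y (nat (csum x)))) = \<zeta> \<bullet> (ii (x$3 - u$3) * Y (nat (csum x)))"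
    proof -
      have "cnj (\<zeta> * ii (u$3) / cnj A) * (ii (x$3) * (A * Y (nat (csum x)))) = cnj \<zeta> * (ii (x$3 - u$3) * Y (nat (csum x)))"
        using A ii_add[of "x$3" "- (u$3)"] by (simp add: ii_cnj)
      then show ?thesis unfolding inner_cnj by (simp only:)
    qed
    moreover have "((\<mu> * \<eta>) *\<^sub>R om (u$1 - u$2)) \<bullet> (\<eta> *\<^sub>R om (x$1 - x$2)) = \<mu> * Re (om ((x$1 - x$2) - (u$1 - u$2)))"
    proof -
      have "om (u$1 - u$2) \<bullet> om (x$1 - x$2) = Re (om ((x$1 - x$2) - (u$1 - u$2)))"
        using om_add[of "- (u$1 - u$2)" "x$1 - x$2"] unfolding inner_cnj by (simp add: algebra_simps)
      then show ?thesis using \<eta> by auto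
    qed
    ultimately show ?thesis unfolding inner5 V_form f_def mk_simps by simp
  qed
  have par: "even (int (nat (csum x)) - int l - (x$3 - u$3) - ((x$1 - x$2) - (u$1 - u$2)))" if "0 \<le> csum x" for x
  proof -
    have "int (nat (csum x)) - int l - (x$3 - u$3) - ((x$1 - x$2) - (u$1 - u$2)) = 2 * (x$2 - u$2)"
      using that l by (simp add: csum_def)
    then show ?thesis by (metis dvd_triv_left)
  qed
  have 1: "f \<bullet> V s x \<le> h (nat (csum x))" if "0 \<le> csum x" for s x unfolding val using L(1)[OF par[OF that]] by simp
  have iff: "f \<bullet> V s y = h (nat (csum y)) \<longleftrightarrow> on_cube (csum y - csum u) (y$3 - u$3) ((y$1 - y$2) - (u$1 - u$2))" if y: "0 \<le> csum y" for s y
  proof -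
    have e: "int (nat (csum y)) - int l = csum y - csum u" using y l by simp
    have r: "p + q = r \<longleftrightarrow> r - p - q = 0" for p q r :: real by auto
    show ?thesis unfolding val r using L(2)[OF par[OF y]] unfolding e .
  qed
  have 2: "f \<bullet> V s x = h (nat (csum x)) \<longleftrightarrow> (\<exists>l\<in>Lam. l + x \<in> unit_cell u UNIV)" if x: "0 \<le> csum x" for s x
  proof
    assume "f \<bullet> V s x = h (nat (csum x))"
    then show "\<exists>l\<in>Lam. l + x \<in> unit_cell u UNIV" unfolding iff[OF x] by (rule on_cube_vertex)
  next
    assume "\<exists>l\<in>Lam. l + x \<in> unit_cell u UNIV"
    then obtain m where m: "m \<in> Lam" "m + x \<in> unit_cell u UNIV" by blast
    have cs: "csum (m + x) = csum x" using m(1) by simp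
    have "f \<bullet> V s (m + x) = h (nat (csum (m + x)))" by (subst iff) (use x cs vertex_on_cube[OF m(2)] in simp_all)
    then show "f \<bullet> V s x = h (nat (csum x))" using V_periodic m(1) cs by simp
  qed
  show ?thesis by (rule that[of f]) (rule 1, assumption, rule 2, assumption)
qed

text \<open>The functional of a cube around \<open>d\<close> equals \<open>h\<close> on
  \<open>d\<close> and is at most \<open>h\<close> on \<open>c\<close>, so the height computed over
  \<open>c\<close> is at least that over \<open>d\<close>; exchanging the cells gives equality.
  Equality removes all weight outside the cube, and exposing \<open>d\<close> inside the cube
  removes the rest.\<close>

lemma V_heights:
  assumes c: "c \<in> strip K" and d: "d \<in> strip K" and K: "3 \<le> K" and a: "\<forall>v\<in>c. 0 \<le> a v" and b: "\<forall>v\<in>d. 0 \<le> b v"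
    and eq: "(\<Sum>v\<in>c. a v *\<^sub>R V 0 v) = (\<Sum>v\<in>d. b v *\<^sub>R V 0 v)"
  shows "(\<Sum>v\<in>c. a v * h (nat (csum v))) = (\<Sum>v\<in>d. b v * h (nat (csum v)))"
    and "v \<in> c ==> 0 < a v ==> \<exists>l\<in>Lam. l + v \<in> d"
proof -
  have fin: "finite c" "finite d" using c d strip_cell cell_finite by blast+
  have ge: "0 \<le> csum v" if "v \<in> c \<or> v \<in> d" for v using that c d by (auto simp: strip_iff)
  have half: "(\<Sum>v\<in>d'. b' v * h (nat (csum v))) \<le> (\<Sum>v\<in>c'. a' v * h (nat (csum v))) \<and>
      ((\<Sum>v\<in>d'. b' v * h (nat (csum v))) = (\<Sum>v\<in>c'. a' v * h (nat (csum v))) --> (\<forall>v\<in>c'. 0 < a' v --> (\<exists>l\<in>Lam. l + v \<in> u)))"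
    if cd: "c' \<in> strip K" "finite c'" "finite d'" "\<forall>v\<in>c'. 0 \<le> a' v" "(\<Sum>v\<in>c'. a' v *\<^sub>R V 0 v) = (\<Sum>v\<in>d'. b' v *\<^sub>R V 0 v)"
      "d' \<subseteq> u" "u \<in> strip K" "u = unit_cell q UNIV" for c' d' a' b' u q
  proof -
    have q: "0 \<le> csum q" using cd(7,8) unit_cell_base[of q UNIV] by (auto simp: strip_iff)
    have ge': "0 \<le> csum v" if "v \<in> c' \<or> v \<in> u" for v using that cd(1,7) by (auto simp: strip_iff)
    obtain f where f: "!!x s. 0 \<le> csum x ==> f \<bullet> V s x \<le> h (nat (csum x))"
      "!!x s. 0 \<le> csum x ==> f \<bullet> V s x = h (nat (csum x)) \<longleftrightarrow> (\<exists>l\<in>Lam. l + x \<in> unit_cell q UNIV)" using cube_support[OF q] by blast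
    have fd: "f \<bullet> V 0 v = h (nat (csum v))" if "v \<in> d'" for v
      using f(2)[of v 0] ge'[of v] that cd(6,8) Lam_0 by (metis add_0 subsetD)
    have "(\<Sum>v\<in>d'. b' v * h (nat (csum v))) = f \<bullet> (\<Sum>v\<in>d'. b' v *\<^sub>R V 0 v)" using fd by (simp add: inner_sum_right)
    also have "\<dots> = (\<Sum>v\<in>c'. a' v * (f \<bullet> V 0 v))" unfolding cd(5)[symmetric] by (simp add: inner_sum_right)
    finally have s: "(\<Sum>v\<in>c'. a' v * h (nat (csum v))) - (\<Sum>v\<in>d'. b' v * h (nat (csum v))) = (\<Sum>v\<in>c'. a' v * (h (nat (csum v)) - f \<bullet> V 0 v))"
      by (simp add: sum_subtractf right_diff_distrib)
    have nn: "0 \<le> a' v * (h (nat (csum v)) - f \<bullet> V 0 v)" if "v \<in> c'" for v using that cd(4) f(1)[of v 0] ge'[of v] by simp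
    have 1: "(\<Sum>v\<in>d'. b' v * h (nat (csum v))) \<le> (\<Sum>v\<in>c'. a' v * h (nat (csum v)))" 
    proof -
      have "0 \<le> (\<Sum>v\<in>c'. a' v * (h (nat (csum v)) - f \<bullet> V 0 v))" by (rule sum_nonneg) (rule nn)
      then show ?thesis using s by linarith
    qed
    have 2: "\<exists>l\<in>Lam. l + v \<in> u" if e: "(\<Sum>v\<in>d'. b' v * h (nat (csum v))) = (\<Sum>v\<in>c'. a' v * h (nat (csum v)))" and v: "v \<in> c'" "0 < a' v" for v
    proof -
      have "a' v * (h (nat (csum v)) - f \<bullet> V 0 v) = 0" using sum_nonneg_0[OF cd(2) nn _ v(1)] s e by simp
      then have "f \<bullet> V 0 v = h (nat (csum v))" using v(2) by simp
      then show ?thesis using f(2)[of v 0] ge'[of v] v(1) cd(8) by simp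
    qed
    from 1 2 show ?thesis by blast
  qed
  obtain p where p: "c \<subseteq> unit_cell p UNIV" "unit_cell p UNIV \<in> strip K" by (rule strip_in_cube[OF c K])
  obtain q where q: "d \<subseteq> unit_cell q UNIV" "unit_cell q UNIV \<in> strip K" by (rule strip_in_cube[OF d K])
  note H1 = half[OF c fin a eq q refl] and H2 = half[OF d fin(2,1) b eq[symmetric] p refl]
  from H1 H2 show he: "(\<Sum>v\<in>c. a v * h (nat (csum v))) = (\<Sum>v\<in>d. b v * h (nat (csum v)))" by linarith
  show "\<exists>l\<in>Lam. l + v \<in> d" if v: "v \<in> c" "0 < a v"
  proof -
    let ?D = "unit_cell q UNIV"
    have inD: "\<exists>l\<in>Lam. l + x \<in> ?D" if "x \<in> c" "0 < a x" for x using H1 he that by simp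
    obtain g where g: "\<forall>x\<in>?D. 0 \<le> g \<bullet> V 0 x" "{x\<in>?D. g \<bullet> V 0 x = 0} = d"
      by (rule convex_cell_expose[OF V_convex_strip[OF q(2) K] strip_cell[OF d] q(1)])
    have per: "V 0 (l + x) = V 0 x" if "l \<in> Lam" for l x using V_periodic that by blast
    have "(\<Sum>x\<in>d. b x * (g \<bullet> V 0 x)) = 0" using g(2) by (intro sum.neutral) auto
    then have "g \<bullet> (\<Sum>x\<in>d. b x *\<^sub>R V 0 x) = 0" by (simp add: inner_sum_right)
    then have z: "(\<Sum>x\<in>c. a x * (g \<bullet> V 0 x)) = 0" unfolding eq[symmetric] by (simp add: inner_sum_right)
    have nn: "0 \<le> a x * (g \<bullet> V 0 x)" if x: "x \<in> c" for x
    proof (cases "a x = 0")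
      case False
      then have "0 < a x" using a x by force
      then obtain l where "l \<in> Lam" "l + x \<in> ?D" using inD x by blast
      then have "0 \<le> g \<bullet> V 0 x" using g(1) per by metis
      then show ?thesis using a x by simp
    qed simp
    have "a v * (g \<bullet> V 0 v) = 0" using sum_nonneg_0[OF fin(1) nn z v(1)] .
    then have "g \<bullet> V 0 v = 0" using v(2) by simp
    moreover obtain l where l: "l \<in> Lam" "l + v \<in> ?D" using inD v by blast
    ultimately have "l + v \<in> {x\<in>?D. g \<bullet> V 0 x = 0}" using per by simp
    then show ?thesis using g(2) l(1) by blast
  qed
qed

lemma flat_sum_V: assumes "(\<Sum>v\<in>c. a v *\<^sub>R V s v) = (\<Sum>v\<in>d. b v *\<^sub>R V s v)" shows "(\<Sum>v\<in>c. a v *\<^sub>R V 0 v) = (\<Sum>v\<in>d. b v *\<^sub>R V 0 v)"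
  using arg_cong[OF assms, of flat] by (simp add: linear_sum[OF linear_flat] linear_scale[OF linear_flat] flat_V)

theorem V_embedded:
  assumes old: "embedded P k" "3 \<le> k" and K: "3 \<le> K"
  shows "embedded (V s) K"
proof -
  have sc: "sph_cube (sph_hull (V s ` c))" if c: "c \<in> strip K" for c
  proof -
    obtain t where t: "(+) t ` c \<in> strip k" by (rule strip_shift[OF c old(2)])
    show ?thesis by (rule sph_cube_translate[OF V_convex_strip[OF c K] strip_cell[OF c] embedded_cell(1,2)[OF old(1) t]])
  qed
  from embeddedI[OF V_periodic V_convex_strip[OF _ K] sc] show ?thesis
    using V_heights(2)[OF _ _ K _ _ flat_sum_V] by blast
qed

end

section \<open>The extended complex is ideal\<close>

lemma sph_hull_single: "sph_hull {p} = {sgn p}" by (simp add: sph_hull_def)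

text \<open>The hull of the two ends is the hull of a cell \<open>d\<close>. A third vertex of
  \<open>d\<close> could be exposed, although it lies in the hull of the two ends; so
  \<open>d\<close> has two vertices, and these differ in one coordinate.\<close>

lemma edge_cone_model:
  assumes R: "embedded R k" and x: "{x} \<in> strip k" and e: "is_edge (cone_model R k) (sgn (R x)) u \<or> is_edge (cone_model R k) u (sgn (R x))"
  obtains y i where "u = sgn (R y)" "{y} \<in> strip k" "y = x + ax i \<or> y = x - ax i"
proof -
  note cc = cells_cone_model[OF embedded_periodic[OF R]]
  have sym: "sph_hull {p, q} = sph_hull {q, p}" for p q by (simp add: insert_commute)
  have ed: "{u} \<in> cells (cone_model R k)" "u \<noteq> sgn (R x)" "sph_hull {sgn (R x), u} \<in> cells (cone_model R k)"
    using e sym by (auto simp: is_edge_def)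
  obtain c where c: "c \<in> strip k" "{u} = sph_hull (R ` c)" using ed(1) unfolding cc by auto
  obtain y0 where y0: "y0 \<in> c" using cell_nonempty[OF strip_cell[OF c(1)]] by blast
  have y0s: "{y0} \<in> strip k" using strip_sub[OF c(1), of "{y0}"] y0 by simp
  have "sph_hull (R ` {y0}) \<subseteq> sph_hull (R ` c)" by (rule sph_hull_mono) (use y0 in auto)
  then have u: "u = sgn (R y0)" unfolding c(2)[symmetric] by (simp add: sph_hull_single)
  have ne: "sph_hull {sgn (R x), u} \<noteq> {}" by (simp add: sph_hull_def)
  obtain d where d: "d \<in> strip k" "sph_hull {sgn (R x), u} = sph_hull (R ` d)" using ed(3) ne unfolding cc by auto
  have nz: "R x \<noteq> 0" "R y0 \<noteq> 0" using hemi_nonzero[OF embedded_cell(3)[OF R x]] hemi_nonzero[OF embedded_cell(3)[OF R y0s]] by auto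
  have ss: "sgn (sgn p) = sgn p" for p :: "real^5" by (cases "p = 0") (simp_all add: sgn_div_norm)
  have "sph_hull (R ` {x}) \<subseteq> sph_hull (R ` d)" "sph_hull (R ` {y0}) \<subseteq> sph_hull (R ` d)"
    unfolding d(2)[symmetric] u sph_hull_single image_insert image_empty
    using sph_hull_mono[of "{sgn (R x)}" "{sgn (R x), sgn (R y0)}"] sph_hull_mono[of "{sgn (R y0)}" "{sgn (R x), sgn (R y0)}"]
    by (simp_all add: sph_hull_single ss)
  then obtain l l' where l: "l \<in> Lam" "l + x \<in> d" "l' \<in> Lam" "l' + y0 \<in> d"
    unfolding embedded_hull_le[OF R x d(1)] embedded_hull_le[OF R y0s d(1)] by auto
  have per: "R (m + z) = R z" if "m \<in> Lam" for m z using embedded_periodic[OF R] that by blast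
  have two: "z = l + x \<or> z = l' + y0" if z: "z \<in> d" for z
  proof (rule ccontr)
    assume neg: "\<not> ?thesis"
    obtain b where b: "\<forall>v\<in>d. 0 \<le> b \<bullet> R v" "{v\<in>d. b \<bullet> R v = 0} = {z}"
      using convex_cell_expose[OF embedded_cell(1)[OF R d(1)], of "{z}"] z by auto
    have pos: "0 < b \<bullet> R v" if "v \<in> d" "v \<noteq> z" for v
    proof -
      have "b \<bullet> R v \<noteq> 0" using b(2) that by blast
      then show ?thesis using b(1) that(1) by force
    qed
    have bx: "0 < b \<bullet> R x" "0 < b \<bullet> R y0" using pos[of "l + x"] pos[of "l' + y0"] neg l per by auto
    have zs: "{z} \<in> strip k" using strip_sub[OF d(1), of "{z}"] z by simp
    have znz: "R z \<noteq> 0" using hemi_nonzero[OF embedded_cell(3)[OF R zs]] by auto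
    have "sph_hull (R ` {z}) \<subseteq> sph_hull (R ` d)" by (rule sph_hull_mono) (use z in auto)
    then have "sgn (R z) \<in> sph_hull {sgn (R x), u}" unfolding d(2) by (simp add: sph_hull_single)
    then obtain w where w: "w \<in> convex hull {sgn (R x), u}" "sgn (R z) = sgn w" by (auto simp: sph_hull_def)
    have "convex hull {sgn (R x), u} \<subseteq> {p. 0 < b \<bullet> p}"
      using bx nz unfolding u by (intro hull_minimal) (auto simp: convex_halfspace_gt sgn_div_norm)
    then have "0 < b \<bullet> w" using w(1) by blast
    then have "0 < b \<bullet> sgn w" by (cases "w = 0") (simp_all add: sgn_div_norm)
    then have "0 < b \<bullet> sgn (R z)" unfolding w(2) .
    then have "0 < (1 / norm (R z)) * (b \<bullet> R z)" by (simp add: sgn_div_norm divide_inverse)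
    then have "0 < b \<bullet> R z" using znz by (simp add: zero_less_mult_iff zero_less_divide_iff)
    then show False using b(2) by force
  qed
  define y where "y = l' - l + y0"
  have uy: "u = sgn (R y)" unfolding u y_def using per[OF Lam_diff[OF l(3) l(1)]] by simp
  have ys: "{y} \<in> strip k" using y0s l unfolding strip_singleton y_def by simp
  have ly: "l + y = l' + y0" by (simp add: y_def)
  have yx: "y \<noteq> x" using ed(2) uy by auto
  then obtain i where i: "y $ i \<noteq> x $ i" by (auto simp: vec_eq_iff)
  have same: "y $ j = x $ j" if "j \<noteq> i" for j
  proof (rule ccontr)
    assume j: "y $ j \<noteq> x $ j"
    define p where "p = (\<chi> m. if m = i then (l + x) $ m else (l + y) $ m)"
    have "p \<in> d" by (rule cell_mix[OF strip_cell[OF d(1)] l(2), of "l + y"]) (use l ly in \<open>auto simp: p_def\<close>)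
    then have "p = l + x \<or> p = l + y" using two ly by simp
    then show False using i j that by (auto simp: p_def vec_eq_iff split: if_splits)
  qed
  have "\<bar>(l + y) $ i - (l + x) $ i\<bar> \<le> 1" using cell_diff[OF strip_cell[OF d(1)], of "l + y" "l + x" i] l ly by simp
  then have "y $ i = x $ i + 1 \<or> y $ i = x $ i - 1" using i by auto
  then have "y = x + ax i \<or> y = x - ax i"
  proof
    assume "y $ i = x $ i + 1"
    then have "y = x + ax i" using same by (auto simp: vec_eq_iff axis_def)
    then show ?thesis ..
  next
    assume "y $ i = x $ i - 1"
    then have "y = x - ax i" using same by (auto simp: vec_eq_iff axis_def)
    then show ?thesis ..
  qed
  with that uy ys show ?thesis by blast
qed

lemma edge_cone_modelI:
  assumes R: "embedded R k" and e: "unit_cell y {i} \<in> strip k"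
  shows "is_edge (cone_model R k) (sgn (R (y + ax i))) (sgn (R y))" "is_edge (cone_model R k) (sgn (R y)) (sgn (R (y + ax i)))"
proof -
  note cc = cells_cone_model[OF embedded_periodic[OF R]]
  have e2: "{y, y + ax i} \<in> strip k" using e unfolding unit_cell_edge .
  have s: "{y} \<in> strip k" "{y + ax i} \<in> strip k" using strip_sub[OF e2] by auto
  have 1: "{sgn (R y)} \<in> cells (cone_model R k)" "{sgn (R (y + ax i))} \<in> cells (cone_model R k)"
    unfolding cc using s by (metis image_empty image_insert image_eqI insertCI sph_hull_single)+
  have "sgn (R y) \<noteq> sgn (R (y + ax i))"
  proof
    assume "sgn (R y) = sgn (R (y + ax i))"
    then have "sph_hull (R ` {y}) \<subseteq> sph_hull (R ` {y + ax i})" by (simp add: sph_hull_single)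
    then obtain l where "l \<in> Lam" "l + y = y + ax i" unfolding embedded_hull_le[OF R s] by auto
    then have "csum l = csum (ax i)" by (metis add.commute add_left_cancel)
    then show False using \<open>l \<in> Lam\<close> by simp
  qed
  moreover have "sph_hull {sgn (R y), sgn (R (y + ax i))} = sph_hull (R ` {y, y + ax i})"
  proof -
    have nz: "R v \<noteq> 0" if "v \<in> {y, y + ax i}" for v using hemi_nonzero[OF embedded_cell(3)[OF R e2]] that by blast
    have "sph_hull ((\<lambda>v. sgn (R v)) ` {y, y + ax i}) = sph_hull (R ` {y, y + ax i})"
      by (rule sph_hull_rescale(1)[where r="\<lambda>v. 1 / norm (R v)", OF embedded_cell(5,3)[OF R e2]])
        (use nz in \<open>auto simp: sgn_div_norm divide_inverse\<close>)
    then show ?thesis by simp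
  qed
  moreover have "sph_hull (R ` {y, y + ax i}) \<in> cells (cone_model R k)" unfolding cc using e2 by blast
  ultimately show "is_edge (cone_model R k) (sgn (R (y + ax i))) (sgn (R y))" "is_edge (cone_model R k) (sgn (R y)) (sgn (R (y + ax i)))"
    using 1 unfolding is_edge_def by (simp_all add: insert_commute)
qed

lemma obtuse:
  fixes u v :: "real^5"
  assumes "u \<bullet> v < 0"
  shows "pi/2 < arccos ((u \<bullet> v) / (norm u * norm v))"
proof -
  have "u \<noteq> 0" "v \<noteq> 0" using assms by auto
  then have nz: "0 < norm u * norm v" by simp
  have "\<bar>u \<bullet> v\<bar> \<le> norm u * norm v" by (rule Cauchy_Schwarz_ineq2)
  then have "-1 \<le> (u \<bullet> v) / (norm u * norm v)" using nz by (simp add: le_divide_eq)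
  moreover have "(u \<bullet> v) / (norm u * norm v) < 0" using assms nz by (simp add: divide_neg_pos)
  ultimately have "arccos 0 < arccos ((u \<bullet> v) / (norm u * norm v))" by (intro arccos_less_arccos) auto
  then show ?thesis by simp
qed

text \<open>Up to a positive factor the inner product of the two tangent components is
  \<open>z \<bullet> z' - 2 * (norm z)\<^sup>2\<close>. The 2 stems from the midpoint, whose first
  coordinate is doubled while the second keeps length 1.\<close>

lemma slope_angle:
  assumes z: "z \<noteq> 0" and W: "norm W = 1" and zz: "z \<bullet> z' < 2 * (norm z)\<^sup>2"
  shows "pi/2 < sph_angle (proj0 (sgn (mk (2 *\<^sub>R z) W 0))) (sgn (mk (2 *\<^sub>R z) W 0)) (sgn (mk z' W 0))"
proof -
  define N where "N = norm (mk (2 *\<^sub>R z) W 0)"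
  define M where "M = norm (mk z' W 0)"
  have N2: "N\<^sup>2 = 4 * (norm z)\<^sup>2 + 1" by (simp add: N_def norm5 W power_mult_distrib)
  have "1 \<le> N\<^sup>2" "1 \<le> M\<^sup>2" unfolding N2 by (simp_all add: M_def norm5 W)
  then have NM: "0 < N" "0 < M" by (auto simp: N_def M_def intro!: zero_less_norm_iff[THEN iffD2])
  define r where "r = norm z"
  have r: "0 < r" using z by (simp add: r_def)
  define m where "m = mk ((2 / N) *\<^sub>R z) ((1 / N) *\<^sub>R W) 0"
  define b where "b = mk ((1 / M) *\<^sub>R z') ((1 / M) *\<^sub>R W) 0"
  define a where "a = mk ((1 / r) *\<^sub>R z) 0 0"
  have m: "sgn (mk (2 *\<^sub>R z) W 0) = m" unfolding sgn_div_norm N_def[symmetric] m_def mk_scale by (simp add: divide_inverse mult.commute)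
  have b: "sgn (mk z' W 0) = b" unfolding sgn_div_norm M_def[symmetric] b_def mk_scale by (simp add: divide_inverse)
  have a: "proj0 m = a" unfolding proj0_def part_flat m_def a_def mk_simps norm_mk0 mk_scale
    using NM r by (simp add: r_def)
  have WW: "W \<bullet> W = 1" using W by (simp add: dot_square_norm)
  have zz2: "z \<bullet> z = r\<^sup>2" by (simp add: r_def dot_square_norm)
  define t where "t = z \<bullet> z'"
  have ab: "a \<bullet> b = t / (r * M)" unfolding a_def b_def inner5 mk_simps t_def by simp
  have am: "a \<bullet> m = 2 * r / N" unfolding a_def m_def inner5 mk_simps using r by (simp add: zz2 power2_eq_square)
  have bm: "b \<bullet> m = (2 * t + 1) / (M * N)" unfolding b_def m_def inner5 mk_simps t_def
    by (simp add: WW inner_commute add_divide_distrib mult.commute)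
  have mm: "m \<bullet> m = 1"
  proof -
    have "m \<bullet> m = (4 * r\<^sup>2 + 1) / N\<^sup>2" unfolding m_def inner5 mk_simps by (simp add: WW zz2 power2_eq_square add_divide_distrib)
    also have "4 * r\<^sup>2 + 1 = N\<^sup>2" using N2 by (simp add: r_def)
    finally show ?thesis using NM by simp
  qed
  have "(a - (a \<bullet> m) *\<^sub>R m) \<bullet> (b - (b \<bullet> m) *\<^sub>R m) = a \<bullet> b - (a \<bullet> m) * (b \<bullet> m)"
    by (simp add: inner_diff_left inner_diff_right mm inner_commute)
  also have "\<dots> = (t - 2 * r\<^sup>2) / (r * M * N\<^sup>2)"
  proof -
    have "t / (r * M) - 2 * r / N * ((2 * t + 1) / (M * N)) = (t * N\<^sup>2 - 2 * r\<^sup>2 * (2 * t + 1)) / (r * M * N\<^sup>2)"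
      using r NM by (simp add: field_simps power2_eq_square)
    also have "t * N\<^sup>2 - 2 * r\<^sup>2 * (2 * t + 1) = t - 2 * r\<^sup>2" unfolding N2 r_def[symmetric] by (simp add: algebra_simps)
    finally show ?thesis unfolding ab am bm .
  qed
  also have "\<dots> < 0" using zz r NM unfolding t_def r_def by (intro divide_neg_pos) auto
  finally show ?thesis unfolding m a b sph_angle_def Let_def by (rule obtuse)
qed

section \<open>Size estimates for the model\<close>

context model begin

lemma seqZ_Y: "seqZ A \<tau> E = (\<lambda>m. A * Y m)" by (simp add: fun_eq_iff seqZ_def seqY_def)

lemma corner_om: assumes "x \<in> unit_cell v UNIV" shows "1/2 \<le> Re (om ((x$1 - x$2) - (v$1 - v$2)))"
    "csum x = csum v + 3 ==> Re (om ((x$1 - x$2) - (v$1 - v$2))) = 1" "csum x \<le> csum v + 3"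
proof -
  obtain a b c where x: "x = corner v a b c" using assms cube_corner by blast
  have e: "(x$1 - x$2) - (v$1 - v$2) = of_bool a - of_bool b" "csum x = csum v + (of_bool a + of_bool b + of_bool c)"
    unfolding x csum_def by simp_all
  show "1/2 \<le> Re (om ((x$1 - x$2) - (v$1 - v$2)))" unfolding e by (cases a; cases b) (simp_all add: om_1 om_m1)
  show "csum x = csum v + 3 ==> Re (om ((x$1 - x$2) - (v$1 - v$2))) = 1" unfolding e by (cases a; cases b; cases c) simp_all
  show "csum x \<le> csum v + 3" unfolding e by (cases a; cases b; cases c) simp_all
qed

lemma inner_axis: "mk 0 (\<eta> *\<^sub>R om j) 0 \<bullet> V s x = Re (om ((x$1 - x$2) - j))"
proof -
  have "om j \<bullet> om (x$1 - x$2) = Re (om ((x$1 - x$2) - j))"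
    using om_add[of "- j" "x$1 - x$2"] unfolding inner_cnj by (simp add: algebra_simps)
  then show ?thesis unfolding inner5 V_form mk_simps using \<eta> by auto
qed

lemma wc_nonzero:
  assumes c: "c \<in> strip K" "3 \<le> K" and p: "p \<in> pcone (V s) c" "p \<noteq> 0"
  shows "wc p \<noteq> 0"
proof -
  obtain v where v: "c \<subseteq> unit_cell v UNIV" "unit_cell v UNIV \<in> strip K" by (rule strip_in_cube[OF c])
  let ?g = "mk 0 (\<eta> *\<^sub>R om (v$1 - v$2)) 0"
  have "0 < ?g \<bullet> V s x" if "x \<in> c" for x unfolding inner_axis using corner_om(1)[of x v] v(1) that by auto
  then have "0 < ?g \<bullet> p" using pcone_pos[OF cell_finite[OF strip_cell[OF c(1)]] _ p] by blast
  then show ?thesis unfolding inner5 mk_simps by auto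
qed

lemma norm_Y: "(norm (Y m))\<^sup>2 = (E m)\<^sup>2 + \<tau>\<^sup>2 * (E (m+1))\<^sup>2" by (simp add: seqY_def cmod_def power_mult_distrib)

lemma norm_Y_double: assumes "1 \<le> m" shows "2 * norm (Y m) \<le> norm (Y (m+1))"
proof -
  obtain i where i: "m = i+1" using assms by (metis add.commute le_Suc_ex plus_1_eq_Suc)
  have b: "2 * E m \<le> E (m+1)" "0 \<le> 2 * E m" "2 * E (m+1) \<le> E (m+2)" "0 \<le> 2 * E (m+1)"
    using E_double[of i] E_double[of "i+1"] Epos(1)[of i] Epos(1)[of "i+1"] i by simp_all
  have "(2 * E m)\<^sup>2 + \<tau>\<^sup>2 * (2 * E (m+1))\<^sup>2 \<le> (E (m+1))\<^sup>2 + \<tau>\<^sup>2 * (E (m+2))\<^sup>2"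
    using power_mono[OF b(1,2), of 2] power_mono[OF b(3,4), of 2] by (intro add_mono mult_left_mono) auto
  then have "(2 * norm (Y m))\<^sup>2 \<le> (norm (Y (m+1)))\<^sup>2" unfolding power_mult_distrib norm_Y by (simp add: algebra_simps)
  then show ?thesis by (rule power2_le_imp_le) simp
qed

lemma norm_Y_half: assumes "m < K" "3 \<le> K" shows "2 * norm (Y m) \<le> norm (Y K)"
proof -
  have up: "2 * norm (Y i) \<le> norm (Y (i + Suc j))" if "1 \<le> i" for i j
  proof (induction j)
    case 0 then show ?case using norm_Y_double[OF that] by simp
  next
    case (Suc j)
    have "norm (Y (i + Suc j)) \<le> norm (Y (i + Suc j + 1))" using norm_Y_double[of "i + Suc j"] norm_ge_zero[of "Y (i + Suc j)"] that by linarith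
    then show ?case using Suc by simp
  qed
  show ?thesis
  proof (cases "m = 0")
    case False then show ?thesis using up[of m "K - m - 1"] assms by simp
  next
    case True
    \<comment> \<open>\<open>E 0\<close> may be negative; the recurrence bounds it from below and
      positivity of \<open>h 0\<close> from above.\<close>
    have E0: "E 0 = 2 * (1+\<tau>) * E 1 - \<tau> * E 2" using seq_rec[OF ok, of 0] by (simp add: numeral_2_eq_2)
    have e: "0 < E 1" "2 * E 1 < E 2" "2 * E 2 < E 3" using Epos(1)[of 0] E_double[of 0] E_double[of 1] by (simp_all add: numeral_2_eq_2 numeral_3_eq_3)
    have "\<tau> * E 1 \<le> \<tau> * E 2" "0 < (1+\<tau>) * E 1" using e tau by simp_all
    moreover have "E 0 < \<tau> * E 1" using h_pos[of 0] by (simp add: seqh_def)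
    ultimately have "\<bar>E 0\<bar> \<le> \<tau> * E 2" using E0 by linarith
    then have "(E 0)\<^sup>2 \<le> (\<tau> * E 2)\<^sup>2" by (metis abs_ge_zero power2_abs power_mono)
    moreover have "\<tau>\<^sup>2 * (E 1)\<^sup>2 \<le> \<tau>\<^sup>2 * (E 2)\<^sup>2" using e by (intro mult_left_mono power_mono) auto
    moreover have "\<tau>\<^sup>2 * (2 * E 2)\<^sup>2 \<le> \<tau>\<^sup>2 * (E 3)\<^sup>2" using e by (intro mult_left_mono power_mono) auto
    moreover have "(norm (Y 0))\<^sup>2 = (E 0)\<^sup>2 + \<tau>\<^sup>2 * (E 1)\<^sup>2" "(norm (Y 2))\<^sup>2 = (E 2)\<^sup>2 + \<tau>\<^sup>2 * (E 3)\<^sup>2" using norm_Y[of 0] norm_Y[of 2] by (simp_all add: numeral_3_eq_3)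
    moreover have "0 \<le> (E 2)\<^sup>2" "0 \<le> \<tau>\<^sup>2 * (E 2)\<^sup>2" by simp_all
    moreover have "(\<tau> * E 2)\<^sup>2 = \<tau>\<^sup>2 * (E 2)\<^sup>2" "\<tau>\<^sup>2 * (2 * E 2)\<^sup>2 = 4 * (\<tau>\<^sup>2 * (E 2)\<^sup>2)" by (simp_all add: power_mult_distrib)
    ultimately have "(norm (Y 0))\<^sup>2 \<le> (norm (Y 2))\<^sup>2" by linarith
    then have "norm (Y 0) \<le> norm (Y 2)" by (rule power2_le_imp_le) simp
    moreover have "2 * norm (Y 2) \<le> norm (Y (2 + Suc (K - 3)))" by (rule up) simp
    moreover have "2 + Suc (K - 3) = K" using assms by simp
    ultimately show ?thesis using True by simp
  qed
qed

text \<open>The first coordinate is longest, relative to the second, at the top layer.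
  \<open>?g\<close> measures the second coordinate in the direction of the base of a cube: it is 1
  at a vertex of layer \<open>K\<close> and at least 1/2 elsewhere, where the first coordinate is at
  most half as long.\<close>

lemma cone_bound:
  assumes c: "c \<in> strip K" "3 \<le> K" and p: "p \<in> pcone (V s) c"
  shows "norm (zc p) \<le> norm (A * Y K) * norm (wc p)"
proof -
  obtain v where v: "c \<subseteq> unit_cell v UNIV" "unit_cell v UNIV \<in> strip K" by (rule strip_in_cube[OF c])
  obtain a where a: "\<forall>x\<in>c. 0 \<le> a x" "p = (\<Sum>x\<in>c. a x *\<^sub>R V s x)" using pconeE[OF p] by blast
  let ?g = "mk 0 (\<eta> *\<^sub>R om (v$1 - v$2)) 0"
  have "corner v True True True \<in> unit_cell v UNIV" using cube_corner by blast
  then have "csum (corner v True True True) \<le> int K" using v(2) by (auto simp: strip_iff)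
  then have vK: "csum v + 3 \<le> int K" by (simp add: csum_def)
  have le: "norm (zc (V s x)) \<le> norm (A * Y K) * (?g \<bullet> V s x)" if x: "x \<in> c" for x
  proof -
    have xc: "x \<in> unit_cell v UNIV" using v(1) x by blast
    have nn: "norm (zc (V s x)) = norm A * norm (Y (nat (csum x)))" by (simp add: V_form norm_mult)
    have x0: "0 \<le> csum x" using x c(1) by (auto simp: strip_iff)
    show ?thesis
    proof (cases "csum x = int K")
      case True
      then have e: "csum x = csum v + 3" using corner_om(3)[OF xc] vK by simp
      have nK: "nat (csum x) = K" using True by simp
      show ?thesis unfolding inner_axis nn nK corner_om(2)[OF xc e] by (simp add: norm_mult)
    next
      case False
      then have "nat (csum x) < K" using corner_om(3)[OF xc] vK x0 by linarith
      from norm_Y_half[OF this c(2)] have "norm (Y (nat (csum x))) \<le> norm (Y K) * (1/2)" by simp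
      also have "\<dots> \<le> norm (Y K) * (?g \<bullet> V s x)" unfolding inner_axis using corner_om(1)[OF xc] by (intro mult_left_mono) auto
      finally show ?thesis unfolding nn norm_mult by (simp add: mult_left_mono mult.assoc)
    qed
  qed
  have "norm (zc p) \<le> (\<Sum>x\<in>c. norm (a x *\<^sub>R zc (V s x)))" unfolding a(2) zc_sum zc_simps by (rule norm_sum)
  also have "\<dots> \<le> (\<Sum>x\<in>c. a x * (norm (A * Y K) * (?g \<bullet> V s x)))" using a(1) le by (intro sum_mono) (simp add: mult_left_mono)
  also have "\<dots> = norm (A * Y K) * (?g \<bullet> p)" unfolding a(2) by (simp add: inner_sum_right sum_distrib_left mult_ac)
  also have "?g \<bullet> p \<le> norm (wc p)"
  proof -
    have "?g \<bullet> p = (\<eta> *\<^sub>R om (v$1 - v$2)) \<bullet> wc p" unfolding inner5 mk_simps by simp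
    also have "\<dots> \<le> norm (\<eta> *\<^sub>R om (v$1 - v$2)) * norm (wc p)" by (rule norm_cauchy_schwarz)
    finally show ?thesis using \<eta> by auto
  qed
  finally show ?thesis by (simp add: mult_left_mono)
qed

end

section \<open>Injectivity, transversality, slope and orientation of the model\<close>

context model begin

lemma V0_S3eq:
  assumes c: "c \<in> strip K" "3 \<le> K" and p: "p \<in> sph_hull (V 0 ` c)"
  shows "p \<in> pcone (V 0) c" "p \<in> S3eq" "wc p \<noteq> 0" "p \<noteq> 0"
proof -
  have cv: "convex_cell (V 0) c" using V_convex_strip[OF c] .
  have pc: "norm p = 1" "p \<in> pcone (V 0) c" using p unfolding sph_hull_iff[OF cell_finite[OF strip_cell[OF c(1)]] convex_cell_hemi[OF cv]] by simp_all
  obtain a where "p = (\<Sum>x\<in>c. a x *\<^sub>R V 0 x)" using pconeE[OF pc(2)] by blast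
  then have "p $ 5 = 0" by (simp add: V_form)
  then show "p \<in> pcone (V 0) c" "p \<in> S3eq" using pc by (simp_all add: S3eq_iff)
  show p0: "p \<noteq> 0" using pc(1) by auto
  show "wc p \<noteq> 0" using wc_nonzero[OF c pc(2) p0] .
qed

text \<open>The fifth coordinate is \<open>s\<close> times the height, and by
  \<open>V_heights\<close> the height depends only on the flattened point.\<close>

lemma V_inj_eq_proj:
  assumes K: "3 \<le> K"
  shows "inj_on eq_proj (\<Union>c\<in>strip K. sph_hull (V s ` c))"
proof (rule inj_onI)
  fix x y assume "x \<in> (\<Union>c\<in>strip K. sph_hull (V s ` c))" "y \<in> (\<Union>c\<in>strip K. sph_hull (V s ` c))" and e: "eq_proj x = eq_proj y"
  then obtain c d where c: "c \<in> strip K" "x \<in> sph_hull (V s ` c)" and d: "d \<in> strip K" "y \<in> sph_hull (V s ` d)" by blast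
  have it: "norm p = 1 \<and> p \<in> pcone (V s) c'" if "c' \<in> strip K" "p \<in> sph_hull (V s ` c')" for p c'
    using that(2) unfolding sph_hull_iff[OF cell_finite[OF strip_cell[OF that(1)]] convex_cell_hemi[OF V_convex_strip[OF that(1) K]]] .
  have x: "norm x = 1" "x \<in> pcone (V s) c" and y: "norm y = 1" "y \<in> pcone (V s) d" using it c d by blast+
  have fz: "flat p \<noteq> 0" if "norm p = 1" "p \<in> pcone (V s) c'" "c' \<in> strip K" for p c'
  proof -
    have "p \<noteq> 0" using that(1) by auto
    from wc_nonzero[OF that(3) K that(2) this] have "wc (flat p) \<noteq> 0" by (simp add: flat_def)
    then show ?thesis by auto
  qed
  note fx = fz[OF x c(1)] and fy = fz[OF y d(1)]
  define r where "r = norm (flat x) / norm (flat y)"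
  have r: "0 < r" using fx fy by (simp add: r_def)
  have fe: "flat x = r *\<^sub>R flat y"
  proof -
    have "flat x = norm (flat x) *\<^sub>R sgn (flat x)" using fx by (simp add: sgn_div_norm)
    also have "sgn (flat x) = sgn (flat y)" using e by (simp add: eq_proj_flat)
    also have "norm (flat x) *\<^sub>R sgn (flat y) = r *\<^sub>R flat y" by (simp add: sgn_div_norm r_def divide_inverse)
    finally show ?thesis .
  qed
  obtain a where a: "\<forall>v\<in>c. 0 \<le> a v" "x = (\<Sum>v\<in>c. a v *\<^sub>R V s v)" using pconeE[OF x(2)] by blast
  obtain b where b: "\<forall>v\<in>d. 0 \<le> b v" "y = (\<Sum>v\<in>d. b v *\<^sub>R V s v)" using pconeE[OF y(2)] by blast
  have fl: "flat (\<Sum>v\<in>c'. a' v *\<^sub>R V s v) = (\<Sum>v\<in>c'. a' v *\<^sub>R V 0 v)" for c' a'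
    by (simp add: linear_sum[OF linear_flat] linear_scale[OF linear_flat] flat_V)
  have eqV: "(\<Sum>v\<in>c. a v *\<^sub>R V 0 v) = (\<Sum>v\<in>d. (r * b v) *\<^sub>R V 0 v)"
    using fe unfolding a(2) b(2) fl by (simp add: scaleR_sum_right)
  have rb: "\<forall>v\<in>d. 0 \<le> r * b v" using b(1) r by simp
  from V_heights(1)[OF c(1) d(1) K a(1) rb eqV] have "s * (\<Sum>v\<in>c. a v * h (nat (csum v))) = r * (s * (\<Sum>v\<in>d. b v * h (nat (csum v))))" by (simp add: sum_distrib_left mult_ac)
  then have h5: "x $ 5 = r * y $ 5" unfolding a(2) b(2) by (simp add: V_form sum_distrib_left mult_ac)
  have "zc x = r *\<^sub>R zc y" "wc x = r *\<^sub>R wc y" using fe unfolding eq5_iff by (simp_all add: flat_def)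
  then have xr: "x = r *\<^sub>R y" using h5 by (simp add: eq5_iff)
  then have "r = 1" using x(1) y(1) r by simp
  then show "x = y" using xr by simp
qed

text \<open>With \<open>2 \<le> i\<close> the band starts in layer 1 or above, where
  \<open>E\<close> is positive, so the octagons have the required shape and each ray meets them
  once.\<close>

lemma V_band:
  assumes K: "3 \<le> K" and i: "2 \<le> i" "i + 1 \<le> K"
  shows "(\<Union>c\<in>layers3 K i. sph_hull (V 0 ` c)) \<subseteq> S3eq - (clifford 0 \<union> clifford 2)"
    "inj_on proj1 (\<Union>c\<in>layers3 K i. sph_hull (V 0 ` c))"
proof -
  obtain m where m: "i = Suc (Suc m)" using i(1) by (metis add_2_eq_Suc le_Suc_ex)
  let ?n = "Suc m"
  have En: "0 < E ?n" "0 < E (?n+1)" "0 < E (?n+2)" "0 < E (?n+3)" using Epos(2) by (simp_all add: numeral_3_eq_3)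
  have fan: "fan_ok (oct \<tau> E ?n x y)" if "0 < x" "0 \<le> y" for x y using oct_fan[OF ok W0 En that] .
  have ob: "on_band A \<tau> E \<eta> ?n (zc p) (wc p)" if "c \<in> layers3 K i" "p \<in> pcone (V 0) c" "p \<noteq> 0" for p c
    using band_point[OF ok En(2,3) that(1)[unfolded m] that(2)[unfolded V_def] that(3) refl refl refl] wc_nonzero[OF _ K that(2,3)] that(1) by simp
  have z: "zc p \<noteq> 0" if p: "c \<in> layers3 K i" "p \<in> pcone (V 0) c" "p \<noteq> 0" for p c
  proof -
    obtain j \<sigma> x y n r where o: "\<sigma> = 1 \<or> \<sigma> = (-1::real)" "0 < x" "0 \<le> y" "n \<le> 3" "0 \<le> r" "r \<le> 1" "zc p = A * ii (j + int ?n) * (\<sigma> *\<^sub>R fan_seg (oct \<tau> E ?n x y) n r)"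
      using ob[OF p] unfolding on_band_def by blast
    have "fan_seg (oct \<tau> E ?n x y) n r \<noteq> 0" by (rule fan_seg_nonzero[OF fan[OF o(2,3)] o(4-6)])
    then show ?thesis using o(1,7) A by auto
  qed
  have el: "\<exists>c\<in>layers3 K i. p \<in> pcone (V 0) c \<and> p \<in> S3eq \<and> wc p \<noteq> 0 \<and> p \<noteq> 0" if pU: "p \<in> (\<Union>c\<in>layers3 K i. sph_hull (V 0 ` c))" for p
  proof -
    obtain c where c: "c \<in> layers3 K i" "p \<in> sph_hull (V 0 ` c)" using pU by blast
    have "c \<in> strip K" using c(1) by simp
    from V0_S3eq[OF this K c(2)] show ?thesis using c(1) by blast
  qed
  show "(\<Union>c\<in>layers3 K i. sph_hull (V 0 ` c)) \<subseteq> S3eq - (clifford 0 \<union> clifford 2)"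
  proof
    fix p assume "p \<in> (\<Union>c\<in>layers3 K i. sph_hull (V 0 ` c))"
    then obtain c where "c \<in> layers3 K i" "p \<in> pcone (V 0) c" "p \<in> S3eq" "wc p \<noteq> 0" "p \<noteq> 0" using el by blast
    then show "p \<in> S3eq - (clifford 0 \<union> clifford 2)" using z[of c p] by (simp add: clifford0_iff clifford2_iff)
  qed
  show "inj_on proj1 (\<Union>c\<in>layers3 K i. sph_hull (V 0 ` c))"
  proof (rule inj_onI)
    fix p q assume pq: "p \<in> (\<Union>c\<in>layers3 K i. sph_hull (V 0 ` c))" "q \<in> (\<Union>c\<in>layers3 K i. sph_hull (V 0 ` c))" and e: "proj1 p = proj1 q"
    obtain c where c: "c \<in> layers3 K i" "p \<in> pcone (V 0) c" "p \<in> S3eq" "wc p \<noteq> 0" "p \<noteq> 0" using el[OF pq(1)] by blast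
    obtain d where d: "d \<in> layers3 K i" "q \<in> pcone (V 0) d" "q \<in> S3eq" "wc q \<noteq> 0" "q \<noteq> 0" using el[OF pq(2)] by blast
    have zpq: "zc p \<noteq> 0" "zc q \<noteq> 0" using z[OF c(1,2,5)] z[OF d(1,2,5)] by simp_all
    obtain a b where ab: "0 < a" "0 < b" "zc q = a *\<^sub>R zc p" "wc q = b *\<^sub>R wc p"
      using proj1_eqD[OF e[symmetric] zpq(2) d(4) zpq(1) c(4)] by blast
    have q': "(1/b) *\<^sub>R q \<in> pcone (V 0) d" "(1/b) *\<^sub>R q \<noteq> 0" using pcone_scale[OF d(2), of "1/b"] ab(2) d(5) by simp_all
    have "on_band A \<tau> E \<eta> ?n ((a/b) *\<^sub>R zc p) (wc p)" using ob[OF d(1) q'] ab by simp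
    moreover have "0 < a/b" using ab by simp
    ultimately have "a/b = 1" using on_band_unique[OF fan A _ ob[OF c(1,2,5)]] \<eta> by fastforce
    then have "a = b" using ab by simp
    then have "q = b *\<^sub>R p" using ab c(3) d(3) by (simp add: eq5_iff S3eq_iff)
    then show "p = q" using c(3) d(3) ab by (simp add: S3eq_iff)
  qed
qed

lemma V_slope:
  assumes Q: "embedded (V 0) K" and K: "3 \<le> K"
  shows "pi/2 < slope (band (cone_model (V 0) K) (K - 1))"
proof -
  define t :: "int^3" where "t = vector [0, 0, int (K - 1) - 1]"
  define R where "R = V 0 \<circ> (+) t"
  have i: "1 \<le> K - 1" "K - 1 + 1 \<le> K" using K by simp_all
  have B: "band (cone_model (V 0) K) (K - 1) = cone_model R 2" and R: "embedded R 2"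
    using band_cone_model(1,2)[OF Q i] unfolding R_def t_def by simp_all
  let ?T = "cone_model R 2"
  define s where "s = (SOME s. s \<in> layer ?T 2)"
  have lay: "layer ?T 2 = (\<lambda>v. sgn (R v)) ` {v. csum v = 2}" using layer_cone_model[OF R, of 2] by simp
  have "vector [0, 0, 2] \<in> {v. csum v = 2}" by simp
  then have "layer ?T 2 \<noteq> {}" unfolding lay by blast
  then have "s \<in> layer ?T 2" unfolding s_def by (simp add: some_in_eq)
  then obtain x where x: "csum x = 2" "s = sgn (R x)" unfolding lay by auto
  define x' where "x' = vector [1, -1, 0] + x"
  have x': "csum x' = 2" using x by (simp add: x'_def)
  have tx: "csum (t + x) = int K" using x K by (simp add: t_def)
  have iso: "(r34 \<circ> r34) (R v) = R (vector [1, -1, 0] + v)" for v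
    unfolding R_def V_def comp_apply using gv_symmetries(2)[of "\<lambda>m. A * Y m" "\<lambda>m. 0 * h m" \<eta> "t + v"] by (simp add: ac_simps)
  have rs: "r34 (r34 s) = sgn (R x')"
  proof -
    have "(r34 \<circ> r34) (sgn (R x)) = sgn ((r34 \<circ> r34) (R x))"
      using linear_scale[OF isometries(2)] isometries(5)[of "R x"] by (simp add: sgn_div_norm)
    then show ?thesis unfolding x(2) x'_def iso[symmetric] by simp
  qed
  \<comment> \<open>The common lower neighbour of \<open>x\<close> and \<open>x'\<close>; the vertex
    at \<open>x'\<close> is \<open>r34 (r34 s)\<close>.\<close>
  define y where "y = x - ax 2"
  have y1: "y + ax 2 = x" by (simp add: y_def)
  have y2: "y + ax 1 = x'" by (simp add: y_def x'_def vec_eq_iff forall_3 axis_def)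
  have ys: "unit_cell y {j} \<in> strip 2" for j unfolding strip_iff by (intro conjI is_cell_unit) (auto simp: unit_cell_edge y_def x)
  have xs: "{x} \<in> strip 2" "{x'} \<in> strip 2" using x x' by (simp_all add: strip_singleton)
  have u: "(THE u. is_edge ?T s u \<and> is_edge ?T u (r34 (r34 s))) = sgn (R y)"
  proof (rule the_equality)
    show "is_edge ?T s (sgn (R y)) \<and> is_edge ?T (sgn (R y)) (r34 (r34 s))"
      unfolding rs unfolding x(2)
      using edge_cone_modelI(1)[OF R ys[of 2], unfolded y1] edge_cone_modelI(2)[OF R ys[of 1], unfolded y2] by blast
  next
    fix u assume u: "is_edge ?T s u \<and> is_edge ?T u (r34 (r34 s))"
    obtain p a where p: "u = sgn (R p)" "{p} \<in> strip 2" "p = x + ax a \<or> p = x - ax a"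
      by (rule edge_cone_model[OF R xs(1), of u]) (use u x(2) in auto)
    obtain q b where q: "u = sgn (R q)" "{q} \<in> strip 2" "q = x' + ax b \<or> q = x' - ax b"
      by (rule edge_cone_model[OF R xs(2), of u]) (use u rs in auto)
    have pa: "p = x - ax a" "q = x' - ax b" using p q x(1) x' by (auto simp: strip_singleton)
    have "sph_hull (R ` {p}) \<subseteq> sph_hull (R ` {q})" using p(1) q(1) by (simp add: sph_hull_single)
    then obtain l where l: "l \<in> Lam" "l + p = q" unfolding embedded_hull_le[OF R p(2) q(2)] by auto
    \<comment> \<open>Two descriptions of the same middle vertex differ by a vector of
      \<open>Lam\<close> with entries at most 2, hence by 0; the second entry then forces
      \<open>a = 2\<close>.\<close>
    have le: "l = vector [1, -1, 0] - ax b + ax a" using l(2) unfolding pa x'_def by (simp add: algebra_simps)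
    have "\<bar>l $ j\<bar> \<le> 2" for j unfolding le using exhaust_3[of j] by (auto simp: axis_def)
    then have "l = 0" using Lam_small[OF l(1)] by blast
    then have "vector [1, -1, 0] - ax b + ax a = 0" using le by simp
    then have "(vector [1, -1, 0] - ax b + ax a) $ 2 = 0" by simp
    then have "a = 2" by (auto simp: axis_def split: if_splits)
    then show "u = sgn (R y)" using p(1) pa(1) by (simp add: y_def)
  qed
  define z where "z = zc (R x)"
  define w where "w = wc (R x)"
  have zf: "z = ii ((t+x)$3) * (A * Y K)" and wf: "w = \<eta> *\<^sub>R om ((t+x)$1 - (t+x)$2)"
    unfolding z_def w_def R_def comp_apply V_form tx by simp_all
  have w1: "norm w = 1" unfolding wf using \<eta> by auto
  have om12: "om 1 * om 1 = om 2" using om_add[of 1 1] by simp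
  have cis1: "cis (pi/3) = om 1" by (simp add: om_def)
  have Rx: "R x = mk z w 0" by (simp add: eq5_iff z_def w_def R_def V_form)
  have Rx': "R x' = mk z (om 2 * w) 0"
  proof -
    have "R x' = (r34 \<circ> r34) (R x)" using iso[of x] by (simp add: x'_def)
    also have "\<dots> = mk z (om 2 * w) 0" unfolding comp_apply r34_mk Rx mk_simps cis1 om12[symmetric] by (simp only: mult.assoc)
    finally show ?thesis .
  qed
  have Ry: "R y = mk (ii ((t+x)$3) * (A * Y (K-1))) (om 1 * w) 0"
  proof -
    have cy: "csum (t + y) = int (K-1)" using tx K by (simp add: y_def)
    have "wc (R y) = \<eta> *\<^sub>R om ((t+x)$1 - (t+x)$2 + 1)" unfolding R_def comp_apply V_form y_def by (simp add: axis_def algebra_simps)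
    then have "wc (R y) = om 1 * w" unfolding wf om_add by (simp add: algebra_simps)
    moreover have "zc (R y) = ii ((t+x)$3) * (A * Y (K-1))" unfolding R_def comp_apply V_form cy by (simp add: y_def axis_def)
    moreover have "R y $ 5 = 0" by (simp add: R_def V_form)
    ultimately show ?thesis by (simp add: eq5_iff)
  qed
  define z' where "z' = ii ((t+x)$3) * (A * Y (K-1))"
  have YK: "Y K \<noteq> 0" using Epos(2)[of K] tau by (auto simp: seqY_def complex_eq_iff)
  have z0: "z \<noteq> 0" unfolding zf using A YK by simp
  have nz: "norm z = norm A * norm (Y K)" "norm z' = norm A * norm (Y (K-1))" by (simp_all add: zf z'_def norm_mult)
  have zz: "z \<bullet> z' < 2 * (norm z)\<^sup>2"
  proof -
    have "K - 1 < K" using K by simp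
    from norm_Y_half[OF this K] norm_ge_zero[of "Y (K-1)"] have "norm (Y (K-1)) \<le> norm (Y K)" by linarith
    then have "norm z' \<le> norm z" unfolding nz by (simp add: mult_left_mono)
    then have "norm z * norm z' \<le> norm z * norm z" by (simp add: mult_left_mono)
    moreover have "z \<bullet> z' \<le> norm z * norm z'" by (rule norm_cauchy_schwarz)
    moreover have "0 < (norm z)\<^sup>2" using z0 by simp
    ultimately show ?thesis by (simp add: power2_eq_square)
  qed
  have ow: "norm (om 1 * w) = 1" using w1 by (simp add: norm_mult)
  \<comment> \<open>Because \<open>1 + om 2 = om 1\<close>, the sum doubles the first coordinate and
    leaves a second coordinate of length 1.\<close>
  have sum: "sgn (s + r34 (r34 s)) = sgn (mk (2 *\<^sub>R z) (om 1 * w) 0)"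
  proof -
    have "norm (R x') = norm (R x)" unfolding Rx Rx' norm_mk by (simp add: norm_mult)
    then have "s + r34 (r34 s) = (1 / norm (R x)) *\<^sub>R (R x + R x')" unfolding rs unfolding x(2) sgn_div_norm by (simp add: scaleR_add_right divide_inverse)
    also have "R x + R x' = mk (2 *\<^sub>R z) (om 1 * w) 0" unfolding Rx Rx' mk_add om_2 by (simp add: scaleR_2 algebra_simps)
    finally have "s + r34 (r34 s) = (1 / norm (R x)) *\<^sub>R mk (2 *\<^sub>R z) (om 1 * w) 0" .
    moreover have "0 < 1 / norm (R x)"
    proof -
      have "R x \<noteq> 0" using z0 z_def by auto
      then show ?thesis by simp
    qed
    ultimately show ?thesis by (simp add: sgn_scaleR)
  qed
  show ?thesis unfolding B slope_def Let_def s_def[symmetric] u sum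
    unfolding Ry z'_def[symmetric] by (rule slope_angle[OF z0 ow zz])
qed

text \<open>The path \<gamma> restores the second coordinate of a top vertex from 0 to its full
  size. By \<open>cone_bound\<close> it stays off the complex before its end, so the vertex lies in
  the closure of the component of \<open>clifford 0\<close>.\<close>

lemma V_oriented:
  assumes Q: "embedded (V 0) K" and K: "3 \<le> K"
  shows "oriented_to_C0 K (cone_model (V 0) K)"
proof -
  let ?T = "cone_model (V 0) K"
  let ?U = "\<Union> (cells ?T)"
  define S where "S = S3eq - ?U"
  have U: "\<exists>c\<in>strip K. p \<in> pcone (V 0) c \<and> wc p \<noteq> 0" if pU: "p \<in> ?U" for p
  proof -
    obtain c where c: "c \<in> strip K" "p \<in> sph_hull (V 0 ` c)" using pU unfolding cells_cone_model[OF embedded_periodic[OF Q]] by auto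
    show ?thesis using V0_S3eq(1,3)[OF c(1) K c(2)] c(1) by blast
  qed
  have C0: "clifford 0 \<subseteq> S"
  proof
    fix x assume "x \<in> clifford 0"
    then have "x \<in> S3eq" "wc x = 0" by (simp_all add: clifford0_iff)
    then show "x \<in> S" unfolding S_def using U[of x] by blast
  qed
  have lin: "linear (\<lambda>p::complex \<times> complex. mk (fst p) (snd p) 0)" by (auto intro!: linearI simp: eq5_iff)
  have cm: "continuous_on X (\<lambda>x. mk (f x) (g x) 0)" if "continuous_on X f" "continuous_on X g" for X :: "'a::topological_space set" and f g
  proof -
    have "continuous_on X (\<lambda>x. (f x, g x))" using that by (intro continuous_intros)
    from continuous_on_compose2[OF linear_continuous_on[OF linear_conv_bounded_linear[THEN iffD1, OF lin]] this subset_UNIV]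
    show ?thesis by simp
  qed
  have con0: "connected (clifford 0)"
  proof -
    have "clifford 0 = (\<lambda>z. mk z 0 0) ` sphere (0::complex) 1"
    proof (rule set_eqI, rule iffI)
      fix x assume "x \<in> clifford 0"
      then have x: "x = mk (zc x) 0 0" "norm x = 1" by (simp_all add: clifford0_iff S3eq_iff eq5_iff)
      have "norm (zc x) = norm (mk (zc x) 0 0)" by simp
      also have "\<dots> = 1" using x by simp
      finally show "x \<in> (\<lambda>z. mk z 0 0) ` sphere (0::complex) 1" using x(1) by (intro image_eqI[of _ _ "zc x"]) auto
    qed (auto simp: clifford0_iff S3eq_iff)
    moreover have "connected (sphere (0::complex) 1)" by (rule connected_sphere) simp
    ultimately show ?thesis using connected_continuous_image[OF cm[OF continuous_on_id continuous_on_const]] by simp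
  qed
  define C where "C = connected_component_set S (mk 1 0 0)"
  have m1: "mk 1 0 0 \<in> clifford 0" by (simp add: clifford0_iff S3eq_iff)
  then have m1S: "mk 1 0 0 \<in> S" using C0 by blast
  have CC: "C \<in> components S" unfolding C_def components_def using m1S by blast
  have C0C: "clifford 0 \<subseteq> C" unfolding C_def by (rule connected_component_maximal[OF m1 con0 C0])
  define v :: "int^3" where "v = vector [0, 0, int K]"
  have v: "csum v = int K" by (simp add: v_def)
  define z where "z = zc (V 0 v)"
  define w where "w = wc (V 0 v)"
  have V: "V 0 v = mk z w 0" by (simp add: eq5_iff z_def w_def V_form)
  have zn: "norm z = norm (A * Y K)" by (simp add: z_def V_form v norm_mult)
  have wn: "norm w = 1" using \<eta> by (auto simp: w_def V_form)
  have YK: "Y K \<noteq> 0" using Epos(2)[of K] tau by (auto simp: seqY_def complex_eq_iff)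
  have z0: "z \<noteq> 0" using zn A YK by auto
  define \<gamma> where "\<gamma> r = sgn (mk z (r *\<^sub>R w) 0)" for r :: real
  have nn: "mk z (r *\<^sub>R w) 0 \<noteq> 0" for r using z0 by (auto simp: eq5_iff)
  have c\<gamma>: "continuous_on X \<gamma>" for X
    unfolding \<gamma>_def sgn_div_norm using nn by (intro continuous_intros cm) auto
  have \<gamma>S: "\<gamma> r \<in> S" if r: "0 \<le> r" "r < 1" for r
  proof -
    have "\<gamma> r \<in> S3eq" using nn[of r] by (simp add: \<gamma>_def S3eq_iff norm_sgn) (simp add: sgn_div_norm)
    moreover have "\<gamma> r \<notin> ?U"
    proof
      assume "\<gamma> r \<in> ?U"
      then obtain c where c: "c \<in> strip K" "\<gamma> r \<in> pcone (V 0) c" using U by blast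
      have "norm (zc (\<gamma> r)) \<le> norm (A * Y K) * norm (wc (\<gamma> r))" by (rule cone_bound[OF c(1) K c(2)])
      then have "norm z \<le> norm z * r" using nn[of r] r wn unfolding \<gamma>_def zn[symmetric] by (simp add: sgn_div_norm divide_simps mult_ac)
      then show False using z0 r by simp
    qed
    ultimately show ?thesis by (simp add: S_def)
  qed
  have \<gamma>0: "\<gamma> 0 \<in> clifford 0" using nn[of 0] z0 by (simp add: clifford0_iff S3eq_iff \<gamma>_def norm_sgn) (simp add: sgn_div_norm)
  have "connected (\<gamma> ` {0..<1})" by (rule connected_continuous_image[OF c\<gamma>]) simp
  then have "connected (clifford 0 \<union> \<gamma> ` {0..<1})" using con0 \<gamma>0 by (intro connected_Un) auto
  then have "clifford 0 \<union> \<gamma> ` {0..<1} \<subseteq> C" unfolding C_def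
    by (rule connected_component_maximal[rotated]) (use m1 C0 \<gamma>S in auto)
  then have "\<gamma> ` {0..<1} \<subseteq> closure C" using closure_subset by blast
  then have "\<gamma> ` closure {0..<1} \<subseteq> closure C" by (rule image_closure_subset[OF c\<gamma> closed_closure])
  then have "\<gamma> 1 \<in> closure C" by auto
  moreover have "\<gamma> 1 \<in> layer ?T (int K)"
  proof -
    have "\<gamma> 1 = sgn (V 0 v)" by (simp add: \<gamma>_def V)
    then show ?thesis unfolding layer_cone_model[OF Q of_nat_0_le_iff order_refl] using v by blast
  qed
  ultimately show ?thesis unfolding oriented_to_C0_def S_def[symmetric] using CC C0C by blast
qed

end

section \<open>Assembly of the extension\<close>

lemma band_union:
  assumes T: "is_cct k T" and Q: "embedded Q k" and i: "1 \<le> i" "i + 1 \<le> k"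
    and cells: "cells T = cells (cone_model Q k)"
    and ch: "!!v. {v} \<in> strip k ==> chart T (orbit {v}) = sph_hull (Q ` {v})"
  shows "\<Union> (cells (band T i)) = (\<Union>c\<in>layers3 k i. sph_hull (Q ` c))"
proof -
  have I: "{int i - 1, int i, int i + 1} \<subseteq> {0..int k}" using i by auto
  have "cells (band T i) = restrict_cells T {int i - 1, int i, int i + 1}" by (simp add: band_def)
  also have "\<dots> = restrict_cells (cone_model Q k) {int i - 1, int i, int i + 1}" by (rule restrict_control[OF T Q I cells ch])
  also have "\<dots> = cells (band (cone_model Q k) i)" by (simp add: band_def)
  finally show ?thesis using band_cone_model(3)[OF Q i] by simp
qed

theorem theorem4p1:
  fixes T :: cct and k :: nat
  assumes "k \<ge> 3" and "ideal_cct k T"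
  shows "\<exists>T'. ideal_cct (k + 1) T' \<and> extends (k + 1) T' k T"
proof -
  note k = assms(1) and I = assms(2)
  obtain Z e \<eta> where nf: "\<eta> = 1 \<or> \<eta> = (-1::real)" "embedded (gv Z e \<eta>) k" "embedded (gv Z (\<lambda>_. 0) \<eta>) k"
    "!!c. c \<in> strip k ==> chart T (orbit c) = sph_hull (gv Z e \<eta> ` c)"
    "cells T = cells (cone_model (gv Z e \<eta>) k)"
    "cells (control T) = cells (cone_model (gv Z (\<lambda>_. 0) \<eta>) k)"
    "!!v. {v} \<in> strip k ==> chart (control T) (orbit {v}) = sph_hull (gv Z (\<lambda>_. 0) \<eta> ` {v})"
  proof (rule ideal_normal_form[OF I k])
    fix Z e \<eta>
    assume "\<eta> = 1 \<or> \<eta> = (-1::real)" "embedded (gv Z e \<eta>) k" "embedded (gv Z (\<lambda>_. 0) \<eta>) k"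
      "!!c. c \<in> strip k ==> chart T (orbit c) = sph_hull (gv Z e \<eta> ` c)"
      "cells T = cells (cone_model (gv Z e \<eta>) k)"
      "cells (control T) = cells (cone_model (gv Z (\<lambda>_. 0) \<eta>) k)"
      "!!v. {v} \<in> strip k ==> chart (control T) (orbit {v}) = sph_hull (gv Z (\<lambda>_. 0) \<eta> ` {v})"
    then show thesis by (rule that)
  qed
  let ?P = "gv Z e \<eta>" and ?Q = "gv Z (\<lambda>_. 0) \<eta>"
  have symT: "symmetric_cct k T" and injT: "inj_on eq_proj (\<Union> (cells T))" and id: "ideal_eq k (control T)"
    using I by (simp_all add: ideal_cct_def)
  have tr: "transversal_eq k (control T)" and orT: "oriented_to_C0 k (control T)" using id by (simp_all add: ideal_eq_def)
  have cctC: "is_cct k (control T)" using tr by (simp add: transversal_eq_def symmetric_cct_def)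
  have cctT: "is_cct k T" using symT by (simp add: symmetric_cct_def)
  have t2: "(\<Union>c\<in>layers3 k i. sph_hull (?Q ` c)) \<subseteq> S3eq - (clifford 0 \<union> clifford 2)"
    "inj_on proj1 (\<Union>c\<in>layers3 k i. sph_hull (?Q ` c))" if i: "1 \<le> i" "i + 1 \<le> k" for i
  proof -
    have "transversal2 (band (control T) i)" using tr i by (simp add: transversal_eq_def)
    then have "\<Union> (cells (band (control T) i)) \<subseteq> S3eq - (clifford 0 \<union> clifford 2)" "inj_on proj1 (\<Union> (cells (band (control T) i)))"
      by (simp_all add: transversal2_def)
    moreover have "\<Union> (cells (band (control T) i)) = (\<Union>c\<in>layers3 k i. sph_hull (?Q ` c))"
      by (rule band_union[OF cctC nf(3) i nf(6)]) (rule nf(7))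
    ultimately show "(\<Union>c\<in>layers3 k i. sph_hull (?Q ` c)) \<subseteq> S3eq - (clifford 0 \<union> clifford 2)"
      "inj_on proj1 (\<Union>c\<in>layers3 k i. sph_hull (?Q ` c))" by (simp_all only:)
  qed
  have injp: "inj_on eq_proj (\<Union>c\<in>strip k. sph_hull (?P ` c))"
    using injT unfolding nf(5) cells_cone_model[OF gv_periodic] by simp
  have k2: "2 \<le> k" using k by simp
  obtain A \<tau> E s where ns: "A \<noteq> 0" "seq_ok \<tau> E" "!!m. m \<le> k ==> Z m = seqZ A \<tau> E m" "!!m. m \<le> k ==> e m = s * seqh \<tau> E m"
    "!!m. m < k ==> 0 < E (m+1)" "0 < (E 1)\<^sup>2 - E 0 * E 2"
  proof (rule normal_sequence[OF nf(2,3,1) k2 t2(2) injp])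
    fix A \<tau> E s
    assume "A \<noteq> 0" "seq_ok \<tau> E" "!!m. m \<le> k ==> Z m = seqZ A \<tau> E m" "!!m. m \<le> k ==> e m = s * seqh \<tau> E m"
      "!!m. m < k ==> 0 < E (m+1)" "0 < (E 1)\<^sup>2 - E 0 * E 2"
    then show thesis by (rule that)
  qed
  have W: "0 < cas E 0" using ns(6) by (simp add: cas_def numeral_2_eq_2)
  obtain C where C: "C \<in> components (S3eq - \<Union> (cells (cone_model ?Q k)))" "clifford 0 \<subseteq> C" "closure C \<inter> layer (cone_model ?Q k) (int k) \<noteq> {}"
  proof -
    have "layer (control T) (int k) = layer (cone_model ?Q k) (int k)"
    proof -
      have "chart (control T) (orbit {v}) = chart (cone_model ?Q k) (orbit {v})" if "csum v = int k" for v
        unfolding chart_cone_model[OF nf(3)] by (rule nf(7)) (simp add: strip_singleton that)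
      then have "{chart (control T) (orbit {v}) | v. csum v = int k} = {chart (cone_model ?Q k) (orbit {v}) | v. csum v = int k}" by metis
      then show ?thesis unfolding layer_def by simp
    qed
    then show ?thesis using orT that unfolding oriented_to_C0_def nf(6) by auto
  qed
  \<comment> \<open>The band centred at \<open>k - 2\<close> stops one layer short of the top and
    exists because \<open>3 \<le> k\<close>.\<close>
  have i2: "1 \<le> k - 2" "k - 2 + 1 \<le> k" using k by simp_all
  have out: "(1+\<tau>) * E 1 < \<tau> * E 2"
    by (rule oriented_outward[OF nf(3) k nf(1) ns(1,2,3,5) W t2[OF i2] C])
  have E1: "0 < E 1" using ns(5)[of 0] k by simp
  interpret model \<tau> E A \<eta> by unfold_locales (use ns(1,2) W E1 out nf(1) in auto)
  define K where "K = k + 1"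
  have K: "3 \<le> K" using k by (simp add: K_def)
  have old: "V s v = ?P v" "V 0 v = ?Q v" if "0 \<le> csum v" "csum v \<le> int k" for v
  proof -
    have "nat (csum v) \<le> k" using that by simp
    then show "V s v = ?P v" "V 0 v = ?Q v" unfolding V_def gv_def by (simp_all add: ns(3,4) seqZ_Y)
  qed
  have oldc: "V s ` c = ?P ` c" "V 0 ` c = ?Q ` c" if "c \<in> strip k" for c
    using that old by (auto simp: strip_iff intro!: image_cong)
  have emb: "embedded (V r) K" for r by (rule V_embedded[OF nf(2) k K])
  have sub: "c \<in> strip K" if "c \<in> strip k" for c using that unfolding strip_iff K_def by fastforce
  define T' where "T' = cone_model (V s) K"
  have ctrl: "control T' = cone_model (V 0) K"
  proof -
    have "flat \<circ> V s = V 0" by (simp add: fun_eq_iff flat_V)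
    then show ?thesis unfolding T'_def control_cone_model by simp
  qed
  have sym: "symmetric_cct K (cone_model (V r) K)" for r
    by (rule symmetric_cone_model[OF emb]) (simp_all only: V_def gv_symmetries)
  have cells': "\<Union> (cells (cone_model (V r) K)) = (\<Union>c\<in>strip K. sph_hull (V r ` c))" for r
    unfolding cells_cone_model[OF V_periodic] by simp
  have avoid: "\<Union> (cells T') \<subseteq> S4 - {axis 5 1, - axis 5 1}"
  proof
    fix p assume "p \<in> \<Union> (cells T')"
    then obtain c where c: "c \<in> strip K" "p \<in> sph_hull (V s ` c)" unfolding T'_def cells' by blast
    have p: "norm p = 1" "p \<in> pcone (V s) c" using c(2) unfolding sph_hull_iff[OF embedded_cell(5,3)[OF emb c(1)]] by simp_all
    then have "p \<noteq> 0" by auto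
    then have "wc p \<noteq> 0" by (rule wc_nonzero[OF c(1) K p(2)])
    moreover have "wc (axis 5 1) = 0" by (simp add: wc_def axis_def complex_eq_iff)
    ultimately have "p \<noteq> axis 5 1" "p \<noteq> - axis 5 1" by auto
    then show "p \<in> S4 - {axis 5 1, - axis 5 1}" using p(1) by (simp add: S4_def)
  qed
  have inj': "inj_on eq_proj (\<Union> (cells T'))" unfolding T'_def cells' by (rule V_inj_eq_proj[OF K])
  have tv: "transversal2 (band (cone_model (V 0) K) i)" if i: "1 \<le> i" "i + 1 \<le> K" for i
  proof -
    have "symmetric_cct 2 (band (cone_model (V 0) K) i)" unfolding V_def by (rule symmetric_band[OF emb[of 0, unfolded V_def] i])
    moreover have "\<Union> (cells (band (cone_model (V 0) K) i)) \<subseteq> S3eq - (clifford 0 \<union> clifford 2) \<and> inj_on proj1 (\<Union> (cells (band (cone_model (V 0) K) i)))"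
    proof (cases "2 \<le> i")
      case True then show ?thesis unfolding band_cone_model(3)[OF emb i] using V_band[OF K True i(2)] by simp
    next
      case False
      then have i1: "i = 1" using i by simp
      \<comment> \<open>The lowest band belongs to the given complex and inherits its
        transversality; \<open>V_band\<close> does not reach it, since \<open>E 0\<close> may fail
        to be positive.\<close>
      have l: "layers3 K 1 = layers3 k 1" using k by (auto simp: strip_iff K_def)
      have "(\<Union>c\<in>layers3 K 1. sph_hull (V 0 ` c)) = (\<Union>c\<in>layers3 k 1. sph_hull (?Q ` c))" unfolding l by (rule SUP_cong) (use oldc(2) in auto)
      then show ?thesis unfolding band_cone_model(3)[OF emb i] unfolding i1 using t2[of 1] k by simp
    qed
    ultimately show ?thesis unfolding transversal2_def by blast
  qed
  have S3: "\<Union> (cells (cone_model (V 0) K)) \<subseteq> S3eq" unfolding cells' using V0_S3eq(2)[OF _ K] by blast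
  have "transversal_eq K (cone_model (V 0) K)" unfolding transversal_eq_def using sym S3 tv by blast
  then have "ideal_eq K (control T')" unfolding ctrl ideal_eq_def using V_slope[OF emb K] V_oriented[OF emb K] K by simp
  then have "ideal_cct K T'" unfolding ideal_cct_def using sym[of s] avoid inj' by (simp add: T'_def)
  moreover have "extends K T' k T"
  proof -
    have "restrict_cells T' {0..int k} = insert {} ((\<lambda>c. sph_hull (V s ` c)) ` {c \<in> strip K. \<forall>v\<in>c. csum v \<in> {0..int k}})"
      unfolding T'_def by (rule restrict_cone_model[OF emb]) (simp add: K_def)
    also have "{c \<in> strip K. \<forall>v\<in>c. csum v \<in> {0..int k}} = strip k"
    proof (rule set_eqI)
      fix c show "c \<in> {c \<in> strip K. \<forall>v\<in>c. csum v \<in> {0..int k}} \<longleftrightarrow> c \<in> strip k" using sub[of c] by (auto simp: strip_iff[of _ k] strip_cell)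
    qed
    also have "(\<lambda>c. sph_hull (V s ` c)) ` strip k = (\<lambda>c. sph_hull (?P ` c)) ` strip k" by (rule image_cong) (simp_all add: oldc(1))
    finally have r: "restrict_cells T' {0..int k} = cells T" unfolding nf(5) cells_cone_model[OF gv_periodic] .
    have ch: "chart T' X = chart T X" if X: "X \<in> torus k" for X
    proof -
      obtain c where "c \<in> strip k" "X = orbit c" using X by (rule torusE)
      then show ?thesis unfolding T'_def using chart_cone_model[OF emb] nf(4) oldc(1) by simp
    qed
    have "is_cct K T'" using sym[of s] by (simp add: T'_def symmetric_cct_def)
    then show ?thesis unfolding extends_def using cctT r ch by (simp add: K_def)
  qed
  ultimately show ?thesis unfolding K_def by blast
qed

end
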